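(* There is a randomized algorithm that, given a system $E=\{P_j(x)\}_{j=1}^m$ of polynomial equations over $\mathbb{F}_2$ of degree at most $d$ in $n$ Boolean variables (each $P_j$ given by its algebraic normal form), with high probability either finds a solution to $E$ or correctly decides that $E$ has no solution. For an arbitrarily small $\epsilon>0$, its running time is bounded by $O(2^{(\tau(d)+\epsilon)n})$.
   Context: Let $H(q)=-q\log_2 q-(1-q)\log_2(1-q)$ be the binary entropy function. For an integer $d\ge 2$ let $f_d(p)=(1-p)\,H\!\left(\frac{(d-1)p}{1-p}\right)$, and let $\tau(d)$ be the maximum value of $f_d$ on the interval $[0,\frac{1}{2d-1}]$. A polynomial is given by its algebraic normal form (sum of multilinear monomials). A solution to $E$ is $\bar x\in\{0,1\}^n$ with $P_j(\bar x)=0$ for all $j$. The degree $d$ is a fixed constant. Standing assumption: $m\le\sum_{i=0}^{d}\binom{n}{i}$. *)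

theory Defs
  imports
    "HOL-Probability.Probability"
    "HOL-Real_Asymp.Real_Asymp"
    "HOL-Library.Landau_Symbols"
    "HOL-Library.Log_Nat"
    "HOL-Library.Z2"
begin

section \<open>The exponent\<close>

text \<open>In Isabelle/HOL \<open>0 * log 2 0 = 0\<close>, which is the usual convention at the end points.\<close>

definition binary_entropy :: "real \<Rightarrow> real" where
  "binary_entropy q = - q * log 2 q - (1 - q) * log 2 (1 - q)"

definition entropy_bound :: "nat \<Rightarrow> real \<Rightarrow> real" where
  "entropy_bound d p = (1 - p) * binary_entropy ((real d - 1) * p / (1 - p))"

definition tau :: "nat \<Rightarrow> real" where
  "tau d = (GREATEST v. v \<in> entropy_bound d ` {0 .. 1 / (2 * real d - 1)})"

lemma continuous_on_x_log_x: "continuous_on {0..} (\<lambda>x::real. x * log 2 x)"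
proof (rule continuous_on_eq_continuous_within[THEN iffD2], rule ballI)
  fix x :: real
  assume "x \<in> {0..}"
  show "continuous (at x within {0..}) (\<lambda>x::real. x * log 2 x)"
  proof (cases "x = 0")
    case True
    have "((\<lambda>x::real. x * log 2 x) \<longlongrightarrow> 0) (at_right 0)"
      by real_asymp
    moreover have "at (0::real) within {0..} = at_right 0"
      by (rule at_within_Ici_at_right)
    ultimately show ?thesis
      using True by (simp add: continuous_within)
  next
    case False
    with \<open>x \<in> {0..}\<close> show ?thesis
      by (intro continuous_intros) auto
  qed
qed

lemma continuous_on_binary_entropy: "continuous_on {0..1} binary_entropy"
proof -
  have "continuous_on {0..1} (\<lambda>q::real. q * log 2 q)"
    by (rule continuous_on_subset[OF continuous_on_x_log_x]) auto
  moreover have "continuous_on {0..1} (\<lambda>q::real. (1 - q) * log 2 (1 - q))"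
    by (rule continuous_on_compose2[OF continuous_on_x_log_x]) (auto intro!: continuous_intros)
  ultimately have "continuous_on {0..1}
      (\<lambda>q::real. - (q * log 2 q) - (1 - q) * log 2 (1 - q))"
    by (intro continuous_on_diff continuous_on_minus)
  then show ?thesis
    by (simp add: binary_entropy_def[abs_def])
qed

lemma tau_is_maximum:
  assumes "d \<ge> 2"
  shows "tau d \<in> entropy_bound d ` {0 .. 1 / (2 * real d - 1)}"
    and "\<And>p. p \<in> {0 .. 1 / (2 * real d - 1)} \<Longrightarrow> entropy_bound d p \<le> tau d"
proof -
  let ?I = "{0 .. 1 / (2 * real d - 1)}"
  have d: "real d \<ge> 2" using assms by simp
  have p: "0 \<le> p \<and> p < 1 \<and> (real d - 1) * p / (1 - p) \<in> {0..1}" if "p \<in> ?I" for p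
  proof -
    have "p * (2 * real d - 1) \<le> 1" "0 \<le> p"
      using that d by (auto simp: field_simps)
    moreover have "p * 3 \<le> p * (2 * real d - 1)"
      using \<open>0 \<le> p\<close> d by (intro mult_left_mono) auto
    ultimately have p1: "p < 1" by linarith
    moreover have "(real d - 1) * p \<le> 1 - p"
      using \<open>p * (2 * real d - 1) \<le> 1\<close> p1 by (simp add: algebra_simps)
    ultimately show ?thesis using \<open>0 \<le> p\<close> d by auto
  qed
  have "continuous_on ?I (\<lambda>p. (real d - 1) * p / (1 - p))"
    by (intro continuous_intros) (use p in fastforce)
  moreover have "(\<lambda>p. (real d - 1) * p / (1 - p)) ` ?I \<subseteq> {0..1}"
    using p by blast
  ultimately have "continuous_on ?I (\<lambda>p. binary_entropy ((real d - 1) * p / (1 - p)))"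
    by (rule continuous_on_compose2[OF continuous_on_binary_entropy])
  then have "continuous_on ?I (entropy_bound d)"
    unfolding entropy_bound_def[abs_def] by (intro continuous_intros)
  moreover have "?I \<noteq> {}" using d by simp
  ultimately obtain q where q: "q \<in> ?I" "\<And>p. p \<in> ?I \<Longrightarrow> entropy_bound d p \<le> entropy_bound d q"
    using continuous_attains_sup[of ?I "entropy_bound d"] by (metis compact_Icc)
  have "tau d = entropy_bound d q"
    unfolding tau_def by (rule Greatest_equality) (use q in auto)
  with q show "tau d \<in> entropy_bound d ` ?I"
    and "\<And>p. p \<in> ?I \<Longrightarrow> entropy_bound d p \<le> tau d"
    by auto
qed


section \<open>Polynomial systems over GF(2)\<close>

text \<open>
  A polynomial is the list of the monomials of its algebraic normal form, a monomial the
  increasing list of its variables; \<open>[]\<close> is the monomial 1 and the empty list of monomials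
  the polynomial 0.
\<close>

type_synonym monomial = "nat list"
type_synonym anf = "monomial list"

definition is_anf :: "nat \<Rightarrow> nat \<Rightarrow> anf \<Rightarrow> bool" where
  "is_anf d n P \<longleftrightarrow> distinct P \<and>
     (\<forall>M\<in>set P. sorted_wrt (<) M \<and> set M \<subseteq> {..<n} \<and> length M \<le> d)"

definition poly_system :: "nat \<Rightarrow> nat \<Rightarrow> anf list \<Rightarrow> bool" where
  "poly_system d n E \<longleftrightarrow> (\<forall>P\<in>set E. is_anf d n P) \<and> length E \<le> (\<Sum>i\<le>d. n choose i)"

definition anf_eval :: "anf \<Rightarrow> bit list \<Rightarrow> bit" where
  "anf_eval P x = (\<Sum>M\<leftarrow>P. \<Prod>i\<leftarrow>M. x ! i)"

definition is_solution :: "nat \<Rightarrow> anf list \<Rightarrow> bit list \<Rightarrow> bool" where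
  "is_solution n E x \<longleftrightarrow> length x = n \<and> (\<forall>P\<in>set E. anf_eval P x = 0)"


section \<open>Randomized random access machines\<close>

text \<open>
  Structured programs for a RAM with finitely many directly addressed registers and an
  indirectly addressed memory, holding natural numbers. Time is charged by the logarithmic
  cost criterion: each operation costs the total bit length of the numbers and addresses it
  handles, so unbounded numbers give no free parallelism. Subtraction is truncated.
\<close>

datatype exp =
    Const nat
  | Reg string
  | Load exp
  | Add exp exp
  | Sub exp exp
  | Mul exp exp
  | Div exp exp

datatype com =
    Skip
  | SetReg string exp
  | Store exp exp
  | Flip string
  | Seq com com
  | Cond exp com com
  | While exp com

record state =
  reg :: "string \<Rightarrow> nat"
  mem :: "nat \<Rightarrow> nat"

definition bit_length :: "nat \<Rightarrow> nat" where
  "bit_length k = max 1 (floorlog 2 k)"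

fun val :: "exp \<Rightarrow> state \<Rightarrow> nat" where
  "val (Const k) s = k"
| "val (Reg r) s = reg s r"
| "val (Load a) s = mem s (val a s)"
| "val (Add a b) s = val a s + val b s"
| "val (Sub a b) s = val a s - val b s"
| "val (Mul a b) s = val a s * val b s"
| "val (Div a b) s = val a s div val b s"

fun exp_cost :: "exp \<Rightarrow> state \<Rightarrow> nat" where
  "exp_cost (Const k) s = bit_length k"
| "exp_cost (Reg r) s = bit_length (reg s r)"
| "exp_cost (Load a) s = exp_cost a s + bit_length (val a s) + bit_length (mem s (val a s))"
| "exp_cost (Add a b) s = exp_cost a s + exp_cost b s + bit_length (val a s) + bit_length (val b s)"
| "exp_cost (Sub a b) s = exp_cost a s + exp_cost b s + bit_length (val a s) + bit_length (val b s)"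
| "exp_cost (Mul a b) s = exp_cost a s + exp_cost b s + bit_length (val a s) + bit_length (val b s)"
| "exp_cost (Div a b) s = exp_cost a s + exp_cost b s + bit_length (val a s) + bit_length (val b s)"

text \<open>
  \<open>exec c s r t s' r'\<close>: started in state \<open>s\<close> with the coin tosses \<open>r\<close> still to come,
  \<open>c\<close> halts after time \<open>t\<close> in state \<open>s'\<close> with \<open>r'\<close> left over. A program that exhausts
  its coin tosses does not halt.
\<close>

inductive exec ::
  "com \<Rightarrow> state \<Rightarrow> bool list \<Rightarrow> nat \<Rightarrow> state \<Rightarrow> bool list \<Rightarrow> bool" where
  Skip: "exec Skip s r 1 s r"
| SetReg: "exec (SetReg x a) s r (1 + exp_cost a s + bit_length (val a s))
     (s\<lparr>reg := (reg s)(x := val a s)\<rparr>) r"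
| Store: "exec (Store a b) s r
     (1 + exp_cost a s + exp_cost b s + bit_length (val a s) + bit_length (val b s))
     (s\<lparr>mem := (mem s)(val a s := val b s)\<rparr>) r"
| Flip: "exec (Flip x) s (b # r) 1 (s\<lparr>reg := (reg s)(x := of_bool b)\<rparr>) r"
| Seq: "exec c s r t s' r' \<Longrightarrow> exec c' s' r' t' s'' r'' \<Longrightarrow> exec (Seq c c') s r (t + t') s'' r''"
| CondTrue: "val a s \<noteq> 0 \<Longrightarrow> exec c s r t s' r' \<Longrightarrow>
     exec (Cond a c c') s r (1 + exp_cost a s + t) s' r'"
| CondFalse: "val a s = 0 \<Longrightarrow> exec c' s r t s' r' \<Longrightarrow>
     exec (Cond a c c') s r (1 + exp_cost a s + t) s' r'"
| WhileFalse: "val a s = 0 \<Longrightarrow> exec (While a c) s r (1 + exp_cost a s) s r"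
| WhileTrue: "val a s \<noteq> 0 \<Longrightarrow> exec c s r t s' r' \<Longrightarrow> exec (While a c) s' r' t' s'' r'' \<Longrightarrow>
     exec (While a c) s r (1 + exp_cost a s + t + t') s'' r''"

inductive_cases exec_elims:
  "exec Skip s r t s' r'"
  "exec (SetReg x a) s r t s' r'"
  "exec (Store a b) s r t s' r'"
  "exec (Flip x) s r t s' r'"
  "exec (Seq c c') s r t s' r'"
  "exec (Cond a c c') s r t s' r'"
  "exec (While a c) s r t s' r'"

lemma exec_deterministic:
  "exec c s r t s' r' \<Longrightarrow> exec c s r u s'' r'' \<Longrightarrow> u = t \<and> s'' = s' \<and> r'' = r'"
proof (induction arbitrary: u s'' r'' rule: exec.induct)
  case (Skip s r)
  then show ?case by (auto elim: exec_elims(1))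
next
  case (SetReg x a s r)
  then show ?case by (auto elim: exec_elims(2))
next
  case (Store a b s r)
  then show ?case by (auto elim: exec_elims(3))
next
  case (Flip x s b r)
  then show ?case by (auto elim: exec_elims(4))
next
  case (Seq c s r t s1 r1 c' t' s2 r2)
  from Seq.prems obtain v v' s3 r3
    where 1: "u = v + v'" "exec c s r v s3 r3" "exec c' s3 r3 v' s'' r''"
    by (rule exec_elims(5))
  from Seq.IH(1)[OF 1(2)] have 2: "v = t" "s3 = s1" "r3 = r1" by simp_all
  from Seq.IH(2)[OF 1(3)[unfolded 2]] show ?case by (simp add: 1(1) 2)
next
  case (CondTrue a s c r t s1 r1 c')
  from CondTrue.prems CondTrue.hyps(1) obtain v
    where 1: "u = 1 + exp_cost a s + v" "exec c s r v s'' r''"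
    by (auto elim: exec_elims(6))
  from CondTrue.IH[OF 1(2)] show ?case by (simp add: 1(1))
next
  case (CondFalse a s c' r t s1 r1 c)
  from CondFalse.prems CondFalse.hyps(1) obtain v
    where 1: "u = 1 + exp_cost a s + v" "exec c' s r v s'' r''"
    by (auto elim: exec_elims(6))
  from CondFalse.IH[OF 1(2)] show ?case by (simp add: 1(1))
next
  case (WhileFalse a s c r)
  from WhileFalse.prems show ?case
    by (rule exec_elims(7)) (simp_all add: WhileFalse.hyps)
next
  case (WhileTrue a s c r t s1 r1 t' s2 r2)
  from WhileTrue.prems obtain v v' s3 r3
    where 1: "u = 1 + exp_cost a s + v + v'" "exec c s r v s3 r3"
      "exec (While a c) s3 r3 v' s'' r''"
    by (rule exec_elims(7)) (use WhileTrue.hyps(1) in simp_all)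
  from WhileTrue.IH(1)[OF 1(2)] have 2: "v = t" "s3 = s1" "r3 = r1" by simp_all
  from WhileTrue.IH(2)[OF 1(3)[unfolded 2]] show ?case by (simp add: 1(1) 2)
qed


section \<open>Solving polynomial systems\<close>

definition encode :: "nat \<Rightarrow> anf list \<Rightarrow> nat list" where
  "encode n E = n # length E #
     concat (map (\<lambda>P. length P # concat (map (\<lambda>M. length M # M) P)) E)"

definition initial_state :: "nat \<Rightarrow> anf list \<Rightarrow> state" where
  "initial_state n E = \<lparr>reg = (\<lambda>_. 0),
     mem = (\<lambda>a. if a < length (encode n E) then encode n E ! a else 0)\<rparr>"

text \<open>
  Cell 0 of the final memory tells whether a solution is reported (nonzero) or the system is
  declared unsolvable (zero); in the former case the solution is read modulo 2 from the
  cells 1 to n.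
\<close>

definition answer :: "nat \<Rightarrow> state \<Rightarrow> bit list option" where
  "answer n s = (if mem s 0 = 0 then None else Some (map (\<lambda>i. of_nat (mem s (Suc i))) [0..<n]))"

definition correct_answer :: "nat \<Rightarrow> anf list \<Rightarrow> bit list option \<Rightarrow> bool" where
  "correct_answer n E ans =
     (case ans of Some x \<Rightarrow> is_solution n E x | None \<Rightarrow> \<nexists>x. is_solution n E x)"

text \<open>Worst case over all systems and all coin tosses. As every toss takes unit time,
  \<open>T n\<close> tosses always suffice.\<close>

definition runs_in_time :: "nat \<Rightarrow> com \<Rightarrow> (nat \<Rightarrow> nat) \<Rightarrow> bool" where
  "runs_in_time d c T \<longleftrightarrow> (\<forall>n E r. poly_system d n E \<and> length r = T n \<longrightarrow>
     (\<exists>t s r'. exec c (initial_state n E) r t s r' \<and> t \<le> T n))"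

definition success_prob :: "com \<Rightarrow> nat \<Rightarrow> anf list \<Rightarrow> nat \<Rightarrow> real" where
  "success_prob c n E k = measure_pmf.prob (pmf_of_set {r :: bool list. length r = k})
     {r. \<exists>t s r'. exec c (initial_state n E) r t s r' \<and> correct_answer n E (answer n s)}"

text \<open>High probability: the failure probability is eventually below every inverse polynomial
  in \<open>n\<close>, uniformly in the system.\<close>

definition solves_whp :: "nat \<Rightarrow> com \<Rightarrow> (nat \<Rightarrow> nat) \<Rightarrow> bool" where
  "solves_whp d c T \<longleftrightarrow> (\<forall>k::nat. \<forall>\<^sub>F n in sequentially. \<forall>E. poly_system d n E \<longrightarrow>
     success_prob c n E (T n) \<ge> 1 - 1 / real n ^ k)"

end

theory Submission
  imports Defs
begin

text \<open>
  The algorithm is multiple parity counting. Adding random affine equations isolates a solution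
  with constant probability, and the bits of an isolated solution are parities of numbers of
  solutions, that is, sums over the cube of the indicator \<open>\<Prod>q. 1 + P q x\<close>. This product
  has a large degree, but if the system is replaced by a few random linear combinations of its
  equations, then the indicator has a low degree and is correct at most points. Sum over the
  \<open>N\<close> variables in \<open>\<surd>N\<close> blocks of \<open>\<surd>N\<close> variables: with
  \<open>s * l + 4\<close> combinations at the level where \<open>s * l\<close> variables are summed, the partial
  sums are polynomials of degree at most \<open>(d - 1) * s * l + 4 * d\<close> in the \<open>N - s * l\<close>
  remaining variables, hence determined by their values at the points of at most that weight. The
  Moebius transform extends them to the points needed at the next level, where the majority
  over many independent choices of combinations removes the errors. The number of points of bounded
  weight dominates the running time; with \<open>p = s * l / N\<close> it is at most
  \<open>2 powr (N * entropy_bound d p)\<close> up to a polynomial factor as long as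
  \<open>p \<le> 1 / (2 * d - 1)\<close>, and at most the value for \<open>p = 1 / (2 * d - 1)\<close> beyond. All other
  factors are \<open>2 powr O(\<surd>n * ln n)\<close>.
\<close>

section \<open>A language of bounded loops\<close>

text \<open>The 4 extra combinations come from a union bound: a sum over \<open>2 ^ (s * l)\<close>
  points can go wrong only if the combinations miss a violated equation at one of them, which has
  probability \<open>1 / 2 ^ (s * l + 4)\<close> per point, hence 1/16 in all, small enough for a
  majority vote. A combination adds \<open>d\<close> to the degree of the indicator and a summed
  variable removes 1, whence the slope \<open>d - 1\<close>. The block size balances two costs: a
  level multiplies the number of systems by \<open>Y\<close>, a block has \<open>2 ^ s\<close>
  points. There are \<open>Y ^ s\<close> systems, but the combinations of system
  \<open>i * Y + r\<close> depend only on \<open>r\<close> and the level, so \<open>Y ^ 5\<close>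
  tosses serve all tries; the union bound over systems and points requires no independence. Errors
  are one-sided: a candidate is checked against the given equations before it is reported. Under
  logarithmic cost the algorithm has to be an explicit machine program; it is written with bounded
  loops, so that a step count can be read off the text and only has to be multiplied by a word
  length.\<close>

datatype lexp =
    LC nat
  | LV string
  | LA nat lexp lexp lexp
  | LAdd lexp lexp
  | LSub lexp lexp
  | LMul lexp lexp
  | LDiv lexp lexp
  | LMin lexp lexp
  | LMod2 lexp

datatype lcom =
    LSet string lexp
  | LSto nat lexp lexp lexp lexp
  | LSeq lcom lcom (infixr ";;" 60)
  | LIf lexp lcom lcom
  | LFor string lexp lcom

record lstate =
  lv :: "string \<Rightarrow> nat"
  la :: "nat \<Rightarrow> nat \<Rightarrow> nat \<Rightarrow> nat \<Rightarrow> nat"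

definition setv :: "string \<Rightarrow> nat \<Rightarrow> lstate \<Rightarrow> lstate" where
  "setv x k s = s\<lparr>lv := (lv s)(x := k)\<rparr>"

definition seta :: "nat \<Rightarrow> nat \<Rightarrow> nat \<Rightarrow> nat \<Rightarrow> nat \<Rightarrow> lstate \<Rightarrow> lstate" where
  "seta k i j l w s = s\<lparr>la := (\<lambda>k' i' j' l'. if k' = k \<and> i' = i \<and> j' = j \<and> l' = l then w
     else la s k' i' j' l')\<rparr>"

lemma setv_sel [simp]:
  "lv (setv x k s) y = (if y = x then k else lv s y)" "la (setv x k s) = la s"
  by (simp_all add: setv_def)

lemma seta_sel [simp]:
  "lv (seta k i j l w s) = lv s"
  "la (seta k i j l w s) k' i' j' l' =
    (if k' = k \<and> i' = i \<and> j' = j \<and> l' = l then w else la s k' i' j' l')"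
  by (simp_all add: seta_def)

primrec lval :: "lexp \<Rightarrow> lstate \<Rightarrow> nat" where
  "lval (LC k) s = k"
| "lval (LV x) s = lv s x"
| "lval (LA k a b c) s = la s k (lval a s) (lval b s) (lval c s)"
| "lval (LAdd a b) s = lval a s + lval b s"
| "lval (LSub a b) s = lval a s - lval b s"
| "lval (LMul a b) s = lval a s * lval b s"
| "lval (LDiv a b) s = lval a s div lval b s"
| "lval (LMin a b) s = min (lval a s) (lval b s)"
| "lval (LMod2 a) s = lval a s mod 2"

primrec iter :: "nat \<Rightarrow> (nat \<Rightarrow> 'a \<Rightarrow> 'a) \<Rightarrow> 'a \<Rightarrow> 'a" where
  "iter 0 f s = s"
| "iter (Suc n) f s = f n (iter n f s)"

lemma iter_induct:
  assumes "I 0 s" "\<And>k t. k < n \<Longrightarrow> I k t \<Longrightarrow> I (Suc k) (f k t)"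
  shows "I n (iter n f s)"
proof -
  have "k \<le> n \<Longrightarrow> I k (iter k f s)" for k
    by (induction k) (use assms in auto)
  then show ?thesis by blast
qed

text \<open>The bound of a loop is evaluated once and the counter ends at that value, as the
  compiled \<open>While\<close> leaves it. Resetting the counter before each round agrees with the
  increment on the machine because \<open>safe\<close> forbids the body to assign it.\<close>

primrec run :: "lcom \<Rightarrow> lstate \<Rightarrow> lstate" where
  "run (LSet x e) s = setv x (lval e s) s"
| "run (LSto k a b c e) s = seta k (lval a s) (lval b s) (lval c s) (lval e s) s"
| "run (LSeq c c') s = run c' (run c s)"
| "run (LIf e c c') s = (if lval e s \<noteq> 0 then run c s else run c' s)"
| "run (LFor x e c) s = setv x (lval e s) (iter (lval e s) (\<lambda>k t. run c (setv x k t)) s)"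

primrec vars :: "lcom \<Rightarrow> string set" where
  "vars (LSet x e) = {x}"
| "vars (LSto k a b c e) = {}"
| "vars (LSeq c c') = vars c \<union> vars c'"
| "vars (LIf e c c') = vars c \<union> vars c'"
| "vars (LFor x e c) = insert x (vars c)"

primrec arrs :: "lcom \<Rightarrow> nat set" where
  "arrs (LSet x e) = {}"
| "arrs (LSto k a b c e) = {k}"
| "arrs (LSeq c c') = arrs c \<union> arrs c'"
| "arrs (LIf e c c') = arrs c \<union> arrs c'"
| "arrs (LFor x e c) = arrs c"

lemma run_vars: "x \<notin> vars c \<Longrightarrow> lv (run c s) x = lv s x"
proof (induction c arbitrary: s)
  case (LFor y e c)
  have "lv (iter n (\<lambda>k t. run c (setv y k t)) s) x = lv s x" for n
    by (induction n) (use LFor in auto)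
  with LFor.prems show ?case by simp
qed auto

lemma run_arrs: "k \<notin> arrs c \<Longrightarrow> la (run c s) k = la s k"
proof (induction c arbitrary: s)
  case (LSto m a b c e)
  then show ?case by (auto simp: fun_eq_iff)
next
  case (LFor y e c)
  have "la (iter n (\<lambda>j t. run c (setv y j t)) s) k = la s k" for n
    by (induction n) (use LFor in auto)
  with LFor.prems show ?case by simp
qed auto

lemma run_For_induct:
  assumes "I 0 s" "lval e s = n"
    "\<And>k t. k < n \<Longrightarrow> I k t \<Longrightarrow> I (Suc k) (run c (setv x k t))"
    "\<And>t. I n t \<Longrightarrow> J (setv x n t)"
  shows "J (run (LFor x e c) s)"
  using iter_induct[of I s n "\<lambda>k t. run c (setv x k t)"] assms by auto

text \<open>
  Here \<open>\<beta>\<close> bounds the variables, \<open>\<gamma>\<close> the entries of the arrays, and \<open>G\<close> all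
  intermediate results.
\<close>

primrec bnd :: "(string \<Rightarrow> nat) \<Rightarrow> (nat \<Rightarrow> nat) \<Rightarrow> lexp \<Rightarrow> nat" where
  "bnd \<beta> \<gamma> (LC k) = k"
| "bnd \<beta> \<gamma> (LV x) = \<beta> x"
| "bnd \<beta> \<gamma> (LA k a b c) = \<gamma> k"
| "bnd \<beta> \<gamma> (LAdd a b) = bnd \<beta> \<gamma> a + bnd \<beta> \<gamma> b"
| "bnd \<beta> \<gamma> (LSub a b) = bnd \<beta> \<gamma> a"
| "bnd \<beta> \<gamma> (LMul a b) = bnd \<beta> \<gamma> a * bnd \<beta> \<gamma> b"
| "bnd \<beta> \<gamma> (LDiv a b) = bnd \<beta> \<gamma> a"
| "bnd \<beta> \<gamma> (LMin a b) = min (bnd \<beta> \<gamma> a) (bnd \<beta> \<gamma> b)"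
| "bnd \<beta> \<gamma> (LMod2 a) = 1"

text \<open>The demand \<open>2 \<le> G\<close> for \<open>LMod2\<close> stems from the constant 2
  in its code. Differences, quotients and minima bring no size condition of their own, since they
  never exceed an operand.\<close>

primrec safe_exp :: "(string \<Rightarrow> nat) \<Rightarrow> (nat \<Rightarrow> nat) \<Rightarrow> nat \<Rightarrow> lexp \<Rightarrow> bool" where
  "safe_exp \<beta> \<gamma> G (LC k) \<longleftrightarrow> k \<le> G"
| "safe_exp \<beta> \<gamma> G (LV x) \<longleftrightarrow> \<beta> x \<le> G"
| "safe_exp \<beta> \<gamma> G (LA k a b c) \<longleftrightarrow>
     k \<le> G \<and> \<gamma> k \<le> G \<and> safe_exp \<beta> \<gamma> G a \<and> safe_exp \<beta> \<gamma> G b \<and> safe_exp \<beta> \<gamma> G c"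
| "safe_exp \<beta> \<gamma> G (LAdd a b) \<longleftrightarrow>
     safe_exp \<beta> \<gamma> G a \<and> safe_exp \<beta> \<gamma> G b \<and> bnd \<beta> \<gamma> a + bnd \<beta> \<gamma> b \<le> G"
| "safe_exp \<beta> \<gamma> G (LSub a b) \<longleftrightarrow> safe_exp \<beta> \<gamma> G a \<and> safe_exp \<beta> \<gamma> G b"
| "safe_exp \<beta> \<gamma> G (LMul a b) \<longleftrightarrow>
     safe_exp \<beta> \<gamma> G a \<and> safe_exp \<beta> \<gamma> G b \<and> bnd \<beta> \<gamma> a * bnd \<beta> \<gamma> b \<le> G"
| "safe_exp \<beta> \<gamma> G (LDiv a b) \<longleftrightarrow> safe_exp \<beta> \<gamma> G a \<and> safe_exp \<beta> \<gamma> G b"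
| "safe_exp \<beta> \<gamma> G (LMin a b) \<longleftrightarrow> safe_exp \<beta> \<gamma> G a \<and> safe_exp \<beta> \<gamma> G b"
| "safe_exp \<beta> \<gamma> G (LMod2 a) \<longleftrightarrow> safe_exp \<beta> \<gamma> G a \<and> 2 \<le> G"

primrec safe :: "(string \<Rightarrow> nat) \<Rightarrow> (nat \<Rightarrow> nat) \<Rightarrow> nat \<Rightarrow> lcom \<Rightarrow> bool" where
  "safe \<beta> \<gamma> G (LSet x e) \<longleftrightarrow> safe_exp \<beta> \<gamma> G e \<and> bnd \<beta> \<gamma> e \<le> \<beta> x"
| "safe \<beta> \<gamma> G (LSto k a b c e) \<longleftrightarrow> k \<le> G \<and> safe_exp \<beta> \<gamma> G a \<and> safe_exp \<beta> \<gamma> G b \<and>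
     safe_exp \<beta> \<gamma> G c \<and> safe_exp \<beta> \<gamma> G e \<and> bnd \<beta> \<gamma> e \<le> \<gamma> k"
| "safe \<beta> \<gamma> G (LSeq c c') \<longleftrightarrow> safe \<beta> \<gamma> G c \<and> safe \<beta> \<gamma> G c'"
| "safe \<beta> \<gamma> G (LIf e c c') \<longleftrightarrow> safe_exp \<beta> \<gamma> G e \<and> safe \<beta> \<gamma> G c \<and> safe \<beta> \<gamma> G c'"
| "safe \<beta> \<gamma> G (LFor x e c) \<longleftrightarrow> safe_exp \<beta> \<gamma> G e \<and> bnd \<beta> \<gamma> e \<le> \<beta> x \<and> x \<notin> vars c \<and>
     safe \<beta> \<gamma> G c"

text \<open>Cost in units of the word length \<open>width\<close>. The code of \<open>LMin\<close>
  and \<open>LMod2\<close> repeats an operand, which is therefore counted twice. Of the 18 for an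
  array access, 16 pay for the address arithmetic and 2 for the load.\<close>

primrec esize :: "lexp \<Rightarrow> nat" where
  "esize (LC k) = 1"
| "esize (LV x) = 1"
| "esize (LA k a b c) = esize a + esize b + esize c + 18"
| "esize (LAdd a b) = esize a + esize b + 2"
| "esize (LSub a b) = esize a + esize b + 2"
| "esize (LMul a b) = esize a + esize b + 2"
| "esize (LDiv a b) = esize a + esize b + 2"
| "esize (LMin a b) = esize a + 2 * esize b + 4"
| "esize (LMod2 a) = 2 * esize a + 8"

text \<open>In a loop, 12 covers the test and the increment of a round (5 and 6 units); 10 covers
  saving the bound (2), clearing the counter (3) and the last, failing test (5). A conditional is
  charged for both branches.\<close>

primrec steps :: "(string \<Rightarrow> nat) \<Rightarrow> (nat \<Rightarrow> nat) \<Rightarrow> lcom \<Rightarrow> nat" where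
  "steps \<beta> \<gamma> (LSet x e) = esize e + 2"
| "steps \<beta> \<gamma> (LSto k a b c e) = esize a + esize b + esize c + esize e + 20"
| "steps \<beta> \<gamma> (LSeq c c') = steps \<beta> \<gamma> c + steps \<beta> \<gamma> c'"
| "steps \<beta> \<gamma> (LIf e c c') = 1 + esize e + steps \<beta> \<gamma> c + steps \<beta> \<gamma> c'"
| "steps \<beta> \<gamma> (LFor x e c) = esize e + 10 + bnd \<beta> \<gamma> e * (steps \<beta> \<gamma> c + 12)"

definition bounded :: "(string \<Rightarrow> nat) \<Rightarrow> (nat \<Rightarrow> nat) \<Rightarrow> lstate \<Rightarrow> bool" where
  "bounded \<beta> \<gamma> s \<longleftrightarrow> (\<forall>x. lv s x \<le> \<beta> x) \<and> (\<forall>k i j l. la s k i j l \<le> \<gamma> k)"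

lemma lval_le_bnd: "bounded \<beta> \<gamma> s \<Longrightarrow> lval e s \<le> bnd \<beta> \<gamma> e"
proof (induction e)
  case (LSub a b) then show ?case by simp
next
  case (LDiv a b) then show ?case by simp (meson div_le_dividend le_trans)
qed (auto simp: bounded_def add_mono mult_le_mono intro: min.coboundedI1 min.coboundedI2)

lemma bnd_le: "safe_exp \<beta> \<gamma> G e \<Longrightarrow> bnd \<beta> \<gamma> e \<le> G"
  by (induction e) auto

lemma bounded_setv: "bounded \<beta> \<gamma> s \<Longrightarrow> k \<le> \<beta> x \<Longrightarrow> bounded \<beta> \<gamma> (setv x k s)"
  by (simp add: bounded_def)

lemma bounded_seta: "bounded \<beta> \<gamma> s \<Longrightarrow> w \<le> \<gamma> k \<Longrightarrow> bounded \<beta> \<gamma> (seta k i j l w s)"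
  by (simp add: bounded_def)

section \<open>Compilation to the random access machine\<close>

text \<open>With this layout the input and the answer are parts of array 0.\<close>

definition adr :: "nat \<Rightarrow> nat \<Rightarrow> nat \<Rightarrow> nat \<Rightarrow> nat \<Rightarrow> nat" where
  "adr B k i j l = ((k * B + i) * B + j) * B + l"

lemma digits_inj:
  fixes a b :: nat
  assumes "a * B + i = b * B + j" "i < B" "j < B"
  shows "a = b \<and> i = j"
proof -
  have "a = (a * B + i) div B" "b = (b * B + j) div B" using assms(2,3) by auto
  with assms(1) show ?thesis by auto
qed

text \<open>An address is a number in base \<open>B\<close>; its leading digit \<open>k\<close> may
  be of any size, the three others are below \<open>B\<close>, so the digits are unique.\<close>

lemma adr_inj:
  assumes "adr B k i j l = adr B k' i' j' l'" "i < B" "j < B" "l < B" "i' < B" "j' < B" "l' < B"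
  shows "k = k' \<and> i = i' \<and> j = j' \<and> l = l'"
  using assms digits_inj unfolding adr_def by metis

lemma digits_less:
  fixes a :: nat
  assumes "a < A" "i < B"
  shows "a * B + i < A * B"
proof -
  have "a * B + i < (a + 1) * B" using assms(2) by simp
  also have "\<dots> \<le> A * B" using assms(1) by (intro mult_le_mono) auto
  finally show ?thesis .
qed

lemma adr_less:
  assumes "k < B" "i < B" "j < B" "l < B"
  shows "adr B k i j l < B ^ 4"
  using digits_less[OF digits_less[OF digits_less[OF assms(1,2)] assms(3)] assms(4)]
  by (simp add: adr_def power4_eq_xxxx)

definition adr_exp :: "nat \<Rightarrow> exp \<Rightarrow> exp \<Rightarrow> exp \<Rightarrow> exp" where
  "adr_exp k a b c = Add (Mul (Add (Mul (Add (Mul (Const k) (Reg ''B'')) a)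
     (Reg ''B'')) b) (Reg ''B'')) c"

text \<open>The first letter keeps registers apart: \<open>v\<close> marks program variables,
  \<open>l\<close> saved loop bounds, and \<open>B\<close> is the address base. With truncated
  subtraction, \<open>b - (b - a)\<close> is the minimum of \<open>a\<close> and
  \<open>b\<close>.\<close>

primrec comp_exp :: "lexp \<Rightarrow> exp" where
  "comp_exp (LC k) = Const k"
| "comp_exp (LV x) = Reg (CHR ''v'' # x)"
| "comp_exp (LA k a b c) = Load (adr_exp k (comp_exp a) (comp_exp b) (comp_exp c))"
| "comp_exp (LAdd a b) = Add (comp_exp a) (comp_exp b)"
| "comp_exp (LSub a b) = Sub (comp_exp a) (comp_exp b)"
| "comp_exp (LMul a b) = Mul (comp_exp a) (comp_exp b)"
| "comp_exp (LDiv a b) = Div (comp_exp a) (comp_exp b)"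
| "comp_exp (LMin a b) = Sub (comp_exp b) (Sub (comp_exp b) (comp_exp a))"
| "comp_exp (LMod2 a) = Sub (comp_exp a) (Mul (Div (comp_exp a) (Const 2)) (Const 2))"

primrec comp :: "lcom \<Rightarrow> com" where
  "comp (LSet x e) = SetReg (CHR ''v'' # x) (comp_exp e)"
| "comp (LSto k a b c e) = Store (adr_exp k (comp_exp a) (comp_exp b) (comp_exp c)) (comp_exp e)"
| "comp (LSeq c c') = Seq (comp c) (comp c')"
| "comp (LIf e c c') = Cond (comp_exp e) (comp c) (comp c')"
| "comp (LFor x e c) = Seq (SetReg (CHR ''l'' # x) (comp_exp e))
     (Seq (SetReg (CHR ''v'' # x) (Const 0))
       (While (Sub (Reg (CHR ''l'' # x)) (Reg (CHR ''v'' # x)))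
         (Seq (comp c) (SetReg (CHR ''v'' # x) (Add (Reg (CHR ''v'' # x)) (Const 1))))))"

definition represents :: "nat \<Rightarrow> lstate \<Rightarrow> state \<Rightarrow> bool" where
  "represents B s \<sigma> \<longleftrightarrow> (\<forall>x. reg \<sigma> (CHR ''v'' # x) = lv s x) \<and> reg \<sigma> ''B'' = B \<and>
     (\<forall>k i j l. k < B \<longrightarrow> i < B \<longrightarrow> j < B \<longrightarrow> l < B \<longrightarrow> mem \<sigma> (adr B k i j l) = la s k i j l)"

lemma bit_length_mono: "x \<le> y \<Longrightarrow> bit_length x \<le> bit_length y"
  unfolding bit_length_def using floorlog_mono[of x y 2] by simp

lemma bit_length_pos: "1 \<le> bit_length x"
  by (simp add: bit_length_def)

context
  fixes B :: nat and G :: nat and \<beta> :: "string \<Rightarrow> nat" and \<gamma> :: "nat \<Rightarrow> nat"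
  assumes GB: "G < B"
begin

text \<open>Values are below \<open>B\<close> and addresses below \<open>B ^ 4\<close>, so this
  single length bounds every number that compiled code handles and turns logarithmic cost into a
  count of operations.\<close>

definition "width = bit_length (B ^ 4)"

lemma width_bound: "x < B ^ 4 \<Longrightarrow> bit_length x \<le> width"
  unfolding width_def by (intro bit_length_mono) simp

lemma width_pos: "1 \<le> width"
  unfolding width_def by (rule bit_length_pos)

lemma B_less: "x < B \<Longrightarrow> x < B ^ 4"
  by (cases B) (auto intro: less_le_trans simp: power4_eq_xxxx)

text \<open>The 16 lengths are two for each of the six operations and one for each of the four
  leaves \<open>k\<close>, \<open>B\<close>, \<open>B\<close>, \<open>B\<close>.\<close>

lemma adr_exp_correct:
  assumes "val a \<sigma> < B" "val b \<sigma> < B" "val c \<sigma> < B" "k < B" "reg \<sigma> ''B'' = B"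
    "exp_cost a \<sigma> \<le> width * ea" "exp_cost b \<sigma> \<le> width * eb" "exp_cost c \<sigma> \<le> width * ec"
  shows "val (adr_exp k a b c) \<sigma> = adr B k (val a \<sigma>) (val b \<sigma>) (val c \<sigma>)"
    and "exp_cost (adr_exp k a b c) \<sigma> \<le> width * (ea + eb + ec + 16)"
proof -
  show "val (adr_exp k a b c) \<sigma> = adr B k (val a \<sigma>) (val b \<sigma>) (val c \<sigma>)"
    using assms by (simp add: adr_exp_def adr_def)
  define p1 where "p1 = k * B + val a \<sigma>"
  define p2 where "p2 = p1 * B + val b \<sigma>"
  have p1: "p1 < B * B" unfolding p1_def by (rule digits_less) (use assms in auto)
  have p2: "p2 < B * B * B" unfolding p2_def by (rule digits_less) (use assms p1 in auto)
  have p3: "p2 * B + val c \<sigma> < B * B * B * B" by (rule digits_less) (use assms p2 in auto)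
  have B0: "B > 0" using assms(1) by simp
  have le: "B * B \<le> B * B * B * B" "B * B * B \<le> B * B * B * B" "B \<le> B * B * B * B"
    using B0 by (auto simp: mult.assoc)
  have B4: "B ^ 4 = B * B * B * B" by (simp add: power4_eq_xxxx)
  have wB: "bit_length B \<le> width"
    unfolding width_def B4 by (rule bit_length_mono) (rule le)
  have w: "bit_length x \<le> width" if "x \<le> B * B * B * B" for x
    unfolding width_def B4 by (rule bit_length_mono) (rule that)
  have w1: "bit_length k \<le> width" "bit_length (k * B) \<le> width" "bit_length (val a \<sigma>) \<le> width"
    "bit_length p1 \<le> width" "bit_length (p1 * B) \<le> width" "bit_length (val b \<sigma>) \<le> width"
    "bit_length p2 \<le> width" "bit_length (p2 * B) \<le> width" "bit_length (val c \<sigma>) \<le> width"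
    using assms(1-4) p1 p2 p3 le unfolding p1_def p2_def
    by - (rule w; linarith)+
  have "exp_cost (adr_exp k a b c) \<sigma> =
      bit_length k + bit_length B + bit_length k + bit_length B + exp_cost a \<sigma> +
      bit_length (k * B) + bit_length (val a \<sigma>) + bit_length B + bit_length p1 + bit_length B +
      exp_cost b \<sigma> + bit_length (p1 * B) + bit_length (val b \<sigma>) + bit_length B + bit_length p2 +
      bit_length B + exp_cost c \<sigma> + bit_length (p2 * B) + bit_length (val c \<sigma>)"
    using assms(5) by (simp add: adr_exp_def p1_def p2_def)
  also have "\<dots> \<le> width * (ea + eb + ec + 16)"
    unfolding distrib_left using w1 wB assms(6-8) by linarith
  finally show "exp_cost (adr_exp k a b c) \<sigma> \<le> width * (ea + eb + ec + 16)" .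
qed

lemma comp_exp_correct:
  assumes "represents B s \<sigma>" "bounded \<beta> \<gamma> s" "safe_exp \<beta> \<gamma> G e"
  shows "val (comp_exp e) \<sigma> = lval e s \<and> lval e s < B \<and> exp_cost (comp_exp e) \<sigma> \<le> width * esize e"
  using assms(3)
proof (induction e)
  have less: "lval e s < B" if "safe_exp \<beta> \<gamma> G e" for e
    using lval_le_bnd[OF assms(2), of e] bnd_le[OF that] GB by linarith
  have w: "bit_length x \<le> width" if "x < B" for x
    using width_bound[OF B_less[OF that]] .
  {
    case (LC k)
    then show ?case using GB by (auto intro!: w)
  next
    case (LV x)
    then show ?case using assms(1) less[OF LV] by (auto simp: represents_def intro!: w)
  next
    case (LA k a b c)
    then have s: "safe_exp \<beta> \<gamma> G a" "safe_exp \<beta> \<gamma> G b" "safe_exp \<beta> \<gamma> G c" and k: "k < B"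
      using GB by auto
    note IH = LA.IH(1)[OF s(1)] LA.IH(2)[OF s(2)] LA.IH(3)[OF s(3)]
    have reg: "reg \<sigma> ''B'' = B" using assms(1) by (simp add: represents_def)
    note A = adr_exp_correct[of "comp_exp a" \<sigma> "comp_exp b" "comp_exp c" k "esize a" "esize b" "esize c"]
    have v: "val (adr_exp k (comp_exp a) (comp_exp b) (comp_exp c)) \<sigma> =
        adr B k (lval a s) (lval b s) (lval c s)"
      and c: "exp_cost (adr_exp k (comp_exp a) (comp_exp b) (comp_exp c)) \<sigma> \<le>
        width * (esize a + esize b + esize c + 16)"
      using A IH k reg by auto
    have m: "mem \<sigma> (adr B k (lval a s) (lval b s) (lval c s)) = lval (LA k a b c) s"
      using assms(1) IH k by (simp add: represents_def)
    have "bit_length (adr B k (lval a s) (lval b s) (lval c s)) \<le> width"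
      by (rule width_bound, rule adr_less) (use IH k in auto)
    with c w[OF less[OF LA.prems]] have
      "exp_cost (comp_exp (LA k a b c)) \<sigma> \<le> width * (esize a + esize b + esize c + 16) + width + width"
      using v m by (simp del: adr_exp_def)
    also have "\<dots> = width * esize (LA k a b c)" by (simp add: algebra_simps)
    finally show ?case using v m less[OF LA.prems] by simp
  next
    case (LAdd a b)
    then have s: "safe_exp \<beta> \<gamma> G a" "safe_exp \<beta> \<gamma> G b" by auto
    show ?case
      using LAdd.IH(1)[OF s(1)] LAdd.IH(2)[OF s(2)] w[OF less[OF s(1)]] w[OF less[OF s(2)]]
        less[OF LAdd.prems] by (simp add: distrib_left)
  next
    case (LSub a b)
    then have s: "safe_exp \<beta> \<gamma> G a" "safe_exp \<beta> \<gamma> G b" by auto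
    show ?case
      using LSub.IH(1)[OF s(1)] LSub.IH(2)[OF s(2)] w[OF less[OF s(1)]] w[OF less[OF s(2)]]
        less[OF LSub.prems] by (simp add: distrib_left)
  next
    case (LMul a b)
    then have s: "safe_exp \<beta> \<gamma> G a" "safe_exp \<beta> \<gamma> G b" by auto
    show ?case
      using LMul.IH(1)[OF s(1)] LMul.IH(2)[OF s(2)] w[OF less[OF s(1)]] w[OF less[OF s(2)]]
        less[OF LMul.prems] by (simp add: distrib_left)
  next
    case (LDiv a b)
    then have s: "safe_exp \<beta> \<gamma> G a" "safe_exp \<beta> \<gamma> G b" by auto
    show ?case
      using LDiv.IH(1)[OF s(1)] LDiv.IH(2)[OF s(2)] w[OF less[OF s(1)]] w[OF less[OF s(2)]]
        less[OF LDiv.prems] by (simp add: distrib_left)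
  next
    case (LMin a b)
    then have s: "safe_exp \<beta> \<gamma> G a" "safe_exp \<beta> \<gamma> G b" by auto
    note IH = LMin.IH(1)[OF s(1)] LMin.IH(2)[OF s(2)]
    have "bit_length (lval b s - lval a s) \<le> width" by (rule w) (use IH in auto)
    moreover have "lval b s - (lval b s - lval a s) = min (lval a s) (lval b s)" by auto
    ultimately show ?case
      using IH w[OF less[OF s(1)]] w[OF less[OF s(2)]] less[OF LMin.prems]
      by (simp add: distrib_left)
  next
    case (LMod2 a)
    then have s: "safe_exp \<beta> \<gamma> G a" "2 < B" using GB by auto
    note IH = LMod2.IH[OF s(1)]
    have b: "bit_length (lval a s div 2) \<le> width" "bit_length (lval a s div 2 * 2) \<le> width"
      "bit_length 2 \<le> width" "bit_length (lval a s) \<le> width"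
      by (rule w, use IH s in auto)+
    moreover have "lval a s - lval a s div 2 * 2 = lval a s mod 2"
      by (simp add: minus_div_mult_eq_mod)
    ultimately show ?case
      using IH less[OF LMod2.prems] by (simp add: distrib_left)
  }
qed

lemma bounded_run:
  "safe \<beta> \<gamma> G c \<Longrightarrow> bounded \<beta> \<gamma> s \<Longrightarrow> bounded \<beta> \<gamma> (run c s)"
proof (induction c arbitrary: s)
  case (LSet x e)
  then show ?case using lval_le_bnd[OF LSet.prems(2), of e] by (auto intro!: bounded_setv)
next
  case (LSto k a b c e)
  then show ?case using lval_le_bnd[OF LSto.prems(2), of e] by (auto intro!: bounded_seta)
next
  case (LFor x e c)
  have n: "lval e s \<le> \<beta> x" using LFor.prems lval_le_bnd[OF LFor.prems(2), of e] by auto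
  have "bounded \<beta> \<gamma> (iter n (\<lambda>k t. run c (setv x k t)) s)" if "n \<le> lval e s" for n
    using that
  proof (induction n)
    case (Suc k)
    then show ?case using n LFor.IH[of "setv x k _"] LFor.prems(1) by (simp add: bounded_setv)
  qed (use LFor.prems in simp)
  then show ?case using n by (auto intro!: bounded_setv)
qed auto

lemma represents_setv:
  assumes "represents B s \<sigma>"
  shows "represents B (setv x k s) (\<sigma>\<lparr>reg := (reg \<sigma>)(CHR ''v'' # x := k)\<rparr>)"
  using assms by (simp add: represents_def)

lemma represents_seta:
  assumes "represents B s \<sigma>" "k < B" "i < B" "j < B" "l < B"
  shows "represents B (seta k i j l w s) (\<sigma>\<lparr>mem := (mem \<sigma>)(adr B k i j l := w)\<rparr>)"
proof -
  have "adr B k' i' j' l' = adr B k i j l \<longleftrightarrow> k' = k \<and> i' = i \<and> j' = j \<and> l' = l"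
    if "i' < B" "j' < B" "l' < B" for k' i' j' l'
    using adr_inj[of B k' i' j' l' k i j l] assms that by auto
  then show ?thesis using assms by (auto simp: represents_def)
qed

text \<open>Compiled code tosses no coins, so \<open>r\<close> passes through unchanged. The last
  conjunct serves nested loops: the saved bound of a loop survives its body because
  \<open>safe\<close> keeps the counter out of the \<open>vars\<close> of the body.\<close>

theorem comp_correct:
  assumes "safe \<beta> \<gamma> G c" "bounded \<beta> \<gamma> s" "represents B s \<sigma>"
  shows "\<exists>t \<sigma>'. (\<forall>r. exec (comp c) \<sigma> r t \<sigma>' r) \<and> t \<le> width * steps \<beta> \<gamma> c \<and>
    represents B (run c s) \<sigma>' \<and> (\<forall>x. x \<notin> vars c \<longrightarrow> reg \<sigma>' (CHR ''l'' # x) = reg \<sigma> (CHR ''l'' # x))"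
  using assms
proof (induction c arbitrary: s \<sigma>)
  have w: "bit_length x \<le> width" if "x < B" for x
    using width_bound[OF B_less[OF that]] .
  {
    case (LSet x e)
    note e = comp_exp_correct[OF LSet.prems(3,2), of e]
    have "exec (comp (LSet x e)) \<sigma> r (1 + exp_cost (comp_exp e) \<sigma> + bit_length (lval e s))
        (\<sigma>\<lparr>reg := (reg \<sigma>)(CHR ''v'' # x := lval e s)\<rparr>) r" for r
      using exec.SetReg[of "CHR ''v'' # x" "comp_exp e" \<sigma> r] e LSet.prems(1) by simp
    moreover have "1 + exp_cost (comp_exp e) \<sigma> + bit_length (lval e s) \<le> width * (esize e + 2)"
      using e w[of "lval e s"] LSet.prems(1) width_pos unfolding distrib_left by simp
    ultimately show ?case using represents_setv[OF LSet.prems(3)]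
      by (intro exI[of _ "1 + exp_cost (comp_exp e) \<sigma> + bit_length (lval e s)"]
          exI[of _ "\<sigma>\<lparr>reg := (reg \<sigma>)(CHR ''v'' # x := lval e s)\<rparr>"]) simp
  next
    case (LSto k a b c e)
    then have k: "k < B" using GB by simp
    note c = comp_exp_correct[OF LSto.prems(3,2)]
    have s: "safe_exp \<beta> \<gamma> G a" "safe_exp \<beta> \<gamma> G b" "safe_exp \<beta> \<gamma> G c" "safe_exp \<beta> \<gamma> G e"
      using LSto.prems(1) by auto
    note C = c[OF s(1)] c[OF s(2)] c[OF s(3)] c[OF s(4)]
    have reg: "reg \<sigma> ''B'' = B" using LSto.prems(3) by (simp add: represents_def)
    let ?a = "adr_exp k (comp_exp a) (comp_exp b) (comp_exp c)"
    let ?p = "adr B k (lval a s) (lval b s) (lval c s)"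
    have v: "val ?a \<sigma> = ?p"
      and t: "exp_cost ?a \<sigma> \<le> width * (esize a + esize b + esize c + 16)"
      using adr_exp_correct[of "comp_exp a" \<sigma> "comp_exp b" "comp_exp c" k "esize a" "esize b" "esize c"]
        C k reg by auto
    let ?t = "1 + exp_cost ?a \<sigma> + exp_cost (comp_exp e) \<sigma> + bit_length ?p + bit_length (lval e s)"
    have "exec (comp (LSto k a b c e)) \<sigma> r ?t (\<sigma>\<lparr>mem := (mem \<sigma>)(?p := lval e s)\<rparr>) r" for r
      using exec.Store[of ?a "comp_exp e" \<sigma> r] v C by simp
    moreover have "bit_length ?p \<le> width"
      by (rule width_bound, rule adr_less) (use C k in auto)
    then have "?t \<le> width * (esize a + esize b + esize c + esize e + 20)"
      using t w[of "lval e s"] C(4) width_pos unfolding distrib_left by simp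
    ultimately show ?case using represents_seta[OF LSto.prems(3) k] C
      by (intro exI[of _ ?t] exI[of _ "\<sigma>\<lparr>mem := (mem \<sigma>)(?p := lval e s)\<rparr>"]) simp
  next
    case (LSeq c c')
    then have s: "safe \<beta> \<gamma> G c" "safe \<beta> \<gamma> G c'" by auto
    from LSeq.IH(1)[OF s(1) LSeq.prems(2,3)] obtain t \<sigma>' where
      1: "\<And>r. exec (comp c) \<sigma> r t \<sigma>' r" "t \<le> width * steps \<beta> \<gamma> c" "represents B (run c s) \<sigma>'"
      "\<And>x. x \<notin> vars c \<Longrightarrow> reg \<sigma>' (CHR ''l'' # x) = reg \<sigma> (CHR ''l'' # x)" by blast
    from LSeq.IH(2)[OF s(2) bounded_run[OF s(1) LSeq.prems(2)] 1(3)] obtain t' \<sigma>'' where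
      2: "\<And>r. exec (comp c') \<sigma>' r t' \<sigma>'' r" "t' \<le> width * steps \<beta> \<gamma> c'"
      "represents B (run c' (run c s)) \<sigma>''"
      "\<And>x. x \<notin> vars c' \<Longrightarrow> reg \<sigma>'' (CHR ''l'' # x) = reg \<sigma>' (CHR ''l'' # x)" by blast
    show ?case
      using 1(2,4) 2(2-4) exec.Seq[OF 1(1) 2(1)]
      by (intro exI[of _ "t + t'"] exI[of _ \<sigma>'']) (simp add: distrib_left)
  next
    case (LIf e c c')
    then have s: "safe_exp \<beta> \<gamma> G e" "safe \<beta> \<gamma> G c" "safe \<beta> \<gamma> G c'" by auto
    note e = comp_exp_correct[OF LIf.prems(3,2) s(1)]
    show ?case
    proof (cases "lval e s = 0")
      case False
      from LIf.IH(1)[OF s(2) LIf.prems(2,3)] obtain t \<sigma>' where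
        1: "\<And>r. exec (comp c) \<sigma> r t \<sigma>' r" "t \<le> width * steps \<beta> \<gamma> c" "represents B (run c s) \<sigma>'"
        "\<And>x. x \<notin> vars c \<Longrightarrow> reg \<sigma>' (CHR ''l'' # x) = reg \<sigma> (CHR ''l'' # x)" by blast
      have "exec (comp (LIf e c c')) \<sigma> r (1 + exp_cost (comp_exp e) \<sigma> + t) \<sigma>' r" for r
        using exec.CondTrue[OF _ 1(1)] e False by simp
      moreover have "1 + exp_cost (comp_exp e) \<sigma> + t \<le> width * steps \<beta> \<gamma> (LIf e c c')"
        using 1(2) e width_pos by (simp add: distrib_left)
      ultimately show ?thesis
        using 1(3,4) False
        by (intro exI[of _ "1 + exp_cost (comp_exp e) \<sigma> + t"] exI[of _ \<sigma>']) simp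
    next
      case True
      from LIf.IH(2)[OF s(3) LIf.prems(2,3)] obtain t \<sigma>' where
        1: "\<And>r. exec (comp c') \<sigma> r t \<sigma>' r" "t \<le> width * steps \<beta> \<gamma> c'" "represents B (run c' s) \<sigma>'"
        "\<And>x. x \<notin> vars c' \<Longrightarrow> reg \<sigma>' (CHR ''l'' # x) = reg \<sigma> (CHR ''l'' # x)" by blast
      have "exec (comp (LIf e c c')) \<sigma> r (1 + exp_cost (comp_exp e) \<sigma> + t) \<sigma>' r" for r
        using exec.CondFalse[OF _ 1(1)] e True by simp
      moreover have "1 + exp_cost (comp_exp e) \<sigma> + t \<le> width * steps \<beta> \<gamma> (LIf e c c')"
        using 1(2) e width_pos by (simp add: distrib_left)
      ultimately show ?thesis
        using 1(3,4) True
        by (intro exI[of _ "1 + exp_cost (comp_exp e) \<sigma> + t"] exI[of _ \<sigma>']) simp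
    qed
  next
    case (LFor x e c)
    then have s: "safe_exp \<beta> \<gamma> G e" "bnd \<beta> \<gamma> e \<le> \<beta> x" "x \<notin> vars c" "safe \<beta> \<gamma> G c" by auto
    note e = comp_exp_correct[OF LFor.prems(3,2) s(1)]
    define n where "n = lval e s"
    define S where "S k = setv x k (iter k (\<lambda>k t. run c (setv x k t)) s)" for k
    have nB: "n < B" using e by (simp add: n_def)
    have n: "n \<le> bnd \<beta> \<gamma> e" unfolding n_def by (rule lval_le_bnd[OF LFor.prems(2)])
    then have nb: "n \<le> \<beta> x" using s(2) by simp
    have S: "bounded \<beta> \<gamma> (S k)" if "k \<le> n" for k
      using that
    proof (induction k)
      case 0
      then show ?case using LFor.prems(2) by (simp add: S_def bounded_setv)
    next
      case (Suc k)
      then show ?case using bounded_run[OF s(4), of "S k"] nb by (auto simp: S_def intro!: bounded_setv)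
    qed
    have S_Suc: "S (Suc k) = setv x (Suc k) (run c (S k))" for k
      by (simp add: S_def)
    let ?w = "While (Sub (Reg (CHR ''l'' # x)) (Reg (CHR ''v'' # x)))
         (Seq (comp c) (SetReg (CHR ''v'' # x) (Add (Reg (CHR ''v'' # x)) (Const 1))))"
    \<comment> \<open>Induction on the number \<open>k\<close> of rounds still to run, starting in
      the state \<open>S (n - k)\<close> that precedes round \<open>n - k\<close>.\<close>
    have loop: "\<exists>t \<sigma>'. (\<forall>r. exec ?w \<sigma> r t \<sigma>' r) \<and> t \<le> width * 5 + k * (width * (steps \<beta> \<gamma> c + 12)) \<and>
        represents B (S n) \<sigma>' \<and> (\<forall>y. y \<notin> vars c \<longrightarrow> reg \<sigma>' (CHR ''l'' # y) = reg \<sigma> (CHR ''l'' # y))"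
      if "k \<le> n" "represents B (S (n - k)) \<sigma>" "reg \<sigma> (CHR ''l'' # x) = n" for k \<sigma>
      using that
    proof (induction k arbitrary: \<sigma>)
      case 0
      then have "reg \<sigma> (CHR ''v'' # x) = n" by (simp add: represents_def S_def)
      with 0 have v: "val (Sub (Reg (CHR ''l'' # x)) (Reg (CHR ''v'' # x))) \<sigma> = 0"
        "1 + exp_cost (Sub (Reg (CHR ''l'' # x)) (Reg (CHR ''v'' # x))) \<sigma> \<le> width * 5"
        using w[OF nB] width_pos by auto
      show ?case using exec.WhileFalse[OF v(1)] v(2) 0 by fastforce
    next
      case (Suc k)
      let ?j = "n - Suc k"
      have j: "?j < n" "Suc ?j = n - k" using Suc.prems(1) by auto
      have x: "reg \<sigma> (CHR ''v'' # x) = ?j" using Suc.prems(2) by (simp add: represents_def S_def)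
      have v: "val (Sub (Reg (CHR ''l'' # x)) (Reg (CHR ''v'' # x))) \<sigma> \<noteq> 0"
        using x Suc.prems by simp
      have cv: "exp_cost (Sub (Reg (CHR ''l'' # x)) (Reg (CHR ''v'' # x))) \<sigma> \<le> width * 4"
        using x Suc.prems w[OF nB] w[of ?j] nB j(1) by simp
      from LFor.IH[OF s(4) S[of ?j, OF less_imp_le[OF j(1)]] Suc.prems(2)] obtain t \<sigma>1 where
        1: "\<And>r. exec (comp c) \<sigma> r t \<sigma>1 r" "t \<le> width * steps \<beta> \<gamma> c" "represents B (run c (S ?j)) \<sigma>1"
        "\<And>x. x \<notin> vars c \<Longrightarrow> reg \<sigma>1 (CHR ''l'' # x) = reg \<sigma> (CHR ''l'' # x)" by blast
      have x1: "reg \<sigma>1 (CHR ''v'' # x) = ?j"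
        using 1(3) run_vars[OF s(3), of "S ?j"] by (simp add: represents_def S_def)
      define \<sigma>2 where "\<sigma>2 = \<sigma>1\<lparr>reg := (reg \<sigma>1)(CHR ''v'' # x := Suc ?j)\<rparr>"
      let ?u = "1 + exp_cost (Add (Reg (CHR ''v'' # x)) (Const 1)) \<sigma>1 + bit_length (Suc ?j)"
      have 2: "exec (SetReg (CHR ''v'' # x) (Add (Reg (CHR ''v'' # x)) (Const 1))) \<sigma>1 r ?u \<sigma>2 r" for r
        using exec.SetReg[of "CHR ''v'' # x" "Add (Reg (CHR ''v'' # x)) (Const 1)" \<sigma>1 r] x1
        by (simp add: \<sigma>2_def)
      have u: "?u \<le> width * 6"
        using x1 w[of ?j] w[of "Suc ?j"] w[of 1] nB j(1) width_pos by simp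
      have r2: "represents B (S (n - k)) \<sigma>2"
        using represents_setv[OF 1(3), of x "Suc ?j"] S_Suc[of ?j] j(2) by (simp add: \<sigma>2_def)
      have "reg \<sigma>2 (CHR ''l'' # x) = n" using 1(4)[OF s(3)] Suc.prems(3) by (simp add: \<sigma>2_def)
      from Suc.IH[OF Suc_leD[OF Suc.prems(1)] r2 this] obtain t' \<sigma>' where
        3: "\<And>r. exec ?w \<sigma>2 r t' \<sigma>' r" "t' \<le> width * 5 + k * (width * (steps \<beta> \<gamma> c + 12))"
        "represents B (S n) \<sigma>'"
        "\<And>y. y \<notin> vars c \<Longrightarrow> reg \<sigma>' (CHR ''l'' # y) = reg \<sigma>2 (CHR ''l'' # y)" by blast
      let ?T = "1 + exp_cost (Sub (Reg (CHR ''l'' # x)) (Reg (CHR ''v'' # x))) \<sigma> + (t + ?u) + t'"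
      have "exec ?w \<sigma> r ?T \<sigma>' r" for r
        by (rule exec.WhileTrue[OF v exec.Seq[OF 1(1) 2] 3(1)])
      moreover have "?T \<le> width * 5 + Suc k * (width * (steps \<beta> \<gamma> c + 12))"
        using 1(2) 3(2) u cv width_pos by (simp add: distrib_left)
      moreover have "reg \<sigma>' (CHR ''l'' # y) = reg \<sigma> (CHR ''l'' # y)" if "y \<notin> vars c" for y
        using 3(4)[OF that] 1(4)[OF that] by (simp add: \<sigma>2_def)
      ultimately show ?case using 3(3) by blast
    qed
    define \<sigma>1 where "\<sigma>1 = \<sigma>\<lparr>reg := (reg \<sigma>)(CHR ''l'' # x := n)\<rparr>"
    define \<sigma>2 where "\<sigma>2 = \<sigma>1\<lparr>reg := (reg \<sigma>1)(CHR ''v'' # x := 0)\<rparr>"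
    let ?t = "1 + exp_cost (comp_exp e) \<sigma> + bit_length n"
    have 1: "exec (SetReg (CHR ''l'' # x) (comp_exp e)) \<sigma> r ?t \<sigma>1 r" for r
      using exec.SetReg[of "CHR ''l'' # x" "comp_exp e" \<sigma> r] e by (simp add: \<sigma>1_def n_def)
    have t: "?t \<le> width * (esize e + 2)"
      using e w[OF nB] width_pos unfolding distrib_left by simp
    have 2: "exec (SetReg (CHR ''v'' # x) (Const 0)) \<sigma>1 r (1 + bit_length 0 + bit_length 0) \<sigma>2 r" for r
      using exec.SetReg[of "CHR ''v'' # x" "Const 0" \<sigma>1 r] by (simp add: \<sigma>2_def)
    have t2: "1 + bit_length 0 + bit_length 0 \<le> width * 3" using width_pos by (simp add: bit_length_def floorlog_def)
    have "represents B s \<sigma>1" using LFor.prems(3) by (simp add: \<sigma>1_def represents_def)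
    then have "represents B (S 0) \<sigma>2" unfolding \<sigma>2_def S_def by (simp add: represents_setv)
    then have "represents B (S (n - n)) \<sigma>2" by simp
    moreover have "reg \<sigma>2 (CHR ''l'' # x) = n" by (simp add: \<sigma>1_def \<sigma>2_def)
    ultimately obtain t' \<sigma>' where
      3: "\<And>r. exec ?w \<sigma>2 r t' \<sigma>' r" "t' \<le> width * 5 + n * (width * (steps \<beta> \<gamma> c + 12))"
      "represents B (S n) \<sigma>'"
      "\<And>y. y \<notin> vars c \<Longrightarrow> reg \<sigma>' (CHR ''l'' # y) = reg \<sigma>2 (CHR ''l'' # y)"
      using loop[OF order.refl] by blast
    have "exec (comp (LFor x e c)) \<sigma> r (?t + (1 + bit_length 0 + bit_length 0 + t')) \<sigma>' r" for r
      unfolding comp.simps by (rule exec.Seq[OF 1 exec.Seq[OF 2 3(1)]])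
    moreover have "n * (width * (steps \<beta> \<gamma> c + 12)) \<le> width * (bnd \<beta> \<gamma> e * (steps \<beta> \<gamma> c + 12))"
      using n by (simp add: mult.left_commute mult_le_mono)
    then have "?t + (1 + bit_length 0 + bit_length 0 + t') \<le> width * steps \<beta> \<gamma> (LFor x e c)"
      using t t2 3(2) unfolding steps.simps distrib_left by linarith
    moreover have "run (LFor x e c) s = S n" by (simp add: S_def n_def)
    ultimately show ?case using 3(3,4)
      by (intro exI[of _ "?t + (1 + bit_length 0 + bit_length 0 + t')"] exI[of _ \<sigma>'])
        (simp add: \<sigma>2_def \<sigma>1_def)
  }
qed

end

section \<open>Polynomials over GF(2) as functions on bit masks\<close>

text \<open>Bits are used as the field with two elements; these rules would rewrite sums and
  products to bit operations, out of reach of the ring lemmas.\<close>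

declare add_bit_eq_xor [simp del] mult_bit_eq_and [simp del]

text \<open>A point of the cube is encoded by the number whose binary digits are its coordinates.\<close>

definition bt :: "nat \<Rightarrow> nat \<Rightarrow> bit" where
  "bt x i = of_nat (x div 2 ^ i)"

lemma bit_cases [case_names 0 1]:
  fixes a :: bit
  obtains "a = 0" | "a = 1"
  by (cases a) auto

lemma bit_add_self [simp]: "(a::bit) + a = 0"
  by (cases a rule: bit_cases) (auto simp: add_bit_eq_xor)

lemma bit_mult_self [simp]: "(a::bit) * a = a"
  by (cases a rule: bit_cases) (auto simp: mult_bit_eq_and)

lemma bit_add_eq_0_iff: "(a::bit) + b = 0 \<longleftrightarrow> a = b"
  by (cases a rule: bit_cases; cases b rule: bit_cases) (auto simp: add_bit_eq_xor)

lemma of_nat_bit_eq: "(of_nat k :: bit) = of_bool (odd k)"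
  by (induction k) (auto simp: add_bit_eq_xor)

lemma bt_eq: "bt x i = of_bool (bit x i)"
  by (simp add: bt_def of_nat_bit_eq bit_iff_odd)

lemma bt_eq_1_iff: "bt x i = 1 \<longleftrightarrow> bit x i"
  by (simp add: bt_eq)

lemma bt_less: "x < 2 ^ m \<Longrightarrow> m \<le> i \<Longrightarrow> bt x i = 0"
proof -
  assume "x < 2 ^ m" "m \<le> i"
  then have "x < 2 ^ i" by (meson less_le_trans one_le_numeral power_increasing)
  then show ?thesis by (simp add: bt_def)
qed

lemma bit_minus_power:
  fixes x :: nat
  assumes "bit x i"
  shows "2 ^ i \<le> x" "bit (x - 2 ^ i) j \<longleftrightarrow> bit x j \<and> j \<noteq> i"
proof -
  show "2 ^ i \<le> x"
    using assms by (metis bit_iff_odd div_less even_zero not_le)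
  have "set_bit i (unset_bit i x) = x"
    by (rule bit_eqI) (use assms in \<open>auto simp: bit_simps\<close>)
  then have "x = unset_bit i x + 2 ^ i"
    using set_bit_eq[of i "unset_bit i x"] by (simp add: bit_unset_bit_iff)
  then have "unset_bit i x = x - 2 ^ i" by linarith
  then show "bit (x - 2 ^ i) j \<longleftrightarrow> bit x j \<and> j \<noteq> i"
    by (metis bit_unset_bit_iff)
qed

lemma bt_minus_power: "bt x i = 1 \<Longrightarrow> bt (x - 2 ^ i) j = (if j = i then 0 else bt x j)"
  using bit_minus_power(2)[of x i j] by (auto simp: bt_eq)

lemma bt_append: "v < 2 ^ a \<Longrightarrow> bt (u * 2 ^ a + v) j = (if j < a then bt v j else bt u (j - a))"
proof -
  assume v: "v < 2 ^ a"
  show ?thesis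
  proof (cases "j < a")
    case True
    then have "u * 2 ^ a = 2 * (u * 2 ^ (a - j - 1)) * 2 ^ j"
      by (simp flip: power_add power_Suc add: mult.assoc)
    then have "(u * 2 ^ a + v) div 2 ^ j = 2 * (u * 2 ^ (a - j - 1)) + v div 2 ^ j"
      by (simp only: div_mult_self3) simp
    with True show ?thesis by (simp add: bt_def of_nat_bit_eq)
  next
    case False
    then have "2 ^ j = 2 ^ a * (2::nat) ^ (j - a)" by (simp flip: power_add)
    moreover have "(u * 2 ^ a + v) div 2 ^ a = u" using v by simp
    ultimately have "(u * 2 ^ a + v) div 2 ^ j = u div 2 ^ (j - a)"
      by (simp only: div_mult2_eq)
    with False show ?thesis by (simp add: bt_def)
  qed
qed

section \<open>Hamming weights of masks\<close>

definition wt :: "nat \<Rightarrow> nat" where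
  "wt x = card {i. bit x i}"

lemma finite_bits: "finite {i. bit (x::nat) i}"
proof -
  have "i < x" if "bit x i" for i
    using bit_minus_power(1)[OF that] less_exp[of i] by linarith
  then have "{i. bit x i} \<subseteq> {..<x}" by auto
  then show ?thesis by (rule finite_subset) simp
qed

lemma wt_minus_power: "bit x i \<Longrightarrow> wt x = Suc (wt (x - 2 ^ i))"
proof -
  assume b: "bit x i"
  then have "{j. bit (x - 2 ^ i) j} = {j. bit x j} - {i}"
    using bit_minus_power[OF b] by auto
  then show ?thesis
    unfolding wt_def using b card.remove[OF finite_bits[of x], of i] by simp
qed

lemma wt_append: "v < 2 ^ a \<Longrightarrow> wt (u * 2 ^ a + v) = wt u + wt v"
proof -
  assume v: "v < 2 ^ a"
  have b: "bit (u * 2 ^ a + v) j \<longleftrightarrow> (if j < a then bit v j else bit u (j - a))" for j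
    using bt_append[OF v, of u j] by (auto simp: bt_eq split: if_splits)
  have v': "j < a" if "bit v j" for j
    using bt_less[OF v, of j] that by (force simp: bt_eq)
  have "{j. bit (u * 2 ^ a + v) j} = (\<lambda>j. j + a) ` {j. bit u j} \<union> {j. bit v j}"
  proof (rule set_eqI)
    fix j
    show "j \<in> {j. bit (u * 2 ^ a + v) j} \<longleftrightarrow> j \<in> (\<lambda>j. j + a) ` {j. bit u j} \<union> {j. bit v j}"
      using v' by (auto simp: b image_iff intro: exI[of _ "j - a"])
  qed
  moreover have "(\<lambda>j. j + a) ` {j. bit u j} \<inter> {j. bit v j} = {}" using v' by fastforce
  ultimately show ?thesis
    unfolding wt_def by (simp add: card_Un_disjoint finite_bits card_image inj_on_def)
qed

lemma wt_0 [simp]: "wt 0 = 0"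
  by (simp add: wt_def)

lemma wt_mask: "wt (2 ^ a - 1) = a"
proof -
  have "{i. bit (2 ^ a - Suc 0) i} = {..<a}"
    using bit_mask_iff[where 'a = nat, of a] by (auto simp: mask_eq_exp_minus_1)
  then show ?thesis by (simp add: wt_def)
qed

subsection \<open>The Moebius transform\<close>

text \<open>One coordinate of the subset-sum transform: if bit \<open>i\<close> of \<open>y\<close>
  is set, then \<open>y - 2 ^ i\<close> is \<open>y\<close> with this bit cleared, and otherwise the
  factor \<open>bt y i\<close> removes the term.\<close>

definition pass :: "nat \<Rightarrow> (nat \<Rightarrow> bit) \<Rightarrow> nat \<Rightarrow> bit" where
  "pass i f y = f y + bt y i * f (y - 2 ^ i)"

text \<open>For \<open>y < 2 ^ N\<close>, \<open>zt N f y\<close> sums \<open>f\<close> over the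
  submasks of \<open>y\<close>: it is the coefficient of the monomial with variable set
  \<open>y\<close> in the algebraic normal form of \<open>f\<close>. In characteristic 2 the same
  transform leads back from coefficients to values (\<open>zt_zt\<close>).\<close>

primrec zt :: "nat \<Rightarrow> (nat \<Rightarrow> bit) \<Rightarrow> nat \<Rightarrow> bit" where
  "zt 0 f = f"
| "zt (Suc i) f = pass i (zt i f)"

lemma pass_pass: "pass i (pass i f) = f"
proof
  fix y
  show "pass i (pass i f) y = f y"
    by (cases "bt y i" rule: bit_cases) (auto simp: pass_def bt_minus_power add.assoc)
qed

lemma pass_commute: "i \<noteq> j \<Longrightarrow> pass i (pass j f) = pass j (pass i f)"
proof
  fix y
  assume "i \<noteq> j"
  then show "pass i (pass j f) y = pass j (pass i f) y"
    by (cases "bt y i" rule: bit_cases; cases "bt y j" rule: bit_cases)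
      (auto simp: pass_def bt_minus_power add_ac diff_commute)
qed

lemma zt_pass: "i \<le> j \<Longrightarrow> zt i (pass j f) = pass j (zt i f)"
  by (induction i) (auto simp: pass_commute)

lemma zt_zt: "zt i (zt i f) = f"
  by (induction i arbitrary: f) (auto simp: zt_pass pass_pass)

lemma zt_add: "zt i (\<lambda>x. f x + g x) y = zt i f y + zt i g y"
  by (induction i arbitrary: y) (auto simp: pass_def algebra_simps)

lemma zt_zero: "zt i (\<lambda>x. 0) y = 0"
  by (induction i arbitrary: y) (auto simp: pass_def)

text \<open>The transform at \<open>y\<close> reads only points that arise from \<open>y\<close> by
  clearing bits, so agreement on a set closed under clearing suffices. This is what allows all
  transforms to run on points of low weight.\<close>

lemma zt_cong:
  assumes "\<And>z i. P z \<Longrightarrow> bit z i \<Longrightarrow> P (z - 2 ^ i)" "\<And>z. P z \<Longrightarrow> f z = g z" "P y"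
  shows "zt i f y = zt i g y"
  using assms(3)
proof (induction i arbitrary: y)
  case (Suc i)
  show ?case
    by (cases "bt y i" rule: bit_cases)
      (use Suc assms(1) in \<open>auto simp: pass_def bt_eq_1_iff\<close>)
qed (use assms in auto)

section \<open>Polynomial functions of bounded degree\<close>

lemma prod_bt: "finite A \<Longrightarrow> (\<Prod>i\<in>A. bt x i) = of_bool (\<forall>i\<in>A. bit x i)"
  by (induction A rule: finite_induct) (auto simp: bt_eq)

text \<open>The span of the monomials; the only scalars are 0 and 1, so closure under addition is
  enough. Degree bounds are thus derived without ever computing a normal form.\<close>

inductive deg :: "nat \<Rightarrow> nat \<Rightarrow> (nat \<Rightarrow> bit) \<Rightarrow> bool" for N D where
  deg_mono: "A \<subseteq> {..<N} \<Longrightarrow> card A \<le> D \<Longrightarrow> deg N D (\<lambda>x. \<Prod>i\<in>A. bt x i)"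
| deg_zero: "deg N D (\<lambda>x. 0)"
| deg_add: "deg N D f \<Longrightarrow> deg N D g \<Longrightarrow> deg N D (\<lambda>x. f x + g x)"

lemma deg_sum: "(\<And>i. i \<in> I \<Longrightarrow> deg N D (f i)) \<Longrightarrow> deg N D (\<lambda>x. \<Sum>i\<in>I. f i x)"
  by (induction I rule: infinite_finite_induct) (auto intro: deg_zero deg_add)

lemma deg_one: "deg N D (\<lambda>x. 1)"
  using deg_mono[of "{}" N D] by simp

lemma deg_const: "deg N D (\<lambda>x. c)"
  by (cases c rule: bit_cases) (auto intro: deg_zero deg_one)

lemma deg_smult: "deg N D f \<Longrightarrow> deg N D (\<lambda>x. c * f x)"
  by (cases c rule: bit_cases) (auto intro: deg_zero)

lemma deg_bt: "i < N \<Longrightarrow> 1 \<le> D \<Longrightarrow> deg N D (\<lambda>x. bt x i)"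
  using deg_mono[of "{i}" N D] by simp

text \<open>Since bits are idempotent, the product of two monomials is the monomial of the union of
  their variable sets.\<close>

lemma deg_mult_mono:
  assumes "deg N b g" "A \<subseteq> {..<N}" "card A \<le> a"
  shows "deg N (a + b) (\<lambda>x. (\<Prod>i\<in>A. bt x i) * g x)"
  using assms(1)
proof induction
  case (deg_mono B)
  have fin: "finite A" "finite B" using assms(2) deg_mono(1) finite_subset by blast+
  have "(\<Prod>i\<in>A. bt x i) * (\<Prod>i\<in>B. bt x i) = (\<Prod>i\<in>A \<union> B. bt x i)" for x
    using fin by (auto simp: prod_bt)
  moreover have "card (A \<union> B) \<le> a + b"
    using card_Un_le[of A B] assms(3) deg_mono(2) by linarith
  ultimately show ?case using deg.deg_mono[of "A \<union> B" N "a + b"] assms(2) deg_mono(1) by simp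
qed (auto simp: distrib_left intro: deg_zero deg_add)

lemma deg_mult:
  assumes "deg N a f" "deg N b g"
  shows "deg N (a + b) (\<lambda>x. f x * g x)"
  using assms(1)
proof induction
  case (deg_mono A)
  then show ?case using deg_mult_mono[OF assms(2)] by blast
qed (auto simp: distrib_right intro: deg_zero deg_add)

lemma deg_prod:
  assumes "\<And>q. q < k \<Longrightarrow> deg N a (f q)"
  shows "deg N (a * k) (\<lambda>x. \<Prod>q<k. f q x)"
  using assms
proof (induction k)
  case (Suc k)
  then have "deg N (a + a * k) (\<lambda>x. f k x * (\<Prod>q<k. f q x))" by (intro deg_mult) auto
  then show ?case by (simp add: mult.commute)
qed (auto intro: deg_one)

text \<open>The submasks of \<open>y\<close> that contain \<open>A\<close> number 2 to the count of
  bits of \<open>y\<close> below \<open>i\<close> outside \<open>A\<close>. This is odd only if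
  there is no such bit.\<close>

lemma zt_mono:
  assumes "finite A"
  shows "zt i (\<lambda>x. \<Prod>j\<in>A. bt x j) y = (\<Prod>j\<in>A. bt y j) * (\<Prod>j\<in>{..<i} - A. 1 + bt y j)"
proof (induction i arbitrary: y)
  case (Suc i)
  show ?case
  proof (cases "bt y i" rule: bit_cases)
    case 0
    have "{..<Suc i} - A = (if i \<in> A then {..<i} - A else insert i ({..<i} - A))"
      by (auto simp: less_Suc_eq)
    then show ?thesis using 0 Suc by (simp add: pass_def)
  next
    case 1
    show ?thesis
    proof (cases "i \<in> A")
      case True
      then have "(\<Prod>j\<in>A. bt (y - 2 ^ i) j) = 0"
        using assms 1 by (auto simp: bt_minus_power intro!: prod_zero)
      moreover have "{..<Suc i} - A = {..<i} - A" using True by (auto simp: less_Suc_eq)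
      ultimately show ?thesis using Suc by (simp add: pass_def)
    next
      case False
      then have "(\<Prod>j\<in>A. bt (y - 2 ^ i) j) = (\<Prod>j\<in>A. bt y j)"
        using 1 by (intro prod.cong) (auto simp: bt_minus_power)
      moreover have "(\<Prod>j\<in>{..<i} - A. 1 + bt (y - 2 ^ i) j) = (\<Prod>j\<in>{..<i} - A. 1 + bt y j)"
        using 1 by (intro prod.cong) (auto simp: bt_minus_power)
      moreover have "{..<Suc i} - A = insert i ({..<i} - A)" using False by (auto simp: less_Suc_eq)
      ultimately show ?thesis using Suc 1 by (simp add: pass_def)
    qed
  qed
qed simp

text \<open>A mask of more than \<open>D\<close> bits has a bit outside the variable set of each
  monomial, and this bit contributes the factor \<open>1 + 1\<close> in
  \<open>zt_mono\<close>.\<close>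

lemma deg_zt_zero:
  assumes "deg N D f" "y < 2 ^ N" "D < wt y"
  shows "zt N f y = 0"
  using assms(1)
proof induction
  case (deg_mono A)
  then have fin: "finite A" using finite_subset by blast
  have "card A < wt y" using deg_mono assms(3) by simp
  then have "\<not> {i. bit y i} \<subseteq> A"
    unfolding wt_def using card_mono[OF fin, of "{i. bit y i}"] by auto
  then obtain i where i: "bit y i" "i \<notin> A" by auto
  have "i < N" using i(1) bt_less[OF assms(2), of i] by (force simp: bt_eq)
  then have "(\<Prod>j\<in>{..<N} - A. 1 + bt y j) = 0"
    using i by (auto simp: bt_eq intro!: prod_zero bexI[of _ i])
  then show ?case by (simp add: zt_mono[OF fin])
qed (auto simp: zt_zero zt_add)

section \<open>Sums over subcubes and interpolation from points of low weight\<close>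

lemma sum_cube_split:
  fixes f :: "nat \<Rightarrow> bit"
  shows "(\<Sum>z<2 ^ Suc i. f (w * 2 ^ Suc i + z)) =
    (\<Sum>z<2 ^ i. f ((2 * w) * 2 ^ i + z)) + (\<Sum>z<2 ^ i. f ((2 * w + 1) * 2 ^ i + z))"
proof -
  have eq: "{..<2 ^ Suc i :: nat} = {..<2 ^ i} \<union> {2 ^ i..<2 ^ i + 2 ^ i}" by auto
  have "(\<Sum>z<2 ^ Suc i. f (w * 2 ^ Suc i + z)) = (\<Sum>z<2 ^ i. f (w * 2 ^ Suc i + z)) +
      (\<Sum>z\<in>{2 ^ i..<2 ^ i + 2 ^ i}. f (w * 2 ^ Suc i + z))"
    unfolding eq by (rule sum.union_disjoint) auto
  also have "(\<Sum>z\<in>{2 ^ i..<2 ^ i + 2 ^ i}. f (w * 2 ^ Suc i + z)) =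
      (\<Sum>z<2 ^ i. f (w * 2 ^ Suc i + (2 ^ i + z)))"
    by (rule sum.reindex_bij_witness[of _ "\<lambda>z. 2 ^ i + z" "\<lambda>z. z - 2 ^ i"]) auto
  finally show ?thesis by (simp add: algebra_simps)
qed

text \<open>If the \<open>i\<close> lowest bits are all set, clearing some of them yields every
  point of the subcube.\<close>

lemma zt_cube: "zt i f (w * 2 ^ i + (2 ^ i - 1)) = (\<Sum>z<2 ^ i. f (w * 2 ^ i + z))"
proof (induction i arbitrary: w)
  case (Suc i)
  define y where "y = w * 2 ^ Suc i + (2 ^ Suc i - 1)"
  have eq: "y = (2 * w + 1) * 2 ^ i + (2 ^ i - 1)"
    by (simp add: y_def algebra_simps)
  have b: "bt y i = 1"
    unfolding eq by (subst bt_append) (auto simp: bt_def of_nat_bit_eq)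
  have "y - 2 ^ i = (2 * w) * 2 ^ i + (2 ^ i - 1)" by (simp add: y_def algebra_simps)
  moreover have "zt (Suc i) f y = zt i f y + zt i f (y - 2 ^ i)"
    using b by (simp add: pass_def)
  ultimately have "zt (Suc i) f y = zt i f ((2 * w + 1) * 2 ^ i + (2 ^ i - 1)) + zt i f ((2 * w) * 2 ^ i + (2 ^ i - 1))"
    using eq by simp
  also have "\<dots> = (\<Sum>z<2 ^ Suc i. f (w * 2 ^ Suc i + z))"
    unfolding Suc sum_cube_split by (simp add: add.commute)
  finally show ?case unfolding y_def .
qed simp

text \<open>Summation over \<open>a\<close> variables is a partial Moebius transform and lowers the degree by \<open>a\<close>.\<close>

lemma zt_cube_sum:
  "zt (a + m) f (y * 2 ^ a + (2 ^ a - 1)) = zt m (\<lambda>y. \<Sum>z<2 ^ a. f (y * 2 ^ a + z)) y"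
proof (induction m arbitrary: y)
  case 0
  show ?case using zt_cube[of a f y] by simp
next
  case (Suc m)
  have b: "bt (y * 2 ^ a + (2 ^ a - 1)) (a + m) = bt y m" by (subst bt_append) auto
  show ?case
  proof (cases "bt y m" rule: bit_cases)
    case 0
    with b Suc show ?thesis by (simp add: pass_def)
  next
    case 1
    then have "2 ^ m \<le> y" by (simp add: bt_eq_1_iff bit_minus_power(1))
    then have "2 ^ (a + m) \<le> y * 2 ^ a" by (simp add: power_add mult.commute)
    then have "y * 2 ^ a + (2 ^ a - 1) - 2 ^ (a + m) = (y * 2 ^ a - 2 ^ (a + m)) + (2 ^ a - 1)"
      by linarith
    also have "y * 2 ^ a - 2 ^ (a + m) = (y - 2 ^ m) * 2 ^ a"
      by (simp only: diff_mult_distrib power_add mult.commute[of "2 ^ a"])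
    finally have "y * 2 ^ a + (2 ^ a - 1) - 2 ^ (a + m) = (y - 2 ^ m) * 2 ^ a + (2 ^ a - 1)" .
    with b 1 Suc show ?thesis by (simp add: pass_def)
  qed
qed

text \<open>By \<open>zt_cube_sum\<close> the coefficient of \<open>y\<close> in the sum is the
  coefficient in \<open>f\<close> of \<open>y\<close> followed by \<open>a\<close> ones, a mask of
  weight \<open>wt y + a\<close>.\<close>

lemma deg_cube_sum_zero:
  assumes "deg (a + m) D f" "y < 2 ^ m" "D < wt y + a"
  shows "zt m (\<lambda>y. \<Sum>z<2 ^ a. f (y * 2 ^ a + z)) y = 0"
proof -
  have "y * 2 ^ a + (2 ^ a - 1) < 2 ^ m * 2 ^ a" by (rule digits_less[OF assms(2)]) simp
  moreover have "wt (y * 2 ^ a + (2 ^ a - 1)) = wt y + a"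
    using wt_append[of "2 ^ a - 1" a y] wt_mask[of a] by simp
  ultimately show ?thesis
    unfolding zt_cube_sum[symmetric] using assms
    by (intro deg_zt_zero) (auto simp: power_add mult.commute)
qed

text \<open>Interpolation: the inner transform turns values into coefficients, those of weight above
  \<open>w\<close> are replaced by 0, and the outer transform evaluates the resulting polynomial
  everywhere.\<close>

definition extend :: "nat \<Rightarrow> nat \<Rightarrow> (nat \<Rightarrow> bit) \<Rightarrow> nat \<Rightarrow> bit" where
  "extend m w h = zt m (\<lambda>y. if wt y \<le> w then zt m h y else 0)"

text \<open>Coefficients of low weight depend only on values at low weight, and the remaining
  coefficients of \<open>u\<close> vanish, so the cut loses nothing and \<open>zt_zt\<close>
  recovers \<open>u\<close>.\<close>

lemma extend_eq:
  assumes "\<And>y. y < 2 ^ m \<Longrightarrow> w < wt y \<Longrightarrow> zt m u y = 0"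
    "\<And>y. y < 2 ^ m \<Longrightarrow> wt y \<le> w \<Longrightarrow> h y = u y" "y < 2 ^ m"
  shows "extend m w h y = u y"
proof -
  have h: "zt m h y = zt m u y" if "y < 2 ^ m" "wt y \<le> w" for y
    by (rule zt_cong[where P = "\<lambda>y. y < 2 ^ m \<and> wt y \<le> w"])
      (use that assms(2) in \<open>auto simp: wt_minus_power\<close>)
  have "extend m w h y = zt m (zt m u) y"
    unfolding extend_def
    by (rule zt_cong[where P = "\<lambda>y. y < 2 ^ m"]) (use assms h in auto)
  then show ?thesis by (simp add: zt_zt)
qed

subsection \<open>Enumerating the points of bounded weight\<close>

text \<open>Pascal's recursion (closed form in \<open>nlow_choose\<close>), stated as the program
  tabulates it and as \<open>unrank\<close> branches on it.\<close>

primrec nlow :: "nat \<Rightarrow> nat \<Rightarrow> nat" where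
  "nlow 0 w = 1"
| "nlow (Suc m) w = (case w of 0 \<Rightarrow> 1 | Suc v \<Rightarrow> nlow m (Suc v) + nlow m v)"

lemma nlow_0 [simp]: "nlow m 0 = 1"
  by (cases m) auto

text \<open>A combinatorial number system in which the masks without bit \<open>m\<close> come
  first. It lets a loop visit the masks of bounded weight and no others, with polynomial work per
  mask.\<close>

primrec unrank :: "nat \<Rightarrow> nat \<Rightarrow> nat \<Rightarrow> nat" where
  "unrank 0 w r = 0"
| "unrank (Suc m) w r = (if r < nlow m w then unrank m w r else 2 ^ m + unrank m (w - 1) (r - nlow m w))"

lemma unrank_less: "unrank m w r < 2 ^ m"
proof (induction m arbitrary: w r)
  case (Suc m)
  from Suc[of w r] Suc[of "w - 1" "r - nlow m w"] show ?case by auto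
qed simp

lemma wt_add_power: "y < 2 ^ m \<Longrightarrow> wt (2 ^ m + y) = Suc (wt y)"
proof -
  assume "y < 2 ^ m"
  moreover have "wt 1 = 1" using wt_mask[of 1] by simp
  ultimately show ?thesis using wt_append[of y m 1] by simp
qed

lemma bij_unrank: "bij_betw (unrank m w) {..<nlow m w} {x. x < 2 ^ m \<and> wt x \<le> w}"
proof (induction m arbitrary: w)
  case 0
  show ?case by (auto simp: bij_betw_def inj_on_def)
next
  case (Suc m)
  show ?case
  proof (cases w)
    case 0
    have "wt x = 0 \<longleftrightarrow> x = 0" for x
    proof
      assume "wt x = 0"
      then have "\<And>i. \<not> bit x i" using finite_bits by (auto simp: wt_def)
      then show "x = 0" by (simp add: bit_eq_iff)
    qed simp
    moreover have "unrank m 0 0 = 0" for m by (induction m) auto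
    ultimately show ?thesis using 0 by (auto simp: bij_betw_def inj_on_def)
  next
    case (Suc v)
    let ?A = "{..<nlow m w}" and ?B = "{nlow m w..<nlow m w + nlow m v}"
    have 1: "bij_betw (unrank (Suc m) w) ?A {x. x < 2 ^ m \<and> wt x \<le> w}"
      using Suc.IH[of w] by (rule bij_betw_cong[THEN iffD1, rotated]) auto
    have "bij_betw (\<lambda>r. r - nlow m w) ?B {..<nlow m v}"
      by (rule bij_betwI[of _ _ _ "\<lambda>r. r + nlow m w"]) auto
    moreover have "bij_betw (unrank m v) {..<nlow m v} {x. x < 2 ^ m \<and> wt x \<le> v}"
      by (rule Suc.IH)
    moreover have "bij_betw (\<lambda>x. 2 ^ m + x) {x. x < 2 ^ m \<and> wt x \<le> v}
        {x. 2 ^ m \<le> x \<and> x < 2 ^ Suc m \<and> wt x \<le> w}"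
    proof (rule bij_betwI[of _ _ _ "\<lambda>x. x - 2 ^ m"])
      show "(\<lambda>x. x - 2 ^ m) \<in> {x. 2 ^ m \<le> x \<and> x < 2 ^ Suc m \<and> wt x \<le> w} \<rightarrow> {x. x < 2 ^ m \<and> wt x \<le> v}"
      proof
        fix x
        assume "x \<in> {x. 2 ^ m \<le> x \<and> x < 2 ^ Suc m \<and> wt x \<le> w}"
        then show "x - 2 ^ m \<in> {x. x < 2 ^ m \<and> wt x \<le> v}"
          using wt_add_power[of "x - 2 ^ m" m] Suc by auto
      qed
    qed (auto simp: wt_add_power Suc)
    ultimately have "bij_betw ((\<lambda>x. 2 ^ m + x) \<circ> (unrank m v \<circ> (\<lambda>r. r - nlow m w))) ?B
        {x. 2 ^ m \<le> x \<and> x < 2 ^ Suc m \<and> wt x \<le> w}"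
      by (intro bij_betw_trans)
    then have 2: "bij_betw (unrank (Suc m) w) ?B {x. 2 ^ m \<le> x \<and> x < 2 ^ Suc m \<and> wt x \<le> w}"
      by (rule bij_betw_cong[THEN iffD1, rotated]) (auto simp: Suc)
    have "bij_betw (unrank (Suc m) w) (?A \<union> ?B)
        ({x. x < 2 ^ m \<and> wt x \<le> w} \<union> {x. 2 ^ m \<le> x \<and> x < 2 ^ Suc m \<and> wt x \<le> w})"
      by (rule bij_betw_combine[OF 1 2]) auto
    moreover have "?A \<union> ?B = {..<nlow (Suc m) w}" by (auto simp: Suc)
    moreover have "{x. x < 2 ^ m \<and> wt x \<le> w} \<union> {x. 2 ^ m \<le> x \<and> x < 2 ^ Suc m \<and> wt x \<le> w} =
        {x. x < 2 ^ Suc m \<and> wt x \<le> w}" by auto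
    ultimately show ?thesis by (simp only:)
  qed
qed

lemma nlow_pow: "m \<le> w \<Longrightarrow> nlow m w = 2 ^ m"
  by (induction m arbitrary: w) (auto split: nat.splits)

lemma nlow_choose: "nlow m w = (\<Sum>k\<le>w. m choose k)"
proof (induction m arbitrary: w)
  case 0
  show ?case by (simp add: sum.atMost_shift)
next
  case (Suc m)
  show ?case
  proof (cases w)
    case (Suc v)
    have 1: "(\<Sum>k\<le>Suc v. m choose k) = 1 + (\<Sum>k\<le>v. m choose Suc k)"
      by (subst sum.atMost_Suc_shift) simp
    have "(\<Sum>k\<le>Suc v. Suc m choose k) = 1 + (\<Sum>k\<le>v. (m choose Suc k) + (m choose k))"
      by (subst sum.atMost_Suc_shift) (simp add: add.commute)
    also have "\<dots> = (\<Sum>k\<le>Suc v. m choose k) + (\<Sum>k\<le>v. m choose k)"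
      unfolding 1 by (simp add: sum.distrib)
    finally show ?thesis using Suc.IH Suc by simp
  qed simp
qed

section \<open>Multiple parity counting\<close>

text \<open>
  Level \<open>l\<close> of the recursion sums over the \<open>s * l\<close> lowest variables. Its systems are indexed by
  \<open>i\<close>; system \<open>i * Y + r\<close> consists of random linear combinations of the equations of
  system \<open>i\<close> of level \<open>l + 1\<close>, and level \<open>s\<close> holds the given system \<open>g\<close>.
\<close>

definition neq :: "nat \<Rightarrow> nat \<Rightarrow> nat \<Rightarrow> nat" where
  "neq s Y l = (if l < s then s * l + 4 else Y)"

text \<open>The recursion of \<open>csys\<close> is on the distance from the top level \<open>s\<close>.\<close>

primrec csys :: "nat \<Rightarrow> nat \<Rightarrow> (nat \<Rightarrow> nat \<Rightarrow> nat \<Rightarrow> nat \<Rightarrow> bit) \<Rightarrow> (nat \<Rightarrow> nat \<Rightarrow> bit) \<Rightarrow>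
    nat \<Rightarrow> nat \<Rightarrow> nat \<Rightarrow> nat \<Rightarrow> bit" where
  "csys s Y A g 0 i q x = g q x"
| "csys s Y A g (Suc j) i q x =
     (\<Sum>q'<neq s Y (s - j). A (s - Suc j) (i mod Y) q q' * csys s Y A g j (i div Y) q' x)"

definition sol_ind :: "(nat \<Rightarrow> nat \<Rightarrow> bit) \<Rightarrow> nat \<Rightarrow> nat \<Rightarrow> bit" where
  "sol_ind P k x = (\<Prod>q<k. 1 + P q x)"

definition csol where
  "csol s Y A g l i x = sol_ind (csys s Y A g (s - l) i) (neq s Y l) x"

definition par where
  "par s Y A g l i y = (\<Sum>z<2 ^ (s * l). csol s Y A g l i (y * 2 ^ (s * l) + z))"

text \<open>The quantity that \<open>par s Y A g l (i * Y + r)\<close> approximates.\<close>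

definition target where
  "target s Y A g l i y = (\<Sum>z<2 ^ (s * l). csol s Y A g (Suc l) i (y * 2 ^ (s * l) + z))"

definition majority :: "nat \<Rightarrow> (nat \<Rightarrow> bit) \<Rightarrow> bit" where
  "majority Y f = of_bool (Y < 2 * card {r. r < Y \<and> f r = 1})"

text \<open>The degree \<open>d * (s * l + 4)\<close> of the indicator at level \<open>l\<close>,
  lowered by the \<open>s * l\<close> summed variables.\<close>

definition wlim :: "nat \<Rightarrow> nat \<Rightarrow> nat \<Rightarrow> nat" where
  "wlim d s l = (d - 1) * (s * l) + 4 * d"

text \<open>Values are trustworthy only at weights up to \<open>wlim d s l\<close>, while the points
  \<open>u * 2 ^ s + v\<close> of interest at the next level may weigh up to \<open>d * s\<close>
  more. Hence the \<open>extend\<close> under the majority.\<close>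

primrec mpc where
  "mpc d s Y A g 0 i y = csol s Y A g 0 i y"
| "mpc d s Y A g (Suc l) i u = (\<Sum>v<2 ^ s. majority Y
     (\<lambda>r. extend (s * s - s * l) (wlim d s l) (mpc d s Y A g l (i * Y + r)) (u * 2 ^ s + v)))"

text \<open>Demanded at every point \<open>y\<close> of a level, not only where the recursion looks:
  the factor \<open>2 ^ (s * s)\<close> that this costs in a union bound is absorbed by the failure
  probability \<open>1 / 2 ^ Y\<close> of one vote.\<close>

definition faithful where
  "faithful s Y A g \<longleftrightarrow> (\<forall>l<s. \<forall>i<Y ^ (s - Suc l). \<forall>y<2 ^ (s * s - s * l).
     2 * card {r. r < Y \<and> par s Y A g l (i * Y + r) y \<noteq> target s Y A g l i y} < Y)"

lemma majority_eq:
  assumes "2 * card {r. r < Y \<and> f r \<noteq> b} < Y"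
  shows "majority Y f = b"
proof (cases b rule: bit_cases)
  case 0
  with assms show ?thesis by (simp add: majority_def)
next
  case 1
  have eq: "{..<Y} = {r. r < Y \<and> f r = 1} \<union> {r. r < Y \<and> f r \<noteq> 1}" by auto
  have "card {..<Y} = card {r. r < Y \<and> f r = 1} + card {r. r < Y \<and> f r \<noteq> 1}"
    unfolding eq by (rule card_Un_disjoint) auto
  with assms 1 show ?thesis by (simp add: majority_def)
qed

lemma deg_csys: "(\<And>q. deg N d (g q)) \<Longrightarrow> deg N d (csys s Y A g j i q)"
proof (induction j arbitrary: i q)
  case 0
  have "csys s Y A g 0 i q = g q" by (simp add: fun_eq_iff)
  with 0 show ?case by simp
next
  case (Suc j)
  have "csys s Y A g (Suc j) i q =
      (\<lambda>x. \<Sum>q'<neq s Y (s - j). A (s - Suc j) (i mod Y) q q' * csys s Y A g j (i div Y) q' x)"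
    by (simp add: fun_eq_iff)
  with Suc show ?case by (auto intro!: deg_sum deg_smult)
qed

lemma deg_csol:
  assumes "\<And>q. deg N d (g q)" "l < s"
  shows "deg N (d * (s * l + 4)) (csol s Y A g l i)"
proof -
  have "deg N d (\<lambda>x. 1 + csys s Y A g (s - l) i q x)" for q
    using assms(1) by (intro deg_add deg_one deg_csys)
  then have "deg N (d * (s * l + 4)) (\<lambda>x. \<Prod>q<s * l + 4. 1 + csys s Y A g (s - l) i q x)"
    by (intro deg_prod)
  moreover have "csol s Y A g l i = (\<lambda>x. \<Prod>q<s * l + 4. 1 + csys s Y A g (s - l) i q x)"
    using assms(2) by (simp add: fun_eq_iff csol_def sol_ind_def neq_def)
  ultimately show ?thesis by simp
qed

lemma sum_blocks:
  fixes f :: "nat \<Rightarrow> bit"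
  shows "(\<Sum>v<m. \<Sum>z<k. f ((u * m + v) * k + z)) = (\<Sum>z<m * k. f (u * (m * k) + z))"
proof -
  have "(\<Sum>z<k. f ((u * m + v) * k + z)) = (\<Sum>z\<in>{v * k..<v * k + k}. f (u * (m * k) + z))" for v
    by (rule sum.reindex_bij_witness[of _ "\<lambda>z. z - v * k" "\<lambda>z. v * k + z"])
      (auto simp: distrib_right mult.assoc add.assoc)
  then show ?thesis by (simp add: sum.nat_group)
qed

theorem mpc_correct:
  assumes g: "\<And>q. deg (s * s) d (g q)" and d: "1 \<le> d" and faithful: "faithful s Y A g"
    and "l \<le> s" "i < Y ^ (s - l)" "y < 2 ^ (s * s - s * l)" "wt y \<le> wlim d s l"
  shows "mpc d s Y A g l i y = par s Y A g l i y"
  using assms(4-)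
proof (induction l arbitrary: i y)
  case 0
  then show ?case by (simp add: par_def)
next
  case (Suc l)
  have l: "l < s" "s * Suc l \<le> s * s" using Suc.prems(1) by (simp, intro mult_le_mono2)
  have split: "s * s - s * l = (s * s - s * Suc l) + s" using l by simp
  \<comment> \<open>\<open>par\<close> has no coefficient of weight above \<open>wlim d s l\<close>,
    so extending the values known by induction gives \<open>par\<close> at every point.\<close>
  have ext: "extend (s * s - s * l) (wlim d s l) (mpc d s Y A g l (i * Y + r)) x =
      par s Y A g l (i * Y + r) x" if "r < Y" "x < 2 ^ (s * s - s * l)" for r x
  proof (rule extend_eq[OF _ _ that(2)])
    have "i * Y + r < Y ^ (s - Suc l) * Y" by (rule digits_less[OF Suc.prems(2) that(1)])
    also have "Y ^ (s - Suc l) * Y = Y ^ (s - l)" using l by (simp flip: power_Suc2 add: Suc_diff_Suc)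
    finally show "mpc d s Y A g l (i * Y + r) y = par s Y A g l (i * Y + r) y"
      if "y < 2 ^ (s * s - s * l)" "wt y \<le> wlim d s l" for y
      using Suc.IH l(1) that by simp
    fix y
    assume y: "y < 2 ^ (s * s - s * l)" "wlim d s l < wt y"
    \<comment> \<open>A mask heavier than \<open>wlim d s l\<close>, followed by
      \<open>s * l\<close> ones, is heavier than the degree of the indicator.\<close>
    have "d * (s * l + 4) = wlim d s l + s * l"
      using d by (cases d) (auto simp: wlim_def algebra_simps)
    with y(2) have "d * (s * l + 4) < wt y + s * l" by simp
    moreover have "s * l + (s * s - s * l) = s * s" using l(1) by simp
    ultimately show "zt (s * s - s * l) (par s Y A g l (i * Y + r)) y = 0"
      using deg_cube_sum_zero[OF _ y(1), of "s * l" "d * (s * l + 4)"] deg_csol[OF g l(1)]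
      unfolding par_def by simp
  qed
  have less: "y * 2 ^ s + v < 2 ^ (s * s - s * l)" if "v < 2 ^ s" for v
    unfolding split power_add by (rule digits_less[OF Suc.prems(3) that])
  have "majority Y (\<lambda>r. extend (s * s - s * l) (wlim d s l) (mpc d s Y A g l (i * Y + r)) (y * 2 ^ s + v))
      = target s Y A g l i (y * 2 ^ s + v)" if "v < 2 ^ s" for v
  proof (rule majority_eq)
    have "{r. r < Y \<and> extend (s * s - s * l) (wlim d s l) (mpc d s Y A g l (i * Y + r)) (y * 2 ^ s + v)
          \<noteq> target s Y A g l i (y * 2 ^ s + v)} =
        {r. r < Y \<and> par s Y A g l (i * Y + r) (y * 2 ^ s + v) \<noteq> target s Y A g l i (y * 2 ^ s + v)}"
      using ext[OF _ less[OF that]] by auto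
    then show "2 * card {r. r < Y \<and> extend (s * s - s * l) (wlim d s l) (mpc d s Y A g l (i * Y + r))
        (y * 2 ^ s + v) \<noteq> target s Y A g l i (y * 2 ^ s + v)} < Y"
      using faithful l(1) Suc.prems(2) less[OF that] unfolding faithful_def by simp
  qed
  then have "mpc d s Y A g (Suc l) i y = (\<Sum>v<2 ^ s. target s Y A g l i (y * 2 ^ s + v))"
    by simp
  also have "\<dots> = par s Y A g (Suc l) i y"
    unfolding target_def par_def using sum_blocks[where f = "csol s Y A g (Suc l) i" and k = "2 ^ (s * l)" and u = y and m = "2 ^ s"]
    by (simp add: power_add)
  finally show ?case .
qed

corollary mpc_parity:
  assumes "\<And>q. deg (s * s) d (g q)" "1 \<le> d" "faithful s Y A g"
  shows "mpc d s Y A g s 0 0 = (\<Sum>x<2 ^ (s * s). sol_ind g Y x)"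
proof -
  have "csys s Y A g 0 0 = g" by (simp add: fun_eq_iff)
  then show ?thesis
    using mpc_correct[OF assms, of s 0 0] by (simp add: par_def csol_def neq_def)
qed

section \<open>Random systems\<close>

lemma Pi_pmf_update:
  assumes "finite A" "x \<in> A"
  shows "Pi_pmf A dflt p = do {f \<leftarrow> Pi_pmf (A - {x}) dflt p; y \<leftarrow> p x; return_pmf (f(x := y))}"
  using Pi_pmf_insert'[of "A - {x}" x dflt p] assms
  by (simp add: insert_absorb bind_commute_pmf[of "p x"])

lemma prob_Pi_pmf_update:
  assumes "finite A" "x \<in> A"
  shows "emeasure (Pi_pmf A dflt p) {f. P f} =
    (\<integral>\<^sup>+f. emeasure (p x) {y. P (f(x := y))} \<partial>Pi_pmf (A - {x}) dflt p)"
proof -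
  have "emeasure (Pi_pmf A dflt p) {f. P f} = (\<integral>\<^sup>+f. emeasure
      (map_pmf (\<lambda>y. f(x := y)) (p x)) {f. P f} \<partial>Pi_pmf (A - {x}) dflt p)"
    unfolding Pi_pmf_update[OF assms] map_pmf_def by (rule emeasure_bind_pmf)
  then show ?thesis by (simp add: vimage_def)
qed

text \<open>Conditioning on all coordinates except \<open>x\<close>.\<close>

lemma prob_Pi_pmf_cond_le:
  assumes "finite A" "x \<in> A" "\<And>f. measure_pmf.prob (p x) {y. P (f(x := y))} \<le> b"
  shows "measure_pmf.prob (Pi_pmf A dflt p) {f. P f} \<le> b"
proof -
  have b: "0 \<le> b" using assms(3) measure_nonneg order_trans by blast
  have "emeasure (Pi_pmf A dflt p) {f. P f} \<le> (\<integral>\<^sup>+f. ennreal b \<partial>Pi_pmf (A - {x}) dflt p)"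
    unfolding prob_Pi_pmf_update[OF assms(1,2)]
    by (intro nn_integral_mono) (simp add: measure_pmf.emeasure_eq_measure ennreal_leI assms(3))
  then show ?thesis
    using b by (simp add: measure_pmf.emeasure_eq_measure)
qed

lemma prob_Pi_pmf_cond_eq:
  assumes "finite A" "x \<in> A" "\<And>f. measure_pmf.prob (p x) {y. P (f(x := y))} = b"
  shows "measure_pmf.prob (Pi_pmf A dflt p) {f. P f} = b"
proof -
  have b: "0 \<le> b" using assms(3) measure_nonneg by metis
  have "emeasure (Pi_pmf A dflt p) {f. P f} = (\<integral>\<^sup>+f. ennreal b \<partial>Pi_pmf (A - {x}) dflt p)"
    unfolding prob_Pi_pmf_update[OF assms(1,2)]
    by (intro nn_integral_cong) (use assms(3) in \<open>simp add: measure_pmf.emeasure_eq_measure\<close>)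
  then show ?thesis
    using b by (simp add: measure_pmf.emeasure_eq_measure)
qed

definition coin :: "bit pmf" where
  "coin = pmf_of_set {0, 1}"

text \<open>One product for each index of the coefficients \<open>A p l r q q'\<close>, from the
  last to the first: row, matrix, repetition, level, try. Every index has \<open>Y\<close> values,
  so that the whole is \<open>Y ^ 5\<close> fair bits.\<close>

definition rvec :: "nat \<Rightarrow> (nat \<Rightarrow> bit) pmf" where
  "rvec Y = Pi_pmf {..<Y} 0 (\<lambda>_. coin)"

definition rmat :: "nat \<Rightarrow> (nat \<Rightarrow> nat \<Rightarrow> bit) pmf" where
  "rmat Y = Pi_pmf {..<Y} (\<lambda>_. 0) (\<lambda>_. rvec Y)"

definition rfam :: "nat \<Rightarrow> (nat \<Rightarrow> nat \<Rightarrow> nat \<Rightarrow> bit) pmf" where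
  "rfam Y = Pi_pmf {..<Y} (\<lambda>_ _. 0) (\<lambda>_. rmat Y)"

definition rlev :: "nat \<Rightarrow> (nat \<Rightarrow> nat \<Rightarrow> nat \<Rightarrow> nat \<Rightarrow> bit) pmf" where
  "rlev Y = Pi_pmf {..<Y} (\<lambda>_ _ _. 0) (\<lambda>_. rfam Y)"

definition rrep :: "nat \<Rightarrow> (nat \<Rightarrow> nat \<Rightarrow> nat \<Rightarrow> nat \<Rightarrow> nat \<Rightarrow> bit) pmf" where
  "rrep Y = Pi_pmf {..<Y} (\<lambda>_ _ _ _. 0) (\<lambda>_. rlev Y)"

lemma prob_coin: "measure_pmf.prob coin {y. y = b} = 1 / 2"
  by (cases b rule: bit_cases) (simp_all add: coin_def measure_pmf_of_set)

text \<open>Condition on all coordinates but \<open>q\<close>: as \<open>v q = 1\<close>, the sum is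
  zero for exactly one of the two values of \<open>c q\<close>.\<close>

lemma prob_rvec:
  assumes "q < K" "K \<le> Y" "v q = 1"
  shows "measure_pmf.prob (rvec Y) {c. (\<Sum>q<K. c q * v q) = 0} = 1 / 2"
  unfolding rvec_def
proof (rule prob_Pi_pmf_cond_eq[where x = q])
  fix f :: "nat \<Rightarrow> bit"
  have "(\<Sum>p<K. (f(q := y)) p * v p) = y + (\<Sum>p\<in>{..<K} - {q}. f p * v p)" for y
    using assms by (subst sum.remove[of _ q]) auto
  then have "{y. (\<Sum>p<K. (f(q := y)) p * v p) = 0} = {y. y = (\<Sum>p\<in>{..<K} - {q}. f p * v p)}"
    by (auto simp: bit_add_eq_0_iff)
  then show "measure_pmf.prob coin {y. (\<Sum>p<K. (f(q := y)) p * v p) = 0} = 1 / 2"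
    by (simp only: prob_coin)
qed (use assms in auto)

lemma prob_rmat:
  assumes "L \<le> Y"
  shows "measure_pmf.prob (rmat Y) {c. \<forall>q<L. P (c q)} = measure_pmf.prob (rvec Y) {c. P c} ^ L"
proof -
  have eq: "{c. \<forall>q<L. P (c q)} = Pi {..<Y} (\<lambda>q. if q < L then {c. P c} else UNIV)"
    using assms by (auto simp: Pi_def)
  have "measure_pmf.prob (rmat Y) {c. \<forall>q<L. P (c q)} =
      (\<Prod>q<Y. if q < L then measure_pmf.prob (rvec Y) {c. P c} else 1)"
    unfolding eq rmat_def by (subst measure_Pi_pmf_Pi) (auto intro!: prod.cong)
  also have "\<dots> = (\<Prod>q\<in>{..<Y} \<inter> {q. q < L}. measure_pmf.prob (rvec Y) {c. P c})"
    by (subst prod.inter_restrict) auto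
  also have "{..<Y} \<inter> {q. q < L} = {..<L}" using assms by auto
  finally show ?thesis by simp
qed

text \<open>If half of the \<open>Y\<close> runs are bad, then all runs in some set \<open>T\<close>
  of at least that size are bad. Each such \<open>T\<close> has probability at most
  \<open>(1/16) ^ (Y/2) = 1 / 4 ^ Y\<close>, and there are at most \<open>2 ^ Y\<close> of them; the
  constant 1/16 is chosen for this count.\<close>

lemma prob_many_bad:
  assumes "\<And>r. measure_pmf.prob (rmat Y) {c. Bad r c} \<le> 1 / 16"
  shows "measure_pmf.prob (rfam Y) {c. Y \<le> 2 * card {r. r < Y \<and> Bad r (c r)}} \<le> 1 / 2 ^ Y"
proof -
  define X where "X = {T. T \<subseteq> {..<Y} \<and> Y \<le> 2 * card T}"
  have finX: "finite X" "X \<subseteq> Pow {..<Y}" by (auto simp: X_def intro: finite_subset[of _ "Pow {..<Y}"])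
  have one: "measure_pmf.prob (rfam Y) {c. \<forall>r\<in>T. Bad r (c r)} \<le> 1 / 4 ^ Y" if "T \<in> X" for T
  proof -
    have T: "T \<subseteq> {..<Y}" "Y \<le> 2 * card T" using that by (auto simp: X_def)
    have eq: "{c. \<forall>r\<in>T. Bad r (c r)} = Pi {..<Y} (\<lambda>r. if r \<in> T then {c. Bad r c} else UNIV)"
      using T by (auto simp: Pi_def)
    have "measure_pmf.prob (rfam Y) {c. \<forall>r\<in>T. Bad r (c r)} =
        (\<Prod>r<Y. if r \<in> T then measure_pmf.prob (rmat Y) {c. Bad r c} else 1)"
      unfolding eq rfam_def by (subst measure_Pi_pmf_Pi) (auto intro!: prod.cong)
    also have "\<dots> = (\<Prod>r\<in>{..<Y} \<inter> T. measure_pmf.prob (rmat Y) {c. Bad r c})"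
      by (simp add: prod.inter_restrict)
    also have "{..<Y} \<inter> T = T" using T by auto
    also have "(\<Prod>r\<in>T. measure_pmf.prob (rmat Y) {c. Bad r c}) \<le> (\<Prod>r\<in>T. 1 / 16)"
      using assms by (intro prod_mono) auto
    also have "\<dots> = (1 / 4) ^ (2 * card T)" by (simp add: power_mult power2_eq_square)
    also have "\<dots> \<le> (1 / 4) ^ Y" using T by (intro power_decreasing) auto
    finally show ?thesis by (simp add: power_one_over)
  qed
  have "measure_pmf.prob (rfam Y) {c. Y \<le> 2 * card {r. r < Y \<and> Bad r (c r)}} \<le>
      measure_pmf.prob (rfam Y) (\<Union>T\<in>X. {c. \<forall>r\<in>T. Bad r (c r)})"
  proof (rule measure_pmf.finite_measure_mono, rule subsetI)
    fix c
    assume "c \<in> {c. Y \<le> 2 * card {r. r < Y \<and> Bad r (c r)}}"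
    then have "{r. r < Y \<and> Bad r (c r)} \<in> X" by (auto simp: X_def)
    then show "c \<in> (\<Union>T\<in>X. {c. \<forall>r\<in>T. Bad r (c r)})" by (rule UN_I) simp
  qed simp
  also have "\<dots> \<le> (\<Sum>T\<in>X. measure_pmf.prob (rfam Y) {c. \<forall>r\<in>T. Bad r (c r)})"
    using finX by (intro measure_pmf.finite_measure_subadditive_finite) auto
  also have "\<dots> \<le> (\<Sum>T\<in>X. 1 / 4 ^ Y)" by (rule sum_mono[OF one])
  also have "\<dots> = real (card X) / 4 ^ Y" by simp
  also have "\<dots> \<le> 2 ^ Y / 4 ^ Y"
  proof -
    have "card X \<le> card (Pow {..<Y})" by (rule card_mono) (use finX in auto)
    then have "real (card X) \<le> real (2 ^ Y)" by (simp only: of_nat_le_iff card_Pow finite_lessThan card_lessThan)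
    then have "real (card X) \<le> 2 ^ Y" by simp
    then show ?thesis by (intro divide_right_mono) auto
  qed
  also have "2 ^ Y / 4 ^ Y = (1 / 2 ^ Y :: real)"
    using power_mult_distrib[of "2 :: real" 2 Y] by (simp add: field_simps)
  finally show ?thesis .
qed

text \<open>The coefficients of level \<open>l\<close> enter only when the recursion has descended
  to \<open>l\<close>; systems of higher levels do not see them.\<close>

lemma csys_upd:
  "j \<le> s - Suc l \<Longrightarrow> l < s \<Longrightarrow> csys s Y (A(l := c)) g j i q x = csys s Y A g j i q x"
proof (induction j arbitrary: i q)
  case (Suc j)
  then have "s - Suc j \<noteq> l" by auto
  with Suc show ?case by simp
qed simp

lemma csol_top_upd: "l < s \<Longrightarrow> csol s Y (A(l := c)) g (Suc l) i x = csol s Y A g (Suc l) i x"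
  by (simp add: csol_def sol_ind_def csys_upd)

lemma sol_ind_eq: "sol_ind P k x = of_bool (\<forall>q<k. P q x = 0)"
  unfolding sol_ind_def
proof (induction k)
  case (Suc k)
  then show ?case by (cases "P k x" rule: bit_cases) (auto simp: less_Suc_eq)
qed simp

text \<open>The error is one-sided: a solution of system \<open>i\<close> satisfies all
  combinations. At any other point some value \<open>v q\<close> is 1, so each of the
  \<open>s * l + 4\<close> independent combinations vanishes with probability 1/2.\<close>

lemma prob_csol_wrong:
  assumes "neq s Y (Suc l) \<le> Y" "s * l + 4 \<le> Y" "l < s" "r < Y"
  shows "measure_pmf.prob (rmat Y) {c. csol s Y (A(l := a(r := c))) g l (i * Y + r) x
    \<noteq> csol s Y A g (Suc l) i x} \<le> 1 / 2 ^ (s * l + 4)"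
proof -
  define v where "v q = csys s Y A g (s - Suc l) i q x" for q
  have r: "(i * Y + r) mod Y = r" "(i * Y + r) div Y = i" using assms(4) by auto
  have l: "s - l = Suc (s - Suc l)" "s - (s - Suc l) = Suc l" "s - Suc (s - Suc l) = l"
    using assms(3) by auto
  have child: "csys s Y (A(l := a(r := c))) g (s - l) (i * Y + r) q x =
      (\<Sum>q'<neq s Y (Suc l). c q q' * v q')" for c q
    unfolding l(1) csys.simps r l(2,3) v_def using assms(3) by (simp add: csys_upd)
  have c: "csol s Y (A(l := a(r := c))) g l (i * Y + r) x =
      of_bool (\<forall>q<s * l + 4. (\<Sum>q'<neq s Y (Suc l). c q q' * v q') = 0)" for c
    using assms(3) by (simp add: csol_def sol_ind_eq child neq_def)
  have p: "csol s Y A g (Suc l) i x = of_bool (\<forall>q<neq s Y (Suc l). v q = 0)"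
    by (simp add: csol_def sol_ind_eq v_def)
  show ?thesis
  proof (cases "\<forall>q<neq s Y (Suc l). v q = 0")
    case True
    then have "{c. csol s Y (A(l := a(r := c))) g l (i * Y + r) x \<noteq> csol s Y A g (Suc l) i x} = {}"
      unfolding c p by simp
    then show ?thesis by simp
  next
    case False
    then obtain q where q: "q < neq s Y (Suc l)" "v q = 1" by auto
    have "{c. csol s Y (A(l := a(r := c))) g l (i * Y + r) x \<noteq> csol s Y A g (Suc l) i x} =
        {c. \<forall>q<s * l + 4. (\<Sum>q'<neq s Y (Suc l). c q q' * v q') = 0}"
      unfolding c p using False by auto
    then have "measure_pmf.prob (rmat Y) {c. csol s Y (A(l := a(r := c))) g l (i * Y + r) x
        \<noteq> csol s Y A g (Suc l) i x} = (1 / 2) ^ (s * l + 4)"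
      using prob_rmat[OF assms(2), of "\<lambda>c. (\<Sum>q'<neq s Y (Suc l). c q' * v q') = 0"]
        prob_rvec[where v = v, OF q(1) assms(1) q(2)] by simp
    then show ?thesis by (simp add: power_one_over)
  qed
qed

text \<open>Union bound over the \<open>2 ^ (s * l)\<close> summands, each wrong with probability at
  most \<open>1 / 2 ^ (s * l + 4)\<close>.\<close>

lemma prob_par_wrong:
  assumes "neq s Y (Suc l) \<le> Y" "s * l + 4 \<le> Y" "l < s" "r < Y"
  shows "measure_pmf.prob (rmat Y) {c. par s Y (A(l := a(r := c))) g l (i * Y + r) y
    \<noteq> target s Y A g l i y} \<le> 1 / 16"
proof -
  let ?x = "\<lambda>z. y * 2 ^ (s * l) + z"
  let ?B = "\<lambda>z. {c. csol s Y (A(l := a(r := c))) g l (i * Y + r) (?x z) \<noteq> csol s Y A g (Suc l) i (?x z)}"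
  have "measure_pmf.prob (rmat Y) {c. par s Y (A(l := a(r := c))) g l (i * Y + r) y
      \<noteq> target s Y A g l i y} \<le> measure_pmf.prob (rmat Y) (\<Union>z\<in>{..<2 ^ (s * l)}. ?B z)"
  proof (rule measure_pmf.finite_measure_mono, rule subsetI, rule ccontr)
    fix c
    assume 1: "c \<in> {c. par s Y (A(l := a(r := c))) g l (i * Y + r) y \<noteq> target s Y A g l i y}"
      and 2: "c \<notin> (\<Union>z\<in>{..<2 ^ (s * l)}. ?B z)"
    from 2 have "par s Y (A(l := a(r := c))) g l (i * Y + r) y = target s Y A g l i y"
      unfolding par_def target_def by (intro sum.cong) auto
    with 1 show False by simp
  qed simp
  also have "\<dots> \<le> (\<Sum>z<2 ^ (s * l). measure_pmf.prob (rmat Y) (?B z))"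
    by (intro measure_pmf.finite_measure_subadditive_finite) auto
  also have "\<dots> \<le> (\<Sum>z<(2::nat) ^ (s * l). 1 / 2 ^ (s * l + 4))"
    by (intro sum_mono prob_csol_wrong assms)
  also have "\<dots> = 1 / 16" by (simp add: power_add)
  finally show ?thesis .
qed

text \<open>The top system may depend on the coins of level \<open>s\<close>, which the lower levels do not use.\<close>

lemma prob_not_faithful:
  assumes Y: "s * s + 4 \<le> Y"
  shows "measure_pmf.prob (rlev Y) {A. \<not> faithful s Y A (G (A s))} \<le>
    real (s * Y ^ s * 2 ^ (s * s)) / 2 ^ Y"
proof -
  define bad where "bad A l i y \<longleftrightarrow>
    Y \<le> 2 * card {r. r < Y \<and> par s Y A (G (A s)) l (i * Y + r) y \<noteq> target s Y A (G (A s)) l i y}"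
    for A l i y
  define I where "I = (SIGMA l:{..<s}. {..<Y ^ (s - Suc l)} \<times> {..<2 ^ (s * s - s * l) :: nat})"
  have s2: "s \<le> Y" using Y by (cases s) auto
  have one: "measure_pmf.prob (rlev Y) {A. bad A l i y} \<le> 1 / 2 ^ Y" if l: "l < s" for l i y
    unfolding rlev_def
  \<comment> \<open>With the coins of all other levels fixed, the target is a constant and only the
    \<open>Y\<close> matrices of level \<open>l\<close> remain random.\<close>
  proof (rule prob_Pi_pmf_cond_le[where x = l])
    show "l \<in> {..<Y}" using l s2 by simp
    fix A :: "nat \<Rightarrow> nat \<Rightarrow> nat \<Rightarrow> nat \<Rightarrow> bit"
    let ?g = "G (A s)"
    have sl: "s * l + 4 \<le> Y" using Y mult_le_mono2[OF less_imp_le[OF l], of s] by linarith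
    have nq: "neq s Y (Suc l) \<le> Y"
    proof (cases "Suc l < s")
      case True
      then have "s * Suc l \<le> s * s" by (intro mult_le_mono2) simp
      with True Y show ?thesis by (simp add: neq_def)
    qed (simp add: neq_def)
    have t: "target s Y (A(l := a)) ?g l i y = target s Y A ?g l i y" for a
      unfolding target_def by (simp add: csol_top_upd[OF l])
    \<comment> \<open>System \<open>i * Y + r\<close> uses the coins of level \<open>l\<close> only
      through the matrix \<open>a r\<close>, so the errors for different \<open>r\<close> are
      independent, as \<open>prob_many_bad\<close> presupposes.\<close>
    have p: "par s Y (A(l := a)) ?g l (i * Y + r) y = par s Y (A(l := (\<lambda>_ _ _. 0)(r := a r))) ?g l (i * Y + r) y"
      if "r < Y" for a r
    proof -
      have l': "s - l = Suc (s - Suc l)" "s - Suc (s - Suc l) = l" using l by auto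
      have "csys s Y (A(l := a)) ?g (s - l) (i * Y + r) q x =
          csys s Y (A(l := (\<lambda>_ _ _. 0)(r := a r))) ?g (s - l) (i * Y + r) q x" for q x
        unfolding l'(1) csys.simps l'(2) using that l by (simp add: csys_upd)
      then show ?thesis by (simp add: par_def csol_def sol_ind_def)
    qed
    have "{a. bad (A(l := a)) l i y} = {a. Y \<le> 2 * card {r. r < Y \<and>
        (\<lambda>r c. r < Y \<and> par s Y (A(l := (\<lambda>_ _ _. 0)(r := c))) ?g l (i * Y + r) y \<noteq> target s Y A ?g l i y) r (a r)}}"
    proof -
      have As: "(A(l := a)) s = A s" for a using l by simp
      have "{r. r < Y \<and> par s Y (A(l := a)) ?g l (i * Y + r) y \<noteq> target s Y A ?g l i y} = {r. r < Y \<and>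
        (\<lambda>r c. r < Y \<and> par s Y (A(l := (\<lambda>_ _ _. 0)(r := c))) ?g l (i * Y + r) y \<noteq> target s Y A ?g l i y) r (a r)}"
        for a
      proof (intro Collect_cong conj_cong refl)
        fix r
        assume r: "r < Y"
        show "par s Y (A(l := a)) ?g l (i * Y + r) y \<noteq> target s Y A ?g l i y \<longleftrightarrow>
          (\<lambda>r c. r < Y \<and> par s Y (A(l := (\<lambda>_ _ _. 0)(r := c))) ?g l (i * Y + r) y \<noteq> target s Y A ?g l i y) r (a r)"
          unfolding p[OF r, of a] using r by blast
      qed
      then show ?thesis unfolding bad_def As t by (simp only:)
    qed
    moreover have "measure_pmf.prob (rfam Y) {a. Y \<le> 2 * card {r. r < Y \<and>
        (\<lambda>r c. r < Y \<and> par s Y (A(l := (\<lambda>_ _ _. 0)(r := c))) ?g l (i * Y + r) y \<noteq> target s Y A ?g l i y) r (a r)}}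
        \<le> 1 / 2 ^ Y"
    proof (rule prob_many_bad)
      show "measure_pmf.prob (rmat Y) {c. r < Y \<and> par s Y (A(l := (\<lambda>_ _ _. 0)(r := c))) ?g l (i * Y + r) y
          \<noteq> target s Y A ?g l i y} \<le> 1 / 16" for r
        using prob_par_wrong[OF nq sl l, of r A "\<lambda>_ _ _. 0" ?g i y] by (cases "r < Y") simp_all
    qed
    ultimately show "measure_pmf.prob (rfam Y) {a. bad (A(l := a)) l i y} \<le> 1 / 2 ^ Y" by (simp only:)
  qed simp
  have finI: "finite I" by (simp add: I_def)
  have "measure_pmf.prob (rlev Y) {A. \<not> faithful s Y A (G (A s))} \<le>
      measure_pmf.prob (rlev Y) (\<Union>(l, i, y)\<in>I. {A. bad A l i y})"
    by (rule measure_pmf.finite_measure_mono) (auto simp: faithful_def bad_def I_def not_less)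
  also have "\<dots> \<le> (\<Sum>p\<in>I. measure_pmf.prob (rlev Y) (case p of (l, i, y) \<Rightarrow> {A. bad A l i y}))"
    using finI by (intro measure_pmf.finite_measure_subadditive_finite) auto
  also have "\<dots> \<le> (\<Sum>p\<in>I. 1 / 2 ^ Y)"
    by (rule sum_mono) (auto simp: I_def intro: one)
  also have "\<dots> = real (card I) / 2 ^ Y" by simp
  also have "\<dots> \<le> real (s * Y ^ s * 2 ^ (s * s)) / 2 ^ Y"
  proof -
    have "card I = (\<Sum>l<s. Y ^ (s - Suc l) * 2 ^ (s * s - s * l))" by (simp add: I_def)
    also have "\<dots> \<le> (\<Sum>l<s. Y ^ s * 2 ^ (s * s))"
      using Y by (intro sum_mono mult_le_mono power_increasing) auto
    finally have "card I \<le> s * Y ^ s * 2 ^ (s * s)" by simp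
    then have "real (card I) \<le> real (s * Y ^ s * 2 ^ (s * s))" by (simp only: of_nat_le_iff)
    then show ?thesis by (intro divide_right_mono) auto
  qed
  finally show ?thesis .
qed

subsection \<open>Isolating a solution\<close>

definition hash :: "nat \<Rightarrow> (nat \<Rightarrow> bit) \<Rightarrow> nat \<Rightarrow> bit" where
  "hash N c x = (\<Sum>j<N. c j * bt x j) + c N"

text \<open>A constant coordinate 1 at position \<open>N\<close> makes the affine hash linear, so
  that \<open>prob_rvec\<close> applies.\<close>

definition hvec :: "nat \<Rightarrow> nat \<Rightarrow> nat \<Rightarrow> bit" where
  "hvec N x j = (if j = N then 1 else bt x j)"

lemma hash_eq: "hash N c x = (\<Sum>j<Suc N. c j * hvec N x j)"
  unfolding hash_def by (auto simp: hvec_def intro!: sum.cong)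

lemma prob_hash: "N < Y \<Longrightarrow> measure_pmf.prob (rvec Y) {c. hash N c x = 0} = 1 / 2"
  unfolding hash_eq by (rule prob_rvec[of N]) (auto simp: hvec_def)

text \<open>The points differ in some bit, so the hash of \<open>x\<close>, the hash of
  \<open>y\<close> and their sum are each 0 with probability 1/2. Together with total mass 1 these
  equations determine the joint distribution.\<close>

lemma prob_hash2:
  assumes "N < Y" "x < 2 ^ N" "y < 2 ^ N" "x \<noteq> y"
  shows "measure_pmf.prob (rvec Y) {c. hash N c x = 0 \<and> hash N c y = 0} = 1 / 4"
proof -
  obtain j where "bit x j \<noteq> bit y j" using assms(4) bit_eq_iff by metis
  then have j: "bt x j \<noteq> bt y j" by (auto simp: bt_eq)
  then have jN: "j < N" using bt_less[OF assms(2), of j] bt_less[OF assms(3), of j] by fastforce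
  let ?P = "measure_pmf.prob (rvec Y)"
  have b01: "a = 0 \<or> a = 1" for a :: bit by (cases a rule: bit_cases) auto
  define E where "E a b = {c. hash N c x = a \<and> hash N c y = b}" for a b
  have un: "?P (E a b \<union> E a' b') = ?P (E a b) + ?P (E a' b')" if "(a, b) \<noteq> (a', b')" for a b a' b'
    by (rule measure_pmf.finite_measure_Union) (use that in \<open>auto simp: E_def\<close>)
  have add: "hash N c x + hash N c y = (\<Sum>i<Suc N. c i * (hvec N x i + hvec N y i))" for c
    unfolding hash_eq by (simp only: distrib_left sum.distrib)
  have "bt x j + bt y j = 1"
    using j by (cases "bt x j" rule: bit_cases; cases "bt y j" rule: bit_cases) auto
  then have "hvec N x j + hvec N y j = 1" using jN by (simp add: hvec_def)
  then have "?P {c. hash N c x + hash N c y = 0} = 1 / 2"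
    unfolding add using prob_rvec[of j "Suc N" Y "\<lambda>i. hvec N x i + hvec N y i"] jN assms(1) by simp
  moreover have "{c. hash N c x + hash N c y = 0} = E 0 0 \<union> E 1 1"
    unfolding bit_add_eq_0_iff E_def using b01 by auto
  ultimately have 1: "?P (E 0 0) + ?P (E 1 1) = 1 / 2"
    using un[of 0 0 1 1] by simp
  have "{c. hash N c x = 0} = E 0 0 \<union> E 0 1"
    unfolding E_def using b01 by auto
  then have 2: "?P (E 0 0) + ?P (E 0 1) = 1 / 2"
    using un[of 0 0 0 1] prob_hash[OF assms(1), of x] by simp
  have "{c. hash N c y = 0} = E 0 0 \<union> E 1 0"
    unfolding E_def using b01 by auto
  then have 3: "?P (E 0 0) + ?P (E 1 0) = 1 / 2"
    using un[of 0 0 1 0] prob_hash[OF assms(1), of y] by simp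
  have "E 0 1 \<union> (E 1 0 \<union> E 1 1) \<union> E 0 0 = UNIV"
    unfolding E_def using b01 by auto
  moreover have "?P (E 0 1 \<union> (E 1 0 \<union> E 1 1) \<union> E 0 0) = ?P (E 0 1) + (?P (E 1 0) + ?P (E 1 1)) + ?P (E 0 0)"
    by (subst measure_pmf.finite_measure_Union; (subst measure_pmf.finite_measure_Union)?;
      (subst measure_pmf.finite_measure_Union)?; auto simp: E_def)
  ultimately have "?P (E 0 1) + (?P (E 1 0) + ?P (E 1 1)) + ?P (E 0 0) = 1"
    using measure_pmf.prob_space[of "rvec Y"] by simp
  with 1 2 3 have "?P (E 0 0) = 1 / 4" by linarith
  then show ?thesis by (simp add: E_def)
qed

definition isolated :: "nat \<Rightarrow> nat set \<Rightarrow> nat \<Rightarrow> (nat \<Rightarrow> nat \<Rightarrow> bit) \<Rightarrow> nat \<Rightarrow> bool" where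
  "isolated N S k c x \<longleftrightarrow> x \<in> S \<and> (\<forall>y\<in>S. (\<forall>q<k. hash N (c q) y = 0) \<longleftrightarrow> y = x)"

text \<open>The Valiant-Vazirani argument. A given \<open>x\<close> survives alone with probability
  at least \<open>1 / 2 ^ k - card S / 4 ^ k\<close>, which is at least half of
  \<open>1 / 2 ^ k\<close>. These events are disjoint for distinct \<open>x\<close>, and summing
  over \<open>S\<close> gives 1/8 because \<open>2 ^ k \<le> 4 * card S\<close>.\<close>

lemma prob_isolated:
  assumes N: "N < Y" and S: "S \<subseteq> {..<2 ^ N}" "S \<noteq> {}" and k: "k \<le> Y" "2 * card S \<le> 2 ^ k" "2 ^ k \<le> 4 * card S"
  shows "measure_pmf.prob (rmat Y) {c. \<exists>x. isolated N S k c x} \<ge> 1 / 8"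
proof -
  let ?P = "measure_pmf.prob (rmat Y)"
  have fin: "finite S" using S finite_subset by blast
  define H where "H x = {c. \<forall>q<k. hash N (c q) x = 0}" for x
  have p1: "?P (H x) = 1 / 2 ^ k" for x
    unfolding H_def using prob_rmat[OF k(1), of "\<lambda>c. hash N c x = 0"] prob_hash[OF N, of x]
    by (simp add: power_one_over)
  have p2: "?P (H x \<inter> H y) = 1 / 4 ^ k" if "x \<in> S" "y \<in> S" "x \<noteq> y" for x y
  proof -
    have "H x \<inter> H y = {c. \<forall>q<k. hash N (c q) x = 0 \<and> hash N (c q) y = 0}" by (auto simp: H_def)
    moreover have "measure_pmf.prob (rvec Y) {c. hash N c x = 0 \<and> hash N c y = 0} = 1 / 4"
      by (rule prob_hash2[OF N]) (use that S in auto)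
    ultimately have "?P (H x \<inter> H y) = (1 / 4) ^ k"
      using prob_rmat[OF k(1), of "\<lambda>c. hash N c x = 0 \<and> hash N c y = 0"] by (simp only:)
    then show ?thesis by (simp add: power_one_over)
  qed
  have iso: "?P {c. isolated N S k c x} \<ge> 1 / (2 * 2 ^ k)" if x: "x \<in> S" for x
  proof -
    have "H x \<subseteq> {c. isolated N S k c x} \<union> (\<Union>y\<in>S - {x}. H x \<inter> H y)"
      using x unfolding isolated_def H_def by auto
    then have "?P (H x) \<le> ?P ({c. isolated N S k c x} \<union> (\<Union>y\<in>S - {x}. H x \<inter> H y))"
      by (rule measure_pmf.finite_measure_mono) simp
    also have "\<dots> \<le> ?P {c. isolated N S k c x} + ?P (\<Union>y\<in>S - {x}. H x \<inter> H y)"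
      by (rule measure_Un_le) auto
    also have "?P (\<Union>y\<in>S - {x}. H x \<inter> H y) \<le> (\<Sum>y\<in>S - {x}. ?P (H x \<inter> H y))"
      using fin by (intro measure_pmf.finite_measure_subadditive_finite) auto
    also have "\<dots> = (\<Sum>y\<in>S - {x}. 1 / 4 ^ k)" using x p2 by (intro sum.cong) auto
    also have "\<dots> = real (card (S - {x})) / 4 ^ k" by simp
    also have "\<dots> \<le> (2 ^ k / 2) / 4 ^ k"
    proof (rule divide_right_mono)
      have "real (2 * card (S - {x})) \<le> real (2 * card S)"
        using fin by (simp only: of_nat_le_iff) (simp add: card_Diff1_le)
      also have "\<dots> \<le> real (2 ^ k)" using k(2) by (simp only: of_nat_le_iff)
      finally show "real (card (S - {x})) \<le> 2 ^ k / 2" by simp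
    qed simp
    also have "(2 ^ k / 2) / 4 ^ k = 1 / (2 * 2 ^ k :: real)"
      by (simp add: field_simps flip: power_mult_distrib)
    finally have "?P (H x) \<le> ?P {c. isolated N S k c x} + 1 / (2 * 2 ^ k)" by simp
    then show ?thesis unfolding p1 by simp
  qed
  have "1 / 8 \<le> real (card S) * (1 / (2 * 2 ^ k))"
  proof -
    have "real (2 ^ k) \<le> real (4 * card S)" using k(3) by (simp only: of_nat_le_iff)
    then show ?thesis by (simp add: field_simps)
  qed
  also have "\<dots> = (\<Sum>x\<in>S. 1 / (2 * 2 ^ k))" by simp
  also have "\<dots> \<le> (\<Sum>x\<in>S. ?P {c. isolated N S k c x})" by (rule sum_mono[OF iso])
  also have "\<dots> = ?P (\<Union>x\<in>S. {c. isolated N S k c x})"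
  proof (rule measure_pmf.finite_measure_finite_Union[symmetric, OF fin])
    show "disjoint_family_on (\<lambda>x. {c. isolated N S k c x}) S"
      by (auto simp: disjoint_family_on_def isolated_def)
  qed simp
  also have "\<dots> \<le> ?P {c. \<exists>x. isolated N S k c x}"
    by (rule measure_pmf.finite_measure_mono) auto
  finally show ?thesis .
qed

lemma prob_rlev_component:
  assumes "l < Y" "r < Y"
  shows "measure_pmf.prob (rlev Y) {A. P (A l r)} = measure_pmf.prob (rmat Y) {c. P c}"
proof -
  have 1: "map_pmf (\<lambda>A. A l) (rlev Y) = rfam Y"
    unfolding rlev_def using assms by (subst Pi_pmf_component) auto
  have 2: "map_pmf (\<lambda>A. A r) (rfam Y) = rmat Y"
    unfolding rfam_def using assms by (subst Pi_pmf_component) auto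
  have "measure_pmf.prob (rmat Y) {c. P c} =
      measure_pmf.prob (map_pmf (\<lambda>A. A r) (map_pmf (\<lambda>A. A l) (rlev Y))) {c. P c}"
    unfolding 1 2 ..
  also have "\<dots> = measure_pmf.prob (rlev Y) {A. P (A l r)}"
    by (simp add: vimage_def)
  finally show ?thesis ..
qed

text \<open>The number of solutions is unknown to the algorithm; the bound \<open>Suc N\<close> is
  why the search tries \<open>N + 2\<close> values of \<open>k\<close>.\<close>

lemma isolation_exponent:
  assumes "0 < a" "a \<le> 2 ^ N"
  obtains k where "k \<le> Suc N" "2 * a \<le> 2 ^ k" "2 ^ k \<le> 4 * (a::nat)"
proof -
  define k where "k = (LEAST k. 2 * a \<le> 2 ^ k)"
  have ex: "2 * a \<le> 2 ^ Suc N" using assms by simp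
  have 1: "2 * a \<le> 2 ^ k" unfolding k_def by (rule LeastI[of "\<lambda>k. 2 * a \<le> 2 ^ k", OF ex])
  have 2: "k \<le> Suc N" unfolding k_def by (rule Least_le[of "\<lambda>k. 2 * a \<le> 2 ^ k", OF ex])
  have "k \<noteq> 0" using 1 assms(1) by (cases k) auto
  then have "\<not> 2 * a \<le> 2 ^ (k - 1)" using not_less_Least[of "k - 1" "\<lambda>k. 2 * a \<le> 2 ^ k"] unfolding k_def by auto
  then have "2 ^ k \<le> 4 * a" using \<open>k \<noteq> 0\<close> by (cases k) auto
  with 1 2 that show ?thesis by blast
qed

text \<open>\<open>G k i c\<close> stands for the top system with \<open>k\<close> hashes taken from
  \<open>c\<close> and bit \<open>i\<close> tested. A single \<open>k\<close> has to serve all bits,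
  and the hash matrix is \<open>A s 0\<close>, from a level that no combination uses.\<close>

definition lucky :: "nat \<Rightarrow> nat \<Rightarrow> nat set \<Rightarrow> (nat \<Rightarrow> nat \<Rightarrow> (nat \<Rightarrow> nat \<Rightarrow> bit) \<Rightarrow> nat \<Rightarrow> nat \<Rightarrow> bit) \<Rightarrow>
    (nat \<Rightarrow> nat \<Rightarrow> nat \<Rightarrow> nat \<Rightarrow> bit) \<Rightarrow> bool" where
  "lucky s Y S G A \<longleftrightarrow> (\<exists>k\<le>Suc (s * s). (\<exists>x. isolated (s * s) S k (A s 0) x) \<and>
     (\<forall>i<s * s. faithful s Y A (G k i (A s 0))))"

text \<open>For the \<open>k\<close> of \<open>isolation_exponent\<close>, which does not depend on
  the coins, isolation has probability at least 1/8; by \<open>small\<close> the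
  \<open>s * s\<close> systems, one for each bit, fail to be faithful with total probability at most
  1/16.\<close>

lemma prob_lucky:
  assumes Y: "s * s + 4 \<le> Y" and S: "S \<subseteq> {..<2 ^ (s * s)}" "S \<noteq> {}"
    and small: "16 * (s * s * (s * Y ^ s * 2 ^ (s * s))) \<le> 2 ^ Y"
  shows "measure_pmf.prob (rlev Y) {A. lucky s Y S G A} \<ge> 1 / 16"
proof -
  let ?P = "measure_pmf.prob (rlev Y)"
  let ?N = "s * s"
  have fin: "finite S" using S finite_subset by blast
  have "0 < card S" using fin S by (simp add: card_gt_0_iff)
  moreover have "card S \<le> 2 ^ ?N" using card_mono[OF _ S(1)] by simp
  ultimately obtain k where k: "k \<le> Suc ?N" "2 * card S \<le> 2 ^ k" "2 ^ k \<le> 4 * card S"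
    by (rule isolation_exponent)
  have sY: "s < Y"
  proof -
    have "s \<le> s * s" by (cases s) auto
    with Y show ?thesis by linarith
  qed
  have "1 / 8 \<le> measure_pmf.prob (rmat Y) {c. \<exists>x. isolated ?N S k c x}"
    by (rule prob_isolated) (use Y S k in auto)
  also have "\<dots> = ?P {A. \<exists>x. isolated ?N S k (A s 0) x}"
    by (rule prob_rlev_component[symmetric]) (use sY in auto)
  also have "\<dots> \<le> ?P ({A. lucky s Y S G A} \<union> (\<Union>i\<in>{..<?N}. {A. \<not> faithful s Y A (G k i (A s 0))}))"
    by (rule measure_pmf.finite_measure_mono) (use k(1) in \<open>auto simp: lucky_def\<close>)
  also have "\<dots> \<le> ?P {A. lucky s Y S G A} + ?P (\<Union>i\<in>{..<?N}. {A. \<not> faithful s Y A (G k i (A s 0))})"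
    by (rule measure_Un_le) auto
  also have "?P (\<Union>i\<in>{..<?N}. {A. \<not> faithful s Y A (G k i (A s 0))}) \<le>
      (\<Sum>i<?N. ?P {A. \<not> faithful s Y A (G k i (A s 0))})"
    by (rule measure_pmf.finite_measure_subadditive_finite) auto
  also have "\<dots> \<le> (\<Sum>i<?N. real (s * Y ^ s * 2 ^ (s * s)) / 2 ^ Y)"
    by (rule sum_mono) (rule prob_not_faithful[OF Y, of "\<lambda>a. G k _ (a 0)"])
  also have "\<dots> = real (?N * (s * Y ^ s * 2 ^ (s * s))) / 2 ^ Y" by simp
  also have "\<dots> \<le> 1 / 16"
  proof -
    have "real (16 * (?N * (s * Y ^ s * 2 ^ (s * s)))) \<le> real (2 ^ Y)"
      using small by (simp only: of_nat_le_iff)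
    then show ?thesis by (simp add: field_simps)
  qed
  finally show ?thesis by simp
qed

lemma prob_some_lucky:
  assumes "measure_pmf.prob (rlev Y) {A. L A} \<ge> 1 / 16"
  shows "measure_pmf.prob (rrep Y) {A. \<exists>p<Y. L (A p)} \<ge> 1 - (15 / 16) ^ Y"
proof -
  have "measure_pmf.prob (rlev Y) {A. \<not> L A} = 1 - measure_pmf.prob (rlev Y) {A. L A}"
    using measure_pmf.prob_compl[of "{A. L A}" "rlev Y"] by (simp add: Compl_eq_Diff_UNIV[symmetric] Collect_neg_eq)
  then have a: "measure_pmf.prob (rlev Y) {A. \<not> L A} \<le> 15 / 16" using assms by simp
  have "measure_pmf.prob (rrep Y) (Pi {..<Y} (\<lambda>_. {A. \<not> L A})) = measure_pmf.prob (rlev Y) {A. \<not> L A} ^ Y"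
    unfolding rrep_def by (subst measure_Pi_pmf_Pi) auto
  also have "\<dots> \<le> (15 / 16) ^ Y" using a by (intro power_mono) auto
  finally have b: "measure_pmf.prob (rrep Y) (Pi {..<Y} (\<lambda>_. {A. \<not> L A})) \<le> (15 / 16) ^ Y" .
  have "{A. \<exists>p<Y. L (A p)} = - Pi {..<Y} (\<lambda>_. {A. \<not> L A})" by (auto simp: Pi_def)
  then have "measure_pmf.prob (rrep Y) {A. \<exists>p<Y. L (A p)} =
      1 - measure_pmf.prob (rrep Y) (Pi {..<Y} (\<lambda>_. {A. \<not> L A}))"
    using measure_pmf.prob_compl[of "Pi {..<Y} (\<lambda>_. {A. \<not> L A})" "rrep Y"] by (simp add: Compl_eq_Diff_UNIV)
  with b show ?thesis by simp
qed

subsection \<open>Coin sequences\<close>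

definition cidx :: "nat \<Rightarrow> nat \<Rightarrow> nat \<Rightarrow> nat \<Rightarrow> nat \<Rightarrow> nat \<Rightarrow> nat" where
  "cidx Y p l r q q' = (((p * Y + l) * Y + r) * Y + q) * Y + q'"

lemma cidx_less:
  assumes "p < Y" "l < Y" "r < Y" "q < Y" "q' < Y"
  shows "cidx Y p l r q q' < Y ^ 5"
  using digits_less[OF digits_less[OF digits_less[OF digits_less[OF assms(1,2)] assms(3)] assms(4)] assms(5)]
  by (simp add: cidx_def power_numeral_reduce mult.assoc)

definition coins :: "nat \<Rightarrow> bool list \<Rightarrow> nat \<Rightarrow> nat \<Rightarrow> nat \<Rightarrow> nat \<Rightarrow> nat \<Rightarrow> bit" where
  "coins Y b p l r q q' = (if p < Y \<and> l < Y \<and> r < Y \<and> q < Y \<and> q' < Y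
     then of_bool (b ! cidx Y p l r q q') else 0)"

lemma cidx_surj:
  assumes "k < Y ^ 5"
  obtains p l r q q' where "p < Y" "l < Y" "r < Y" "q < Y" "q' < Y" "k = cidx Y p l r q q'"
proof -
  have Y: "0 < Y" using assms by (cases Y) auto
  define q' where "q' = k mod Y"
  define q where "q = k div Y mod Y"
  define r where "r = k div Y div Y mod Y"
  define l where "l = k div Y div Y div Y mod Y"
  define p where "p = k div Y div Y div Y div Y"
  have "k < Y * Y * Y * Y * Y" using assms by (simp add: power_numeral_reduce mult.assoc)
  then have "p < Y" by (simp add: p_def less_mult_imp_div_less)
  moreover have "k = cidx Y p l r q q'" by (simp add: cidx_def p_def l_def r_def q_def q'_def)
  moreover have "l < Y" "r < Y" "q < Y" "q' < Y"
    using Y by (simp_all only: l_def r_def q_def q'_def mod_less_divisor)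
  ultimately show ?thesis using that by blast
qed

text \<open>Both sides are uniform: \<open>coins Y\<close> is injective on lists of length
  \<open>Y ^ 5\<close>, and the iterated product \<open>X5\<close> has as many elements as there are
  such lists.\<close>

lemma rrep_eq_coins: "rrep Y = map_pmf (coins Y) (pmf_of_set {b. length b = Y ^ 5})"
proof -
  define X1 where "X1 = PiE_dflt {..<Y} (0::bit) (\<lambda>_. {0, 1})"
  define X2 where "X2 = PiE_dflt {..<Y} (\<lambda>_. 0) (\<lambda>_. X1)"
  define X3 where "X3 = PiE_dflt {..<Y} (\<lambda>_ _. 0) (\<lambda>_. X2)"
  define X4 where "X4 = PiE_dflt {..<Y} (\<lambda>_ _ _. 0) (\<lambda>_. X3)"
  define X5 where "X5 = PiE_dflt {..<Y} (\<lambda>_ _ _ _. 0) (\<lambda>_. X4)"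
  have fin: "finite X1" "finite X2" "finite X3" "finite X4" "finite X5"
    unfolding X5_def X4_def X3_def X2_def X1_def by (intro finite_PiE_dflt; simp)+
  have ne: "X1 \<noteq> {}" "X2 \<noteq> {}" "X3 \<noteq> {}" "X4 \<noteq> {}" "X5 \<noteq> {}"
    unfolding X5_def X4_def X3_def X2_def X1_def by simp_all
  have "rvec Y = pmf_of_set X1" unfolding rvec_def coin_def X1_def by (rule Pi_pmf_of_set) auto
  then have "rmat Y = pmf_of_set X2" unfolding rmat_def X2_def using fin ne by (simp add: Pi_pmf_of_set)
  then have "rfam Y = pmf_of_set X3" unfolding rfam_def X3_def using fin ne by (simp add: Pi_pmf_of_set)
  then have "rlev Y = pmf_of_set X4" unfolding rlev_def X4_def using fin ne by (simp add: Pi_pmf_of_set)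
  then have rep: "rrep Y = pmf_of_set X5" unfolding rrep_def X5_def using fin ne by (simp add: Pi_pmf_of_set)
  have "card X1 = 2 ^ Y" unfolding X1_def by (subst card_PiE_dflt) (auto simp: numeral_2_eq_2)
  then have "card X2 = 2 ^ (Y * Y)" unfolding X2_def using fin by (subst card_PiE_dflt) (auto simp: power_mult)
  then have "card X3 = 2 ^ (Y * Y * Y)" unfolding X3_def using fin by (subst card_PiE_dflt) (auto simp: power_mult)
  then have "card X4 = 2 ^ (Y * Y * Y * Y)" unfolding X4_def using fin by (subst card_PiE_dflt) (auto simp: power_mult)
  then have "card X5 = 2 ^ (Y * Y * Y * Y * Y)" unfolding X5_def using fin by (subst card_PiE_dflt) (auto simp: power_mult)
  then have card: "card X5 = 2 ^ (Y ^ 5)" by (simp add: power_numeral_reduce mult.assoc)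
  let ?L = "{b :: bool list. length b = Y ^ 5}"
  have L: "finite ?L" "card ?L = 2 ^ (Y ^ 5)" "?L \<noteq> {}"
    using finite_lists_length_eq[of "UNIV :: bool set" "Y ^ 5"] card_lists_length_eq[of "UNIV :: bool set" "Y ^ 5"]
      Ex_list_of_length by (auto simp: card_UNIV_bool)
  have inj: "inj_on (coins Y) ?L"
  proof (rule inj_onI, rule nth_equalityI)
    fix b c k
    assume bc: "b \<in> ?L" "c \<in> ?L" "coins Y b = coins Y c" and k: "k < length b"
    then have "k < Y ^ 5" by simp
    then obtain p l r q q' where d: "p < Y" "l < Y" "r < Y" "q < Y" "q' < Y" "k = cidx Y p l r q q'"
      by (rule cidx_surj)
    have "coins Y b p l r q q' = coins Y c p l r q q'" using bc(3) by simp
    with d show "b ! k = c ! k" by (simp add: coins_def of_bool_eq_iff)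
  qed auto
  have "coins Y ` ?L \<subseteq> X5"
    by (simp add: X5_def X4_def X3_def X2_def X1_def PiE_dflt_def coins_def fun_eq_iff image_subset_iff)
  moreover have "card (coins Y ` ?L) = card X5" using card_image[OF inj] L card by simp
  ultimately have "coins Y ` ?L = X5" using card_subset_eq[OF fin(5)] by blast
  then show ?thesis using map_pmf_of_set_inj[OF inj L(3,1)] rep by simp
qed

text \<open>Bridges the sample space of \<open>success_prob\<close>, lists as long as the time
  bound, and the prefix that the program reads.\<close>

lemma map_take_uniform:
  assumes "Q \<le> T"
  shows "map_pmf (take Q) (pmf_of_set {b :: bool list. length b = T}) = pmf_of_set {b. length b = Q}"
proof -
  let ?L = "\<lambda>n. {b :: bool list. length b = n}"
  have L: "finite (?L n)" "?L n \<noteq> {}" for n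
    using finite_lists_length_eq[of "UNIV :: bool set" n] Ex_list_of_length by auto
  have bij: "bij_betw (\<lambda>(x, y). x @ y) (?L Q \<times> ?L (T - Q)) (?L T)"
    by (rule bij_betwI[of _ _ _ "\<lambda>b. (take Q b, drop Q b)"]) (use assms in auto)
  have "pmf_of_set (?L Q \<times> ?L (T - Q)) = pair_pmf (pmf_of_set (?L Q)) (pmf_of_set (?L (T - Q)))"
  proof (rule pmf_eqI)
    fix p :: "bool list \<times> bool list"
    show "pmf (pmf_of_set (?L Q \<times> ?L (T - Q))) p = pmf (pair_pmf (pmf_of_set (?L Q)) (pmf_of_set (?L (T - Q)))) p"
      using L by (cases p) (simp add: pmf_pair indicator_def card_cartesian_product)
  qed
  moreover have "map_pmf (\<lambda>(x, y). x @ y) (pmf_of_set (?L Q \<times> ?L (T - Q))) = pmf_of_set (?L T)"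
    by (rule map_pmf_of_set_bij_betw[OF bij]) (use L in auto)
  ultimately have "map_pmf (take Q) (pmf_of_set (?L T)) =
      map_pmf (take Q) (map_pmf (\<lambda>(x, y). x @ y) (pair_pmf (pmf_of_set (?L Q)) (pmf_of_set (?L (T - Q)))))"
    by simp
  also have "\<dots> = map_pmf fst (pair_pmf (pmf_of_set (?L Q)) (pmf_of_set (?L (T - Q))))"
    unfolding pmf.map_comp using L by (intro map_pmf_cong) auto
  finally show ?thesis by (simp add: map_fst_pair_pmf)
qed

lemma prob_coins:
  assumes "Y ^ 5 \<le> T"
  shows "measure_pmf.prob (pmf_of_set {b. length b = T}) {b. P (coins Y b)} =
    measure_pmf.prob (rrep Y) {A. P A}"
proof -
  have c: "coins Y (take (Y ^ 5) b) = coins Y b" for b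
    using cidx_less[of _ Y] by (auto simp: coins_def fun_eq_iff)
  have "measure_pmf.prob (rrep Y) {A. P A} = measure_pmf.prob (map_pmf (coins Y)
      (map_pmf (take (Y ^ 5)) (pmf_of_set {b. length b = T}))) {A. P A}"
    unfolding rrep_eq_coins map_take_uniform[OF assms] ..
  then show ?thesis by (simp add: vimage_def c)
qed

section \<open>The program\<close>

text \<open>
  Arrays: 0 input and answer, 1 coin tosses, 2 the numbers \<open>nlow\<close> (whose entries
  \<open>nlow i N = 2 ^ i\<close> serve as powers of two), 3 the number of points of bounded weight at each
  level, 4 values of the equations at a point, 5 tables of approximate parities, 6 the table
  under transformation, 7 vote counts, 8 bits of the candidate solution. The minima with \<open>Y\<close>
  and \<open>Z\<close> never take effect; they only make the static bounds checkable.
\<close>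

definition bval :: "bit \<Rightarrow> nat" where
  "bval b = (if b = 0 then 0 else 1)"

lemma bval_simps [simp]: "bval 0 = 0" "bval 1 = Suc 0"
  by (simp_all add: bval_def)

lemma bval_add: "(bval a + bval b) mod 2 = bval (a + b)"
  by (cases a rule: bit_cases; cases b rule: bit_cases) auto

lemma bval_mult: "bval a * bval b = bval (a * b)"
  by (cases a rule: bit_cases; cases b rule: bit_cases) auto

lemma bval_mod: "bval a mod 2 = bval a"
  by (cases a rule: bit_cases) auto

lemma bval_bt: "x div 2 ^ i mod 2 = bval (bt x i)"
  by (simp add: bt_def of_nat_bit_eq mod_2_eq_odd)

lemma bval_eq_0 [simp]: "bval a = 0 \<longleftrightarrow> a = 0"
  by (cases a rule: bit_cases) auto

lemma bval_compl: "1 - bval a = bval (1 + a)"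
  by (cases a rule: bit_cases) auto

definition same :: "string set \<Rightarrow> nat set \<Rightarrow> lstate \<Rightarrow> lstate \<Rightarrow> bool" where
  "same V Q s t \<longleftrightarrow> (\<forall>x. x \<notin> V \<longrightarrow> lv t x = lv s x) \<and> (\<forall>k. k \<notin> Q \<longrightarrow> la t k = la s k)"

lemma same_lv: "same V Q s t \<Longrightarrow> x \<notin> V \<Longrightarrow> lv t x = lv s x"
  and same_la: "same V Q s t \<Longrightarrow> k \<notin> Q \<Longrightarrow> la t k = la s k"
  by (auto simp: same_def)

lemma same_refl: "same V Q s s"
  by (simp add: same_def)

lemma same_run: "vars c \<subseteq> V \<Longrightarrow> arrs c \<subseteq> Q \<Longrightarrow> same V Q s t \<Longrightarrow> same V Q s (run c t)"
proof -
  assume c: "vars c \<subseteq> V" "arrs c \<subseteq> Q" "same V Q s t"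
  have "lv (run c t) x = lv s x" if "x \<notin> V" for x
    using run_vars[of x c t] that c by (auto simp: same_def)
  moreover have "la (run c t) k = la s k" if "k \<notin> Q" for k
    using run_arrs[of k c t] that c by (auto simp: same_def)
  ultimately show ?thesis by (simp add: same_def)
qed

lemma same_setv: "x \<in> V \<Longrightarrow> same V Q s t \<Longrightarrow> same V Q s (setv x v t)"
  unfolding same_def by auto

text \<open>The frame relation \<open>same\<close> to the state before the loop is carried along
  automatically. An invariant therefore mentions only what the body changes, and must be insensitive
  to the counter.\<close>

lemma For_rule:
  assumes "lval e s = n" "I 0 s"
    "\<And>k t v. I k t \<Longrightarrow> I k (setv x v t)"
    "\<And>k t. k < n \<Longrightarrow> I k t \<Longrightarrow> same (insert x (vars c)) (arrs c) s t \<Longrightarrow> lv t x = k \<Longrightarrow>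
      I (Suc k) (run c t)"
  shows "I n (run (LFor x e c) s)"
proof -
  let ?S = "same (insert x (vars c)) (arrs c) s"
  have "I n (run (LFor x e c) s) \<and> ?S (run (LFor x e c) s)"
  proof (rule run_For_induct[where I = "\<lambda>k t. I k t \<and> ?S t"])
    show "lval e s = n" by fact
    fix k t
    assume "k < n" "I k t \<and> ?S t"
    moreover from this have "?S (setv x k t)" by (intro same_setv) auto
    ultimately show "I (Suc k) (run c (setv x k t)) \<and> ?S (run c (setv x k t))"
      using assms(3,4) same_run[of c "insert x (vars c)" "arrs c" s "setv x k t"] by auto
  qed (use assms(2,3) same_setv in \<open>auto simp: same_refl\<close>)
  then show ?thesis ..
qed

text \<open>For code that stores to no array: an invariant that survives assignments to the
  temporaries survives the code, whatever it computes. Used to pass \<open>unrankC\<close>.\<close>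

lemma run_stable:
  assumes "arrs c = {}" "\<And>x v t. x \<in> vars c \<Longrightarrow> I t \<Longrightarrow> I (setv x v t)" "I s"
  shows "I (run c s)"
  using assms
proof (induction c arbitrary: s)
  case (LFor x e c)
  have "I (iter n (\<lambda>k t. run c (setv x k t)) s)" for n
    by (induction n) (use LFor in auto)
  with LFor show ?case by simp
qed auto

definition skip :: lcom where
  "skip = LSet ''o'' (LC 0)"

definition pow2E :: "lexp \<Rightarrow> lexp" where
  "pow2E e = LA 2 (LC 0) e (LV ''N'')"

definition bitE :: "lexp \<Rightarrow> lexp \<Rightarrow> lexp" where
  "bitE x e = LMod2 (LDiv x (pow2E e))"

definition wlimE :: "nat \<Rightarrow> lexp \<Rightarrow> lexp" where
  "wlimE d e = LAdd (LMul (LC (d - 1)) (LMul (LV ''s'') e)) (LC (4 * d))"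

definition dimE :: "lexp \<Rightarrow> lexp" where
  "dimE e = LSub (LV ''N'') (LMul (LV ''s'') e)"

definition nextC :: "string \<Rightarrow> lcom" where
  "nextC x = LSet x (LMin (LAdd (LV x) (LC 1)) (LV ''Z''))"

text \<open>Iterative form of \<open>unrank\<close>, from the top bit down. The truncated difference
  of \<open>''c''\<close> and \<open>''rr''\<close> is nonzero exactly if the rank falls among the
  masks with bit \<open>''b''\<close> clear.\<close>

definition unrankC :: "nat \<Rightarrow> string \<Rightarrow> lexp \<Rightarrow> lcom" where
  "unrankC d y e =
     LSet y (LC 0) ;; LSet ''rr'' (LV ''rk'') ;; LSet ''w'' (wlimE d e) ;; LSet ''mm'' (dimE e) ;;
     LFor ''h'' (LV ''mm'') (
       LSet ''b'' (LSub (LSub (LV ''mm'') (LC 1)) (LV ''h'')) ;;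
       LSet ''c'' (LA 2 (LC 0) (LV ''b'') (LV ''w'')) ;;
       LIf (LSub (LV ''c'') (LV ''rr'')) skip
         (LSet y (LMin (LAdd (LV y) (pow2E (LV ''b''))) (LV ''Z'')) ;;
          LSet ''rr'' (LSub (LV ''rr'') (LV ''c'')) ;; LSet ''w'' (LSub (LV ''w'') (LC 1))))"

definition forW :: "nat \<Rightarrow> string \<Rightarrow> lexp \<Rightarrow> lcom \<Rightarrow> lcom" where
  "forW d y e c = LFor ''rk'' (LA 3 (LC 0) (LC 0) e) (unrankC d y e ;; c)"

definition wtemps :: "string set" where
  "wtemps = {''rk'', ''rr'', ''w'', ''mm'', ''h'', ''b'', ''c'', ''o''}"

lemma vars_skip [simp]: "vars skip = {''o''}" "arrs skip = {}"
  by (simp_all add: skip_def)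

lemma vars_nextC [simp]: "vars (nextC x) = {x}" "arrs (nextC x) = {}"
  by (simp_all add: nextC_def)

lemma vars_unrankC: "vars (unrankC d y e) = insert y (wtemps - {''rk''})"
  by (auto simp: unrankC_def wtemps_def)

lemma arrs_unrankC [simp]: "arrs (unrankC d y e) = {}"
  by (simp add: unrankC_def)

lemma vars_forW [simp]: "vars (forW d y e c) = insert y (wtemps \<union> vars c)"
  by (auto simp: forW_def vars_unrankC) (auto simp: wtemps_def)

lemma arrs_forW [simp]: "arrs (forW d y e c) = arrs c"
  by (simp add: forW_def)

section \<open>Parameters, input format and the context of all program parts\<close>

definition params :: "string set" where
  "params = {''n'', ''m'', ''s'', ''N'', ''K'', ''Y'', ''Z'', ''S''}"

definition enc_monomials :: "anf \<Rightarrow> nat list" where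
  "enc_monomials P = concat (map (\<lambda>M. length M # M) P)"

definition enc_polys :: "anf list \<Rightarrow> nat list" where
  "enc_polys E = concat (map (\<lambda>P. length P # enc_monomials P) E)"

definition pe :: "anf \<Rightarrow> nat \<Rightarrow> bit" where
  "pe P x = (\<Sum>M\<leftarrow>P. \<Prod>i\<leftarrow>M. bt x i)"

text \<open>The top system has \<open>m\<close> given rows, \<open>N\<close> padding rows, at most
  \<open>Suc N\<close> hash rows and the row \<open>m + 2 * N + 1\<close> for the tested bit; the
  bound on \<open>Y\<close> makes room for them and for the \<open>s * l + 4\<close> combinations of
  a level. \<open>A\<close> stands for the coin values already drawn.\<close>

locale solver =
  fixes d n s Y Z :: nat and E :: "anf list"
    and A :: "nat \<Rightarrow> nat \<Rightarrow> nat \<Rightarrow> nat \<Rightarrow> nat \<Rightarrow> bit"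
  assumes d: "2 \<le> d" and s: "1 \<le> s" and ns: "n \<le> s * s"
    and E: "poly_system d n E"
    and Y: "length E + 2 * (s * s) + 4 \<le> Y"
    and Z: "2 ^ (s * s) \<le> Z" "length (encode n E) \<le> Z" "Y \<le> Z"
begin

abbreviation "N \<equiv> s * s"
abbreviation "m \<equiv> length E"

definition inp :: "nat \<Rightarrow> nat" where
  "inp a = (if a < length (encode n E) then encode n E ! a else 0)"

text \<open>What setup establishes and everything up to the output leaves alone: the search assigns
  no variable in \<open>params\<close> and writes none of the arrays 0 to 3.\<close>

definition ctx :: "lstate \<Rightarrow> bool" where
  "ctx t \<longleftrightarrow> lv t ''n'' = n \<and> lv t ''m'' = m \<and> lv t ''s'' = s \<and> lv t ''N'' = N \<and>
     lv t ''K'' = Y ^ s \<and> lv t ''Y'' = Y \<and> lv t ''Z'' = Z \<and> lv t ''S'' = 2 ^ s \<and>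
     (\<forall>i w. i \<le> N \<longrightarrow> w \<le> wlim d s s \<longrightarrow> la t 2 0 i w = nlow i w) \<and>
     (\<forall>l\<le>s. la t 3 0 0 l = nlow (N - s * l) (wlim d s l)) \<and>
     (\<forall>a. la t 0 0 0 a = inp a) \<and>
     (\<forall>p<Y. \<forall>l<Y. \<forall>r<Y. \<forall>q<Y. \<forall>q'<Y. la t 1 0 0 (cidx Y p l r q q') = bval (A p l r q q'))"

lemma ctxD:
  assumes "ctx t"
  shows "lv t ''n'' = n" "lv t ''m'' = m" "lv t ''s'' = s" "lv t ''N'' = N"
    "lv t ''K'' = Y ^ s" "lv t ''Y'' = Y" "lv t ''Z'' = Z"
    "\<And>i w. i \<le> N \<Longrightarrow> w \<le> wlim d s s \<Longrightarrow> la t 2 0 i w = nlow i w"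
    "\<And>l. l \<le> s \<Longrightarrow> la t 3 0 0 l = nlow (N - s * l) (wlim d s l)"
    "\<And>a. la t 0 0 0 a = inp a"
    "\<And>p l r q q'. p < Y \<Longrightarrow> l < Y \<Longrightarrow> r < Y \<Longrightarrow> q < Y \<Longrightarrow> q' < Y \<Longrightarrow>
      la t 1 0 0 (cidx Y p l r q q') = bval (A p l r q q')"
    "lv t ''S'' = 2 ^ s"
  using assms by (auto simp: ctx_def)

lemma ctx_same:
  assumes "ctx t" "same V Q t t'" "V \<inter> params = {}" "Q \<inter> {0, 1, 2, 3} = {}"
  shows "ctx t'"
proof -
  have "lv t' x = lv t x" if "x \<in> params" for x
    using assms(2,3) that by (auto intro: same_lv)
  moreover have "la t' k = la t k" if "k \<in> {0, 1, 2, 3}" for k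
    using assms(2,4) that by (auto intro: same_la)
  ultimately show ?thesis using assms(1) unfolding ctx_def params_def by simp
qed

lemma ctx_run: "ctx t \<Longrightarrow> vars c \<inter> params = {} \<Longrightarrow> arrs c \<inter> {0, 1, 2, 3} = {} \<Longrightarrow> ctx (run c t)"
  using ctx_same[of t "vars c" "arrs c" "run c t"] same_run[of c "vars c" "arrs c" t t]
  by (simp add: same_refl)

lemma ctx_setv: "ctx t \<Longrightarrow> x \<notin> params \<Longrightarrow> ctx (setv x v t)"
  using ctx_same[of t "{x}" "{}" "setv x v t"] by (simp add: same_def)

lemma wlim_le: "l \<le> s \<Longrightarrow> wlim d s l \<le> wlim d s s"
  by (simp add: wlim_def)

lemma N_le_wlim: "N \<le> wlim d s s"
  using d by (cases "d - 1") (auto simp: wlim_def)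

lemma pow2E_val: "ctx t \<Longrightarrow> lval e t \<le> N \<Longrightarrow> lval (pow2E e) t = 2 ^ lval e t"
  by (simp add: pow2E_def ctxD N_le_wlim nlow_pow)

lemma bitE_val: "ctx t \<Longrightarrow> lval e t \<le> N \<Longrightarrow> lval (bitE x e) t = bval (bt (lval x t) (lval e t))"
  by (simp add: bitE_def pow2E_val bval_bt)

lemma wlimE_val: "ctx t \<Longrightarrow> lval (wlimE d e) t = wlim d s (lval e t)"
  by (simp add: wlimE_def ctxD wlim_def)

lemma dimE_val: "ctx t \<Longrightarrow> lval (dimE e) t = N - s * lval e t"
  by (simp add: dimE_def ctxD)

lemma s_le_N: "l \<le> s \<Longrightarrow> s * l \<le> N"
  by (rule mult_le_mono2)

text \<open>The level expression is evaluated twice, for the weight limit and for the dimension,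
  with different temporaries already overwritten; hence the two assumptions about its value.\<close>

lemma unrankC_correct:
  assumes t: "ctx t" and l: "lval e (setv ''rr'' (lv t ''rk'') (setv y 0 t)) = l" "l \<le> s"
    "lval e (setv ''w'' (wlim d s l) (setv ''rr'' (lv t ''rk'') (setv y 0 t))) = l"
    and rk: "lv t ''rk'' < nlow (N - s * l) (wlim d s l)"
    and y: "y \<notin> wtemps" "y \<notin> params"
  shows "lv (run (unrankC d y e) t) y = unrank (N - s * l) (wlim d s l) (lv t ''rk'')"
proof -
  define M where "M = N - s * l"
  define U where "U = unrank M (wlim d s l) (lv t ''rk'')"
  let ?c = "LSet ''b'' (LSub (LSub (LV ''mm'') (LC 1)) (LV ''h'')) ;;
       LSet ''c'' (LA 2 (LC 0) (LV ''b'') (LV ''w'')) ;;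
       LIf (LSub (LV ''c'') (LV ''rr'')) skip
         (LSet y (LMin (LAdd (LV y) (pow2E (LV ''b''))) (LV ''Z'')) ;;
          LSet ''rr'' (LSub (LV ''rr'') (LV ''c'')) ;; LSet ''w'' (LSub (LV ''w'') (LC 1)))"
  \<comment> \<open>The bits already placed in \<open>y\<close> and the mask that remains to be
    decoded always add up to \<open>U\<close>.\<close>
  define I where "I k t \<longleftrightarrow> ctx t \<and> lv t ''mm'' = M \<and>
    lv t y + unrank (M - k) (lv t ''w'') (lv t ''rr'') = U \<and>
    lv t ''rr'' < nlow (M - k) (lv t ''w'') \<and> lv t ''w'' \<le> wlim d s l" for k t
  define t' where "t' = setv ''mm'' M (setv ''w'' (wlim d s l) (setv ''rr'' (lv t ''rk'') (setv y 0 t)))"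
  have yn: "y \<noteq> ''rk''" "y \<noteq> ''rr''" "y \<noteq> ''w''" "y \<noteq> ''mm''" "y \<noteq> ''h''" "y \<noteq> ''b''" "y \<noteq> ''c''" "y \<noteq> ''o''"
    using y(1) by (auto simp: wtemps_def)
  have nc: "''rr'' \<notin> params" "''w'' \<notin> params" "''mm'' \<notin> params" "''h'' \<notin> params" "''b'' \<notin> params"
    "''c'' \<notin> params" "''o'' \<notin> params" by (auto simp: params_def)
  have ct: "ctx t'" unfolding t'_def by (intro ctx_setv t nc y)
  have MN: "M \<le> N" by (simp add: M_def)
  have "I M (run (LFor ''h'' (LV ''mm'') ?c) t')"
  proof (rule For_rule)
    show "lval (LV ''mm'') t' = M" by (simp add: t'_def)
    show "I 0 t'" using ct rk yn by (simp add: I_def t'_def U_def M_def)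
    show "I k (setv ''h'' v t)" if "I k t" for k t v
      using that yn nc by (simp add: I_def ctx_setv)
    fix k t
    assume k: "k < M" and I: "I k t" and h: "lv t ''h'' = k"
    define b where "b = M - 1 - k"
    have b: "M - k = Suc b" "M - Suc k = b" "b < N" using k MN by (auto simp: b_def)
    have t: "ctx t" using I by (simp add: I_def)
    define t2 where "t2 = setv ''c'' (nlow b (lv t ''w'')) (setv ''b'' b t)"
    have t2: "ctx t2" unfolding t2_def by (intro ctx_setv t nc)
    have w: "lv t ''w'' \<le> wlim d s s" using I wlim_le[OF l(2)] by (simp add: I_def)
    have run: "run ?c t = run (LIf (LSub (LV ''c'') (LV ''rr'')) skip
         (LSet y (LMin (LAdd (LV y) (pow2E (LV ''b''))) (LV ''Z'')) ;;
          LSet ''rr'' (LSub (LV ''rr'') (LV ''c'')) ;; LSet ''w'' (LSub (LV ''w'') (LC 1)))) t2"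
      using h I b w ctxD(8)[OF t] by (simp add: t2_def I_def b_def[symmetric])
    show "I (Suc k) (run ?c t)"
    proof (cases "lv t ''rr'' < nlow b (lv t ''w'')")
      case True
      have rn: "run ?c t = setv ''o'' 0 t2" unfolding run using True by (simp add: t2_def skip_def)
      have "ctx (setv ''o'' 0 t2)" by (intro ctx_setv t2 nc)
      then show ?thesis
        unfolding rn using I True b yn by (simp add: I_def t2_def)
    next
      case False
      have p: "lval (pow2E (LV ''b'')) t2 = 2 ^ b"
        using pow2E_val[OF t2, of "LV ''b''"] b by (simp add: t2_def)
      have U: "lv t y + (2 ^ b + unrank b (lv t ''w'' - 1) (lv t ''rr'' - nlow b (lv t ''w''))) = U"
        using I False b by (simp add: I_def)
      have "U < 2 ^ M" unfolding U_def by (rule unrank_less)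
      also have "(2::nat) ^ M \<le> 2 ^ N" by (rule power_increasing[OF MN]) simp
      finally have "lv t y + 2 ^ b \<le> Z" using U Z(1) by linarith
      then have min: "min (lv t y + 2 ^ b) Z = lv t y + 2 ^ b" by simp
      define t3 where "t3 = setv ''w'' (lv t ''w'' - 1) (setv ''rr'' (lv t ''rr'' - nlow b (lv t ''w''))
        (setv y (lv t y + 2 ^ b) t2))"
      have rn: "run ?c t = t3" unfolding run
        using False p min yn ctxD(7)[OF t2] by (simp add: t2_def t3_def)
      have "ctx t3" unfolding t3_def by (intro ctx_setv t2 nc y)
      moreover have "lv t ''w'' - 1 \<le> wlim d s l" using I unfolding I_def by linarith
      moreover have "lv t ''rr'' - nlow b (lv t ''w'') < nlow b (lv t ''w'' - 1)"
      proof (cases "lv t ''w''")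
        case 0
        with I False b show ?thesis by (simp add: I_def)
      next
        case (Suc v)
        then have "lv t ''rr'' < nlow b (Suc v) + nlow b v" using I b by (simp add: I_def)
        with Suc False show ?thesis by (simp; linarith)
      qed
      ultimately show ?thesis
        unfolding rn using I U b yn by (simp add: I_def t2_def t3_def add.assoc)
    qed
  qed
  moreover have "run (unrankC d y e) t = run (LFor ''h'' (LV ''mm'') ?c) t'"
  proof -
    have c1: "ctx (setv ''rr'' (lv t ''rk'') (setv y 0 t))" by (intro ctx_setv t nc y)
    then have c2: "ctx (setv ''w'' (wlim d s l) (setv ''rr'' (lv t ''rk'') (setv y 0 t)))"
      by (rule ctx_setv[OF _ nc(2)])
    show ?thesis unfolding unrankC_def t'_def
      using l wlimE_val[OF c1, of e] dimE_val[OF c2, of e] yn by (simp add: M_def)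
  qed
  ultimately show ?thesis by (simp add: I_def U_def M_def)
qed

definition W :: "nat \<Rightarrow> nat set" where
  "W l = {x. x < 2 ^ (N - s * l) \<and> wt x \<le> wlim d s l}"

text \<open>The invariant is indexed by the set \<open>D\<close> of points visited so far, which
  hides ranks and the order of the visits; since \<open>unrank\<close> is a bijection, each point is
  met once.\<close>

lemma forW_rule:
  assumes t0: "ctx t0" and e: "e = LC 0 \<or> e = LV ''l'' \<or> e = LAdd (LV ''l'') (LC 1)"
    and l: "lval e t0 = l" "l \<le> s"
    and y: "y \<notin> wtemps" "y \<notin> params" "y \<noteq> ''l''"
    and c: "vars c \<inter> params = {}" "''l'' \<notin> vars c" "arrs c \<inter> {0, 1, 2, 3} = {}" "''rk'' \<notin> vars c"
    and I0: "I {} t0"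
    and stab: "\<And>D t x v. x \<in> insert y wtemps \<Longrightarrow> I D t \<Longrightarrow> I D (setv x v t)"
    and step: "\<And>D t a. a \<in> W l \<Longrightarrow> a \<notin> D \<Longrightarrow> D \<subseteq> W l \<Longrightarrow> I D t \<Longrightarrow>
      same (insert y (wtemps \<union> vars c)) (arrs c) t0 t \<Longrightarrow> ctx t \<Longrightarrow> lv t y = a \<Longrightarrow> I (insert a D) (run c t)"
  shows "I (W l) (run (forW d y e c) t0)"
proof -
  let ?u = "unrank (N - s * l) (wlim d s l)"
  let ?n = "nlow (N - s * l) (wlim d s l)"
  have bij: "bij_betw ?u {..<?n} (W l)" unfolding W_def by (rule bij_unrank)
  have lw: "''l'' \<notin> wtemps" "''l'' \<notin> params" by (auto simp: wtemps_def params_def)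
  have wc: "insert y (wtemps \<union> vars c) \<inter> params = {}"
    using y c by (auto simp: wtemps_def params_def)
  have el: "lval e t = l" if "lv t ''l'' = lv t0 ''l''" for t
    using e l(1) that by auto
  have "I (?u ` {..<?n}) (run (forW d y e c) t0)"
    unfolding forW_def
  proof (rule For_rule[where I = "\<lambda>k t. I (?u ` {..<k}) t"])
    show "lval (LA 3 (LC 0) (LC 0) e) t0 = ?n" using l ctxD(9)[OF t0] by simp
    show "I (?u ` {..<0}) t0" using I0 by simp
    show "I (?u ` {..<k}) (setv ''rk'' v t)" if "I (?u ` {..<k}) t" for k t v
      using stab[OF _ that] by (simp add: wtemps_def)
    fix k t
    assume k: "k < ?n" and I: "I (?u ` {..<k}) t" and rk: "lv t ''rk'' = k"
      and sm: "same (insert ''rk'' (vars (unrankC d y e;; c))) (arrs (unrankC d y e;; c)) t0 t"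
    have V: "insert ''rk'' (vars (unrankC d y e;; c)) = insert y (wtemps \<union> vars c)"
      by (auto simp: vars_unrankC) (auto simp: wtemps_def)
    have sm: "same (insert y (wtemps \<union> vars c)) (arrs c) t0 t" using sm unfolding V by simp
    have t: "ctx t" by (rule ctx_same[OF t0 sm wc c(3)])
    have lt: "lv t ''l'' = lv t0 ''l''" using same_lv[OF sm] lw y(3) c(2) by auto
    let ?t = "run (unrankC d y e) t"
    have 1: "lv ?t y = ?u k"
      using unrankC_correct[OF t el l(2) el] k rk y lt by simp
    have 2: "I (?u ` {..<k}) ?t"
      by (rule run_stable[where I = "I (?u ` {..<k})"]) (use I in \<open>auto simp: vars_unrankC intro: stab\<close>)
    have 3: "same (insert y (wtemps \<union> vars c)) (arrs c) t0 ?t"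
      by (rule same_run[OF _ _ sm]) (auto simp: vars_unrankC)
    have 4: "ctx ?t"
      by (rule ctx_run[OF t]) (use wc in \<open>auto simp: vars_unrankC\<close>)
    have 5: "?u k \<in> W l" "?u ` {..<k} \<subseteq> W l"
      using bij k by (auto simp: bij_betw_def)
    have 6: "?u k \<notin> ?u ` {..<k}"
    proof
      assume "?u k \<in> ?u ` {..<k}"
      then obtain j where "j < k" "?u k = ?u j" by auto
      with bij k show False by (auto simp: bij_betw_def dest: inj_onD[of _ _ k j])
    qed
    have "I (insert (?u k) (?u ` {..<k})) (run c ?t)"
      by (rule step[OF 5(1) 6 5(2) 2 3 4 1])
    then show "I (?u ` {..<Suc k}) (run (unrankC d y e;; c) t)"
      by (simp add: lessThan_Suc)
  qed
  then show ?thesis using bij by (simp add: bij_betw_def)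
qed

end

subsection \<open>Evaluation of the equations at a point\<close>

definition inE :: "lexp \<Rightarrow> lexp" where
  "inE e = LA 0 (LC 0) (LC 0) e"

definition termC :: lcom where
  "termC = LSet ''g'' (inE (LV ''pt'')) ;; nextC ''pt'' ;; LSet ''pr'' (LC 1) ;;
     LFor ''f'' (LV ''g'') (LSet ''pr'' (LMod2 (LMul (LV ''pr'') (bitE (LV ''x'') (inE (LV ''pt''))))) ;;
       nextC ''pt'') ;;
     LSet ''acc'' (LMod2 (LAdd (LV ''acc'') (LV ''pr'')))"

definition polyC :: lcom where
  "polyC = LSet ''a'' (inE (LV ''pt'')) ;; nextC ''pt'' ;; LSet ''acc'' (LC 0) ;;
     LFor ''j'' (LV ''a'') termC"

definition evalC :: lcom where
  "evalC = LSet ''pt'' (LC 2) ;;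
     LFor ''q'' (LV ''m'') (polyC ;; LSto 4 (LV ''s'') (LC 0) (LV ''q'') (LV ''acc''))"

definition coinE :: "lexp \<Rightarrow> lexp \<Rightarrow> lexp \<Rightarrow> lexp \<Rightarrow> lexp" where
  "coinE l r q f = LA 1 (LC 0) (LC 0) (LAdd (LMul (LAdd (LMul (LAdd (LMul (LAdd (LMul (LV ''R'')
     (LV ''Y'')) l) (LV ''Y'')) r) (LV ''Y'')) q) (LV ''Y'')) f)"

definition clearC :: lcom where
  "clearC = LFor ''q'' (LV ''Y'') (LSto 4 (LV ''s'') (LC 0) (LV ''q'') (LC 0))"

definition padC :: lcom where
  "padC = LFor ''j'' (LV ''N'') (LIf (LSub (LV ''n'') (LV ''j'')) skip
     (LSto 4 (LV ''s'') (LC 0) (LAdd (LV ''m'') (LV ''j'')) (bitE (LV ''x'') (LV ''j''))))"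

definition hashC :: lcom where
  "hashC = LFor ''j'' (LV ''k'') (LSet ''acc'' (LC 0) ;;
     LFor ''f'' (LV ''N'') (LSet ''acc'' (LMod2 (LAdd (LV ''acc'')
       (LMul (coinE (LV ''s'') (LC 0) (LV ''j'') (LV ''f'')) (bitE (LV ''x'') (LV ''f'')))))) ;;
     LSto 4 (LV ''s'') (LC 0) (LAdd (LAdd (LV ''m'') (LV ''N'')) (LV ''j''))
       (LMod2 (LAdd (LV ''acc'') (coinE (LV ''s'') (LC 0) (LV ''j'') (LV ''N'')))))"

definition topC :: lcom where
  "topC = clearC ;; evalC ;; padC ;; hashC ;;
     LSto 4 (LV ''s'') (LC 0) (LAdd (LAdd (LV ''m'') (LMul (LC 2) (LV ''N''))) (LC 1))
       (LSub (LC 1) (bitE (LV ''x'') (LV ''e'')))"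

definition sysrowC :: lcom where
  "sysrowC = LSet ''acc'' (LC 0) ;;
     LFor ''f'' (LV ''t'') (LSet ''acc'' (LMod2 (LAdd (LV ''acc'')
       (LMul (coinE (LV ''ll'') (LV ''r'') (LV ''q'') (LV ''f''))
         (LA 4 (LAdd (LV ''ll'') (LC 1)) (LV ''pa'') (LV ''f'')))))) ;;
     LSto 4 (LV ''ll'') (LV ''i'') (LV ''q'') (LV ''acc'')"

text \<open>Each level runs through all \<open>Y ^ s\<close> indices; only the first
  \<open>Y ^ (s - l)\<close> of them denote systems, and the other cells receive values about which
  nothing is claimed.\<close>

definition syslevC :: lcom where
  "syslevC = LFor ''i'' (LV ''K'') (LSet ''pa'' (LDiv (LV ''i'') (LV ''Y'')) ;;
     LSet ''r'' (LSub (LV ''i'') (LMul (LV ''pa'') (LV ''Y''))) ;;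
     LFor ''q'' (LAdd (LMul (LV ''s'') (LV ''ll'')) (LC 4)) sysrowC)"

text \<open>Descends from level \<open>s - 1\<close> to 0; \<open>''t''\<close> holds the number of
  equations of the level above, initially \<open>Y\<close> for the given system.\<close>

definition sysC :: lcom where
  "sysC = LSet ''t'' (LV ''Y'') ;;
     LFor ''j'' (LV ''s'') (LSet ''ll'' (LSub (LSub (LV ''s'') (LC 1)) (LV ''j'')) ;; syslevC ;;
       LSet ''t'' (LAdd (LMul (LV ''s'') (LV ''ll'')) (LC 4)))"

definition leafC :: lcom where
  "leafC = LFor ''i'' (LV ''K'') (LSet ''acc'' (LC 1) ;;
     LFor ''q'' (LC 4) (LIf (LA 4 (LC 0) (LV ''i'') (LV ''q'')) (LSet ''acc'' (LC 0)) skip) ;;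
     LSto 5 (LC 0) (LV ''i'') (LV ''x'') (LV ''acc''))"

text \<open>No combined polynomial is ever expanded: at each point the given equations are
  evaluated, and the values of all derived systems are computed from these values.\<close>

definition leavesC :: "nat \<Rightarrow> lcom" where
  "leavesC d = forW d ''x'' (LC 0) (topC ;; sysC ;; leafC)"

lemma vars_termC [simp]: "vars termC = {''g'', ''pt'', ''pr'', ''f'', ''acc''}" "arrs termC = {}"
  by (auto simp: termC_def)

lemma vars_polyC [simp]: "vars polyC = {''a'', ''j'', ''g'', ''pt'', ''pr'', ''f'', ''acc''}" "arrs polyC = {}"
  by (auto simp: polyC_def)

lemma vars_evalC [simp]: "vars evalC = {''q'', ''a'', ''j'', ''g'', ''pt'', ''pr'', ''f'', ''acc''}"
  "arrs evalC = {4}"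
  by (auto simp: evalC_def)

lemma vars_topC [simp]: "vars topC = {''o'', ''q'', ''a'', ''j'', ''g'', ''pt'', ''pr'', ''f'', ''acc''}"
  "arrs topC = {4}"
  by (auto simp: topC_def clearC_def padC_def hashC_def)

lemma vars_padC [simp]: "vars padC = {''j'', ''o''}" "arrs padC = {4}"
  by (auto simp: padC_def)

lemma vars_hashC [simp]: "vars hashC = {''j'', ''f'', ''acc''}" "arrs hashC = {4}"
  by (auto simp: hashC_def)

lemma vars_clearC [simp]: "vars clearC = {''q''}" "arrs clearC = {4}"
  by (auto simp: clearC_def)

lemma vars_sysrowC [simp]: "vars sysrowC = {''acc'', ''f''}" "arrs sysrowC = {4}"
  by (auto simp: sysrowC_def)

lemma vars_syslevC [simp]: "vars syslevC = {''i'', ''pa'', ''r'', ''q'', ''acc'', ''f''}" "arrs syslevC = {4}"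
  by (auto simp: syslevC_def)

lemma vars_sysC [simp]: "vars sysC = {''t'', ''j'', ''ll'', ''i'', ''pa'', ''r'', ''q'', ''acc'', ''f''}"
  "arrs sysC = {4}"
  by (auto simp: sysC_def)

lemma vars_leafC [simp]: "vars leafC = {''i'', ''acc'', ''q'', ''o''}" "arrs leafC = {5}"
  by (auto simp: leafC_def)

context solver
begin

lemma paramsI: "''n'' \<in> params" "''m'' \<in> params" "''s'' \<in> params" "''N'' \<in> params" "''K'' \<in> params"
  "''Y'' \<in> params" "''Z'' \<in> params"
  by (auto simp: params_def)

lemma sY: "s * s + 4 \<le> Y" "s < Y" "0 < Y"
proof -
  show a: "s * s + 4 \<le> Y" using Y by simp
  have "s \<le> s * s" by (cases s) auto
  then show "s < Y" using a by linarith
  then show "0 < Y" by simp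
qed

section \<open>Reading and evaluating the given equations\<close>

lemma read_inp:
  assumes "ctx t" "drop p (encode n E) = x # xs"
  shows "la t 0 0 0 p = x" "Suc p \<le> Z" "drop (Suc p) (encode n E) = xs"
proof -
  have p: "p < length (encode n E)" using assms(2) by (metis drop_eq_Nil list.distinct(1) not_le)
  have "encode n E ! p = x" using assms(2) p by (metis nth_via_drop)
  then show "la t 0 0 0 p = x" using ctxD(10)[OF assms(1)] p by (simp add: inp_def)
  show "Suc p \<le> Z" using p Z(2) by linarith
  show "drop (Suc p) (encode n E) = xs" using assms(2) by (metis drop_Suc list.sel(3) tl_drop)
qed

lemma nextC_run: "ctx t \<Longrightarrow> Suc (lv t x) \<le> Z \<Longrightarrow> run (nextC x) t = setv x (Suc (lv t x)) t"
  by (simp add: nextC_def ctxD)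

text \<open>The parser is specified by the unread input: if the text from \<open>''pt''\<close> on
  starts with the code of \<open>M\<close>, then afterwards \<open>''pt''\<close> stands right
  behind it.\<close>

lemma termC_correct:
  assumes t: "ctx t" and dr: "drop (lv t ''pt'') (encode n E) = length M # M @ xs" and M: "set M \<subseteq> {..<n}"
  shows "drop (lv (run termC t) ''pt'') (encode n E) = xs"
    and "lv (run termC t) ''acc'' = (lv t ''acc'' + bval (\<Prod>i\<leftarrow>M. bt (lv t ''x'') i)) mod 2"
proof -
  let ?x = "lv t ''x''"
  let ?b = "LSet ''pr'' (LMod2 (LMul (LV ''pr'') (bitE (LV ''x'') (inE (LV ''pt''))))) ;; nextC ''pt''"
  note rd = read_inp[OF t dr]
  define t1 where "t1 = setv ''pr'' 1 (setv ''pt'' (Suc (lv t ''pt'')) (setv ''g'' (length M) t))"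
  have t1: "ctx t1" unfolding t1_def by (intro ctx_setv t) (auto simp: params_def)
  define I where "I k u \<longleftrightarrow> drop (lv u ''pt'') (encode n E) = drop k M @ xs \<and>
    lv u ''pr'' = bval (\<Prod>i\<leftarrow>take k M. bt ?x i)" for k and u :: lstate
  define t2 where "t2 = run (LFor ''f'' (LV ''g'') ?b) t1"
  have "I (length M) t2" unfolding t2_def
  proof (rule For_rule)
    show "lval (LV ''g'') t1 = length M" by (simp add: t1_def)
    show "I 0 t1" using rd by (simp add: I_def t1_def)
    show "\<And>k t v. I k t \<Longrightarrow> I k (setv ''f'' v t)" by (simp add: I_def)
    fix k u
    assume k: "k < length M" and I: "I k u" and sm: "same (insert ''f'' (vars ?b)) (arrs ?b) t1 u"
    have u: "ctx u" by (rule ctx_same[OF t1 sm]) (auto simp: params_def)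
    have x: "lv u ''x'' = ?x" using same_lv[OF sm, of "''x''"] by (simp add: t1_def)
    have du: "drop (lv u ''pt'') (encode n E) = M ! k # drop (Suc k) M @ xs"
      using I k by (simp add: I_def Cons_nth_drop_Suc[symmetric])
    note ru = read_inp[OF u du]
    have "M ! k < n" using M k by (metis lessThan_iff nth_mem subsetD)
    then have "lval (bitE (LV ''x'') (inE (LV ''pt''))) u = bval (bt ?x (M ! k))"
      using bitE_val[OF u, of "inE (LV ''pt'')" "LV ''x''"] ru ns x by (simp add: inE_def)
    moreover have "(\<Prod>i\<leftarrow>take (Suc k) M. bt ?x i) = (\<Prod>i\<leftarrow>take k M. bt ?x i) * bt ?x (M ! k)"
      using k by (simp add: take_Suc_conv_app_nth)
    ultimately have pr: "lval (LMod2 (LMul (LV ''pr'') (bitE (LV ''x'') (inE (LV ''pt''))))) u =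
        bval (\<Prod>i\<leftarrow>take (Suc k) M. bt ?x i)"
      using I by (simp add: I_def bval_mult bval_mod)
    have "run ?b u = setv ''pt'' (Suc (lv u ''pt'')) (setv ''pr'' (bval (\<Prod>i\<leftarrow>take (Suc k) M. bt ?x i)) u)"
      unfolding run.simps pr using nextC_run[OF ctx_setv[OF u, of "''pr''"], where x = "''pt''"] ru(2)
      by (simp add: params_def)
    then show "I (Suc k) (run ?b u)" using ru by (simp add: I_def)
  qed
  then have I: "drop (lv t2 ''pt'') (encode n E) = xs" "lv t2 ''pr'' = bval (\<Prod>i\<leftarrow>M. bt ?x i)"
    by (auto simp: I_def)
  have acc: "lv t2 ''acc'' = lv t ''acc''"
    unfolding t2_def using run_vars[of "''acc''" "LFor ''f'' (LV ''g'') ?b" t1] by (simp add: t1_def)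
  have "run (nextC ''pt'') (setv ''g'' (length M) t) = setv ''pt'' (Suc (lv t ''pt'')) (setv ''g'' (length M) t)"
    using nextC_run[OF ctx_setv[OF t, of "''g''"], where x = "''pt''"] rd(2) by (simp add: params_def)
  then have run: "run termC t = setv ''acc'' ((lv t2 ''acc'' + lv t2 ''pr'') mod 2) t2"
    unfolding termC_def using rd(1) by (simp add: inE_def t2_def t1_def)
  show "drop (lv (run termC t) ''pt'') (encode n E) = xs"
    and "lv (run termC t) ''acc'' = (lv t ''acc'' + bval (\<Prod>i\<leftarrow>M. bt ?x i)) mod 2"
    unfolding run using I acc by simp_all
qed

lemma polyC_correct:
  assumes t: "ctx t" and dr: "drop (lv t ''pt'') (encode n E) = length P # enc_monomials P @ xs"
    and P: "is_anf d n P"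
  shows "drop (lv (run polyC t) ''pt'') (encode n E) = xs"
    and "lv (run polyC t) ''acc'' = bval (pe P (lv t ''x''))"
proof -
  let ?x = "lv t ''x''"
  note rd = read_inp[OF t dr]
  define t1 where "t1 = setv ''acc'' 0 (setv ''pt'' (Suc (lv t ''pt'')) (setv ''a'' (length P) t))"
  have t1: "ctx t1" unfolding t1_def by (intro ctx_setv t) (auto simp: params_def)
  define I where "I k u \<longleftrightarrow> drop (lv u ''pt'') (encode n E) = enc_monomials (drop k P) @ xs \<and>
    lv u ''acc'' = bval (pe (take k P) ?x)" for k and u :: lstate
  have "run (nextC ''pt'') (setv ''a'' (length P) t) = setv ''pt'' (Suc (lv t ''pt'')) (setv ''a'' (length P) t)"
    using nextC_run[OF ctx_setv[OF t, of "''a''"], where x = "''pt''"] rd(2) by (simp add: params_def)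
  then have run: "run polyC t = run (LFor ''j'' (LV ''a'') termC) t1"
    unfolding polyC_def using rd(1) by (simp add: inE_def t1_def)
  have "I (length P) (run polyC t)" unfolding run
  proof (rule For_rule)
    show "lval (LV ''a'') t1 = length P" by (simp add: t1_def)
    show "I 0 t1" using rd by (simp add: I_def t1_def pe_def)
    show "\<And>k t v. I k t \<Longrightarrow> I k (setv ''j'' v t)" by (simp add: I_def)
    fix k u
    assume k: "k < length P" and I: "I k u" and sm: "same (insert ''j'' (vars termC)) (arrs termC) t1 u"
    have u: "ctx u" by (rule ctx_same[OF t1 sm]) (auto simp: params_def)
    have x: "lv u ''x'' = ?x" using same_lv[OF sm, of "''x''"] by (simp add: t1_def)
    have "drop k P = P ! k # drop (Suc k) P" using k by (simp add: Cons_nth_drop_Suc)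
    then have du: "drop (lv u ''pt'') (encode n E) =
        length (P ! k) # P ! k @ enc_monomials (drop (Suc k) P) @ xs"
      using I by (simp add: I_def enc_monomials_def)
    have "set (P ! k) \<subseteq> {..<n}" using P k by (auto simp: is_anf_def)
    note T = termC_correct[OF u du this]
    have "pe (take (Suc k) P) ?x = pe (take k P) ?x + (\<Prod>i\<leftarrow>P ! k. bt ?x i)"
      using k by (simp add: pe_def take_Suc_conv_app_nth)
    then show "I (Suc k) (run termC u)" using T I x by (simp add: I_def bval_add)
  qed
  then show "drop (lv (run polyC t) ''pt'') (encode n E) = xs"
    and "lv (run polyC t) ''acc'' = bval (pe P ?x)"
    by (auto simp: I_def enc_monomials_def)
qed

lemma evalC_correct:
  assumes t: "ctx t"
  shows "q < m \<Longrightarrow> la (run evalC t) 4 s 0 q = bval (pe (E ! q) (lv t ''x''))"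
    and "m \<le> q \<Longrightarrow> la (run evalC t) 4 s 0 q = la t 4 s 0 q"
proof -
  let ?x = "lv t ''x''"
  let ?b = "polyC ;; LSto 4 (LV ''s'') (LC 0) (LV ''q'') (LV ''acc'')"
  define t1 where "t1 = setv ''pt'' 2 t"
  have t1: "ctx t1" unfolding t1_def by (intro ctx_setv t) (auto simp: params_def)
  define I where "I k u \<longleftrightarrow> drop (lv u ''pt'') (encode n E) = enc_polys (drop k E) \<and>
    (\<forall>q. la u 4 s 0 q = (if q < k then bval (pe (E ! q) ?x) else la t 4 s 0 q))" for k and u :: lstate
  have "I m (run (LFor ''q'' (LV ''m'') ?b) t1)"
  proof (rule For_rule)
    show "lval (LV ''m'') t1 = m" using ctxD[OF t1] by simp
    have "drop 2 (encode n E) = enc_polys E"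
      by (simp add: encode_def enc_polys_def enc_monomials_def numeral_2_eq_2)
    then show "I 0 t1" by (simp add: I_def t1_def)
    show "\<And>k t v. I k t \<Longrightarrow> I k (setv ''q'' v t)" by (simp add: I_def)
    fix k u
    assume k: "k < m" and I: "I k u" and sm: "same (insert ''q'' (vars ?b)) (arrs ?b) t1 u" and q: "lv u ''q'' = k"
    have u: "ctx u" by (rule ctx_same[OF t1 sm]) (auto simp: params_def)
    have x: "lv u ''x'' = ?x" using same_lv[OF sm, of "''x''"] by (simp add: t1_def)
    have "drop k E = E ! k # drop (Suc k) E" using k by (simp add: Cons_nth_drop_Suc)
    then have du: "drop (lv u ''pt'') (encode n E) =
        length (E ! k) # enc_monomials (E ! k) @ enc_polys (drop (Suc k) E)"
      using I by (simp add: I_def enc_polys_def)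
    have "is_anf d n (E ! k)" using E k by (auto simp: poly_system_def)
    note T = polyC_correct[OF u du this]
    have 1: "lv (run polyC u) ''s'' = s" "lv (run polyC u) ''q'' = k" "la (run polyC u) = la u"
      using run_vars[of _ polyC u] run_arrs[of _ polyC u] ctxD(3)[OF u] q by (auto simp: fun_eq_iff)
    show "I (Suc k) (run ?b u)" using T I 1 x by (auto simp: I_def)
  qed
  moreover have "run evalC t = run (LFor ''q'' (LV ''m'') ?b) t1" by (simp add: evalC_def t1_def)
  ultimately show "q < m \<Longrightarrow> la (run evalC t) 4 s 0 q = bval (pe (E ! q) ?x)"
    and "m \<le> q \<Longrightarrow> la (run evalC t) 4 s 0 q = la t 4 s 0 q"
    by (auto simp: I_def)
qed

text \<open>
  The given equations, the equations \<open>x_j = 0\<close> for the padding variables, \<open>k\<close> random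
  affine equations and the equation \<open>x_e = 1\<close>: if the first three kinds isolate a solution,
  then the parity of the number of solutions is its bit \<open>e\<close>.
\<close>

definition top :: "nat \<Rightarrow> nat \<Rightarrow> (nat \<Rightarrow> nat \<Rightarrow> bit) \<Rightarrow> nat \<Rightarrow> nat \<Rightarrow> bit" where
  "top k e c q x = (if q < m then pe (E ! q) x
     else if q < m + N then (if n \<le> q - m then bt x (q - m) else 0)
     else if q < m + N + k then hash N (c (q - m - N)) x
     else if q = m + 2 * N + 1 then 1 + bt x e else 0)"

lemma coinE_val:
  assumes "ctx t" "lv t ''R'' < Y" "lval l t < Y" "lval r t < Y" "lval q t < Y" "lval f t < Y"
  shows "lval (coinE l r q f) t = bval (A (lv t ''R'') (lval l t) (lval r t) (lval q t) (lval f t))"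
  using ctxD(11)[OF assms] ctxD(6)[OF assms(1)] by (simp add: coinE_def cidx_def)

lemma padC_correct:
  assumes t: "ctx t"
  shows "la (run padC t) 4 s 0 q = (if m \<le> q \<and> q < m + N \<and> n \<le> q - m then bval (bt (lv t ''x'') (q - m))
    else la t 4 s 0 q)"
proof -
  let ?x = "lv t ''x''"
  define I where "I k u \<longleftrightarrow> (\<forall>q. la u 4 s 0 q = (if m \<le> q \<and> q < m + k \<and> n \<le> q - m then bval (bt ?x (q - m))
    else la t 4 s 0 q))" for k and u :: lstate
  have "I N (run padC t)" unfolding padC_def
  proof (rule For_rule)
    show "lval (LV ''N'') t = N" using ctxD[OF t] by simp
    show "I 0 t" by (auto simp: I_def)
    show "\<And>k t v. I k t \<Longrightarrow> I k (setv ''j'' v t)" by (simp add: I_def)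
    fix k u
    let ?b = "LIf (LSub (LV ''n'') (LV ''j'')) skip
     (LSto 4 (LV ''s'') (LC 0) (LAdd (LV ''m'') (LV ''j'')) (bitE (LV ''x'') (LV ''j'')))"
    assume k: "k < N" and I: "I k u" and sm: "same (insert ''j'' (vars ?b)) (arrs ?b) t u" and q: "lv u ''j'' = k"
    have u: "ctx u" by (rule ctx_same[OF t sm]) (auto simp: params_def)
    have x: "lv u ''x'' = ?x" using same_lv[OF sm, of "''x''"] by simp
    have b: "lval (bitE (LV ''x'') (LV ''j'')) u = bval (bt ?x k)"
      using bitE_val[OF u, of "LV ''j''" "LV ''x''"] k q x by simp
    show "I (Suc k) (run ?b u)"
      using I q ctxD(1-3)[OF u] b by (auto simp: I_def skip_def less_Suc_eq)
  qed
  then show ?thesis by (simp add: I_def)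
qed

lemma hashC_correct:
  assumes t: "ctx t" and k: "lv t ''k'' \<le> Suc N" and R: "lv t ''R'' < Y"
  shows "la (run hashC t) 4 s 0 q = (if m + N \<le> q \<and> q < m + N + lv t ''k''
    then bval (hash N (A (lv t ''R'') s 0 (q - m - N)) (lv t ''x'')) else la t 4 s 0 q)"
proof -
  let ?x = "lv t ''x''" and ?R = "lv t ''R''"
  define I where "I k u \<longleftrightarrow> (\<forall>q. la u 4 s 0 q = (if m + N \<le> q \<and> q < m + N + k
    then bval (hash N (A ?R s 0 (q - m - N)) ?x) else la t 4 s 0 q))" for k and u :: lstate
  have "I (lv t ''k'') (run hashC t)" unfolding hashC_def
  proof (rule For_rule)
    show "lval (LV ''k'') t = lv t ''k''" by simp
    show "I 0 t" by (auto simp: I_def)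
    show "\<And>k t v. I k t \<Longrightarrow> I k (setv ''j'' v t)" by (simp add: I_def)
    fix k u
    let ?f = "LSet ''acc'' (LMod2 (LAdd (LV ''acc'')
       (LMul (coinE (LV ''s'') (LC 0) (LV ''j'') (LV ''f'')) (bitE (LV ''x'') (LV ''f'')))))"
    let ?b = "LSet ''acc'' (LC 0) ;; LFor ''f'' (LV ''N'') ?f ;;
     LSto 4 (LV ''s'') (LC 0) (LAdd (LAdd (LV ''m'') (LV ''N'')) (LV ''j''))
       (LMod2 (LAdd (LV ''acc'') (coinE (LV ''s'') (LC 0) (LV ''j'') (LV ''N''))))"
    assume k: "k < lv t ''k''" and I: "I k u" and sm: "same (insert ''j'' (vars ?b)) (arrs ?b) t u" and q: "lv u ''j'' = k"
    have kY: "k < Y" "N < Y" using k assms(2) Y by auto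
    have u: "ctx u" by (rule ctx_same[OF t sm]) (auto simp: params_def)
    have x: "lv u ''x'' = ?x" "lv u ''R'' = ?R" using same_lv[OF sm, of "''x''"] same_lv[OF sm, of "''R''"] by auto
    define u1 where "u1 = setv ''acc'' 0 u"
    have u1: "ctx u1" unfolding u1_def by (intro ctx_setv u) (auto simp: params_def)
    define u2 where "u2 = run (LFor ''f'' (LV ''N'') ?f) u1"
    define J where "J j w \<longleftrightarrow> lv w ''acc'' = bval (\<Sum>f<j. A ?R s 0 k f * bt ?x f)" for j and w :: lstate
    have "J N u2" unfolding u2_def
    proof (rule For_rule)
      show "lval (LV ''N'') u1 = N" using ctxD[OF u1] by simp
      show "J 0 u1" by (simp add: J_def u1_def)
      show "\<And>k t v. J k t \<Longrightarrow> J k (setv ''f'' v t)" by (simp add: J_def)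
      fix j w
      assume j: "j < N" and J: "J j w" and smw: "same (insert ''f'' (vars ?f)) (arrs ?f) u1 w" and f: "lv w ''f'' = j"
      have w: "ctx w" by (rule ctx_same[OF u1 smw]) (auto simp: params_def)
      have v: "lv w ''x'' = ?x" "lv w ''R'' = ?R" "lv w ''j'' = k"
        using same_lv[OF smw, of "''x''"] same_lv[OF smw, of "''R''"] same_lv[OF smw, of "''j''"] x q
        by (auto simp: u1_def)
      have "lval (coinE (LV ''s'') (LC 0) (LV ''j'') (LV ''f'')) w = bval (A ?R s 0 k j)"
        using coinE_val[OF w, of "LV ''s''" "LC 0" "LV ''j''" "LV ''f''"] v f j kY R sY ctxD(3)[OF w] by simp
      moreover have "lval (bitE (LV ''x'') (LV ''f'')) w = bval (bt ?x j)"
        using bitE_val[OF w, of "LV ''f''" "LV ''x''"] j f v by simp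
      ultimately show "J (Suc j) (run ?f w)"
        using J by (simp add: J_def bval_mult bval_add)
    qed
    then have acc: "lv u2 ''acc'' = bval (\<Sum>f<N. A ?R s 0 k f * bt ?x f)" by (simp add: J_def)
    have u2: "ctx u2" unfolding u2_def by (rule ctx_run[OF u1]) (auto simp: params_def)
    have v2: "lv u2 ''R'' = ?R" "lv u2 ''j'' = k" "la u2 = la u"
      unfolding u2_def using run_vars[of _ "LFor ''f'' (LV ''N'') ?f" u1] run_arrs[of _ "LFor ''f'' (LV ''N'') ?f" u1] x q
      by (auto simp: u1_def fun_eq_iff)
    have "lval (coinE (LV ''s'') (LC 0) (LV ''j'') (LV ''N'')) u2 = bval (A ?R s 0 k N)"
      using coinE_val[OF u2, of "LV ''s''" "LC 0" "LV ''j''" "LV ''N''"] v2 kY R sY ctxD(3,4)[OF u2] by simp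
    then have "lval (LMod2 (LAdd (LV ''acc'') (coinE (LV ''s'') (LC 0) (LV ''j'') (LV ''N'')))) u2 =
        bval (hash N (A ?R s 0 k) ?x)"
      using acc by (simp add: hash_def bval_add)
    moreover have "run ?b u = run (LSto 4 (LV ''s'') (LC 0) (LAdd (LAdd (LV ''m'') (LV ''N'')) (LV ''j''))
       (LMod2 (LAdd (LV ''acc'') (coinE (LV ''s'') (LC 0) (LV ''j'') (LV ''N''))))) u2"
      unfolding u2_def u1_def by (simp only: run.simps lval.simps)
    ultimately have "run ?b u = seta 4 s 0 (m + N + k) (bval (hash N (A ?R s 0 k) ?x)) u2"
      using v2 ctxD(2-4)[OF u2] by (simp only: run.simps lval.simps)
    then show "I (Suc k) (run ?b u)"
      using I v2(3) by (auto simp: I_def)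
  qed
  then show ?thesis by (simp add: I_def)
qed

lemma topC_correct:
  assumes t: "ctx t" and k: "lv t ''k'' \<le> Suc N" and R: "lv t ''R'' < Y" and e: "lv t ''e'' < N" and q: "q < Y"
  shows "la (run topC t) 4 s 0 q = bval (top (lv t ''k'') (lv t ''e'') (A (lv t ''R'') s 0) q (lv t ''x''))"
proof -
  let ?x = "lv t ''x''"
  define t1 where "t1 = run clearC t"
  define t2 where "t2 = run evalC t1"
  define t3 where "t3 = run padC t2"
  define t4 where "t4 = run hashC t3"
  have c: "ctx t1" "ctx t2" "ctx t3" "ctx t4"
    unfolding t4_def t3_def t2_def t1_def by (intro ctx_run t; auto simp: params_def)+
  have v: "lv u z = lv t z" if "z \<in> {''x'', ''k'', ''R'', ''e''}" "u \<in> {t1, t2, t3, t4}" for u z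
    using that unfolding t4_def t3_def t2_def t1_def
    by (auto simp: run_vars)
  have "(\<forall>q<Y. la t1 4 s 0 q = 0)" unfolding t1_def clearC_def
  proof (rule For_rule[where I = "\<lambda>k u. \<forall>q<k. la u 4 s 0 q = 0"])
    show "lval (LV ''Y'') t = Y" using ctxD[OF t] by simp
    fix k u
    let ?b = "LSto 4 (LV ''s'') (LC 0) (LV ''q'') (LC 0)"
    assume "\<forall>q<k. la u 4 s 0 q = 0" and sm: "same (insert ''q'' (vars ?b)) (arrs ?b) t u" and "lv u ''q'' = k"
    moreover have "ctx u" by (rule ctx_same[OF t sm]) (auto simp: params_def)
    ultimately show "\<forall>q<Suc k. la (run ?b u) 4 s 0 q = 0" by (simp add: ctxD less_Suc_eq)
  qed auto
  then have 1: "la t1 4 s 0 q = 0" using q by simp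
  have 2: "la t2 4 s 0 q = (if q < m then bval (pe (E ! q) ?x) else 0)"
    unfolding t2_def using evalC_correct[OF c(1), of q] 1 v[of "''x''" t1] by simp
  have 3: "la t3 4 s 0 q = (if m \<le> q \<and> q < m + N \<and> n \<le> q - m then bval (bt ?x (q - m))
      else if q < m then bval (pe (E ! q) ?x) else 0)"
    unfolding t3_def using padC_correct[OF c(2), of q] 2 v[of "''x''" t2] by simp
  have 4: "la t4 4 s 0 q = (if m + N \<le> q \<and> q < m + N + lv t ''k'' then bval (hash N (A (lv t ''R'') s 0 (q - m - N)) ?x)
      else if m \<le> q \<and> q < m + N \<and> n \<le> q - m then bval (bt ?x (q - m))
      else if q < m then bval (pe (E ! q) ?x) else 0)"
    unfolding t4_def using hashC_correct[OF c(3), of q] k R 3 v[of "''x''" t3] v[of "''k''" t3] v[of "''R''" t3] by simp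
  have "lval (bitE (LV ''x'') (LV ''e'')) t4 = bval (bt ?x (lv t ''e''))"
    using bitE_val[OF c(4), of "LV ''e''" "LV ''x''"] e v[of "''x''" t4] v[of "''e''" t4] by simp
  then have "run topC t = seta 4 s 0 (m + 2 * N + 1) (bval (1 + bt ?x (lv t ''e''))) t4"
    unfolding topC_def using ctxD[OF c(4)] bval_compl[of "bt ?x (lv t ''e'')"]
    by (simp add: t4_def t3_def t2_def t1_def)
  then show ?thesis using 4 k by (auto simp: top_def)
qed

end

context solver
begin

section \<open>Values of all systems at one point\<close>

lemma sysrowC_correct:
  assumes t: "ctx t" and v: "lv t ''R'' = p" "lv t ''ll'' = l" "lv t ''r'' = r" "lv t ''q'' = q" "lv t ''pa'' = pa"
    "lv t ''t'' = c" "lv t ''i'' = i"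
    and b: "p < Y" "l < s" "r < Y" "q < Y" "c \<le> Y"
    and par: "\<And>q'. q' < c \<Longrightarrow> la t 4 (Suc l) pa q' = bval (f q')"
  shows "la (run sysrowC t) 4 a b' c' = (if a = l \<and> b' = i \<and> c' = q then bval (\<Sum>q'<c. A p l r q q' * f q')
      else la t 4 a b' c')"
proof -
  let ?f = "LSet ''acc'' (LMod2 (LAdd (LV ''acc'')
       (LMul (coinE (LV ''ll'') (LV ''r'') (LV ''q'') (LV ''f''))
         (LA 4 (LAdd (LV ''ll'') (LC 1)) (LV ''pa'') (LV ''f'')))))"
  define u1 where "u1 = setv ''acc'' 0 t"
  have u1: "ctx u1" unfolding u1_def by (intro ctx_setv t) (auto simp: params_def)
  define u2 where "u2 = run (LFor ''f'' (LV ''t'') ?f) u1"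
  define J where "J j w \<longleftrightarrow> lv w ''acc'' = bval (\<Sum>q'<j. A p l r q q' * f q')" for j and w :: lstate
  have lY: "l < Y" using b(2) sY(2) by simp
  have "J c u2" unfolding u2_def
  proof (rule For_rule)
    show "lval (LV ''t'') u1 = c" using v by (simp add: u1_def)
    show "J 0 u1" by (simp add: J_def u1_def)
    show "\<And>k t v. J k t \<Longrightarrow> J k (setv ''f'' v t)" by (simp add: J_def)
    fix j w
    assume j: "j < c" and J: "J j w" and smw: "same (insert ''f'' (vars ?f)) (arrs ?f) u1 w" and fj: "lv w ''f'' = j"
    have w: "ctx w" by (rule ctx_same[OF u1 smw]) (auto simp: params_def)
    have vw: "lv w ''R'' = p" "lv w ''ll'' = l" "lv w ''r'' = r" "lv w ''q'' = q" "lv w ''pa'' = pa" "la w 4 = la t 4"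
      using smw v by (auto simp: same_def u1_def)
    have "lval (coinE (LV ''ll'') (LV ''r'') (LV ''q'') (LV ''f'')) w = bval (A p l r q j)"
      using coinE_val[OF w, of "LV ''ll''" "LV ''r''" "LV ''q''" "LV ''f''"] vw fj j b lY by simp
    then show "J (Suc j) (run ?f w)"
      using J par[OF j] vw fj by (simp add: J_def bval_mult bval_add)
  qed
  then have acc: "lv u2 ''acc'' = bval (\<Sum>q'<c. A p l r q q' * f q')" by (simp add: J_def)
  have v2: "lv u2 ''ll'' = l" "lv u2 ''i'' = i" "lv u2 ''q'' = q" "la u2 = la t"
    unfolding u2_def using run_vars[of _ "LFor ''f'' (LV ''t'') ?f" u1] run_arrs[of _ "LFor ''f'' (LV ''t'') ?f" u1] v
    by (auto simp: u1_def fun_eq_iff)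
  have "run sysrowC t = run (LSto 4 (LV ''ll'') (LV ''i'') (LV ''q'') (LV ''acc'')) u2"
    unfolding u2_def u1_def sysrowC_def by (simp only: run.simps lval.simps)
  then have rn: "run sysrowC t = seta 4 l i q (bval (\<Sum>q'<c. A p l r q q' * f q')) u2"
    using v2 acc by (simp only: run.simps lval.simps)
  show "la (run sysrowC t) 4 a b' c' = (if a = l \<and> b' = i \<and> c' = q then bval (\<Sum>q'<c. A p l r q q' * f q')
      else la t 4 a b' c')"
    unfolding rn using v2(4) by simp
qed

text \<open>\<open>B\<close> is the number of systems at the level above. An index whose quotient by
  \<open>Y\<close> reaches \<open>B\<close> has no parent; for it only the preservation of other
  levels matters.\<close>

lemma syslevC_correct:
  assumes t: "ctx t" and v: "lv t ''R'' = p" "lv t ''ll'' = l" "lv t ''t'' = c"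
    and b: "p < Y" "l < s" "c \<le> Y"
    and par: "\<And>i q'. i < B \<Longrightarrow> q' < c \<Longrightarrow> la t 4 (Suc l) i q' = bval (f i q')"
  shows "i < Y ^ s \<Longrightarrow> i div Y < B \<Longrightarrow> q < s * l + 4 \<Longrightarrow>
      la (run syslevC t) 4 l i q = bval (\<Sum>q'<c. A p l (i mod Y) q q' * f (i div Y) q')"
    and "a \<noteq> l \<Longrightarrow> la (run syslevC t) 4 a b' c' = la t 4 a b' c'"
proof -
  define g where "g i q = bval (\<Sum>q'<c. A p l (i mod Y) q q' * f (i div Y) q')" for i q
  define I where "I k u \<longleftrightarrow> (\<forall>i<k. i div Y < B \<longrightarrow> (\<forall>q<s * l + 4. la u 4 l i q = g i q)) \<and>
    (\<forall>a b c. a \<noteq> l \<longrightarrow> la u 4 a b c = la t 4 a b c)" for k and u :: lstate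
  let ?b = "LSet ''pa'' (LDiv (LV ''i'') (LV ''Y'')) ;;
     LSet ''r'' (LSub (LV ''i'') (LMul (LV ''pa'') (LV ''Y''))) ;;
     LFor ''q'' (LAdd (LMul (LV ''s'') (LV ''ll'')) (LC 4)) sysrowC"
  have slY: "s * l + 4 \<le> Y" using sY(1) s_le_N[OF less_imp_le[OF b(2)]] by linarith
  have "I (Y ^ s) (run syslevC t)" unfolding syslevC_def
  proof (rule For_rule)
    show "lval (LV ''K'') t = Y ^ s" using ctxD[OF t] by simp
    show "I 0 t" by (simp add: I_def)
    show "\<And>k t v. I k t \<Longrightarrow> I k (setv ''i'' v t)" by (simp add: I_def)
    fix k u
    assume I: "I k u" and sm: "same (insert ''i'' (vars ?b)) (arrs ?b) t u" and i: "lv u ''i'' = k"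
    have u: "ctx u" by (rule ctx_same[OF t sm]) (auto simp: params_def)
    have vu: "lv u ''R'' = p" "lv u ''ll'' = l" "lv u ''t'' = c"
      using sm v by (auto simp: same_def)
    define u1 where "u1 = setv ''r'' (k mod Y) (setv ''pa'' (k div Y) u)"
    have u1: "ctx u1" unfolding u1_def by (intro ctx_setv u) (auto simp: params_def)
    have rn: "run ?b u = run (LFor ''q'' (LAdd (LMul (LV ''s'') (LV ''ll'')) (LC 4)) sysrowC) u1"
      using i ctxD(6)[OF u] by (simp add: u1_def minus_div_mult_eq_mod)
    define J where "J j w \<longleftrightarrow> (k div Y < B \<longrightarrow> (\<forall>q<j. la w 4 l k q = g k q)) \<and>
      (\<forall>a b c. a \<noteq> l \<or> b \<noteq> k \<longrightarrow> la w 4 a b c = la u 4 a b c)" for j and w :: lstate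
    have "J (s * l + 4) (run ?b u)" unfolding rn
    proof (rule For_rule)
      show "lval (LAdd (LMul (LV ''s'') (LV ''ll'')) (LC 4)) u1 = s * l + 4"
        using vu ctxD[OF u1] by (simp add: u1_def)
      show "J 0 u1" by (simp add: J_def u1_def)
      show "\<And>k t v. J k t \<Longrightarrow> J k (setv ''q'' v t)" by (simp add: J_def)
      fix j w
      assume j: "j < s * l + 4" and J: "J j w" and smw: "same (insert ''q'' (vars sysrowC)) (arrs sysrowC) u1 w"
        and q: "lv w ''q'' = j"
      have w: "ctx w" by (rule ctx_same[OF u1 smw]) (auto simp: params_def)
      have vw: "lv w ''R'' = p" "lv w ''ll'' = l" "lv w ''r'' = k mod Y" "lv w ''pa'' = k div Y"
        "lv w ''t'' = c" "lv w ''i'' = k"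
        using smw vu i by (auto simp: same_def u1_def)
      have kY: "k mod Y < Y" using sY(3) by simp
      have jY: "j < Y" using j slY by simp
      show "J (Suc j) (run sysrowC w)"
      proof (cases "k div Y < B")
        case True
        have pw: "la w 4 (Suc l) (k div Y) q' = bval (f (k div Y) q')" if "q' < c" for q'
          using J I par[OF True that] by (simp add: J_def I_def)
        have R: "la (run sysrowC w) 4 a b e = (if a = l \<and> b = k \<and> e = j then g k j else la w 4 a b e)" for a b e
          unfolding g_def by (rule sysrowC_correct[OF w vw(1-3) q vw(4-6) b(1,2) kY jY b(3) pw])
        show ?thesis unfolding J_def R using J by (auto simp: J_def less_Suc_eq)
      next
        case False
        \<comment> \<open>Without a parent the computed value is unknown, but the single store still
          goes to level \<open>l\<close> and index \<open>k\<close>.\<close>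
        have "la (run sysrowC w) 4 a b c = la w 4 a b c" if "a \<noteq> l \<or> b \<noteq> k" for a b c
        proof -
          let ?f = "LSet ''acc'' (LMod2 (LAdd (LV ''acc'')
            (LMul (coinE (LV ''ll'') (LV ''r'') (LV ''q'') (LV ''f''))
            (LA 4 (LAdd (LV ''ll'') (LC 1)) (LV ''pa'') (LV ''f'')))))"
          let ?c = "LSet ''acc'' (LC 0) ;; LFor ''f'' (LV ''t'') ?f"
          have 1: "lv (run ?c w) ''ll'' = l" "lv (run ?c w) ''i'' = k" "la (run ?c w) = la w"
            using run_vars[of _ ?c w] run_arrs[of _ ?c w] vw by (auto simp: fun_eq_iff)
          have "run sysrowC w = run (LSto 4 (LV ''ll'') (LV ''i'') (LV ''q'') (LV ''acc'')) (run ?c w)"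
            by (simp only: sysrowC_def run.simps)
          then show ?thesis using 1 that by (auto simp del: run.simps(3,5))
        qed
        then show ?thesis using J False by (auto simp: J_def)
      qed
    qed
    then show "I (Suc k) (run ?b u)"
      using I unfolding I_def J_def by (metis less_antisym)
  qed
  then show "i < Y ^ s \<Longrightarrow> i div Y < B \<Longrightarrow> q < s * l + 4 \<Longrightarrow>
      la (run syslevC t) 4 l i q = bval (\<Sum>q'<c. A p l (i mod Y) q q' * f (i div Y) q')"
    and "a \<noteq> l \<Longrightarrow> la (run syslevC t) 4 a b' c' = la t 4 a b' c'"
    by (auto simp: I_def g_def)
qed

lemma sysC_correct:
  assumes t: "ctx t" and p: "lv t ''R'' = p" "p < Y"
    and g: "\<And>q. q < Y \<Longrightarrow> la t 4 s 0 q = bval (g q x)"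
    and j: "j \<le> s" "i < Y ^ j" "q < neq s Y (s - j)"
  shows "la (run sysC t) 4 (s - j) i q = bval (csys s Y (A p) g j i q x)"
proof -
  define t1 where "t1 = setv ''t'' Y t"
  have t1: "ctx t1" unfolding t1_def by (intro ctx_setv t) (auto simp: params_def)
  let ?b = "LSet ''ll'' (LSub (LSub (LV ''s'') (LC 1)) (LV ''j'')) ;; syslevC ;;
       LSet ''t'' (LAdd (LMul (LV ''s'') (LV ''ll'')) (LC 4))"
  define I where "I k u \<longleftrightarrow> lv u ''t'' = neq s Y (s - k) \<and>
    (\<forall>j\<le>k. \<forall>i<Y ^ j. \<forall>q<neq s Y (s - j). la u 4 (s - j) i q = bval (csys s Y (A p) g j i q x))" for k and u :: lstate
  have run: "run sysC t = run (LFor ''j'' (LV ''s'') ?b) t1"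
    using ctxD(6)[OF t] by (simp add: sysC_def t1_def)
  have "I s (run sysC t)" unfolding run
  proof (rule For_rule)
    show "lval (LV ''s'') t1 = s" using ctxD[OF t1] by simp
    show "I 0 t1" using g by (simp add: I_def t1_def neq_def)
    show "\<And>k t v. I k t \<Longrightarrow> I k (setv ''j'' v t)" by (simp add: I_def)
    fix k u
    assume k: "k < s" and I: "I k u" and sm: "same (insert ''j'' (vars ?b)) (arrs ?b) t1 u" and jk: "lv u ''j'' = k"
    define l where "l = s - Suc k"
    have l: "l < s" "s - k = Suc l" "s - Suc l = k" "s - Suc k = l" using k by (auto simp: l_def)
    have u: "ctx u" by (rule ctx_same[OF t1 sm]) (auto simp: params_def)
    have vu: "lv u ''R'' = p" using same_lv[OF sm, of "''R''"] p by (simp add: t1_def)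
    define u1 where "u1 = setv ''ll'' l u"
    have u1: "ctx u1" unfolding u1_def by (intro ctx_setv u) (auto simp: params_def)
    define u2 where "u2 = run syslevC u1"
    have u2: "ctx u2" unfolding u2_def by (rule ctx_run[OF u1]) (auto simp: params_def)
    define c where "c = neq s Y (Suc l)"
    have c: "c \<le> Y"
    proof (cases "Suc l < s")
      case True
      then show ?thesis using sY(1) s_le_N[of "Suc l"] by (simp add: c_def neq_def)
    qed (simp add: c_def neq_def)
    have v1: "lv u1 ''R'' = p" "lv u1 ''ll'' = l" "lv u1 ''t'' = c"
      using vu I l by (auto simp: u1_def I_def c_def)
    have par: "la u1 4 (Suc l) i q' = bval (csys s Y (A p) g k i q' x)" if "i < Y ^ k" "q' < c" for i q'
      using I that l by (auto simp: I_def u1_def c_def)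
    note S = syslevC_correct[where B = "Y ^ k" and f = "\<lambda>i q'. csys s Y (A p) g k i q' x",
      OF u1 v1 p(2) l(1) c par]
    have v2: "lv u2 ''ll'' = l" unfolding u2_def by (simp add: run_vars v1)
    have rn: "run ?b u = setv ''t'' (s * l + 4) u2"
      using jk ctxD(3)[OF u] ctxD(3)[OF u2] v2 by (simp add: u2_def u1_def l_def)
    have new: "la u2 4 l i q = bval (csys s Y (A p) g (Suc k) i q x)" if "i < Y ^ Suc k" "q < s * l + 4" for i q
    proof -
      have "Y ^ Suc k \<le> Y ^ s" using k sY(3) by (intro power_increasing) auto
      then have "i < Y ^ s" using that(1) by simp
      moreover have "i div Y < Y ^ k" using that(1) by (simp add: less_mult_imp_div_less mult.commute)
      ultimately show ?thesis using S(1)[where i = i and q = q] that(2) l by (simp add: u2_def c_def)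
    qed
    have old: "la u2 4 (s - j) i q = bval (csys s Y (A p) g j i q x)"
      if "j \<le> k" "i < Y ^ j" "q < neq s Y (s - j)" for j i q
    proof -
      have "s - j \<noteq> l" using that(1) l by auto
      then have "la u2 4 (s - j) i q = la u 4 (s - j) i q" using S(2) by (simp add: u2_def u1_def)
      then show ?thesis using I that by (simp add: I_def)
    qed
    show "I (Suc k) (run ?b u)" unfolding rn
      using new old l by (auto simp: I_def le_Suc_eq neq_def)
  qed
  then show ?thesis using j by (simp add: I_def)
qed

lemma leafC_correct:
  assumes t: "ctx t"
    and f: "\<And>i q. i < Y ^ s \<Longrightarrow> q < 4 \<Longrightarrow> la t 4 0 i q = bval (f i q)"
  shows "i < Y ^ s \<Longrightarrow> la (run leafC t) 5 0 i (lv t ''x'') = of_bool (\<forall>q<4. f i q = 0)"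
    and "y \<noteq> lv t ''x'' \<Longrightarrow> la (run leafC t) 5 0 i y = la t 5 0 i y"
proof -
  let ?x = "lv t ''x''"
  let ?c = "LIf (LA 4 (LC 0) (LV ''i'') (LV ''q'')) (LSet ''acc'' (LC 0)) skip"
  let ?b = "LSet ''acc'' (LC 1) ;; LFor ''q'' (LC 4) ?c ;; LSto 5 (LC 0) (LV ''i'') (LV ''x'') (LV ''acc'')"
  define I where "I k u \<longleftrightarrow> (\<forall>i y. la u 5 0 i y = (if i < k \<and> y = ?x then of_bool (\<forall>q<4. f i q = 0) else la t 5 0 i y))"
    for k and u :: lstate
  have "I (Y ^ s) (run leafC t)" unfolding leafC_def
  proof (rule For_rule)
    show "lval (LV ''K'') t = Y ^ s" using ctxD[OF t] by simp
    show "I 0 t" by (simp add: I_def)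
    show "\<And>k t v. I k t \<Longrightarrow> I k (setv ''i'' v t)" by (simp add: I_def)
    fix k u
    assume k: "k < Y ^ s" and I: "I k u" and sm: "same (insert ''i'' (vars ?b)) (arrs ?b) t u" and i: "lv u ''i'' = k"
    have u: "ctx u" by (rule ctx_same[OF t sm]) (auto simp: params_def)
    have vu: "lv u ''x'' = ?x" "la u 4 = la t 4" using sm by (auto simp: same_def)
    define u1 where "u1 = run (LFor ''q'' (LC 4) ?c) (setv ''acc'' 1 u)"
    define J where "J j w \<longleftrightarrow> lv w ''acc'' = of_bool (\<forall>q<j. f k q = 0)" for j and w :: lstate
    have "J 4 u1" unfolding u1_def
    proof (rule For_rule)
      show "lval (LC 4) (setv ''acc'' 1 u) = 4" by simp
      show "J 0 (setv ''acc'' 1 u)" by (simp add: J_def)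
      show "\<And>k t v. J k t \<Longrightarrow> J k (setv ''q'' v t)" by (simp add: J_def)
      fix j w
      assume j: "j < 4" and J: "J j w" and smw: "same (insert ''q'' (vars ?c)) (arrs ?c) (setv ''acc'' 1 u) w"
        and q: "lv w ''q'' = j"
      have "la w 4 0 (lv w ''i'') j = bval (f k j)"
        using smw f[OF k j] vu(2) i by (simp add: same_def)
      then show "J (Suc j) (run ?c w)"
        using J q by (auto simp: J_def skip_def less_Suc_eq)
    qed
    moreover have "lv u1 ''i'' = k" "lv u1 ''x'' = ?x" "la u1 = la u"
      unfolding u1_def using run_vars[of _ "LFor ''q'' (LC 4) ?c"] run_arrs[of _ "LFor ''q'' (LC 4) ?c"] i vu
      by (auto simp: fun_eq_iff)
    moreover have "run ?b u = run (LSto 5 (LC 0) (LV ''i'') (LV ''x'') (LV ''acc'')) u1"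
      unfolding u1_def by (simp only: run.simps lval.simps)
    ultimately have "run ?b u = seta 5 0 k ?x (of_bool (\<forall>q<4. f k q = 0)) u1" "la u1 = la u"
      unfolding J_def by (simp_all only: run.simps lval.simps)
    then show "I (Suc k) (run ?b u)" using I by (auto simp: I_def)
  qed
  then show "i < Y ^ s \<Longrightarrow> la (run leafC t) 5 0 i ?x = of_bool (\<forall>q<4. f i q = 0)"
    and "y \<noteq> ?x \<Longrightarrow> la (run leafC t) 5 0 i y = la t 5 0 i y"
    by (auto simp: I_def)
qed

lemma leavesC_correct:
  assumes t: "ctx t" and k: "lv t ''k'' \<le> Suc N" and p: "lv t ''R'' = p" "p < Y" and e: "lv t ''e'' < N"
    and i: "i < Y ^ s" and x: "x \<in> W 0"
  shows "la (run (leavesC d) t) 5 0 i x =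
    bval (csol s Y (A p) (top (lv t ''k'') (lv t ''e'') (A p s 0)) 0 i x)"
proof -
  let ?g = "top (lv t ''k'') (lv t ''e'') (A p s 0)"
  let ?c = "topC ;; sysC ;; leafC"
  define I where "I D u \<longleftrightarrow> (\<forall>x\<in>D. \<forall>i<Y ^ s. la u 5 0 i x = bval (csol s Y (A p) ?g 0 i x))" for D and u :: lstate
  have "I (W 0) (run (leavesC d) t)" unfolding leavesC_def
  proof (rule forW_rule[OF t])
    show "lval (LC 0) t = 0" by simp
    show "I {} t" by (simp add: I_def)
    show "\<And>D t x v. I D t \<Longrightarrow> I D (setv x v t)" by (simp add: I_def)
    fix D u x
    assume x: "x \<notin> D" and I: "I D u" and sm: "same (insert ''x'' (wtemps \<union> vars ?c)) (arrs ?c) t u"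
      and u: "ctx u" and ux: "lv u ''x'' = x"
    have v: "lv u ''R'' = p" "lv u ''k'' = lv t ''k''" "lv u ''e'' = lv t ''e''"
      using sm p by (auto simp: same_def wtemps_def)
    define u1 where "u1 = run topC u"
    define u2 where "u2 = run sysC u1"
    have c: "ctx u1" "ctx u2" unfolding u2_def u1_def by (intro ctx_run u; auto simp: params_def)+
    have v1: "lv u1 ''R'' = p" "lv u2 ''x'' = x" "la u2 5 = la u 5"
      unfolding u2_def u1_def by (auto simp: run_vars run_arrs v ux)
    have top: "la u1 4 s 0 q = bval (?g q x)" if "q < Y" for q
      unfolding u1_def using topC_correct[OF u _ _ _ that] v k p e ux by simp
    have sys: "la u2 4 0 i q = bval (csys s Y (A p) ?g s i q x)" if "i < Y ^ s" "q < 4" for i q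
      unfolding u2_def using sysC_correct[OF c(1) v1(1) p(2), of ?g x s i q] top that s by (simp add: neq_def)
    have leaf: "la (run leafC u2) 5 0 i x = bval (csol s Y (A p) ?g 0 i x)" if "i < Y ^ s" for i
      using leafC_correct(1)[OF c(2), of "\<lambda>i q. csys s Y (A p) ?g s i q x", OF sys that] v1 s
      by (auto simp: csol_def sol_ind_eq neq_def)
    have other: "la (run leafC u2) 5 0 i y = la u 5 0 i y" if "y \<noteq> x" for i y
      using leafC_correct(2)[OF c(2), of "\<lambda>i q. csys s Y (A p) ?g s i q x", OF sys] v1 that by simp
    have "run ?c u = run leafC u2" by (simp add: u1_def u2_def)
    then show "I (insert x D) (run ?c u)" using leaf other I x by (auto simp: I_def) metis
  qed (auto simp: wtemps_def params_def)
  then show ?thesis using i x by (simp add: I_def)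
qed

end

subsection \<open>One level of the recursion\<close>

definition forD :: "nat \<Rightarrow> lcom \<Rightarrow> lcom" where
  "forD d c = forW d ''u'' (LAdd (LV ''l'') (LC 1)) (LFor ''v'' (LV ''S'')
     (LSet ''y'' (LMin (LAdd (LMul (LV ''u'') (pow2E (LV ''s''))) (LV ''v'')) (LV ''Z'')) ;; c))"

definition arr1 :: "nat \<Rightarrow> lexp \<Rightarrow> lexp" where
  "arr1 k e = LA k (LC 0) (LC 0) e"

definition sto1 :: "nat \<Rightarrow> lexp \<Rightarrow> lexp \<Rightarrow> lcom" where
  "sto1 k e v = LSto k (LC 0) (LC 0) e v"

definition passC :: lcom where
  "passC = LIf (bitE (LV ''y'') (LV ''z'')) (sto1 6 (LV ''y'') (LMod2 (LAdd (arr1 6 (LV ''y''))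
     (arr1 6 (LSub (LV ''y'') (pow2E (LV ''z''))))))) skip"

text \<open>The first loop stores the zeros that \<open>extend\<close> wants at heavy points. The
  first transform is confined to the light points, where values are known; the second covers all
  points that the vote will look at.\<close>

definition extendC :: "nat \<Rightarrow> lcom" where
  "extendC d = forD d (sto1 6 (LV ''y'') (LC 0)) ;;
     forW d ''y'' (LV ''l'') (sto1 6 (LV ''y'')
       (LA 5 (LV ''l'') (LAdd (LMul (LV ''i'') (LV ''Y'')) (LV ''r'')) (LV ''y''))) ;;
     LFor ''z'' (dimE (LV ''l'')) (forW d ''y'' (LV ''l'') passC) ;;
     LFor ''z'' (dimE (LV ''l'')) (forD d passC)"

definition countC :: "nat \<Rightarrow> lcom" where
  "countC d = forD d (sto1 7 (LV ''y'') (LC 0)) ;;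
     LFor ''r'' (LV ''Y'') (extendC d ;;
       forD d (sto1 7 (LV ''y'') (LMin (LAdd (arr1 7 (LV ''y'')) (arr1 6 (LV ''y''))) (LV ''Z''))))"

text \<open>Majority and block sum in one pass: \<open>''acc''\<close> is toggled whenever more than
  half of the \<open>Y\<close> votes are 1.\<close>

definition voteC :: "nat \<Rightarrow> lcom" where
  "voteC d = forW d ''u'' (LAdd (LV ''l'') (LC 1)) (LSet ''acc'' (LC 0) ;;
     LFor ''v'' (LV ''S'')
       (LIf (LSub (LMul (LC 2) (arr1 7 (LAdd (LMul (LV ''u'') (pow2E (LV ''s''))) (LV ''v'')))) (LV ''Y''))
         (LSet ''acc'' (LSub (LC 1) (LV ''acc''))) skip) ;;
     LSto 5 (LAdd (LV ''l'') (LC 1)) (LV ''i'') (LV ''u'') (LV ''acc''))"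

definition levelC :: "nat \<Rightarrow> lcom" where
  "levelC d = LFor ''i'' (LV ''K'') (countC d ;; voteC d)"

definition mpcC :: "nat \<Rightarrow> lcom" where
  "mpcC d = leavesC d ;; LFor ''l'' (LV ''s'') (levelC d)"

definition solC :: "nat \<Rightarrow> lcom" where
  "solC d = LFor ''e'' (LV ''N'') (mpcC d ;; sto1 8 (LV ''e'') (LA 5 (LV ''s'') (LC 0) (LC 0)))"

definition asmC :: lcom where
  "asmC = LSet ''x'' (LC 0) ;; LFor ''e'' (LV ''N'')
     (LSet ''x'' (LMin (LAdd (LV ''x'') (LMul (arr1 8 (LV ''e'')) (pow2E (LV ''e'')))) (LV ''Z'')))"

text \<open>This test is what makes the error one-sided: unlucky coins may produce a wrong
  candidate, but never a wrong report.\<close>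

definition checkC :: lcom where
  "checkC = evalC ;; LSet ''ok'' (LC 1) ;;
     LFor ''q'' (LV ''m'') (LIf (LA 4 (LV ''s'') (LC 0) (LV ''q'')) (LSet ''ok'' (LC 0)) skip) ;;
     LIf (LV ''ok'') (LSet ''F'' (LC 1) ;; LSet ''X'' (LV ''x'')) skip"

text \<open>The inner loop covers every \<open>k \<le> Suc N\<close>, hence the one supplied by
  \<open>isolation_exponent\<close>.\<close>

definition searchC :: "nat \<Rightarrow> lcom" where
  "searchC d = LFor ''R'' (LV ''Y'') (LFor ''k'' (LAdd (LV ''N'') (LC 2)) (solC d ;; asmC ;; checkC))"

lemma vars_arr1_sto1 [simp]: "vars (sto1 k e v) = {}" "arrs (sto1 k e v) = {k}"
  "run (sto1 k e v) t = seta k 0 0 (lval e t) (lval v t) t" "lval (arr1 k e) t = la t k 0 0 (lval e t)"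
  by (simp_all add: sto1_def arr1_def)

lemma vars_forD [simp]: "vars (forD d c) = {''u'', ''v'', ''y''} \<union> wtemps \<union> vars c" "arrs (forD d c) = arrs c"
  by (auto simp: forD_def)

lemma vars_passC [simp]: "vars passC = {''o''}" "arrs passC = {6}"
  by (simp_all add: passC_def)

lemma vars_extendC [simp]: "vars (extendC d) = {''u'', ''v'', ''y'', ''z''} \<union> wtemps" "arrs (extendC d) = {6}"
  by (auto simp: extendC_def) (auto simp: wtemps_def)

lemma vars_countC [simp]: "vars (countC d) = {''r'', ''u'', ''v'', ''y'', ''z''} \<union> wtemps" "arrs (countC d) = {6, 7}"
  by (auto simp: countC_def)

lemma vars_voteC [simp]: "vars (voteC d) = {''acc'', ''u'', ''v''} \<union> wtemps" "arrs (voteC d) = {5}"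
  by (auto simp: voteC_def) (auto simp: wtemps_def)

lemma vars_levelC [simp]: "vars (levelC d) = {''i'', ''r'', ''u'', ''v'', ''y'', ''z'', ''acc''} \<union> wtemps"
  "arrs (levelC d) = {5, 6, 7}"
  by (auto simp: levelC_def)

lemma vars_leavesC [simp]: "vars (leavesC d) = insert ''x'' (wtemps \<union> (vars topC \<union> (vars sysC \<union> vars leafC)))"
    "arrs (leavesC d) = {4, 5}"
  by (simp_all add: leavesC_def insert_commute)

lemma vars_mpcC [simp]: "vars (mpcC d) = vars (leavesC d) \<union> insert ''l'' (vars (levelC d))"
  "arrs (mpcC d) = {4, 5, 6, 7}"
  by (simp_all only: mpcC_def vars.simps arrs.simps vars_leavesC vars_levelC) auto

lemma vars_solC [simp]: "vars (solC d) = insert ''e'' (vars (mpcC d))" "arrs (solC d) = {4, 5, 6, 7, 8}"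
  by (simp_all only: solC_def vars.simps arrs.simps vars_mpcC vars_arr1_sto1) auto

lemma vars_asmC [simp]: "vars asmC = {''x'', ''e''}" "arrs asmC = {}"
  by (auto simp: asmC_def)

lemma vars_checkC [simp]: "vars checkC = {''q'', ''a'', ''j'', ''g'', ''pt'', ''pr'', ''f'', ''acc'', ''ok'', ''o'', ''F'', ''X''}"
  "arrs checkC = {4}"
  by (auto simp: checkC_def)

context solver
begin

section \<open>Correctness of one level of the recursion\<close>

definition Dl :: "nat \<Rightarrow> nat set" where
  "Dl l = {u * 2 ^ s + v |u v. u \<in> W (Suc l) \<and> v < 2 ^ s}"

lemma split_dim: "l < s \<Longrightarrow> N - s * l = (N - s * Suc l) + s"
  using s_le_N[of "Suc l"] by simp

lemma Dl_iff:
  assumes "l < s"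
  shows "y \<in> Dl l \<longleftrightarrow> y < 2 ^ (N - s * l) \<and> wt (y div 2 ^ s) \<le> wlim d s (Suc l)"
proof
  assume "y \<in> Dl l"
  then obtain u v where y: "y = u * 2 ^ s + v" "u \<in> W (Suc l)" "v < 2 ^ s" by (auto simp: Dl_def)
  have "y < 2 ^ (N - s * Suc l) * 2 ^ s"
    unfolding y(1) by (rule digits_less) (use y in \<open>auto simp: W_def\<close>)
  then show "y < 2 ^ (N - s * l) \<and> wt (y div 2 ^ s) \<le> wlim d s (Suc l)"
    using y unfolding split_dim[OF assms] power_add by (simp add: W_def)
next
  assume y: "y < 2 ^ (N - s * l) \<and> wt (y div 2 ^ s) \<le> wlim d s (Suc l)"
  then have "y div 2 ^ s < 2 ^ (N - s * Suc l)"
    unfolding split_dim[OF assms] power_add by (simp add: less_mult_imp_div_less)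
  then have "y div 2 ^ s \<in> W (Suc l)" using y by (simp add: W_def)
  moreover have "y = (y div 2 ^ s) * 2 ^ s + y mod 2 ^ s" by (metis div_mult_mod_eq)
  moreover have "y mod 2 ^ s < 2 ^ s" by simp
  ultimately show "y \<in> Dl l" unfolding Dl_def by blast
qed

text \<open>Clearing a bit of the low block leaves the high part alone, and clearing a high bit
  lowers its weight. So a transform started at points of \<open>Dl l\<close> stays inside.\<close>

lemma Dl_clear:
  assumes l: "l < s" and y: "y \<in> Dl l" "bit y z"
  shows "y - 2 ^ z \<in> Dl l"
proof -
  define u v where "u = y div 2 ^ s" and "v = y mod 2 ^ s"
  have uv: "y = u * 2 ^ s + v" "v < 2 ^ s" unfolding u_def v_def by (metis div_mult_mod_eq) simp
  have b: "bit y z \<longleftrightarrow> (if z < s then bit v z else bit u (z - s))"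
    using bt_append[OF uv(2), of u z] uv(1) by (auto simp: bt_eq split: if_splits)
  have "wt ((y - 2 ^ z) div 2 ^ s) \<le> wt u"
  proof (cases "z < s")
    case True
    then have "2 ^ z \<le> v" using b y(2) bit_minus_power(1) by auto
    then have "y - 2 ^ z = u * 2 ^ s + (v - 2 ^ z)" using uv by simp
    then show ?thesis using uv(2) by simp
  next
    case False
    then have bu: "bit u (z - s)" using b y(2) by simp
    have "(2::nat) ^ z = 2 ^ (z - s) * 2 ^ s" using False by (simp flip: power_add)
    then have "y - 2 ^ z = (u - 2 ^ (z - s)) * 2 ^ s + v"
      using uv(1) bit_minus_power(1)[OF bu] by (simp add: diff_mult_distrib)
    then show ?thesis using uv(2) wt_minus_power[OF bu] by simp
  qed
  then show ?thesis using y(1) unfolding Dl_iff[OF l] u_def by auto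
qed

lemma W_clear: "y \<in> W l \<Longrightarrow> bit y z \<Longrightarrow> y - 2 ^ z \<in> W l"
  by (auto simp: W_def wt_minus_power)

lemma Dl_W_iff: "l < s \<Longrightarrow> y \<in> Dl l \<Longrightarrow> y \<in> W l \<longleftrightarrow> wt y \<le> wlim d s l"
  by (auto simp: Dl_iff W_def)

text \<open>Counterpart of \<open>forW_rule\<close> for the points \<open>u * 2 ^ s + v\<close> with
  light \<open>u\<close>, the arguments that \<open>mpc\<close> uses one level up.\<close>

lemma forD_rule:
  assumes t0: "ctx t0" and l: "lv t0 ''l'' = l" "l < s"
    and c: "vars c \<inter> params = {}" "{''l'', ''u'', ''v'', ''rk''} \<inter> vars c = {}" "arrs c \<inter> {0, 1, 2, 3} = {}"
    and I0: "I {} t0"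
    and stab: "\<And>D t x v. x \<in> {''u'', ''v'', ''y''} \<union> wtemps \<Longrightarrow> I D t \<Longrightarrow> I D (setv x v t)"
    and step: "\<And>D t a. a \<in> Dl l \<Longrightarrow> a \<notin> D \<Longrightarrow> D \<subseteq> Dl l \<Longrightarrow> I D t \<Longrightarrow>
      same ({''u'', ''v'', ''y''} \<union> wtemps \<union> vars c) (arrs c) t0 t \<Longrightarrow> ctx t \<Longrightarrow> lv t ''y'' = a \<Longrightarrow>
      I (insert a D) (run c t)"
  shows "I (Dl l) (run (forD d c) t0)"
proof -
  define P where "P U = {u * 2 ^ s + v |u v. u \<in> U \<and> v < 2 ^ s}" for U :: "nat set"
  let ?b = "LSet ''y'' (LMin (LAdd (LMul (LV ''u'') (pow2E (LV ''s''))) (LV ''v'')) (LV ''Z'')) ;; c"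
  let ?c = "LFor ''v'' (LV ''S'') ?b"
  let ?V = "{''u'', ''v'', ''y''} \<union> wtemps \<union> vars c"
  have "I (P (W (Suc l))) (run (forD d c) t0)" unfolding forD_def
  proof (rule forW_rule[where I = "\<lambda>U t. I (P U) t", OF t0])
    show "lval (LAdd (LV ''l'') (LC 1)) t0 = Suc l" "Suc l \<le> s" using l by auto
    show "''u'' \<notin> wtemps" "''u'' \<notin> params" "''u'' \<noteq> ''l''" by (auto simp: wtemps_def params_def)
    show "vars ?c \<inter> params = {}" "''l'' \<notin> vars ?c" "arrs ?c \<inter> {0, 1, 2, 3} = {}" "''rk'' \<notin> vars ?c"
      using c by (auto simp: params_def)
    show "I (P {}) t0" using I0 by (simp add: P_def)
    show "\<And>D t x v. x \<in> insert ''u'' wtemps \<Longrightarrow> I (P D) t \<Longrightarrow> I (P D) (setv x v t)" using stab by auto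
    fix U t u
    assume u: "u \<in> W (Suc l)" "u \<notin> U" and U: "U \<subseteq> W (Suc l)" and I: "I (P U) t"
      and sm: "same (insert ''u'' (wtemps \<union> vars ?c)) (arrs ?c) t0 t" and t: "ctx t" and ut: "lv t ''u'' = u"
    have V: "insert ''u'' (wtemps \<union> vars ?c) = ?V" "arrs ?c = arrs c" by auto
    define Q where "Q k = P U \<union> {u * 2 ^ s + v |v. v < k}" for k
    have s2: "lval (pow2E (LV ''s'')) w = 2 ^ s" if "ctx w" for w
      using pow2E_val[OF that, of "LV ''s''"] ctxD(3)[OF that] s_le_N[OF s] by simp
    have "I (Q (2 ^ s)) (run ?c t)"
    proof (rule For_rule[where I = "\<lambda>k t. I (Q k) t"])
      show "lval (LV ''S'') t = 2 ^ s" using ctxD(12)[OF t] by simp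
      show "I (Q 0) t" using I by (simp add: Q_def)
      show "\<And>k t v. I (Q k) t \<Longrightarrow> I (Q k) (setv ''v'' v t)" using stab by auto
      fix k w
      assume k: "k < 2 ^ s" and Iw: "I (Q k) w" and smw: "same (insert ''v'' (vars ?b)) (arrs ?b) t w"
        and vw: "lv w ''v'' = k"
      have w: "ctx w" by (rule ctx_same[OF t smw]) (use c in \<open>auto simp: params_def\<close>)
      have uw: "lv w ''u'' = u" using same_lv[OF smw, of "''u''"] c(2) ut by auto
      have a: "u * 2 ^ s + k \<in> Dl l" using u k by (auto simp: Dl_def)
      have "u * 2 ^ s + k < 2 ^ (N - s * l)" using a Dl_iff[OF l(2)] by simp
      also have "(2::nat) ^ (N - s * l) \<le> 2 ^ N" by (rule power_increasing) auto
      finally have min: "min (u * 2 ^ s + k) Z = u * 2 ^ s + k" using Z(1) by simp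
      let ?w = "setv ''y'' (u * 2 ^ s + k) w"
      have rn: "run ?b w = run c ?w" using s2[OF w] uw vw min ctxD(7)[OF w] by simp
      \<comment> \<open>The pair of high and low part is determined by the point, so no point is
        visited twice. An in-place transform depends on this.\<close>
      have "u * 2 ^ s + k \<notin> Q k"
      proof
        assume "u * 2 ^ s + k \<in> Q k"
        then obtain u' v' where "u * 2 ^ s + k = u' * 2 ^ s + v'" "v' < 2 ^ s" "u' \<in> U \<or> (u' = u \<and> v' < k)"
          using k by (auto simp: Q_def P_def)
        moreover from this have "u = u' \<and> k = v'" using k by (intro digits_inj) auto
        ultimately show False using u(2) by auto
      qed
      moreover have "Q k \<subseteq> Dl l"
        using U u(1) k unfolding Q_def P_def Dl_def by (blast intro: less_trans)
      moreover have "I (Q k) ?w" using stab Iw by auto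
      moreover have "same ?V (arrs c) t0 ?w"
        using sm smw unfolding same_def V by auto
      moreover have "ctx ?w" by (rule ctx_setv[OF w]) (simp add: params_def)
      ultimately have "I (insert (u * 2 ^ s + k) (Q k)) (run c ?w)" by (intro step[OF a]) auto
      moreover have "insert (u * 2 ^ s + k) (Q k) = Q (Suc k)" by (auto simp: Q_def less_Suc_eq)
      ultimately show "I (Q (Suc k)) (run ?b w)" unfolding rn by simp
    qed
    moreover have "Q (2 ^ s) = P (insert u U)" by (auto simp: Q_def P_def)
    ultimately show "I (P (insert u U)) (run ?c t)" by simp
  qed simp
  then show ?thesis by (simp add: P_def Dl_def)
qed

text \<open>Updating in place is safe in any order: the other cell read, \<open>y - 2 ^ z\<close>,
  has bit \<open>z\<close> clear, and \<open>pass\<close> does not change such cells.\<close>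

lemma passC_step:
  assumes t: "ctx t" and z: "lv t ''z'' = z" "z \<le> N" and y: "lv t ''y'' = a"
    and S: "\<And>y. y \<in> S \<Longrightarrow> bit y z \<Longrightarrow> y - 2 ^ z \<in> S"
    and h: "\<And>y. y \<in> S \<Longrightarrow> h0 y = bval (h y)"
    and a: "a \<in> S" "a \<notin> D"
    and I: "\<forall>y. la t 6 0 0 y = (if y \<in> D then bval (pass z h y) else h0 y)"
  shows "\<forall>y. la (run passC t) 6 0 0 y = (if y \<in> insert a D then bval (pass z h y) else h0 y)"
proof -
  have b: "lval (bitE (LV ''y'') (LV ''z'')) t = bval (bt a z)"
    using bitE_val[OF t, of "LV ''z''" "LV ''y''"] z y by simp
  have p: "lval (pow2E (LV ''z'')) t = 2 ^ z" using pow2E_val[OF t, of "LV ''z''"] z by simp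
  show ?thesis
  proof (cases "bt a z" rule: bit_cases)
    case 0
    then show ?thesis using I h[OF a(1)] a(2) b by (simp add: passC_def skip_def pass_def)
  next
    case 1
    then have a': "a - 2 ^ z \<in> S" using S[OF a(1)] by (simp add: bt_eq_1_iff)
    have "pass z h (a - 2 ^ z) = h (a - 2 ^ z)" using 1 by (simp add: pass_def bt_minus_power)
    then have "la t 6 0 0 (a - 2 ^ z) = bval (h (a - 2 ^ z))" using I h[OF a'] by simp
    moreover have "la t 6 0 0 a = bval (h a)" using I h[OF a(1)] a(2) by simp
    ultimately show ?thesis using I b p y 1 by (simp add: passC_def pass_def bval_add)
  qed
qed

lemma extendC_correct:
  assumes t: "ctx t" and l: "lv t ''l'' = l" "l < s"
    and h: "\<And>y. y \<in> W l \<Longrightarrow> la t 5 l (lv t ''i'' * Y + lv t ''r'') y = bval (h y)"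
    and y: "y \<in> Dl l"
  shows "la (run (extendC d) t) 6 0 0 y = bval (extend (N - s * l) (wlim d s l) h y)"
proof -
  let ?M = "N - s * l" and ?k = "lv t ''i'' * Y + lv t ''r''"
  let ?c1 = "forD d (sto1 6 (LV ''y'') (LC 0))"
  let ?c2 = "forW d ''y'' (LV ''l'') (sto1 6 (LV ''y'')
       (LA 5 (LV ''l'') (LAdd (LMul (LV ''i'') (LV ''Y'')) (LV ''r'')) (LV ''y'')))"
  let ?c3 = "LFor ''z'' (dimE (LV ''l'')) (forW d ''y'' (LV ''l'') passC)"
  let ?c4 = "LFor ''z'' (dimE (LV ''l'')) (forD d passC)"
  define t1 where "t1 = run ?c1 t"
  define t2 where "t2 = run ?c2 t1"
  define t3 where "t3 = run ?c3 t2"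
  have c: "ctx t1" "ctx t2" "ctx t3"
    unfolding t3_def t2_def t1_def by (intro ctx_run t; auto simp: params_def wtemps_def)+
  have v: "lv w z = lv t z" if "z \<in> {''l'', ''i'', ''r''}" "w \<in> {t1, t2, t3}" for w z
  proof -
    have "lv t1 z = lv t z" "lv t2 z = lv t1 z" "lv t3 z = lv t2 z"
      unfolding t3_def t2_def t1_def using that(1) by (intro run_vars; auto simp: wtemps_def)+
    with that(2) show ?thesis by auto
  qed
  have a5: "la t1 5 = la t 5" unfolding t1_def by (simp add: run_arrs)
  have 1: "\<forall>y\<in>Dl l. la t1 6 0 0 y = 0" unfolding t1_def
    by (rule forD_rule[where I = "\<lambda>D t. \<forall>y\<in>D. la t 6 0 0 y = 0", OF t l]) (auto simp: params_def)
  have 2: "(\<forall>y\<in>W l. la t2 6 0 0 y = bval (h y)) \<and> (\<forall>y. y \<notin> W l \<longrightarrow> la t2 6 0 0 y = la t1 6 0 0 y)"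
    unfolding t2_def
  proof (rule forW_rule[where I = "\<lambda>D t. (\<forall>y\<in>D. la t 6 0 0 y = bval (h y)) \<and> (\<forall>y. y \<notin> D \<longrightarrow> la t 6 0 0 y = la t1 6 0 0 y)", OF c(1)])
    fix D w a
    let ?b = "sto1 6 (LV ''y'') (LA 5 (LV ''l'') (LAdd (LMul (LV ''i'') (LV ''Y'')) (LV ''r'')) (LV ''y''))"
    assume a: "a \<in> W l" and I: "(\<forall>y\<in>D. la w 6 0 0 y = bval (h y)) \<and> (\<forall>y. y \<notin> D \<longrightarrow> la w 6 0 0 y = la t1 6 0 0 y)"
      and sm: "same (insert ''y'' (wtemps \<union> vars ?b)) (arrs ?b) t1 w" and w: "ctx w" and y: "lv w ''y'' = a"
    have "lv w z = lv t z" if "z \<in> {''l'', ''i'', ''r''}" for z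
      using same_lv[OF sm, of z] v[OF that, of t1] that by (auto simp: wtemps_def)
    moreover have "la w 5 = la t 5" using same_la[OF sm, of 5] a5 by simp
    ultimately have "lval (LA 5 (LV ''l'') (LAdd (LMul (LV ''i'') (LV ''Y'')) (LV ''r'')) (LV ''y'')) w = bval (h a)"
      using y ctxD(6)[OF w] h[OF a] l by simp
    then show "(\<forall>y\<in>insert a D. la (run ?b w) 6 0 0 y = bval (h y)) \<and>
        (\<forall>y. y \<notin> insert a D \<longrightarrow> la (run ?b w) 6 0 0 y = la t1 6 0 0 y)"
      using I y by simp
  qed (use l v[of "''l''" t1] in \<open>auto simp: params_def wtemps_def\<close>)
  have zl: "z \<le> N" if "z < ?M" for z using that by simp
  have 3: "(\<forall>y\<in>W l. la t3 6 0 0 y = bval (zt ?M h y)) \<and> (\<forall>y. y \<notin> W l \<longrightarrow> la t3 6 0 0 y = la t2 6 0 0 y)"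
    unfolding t3_def
  proof (rule For_rule[where I = "\<lambda>z t. (\<forall>y\<in>W l. la t 6 0 0 y = bval (zt z h y)) \<and> (\<forall>y. y \<notin> W l \<longrightarrow> la t 6 0 0 y = la t2 6 0 0 y)"])
    show "lval (dimE (LV ''l'')) t2 = ?M" using dimE_val[OF c(2), of "LV ''l''"] v[of "''l''" t2] l by simp
    show "(\<forall>y\<in>W l. la t2 6 0 0 y = bval (zt 0 h y)) \<and> (\<forall>y. y \<notin> W l \<longrightarrow> la t2 6 0 0 y = la t2 6 0 0 y)"
      using 2 by simp
    fix z w
    let ?b = "forW d ''y'' (LV ''l'') passC"
    assume z: "z < ?M" and I: "(\<forall>y\<in>W l. la w 6 0 0 y = bval (zt z h y)) \<and> (\<forall>y. y \<notin> W l \<longrightarrow> la w 6 0 0 y = la t2 6 0 0 y)"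
      and sm: "same (insert ''z'' (vars ?b)) (arrs ?b) t2 w" and zw: "lv w ''z'' = z"
    have w: "ctx w" by (rule ctx_same[OF c(2) sm]) (auto simp: params_def wtemps_def)
    have lw: "lv w ''l'' = l" using same_lv[OF sm, of "''l''"] v[of "''l''" t2] l by (auto simp: wtemps_def)
    have "\<forall>y. la (run ?b w) 6 0 0 y = (if y \<in> W l then bval (pass z (zt z h) y) else la w 6 0 0 y)"
    proof (rule forW_rule[where I = "\<lambda>D u. \<forall>y. la u 6 0 0 y = (if y \<in> D then bval (pass z (zt z h) y) else la w 6 0 0 y)", OF w])
      fix D u a
      assume a: "a \<in> W l" "a \<notin> D"
        and J: "\<forall>y. la u 6 0 0 y = (if y \<in> D then bval (pass z (zt z h) y) else la w 6 0 0 y)"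
        and smu: "same (insert ''y'' (wtemps \<union> vars passC)) (arrs passC) w u" and u: "ctx u" and y: "lv u ''y'' = a"
      have "lv u ''z'' = z" using same_lv[OF smu, of "''z''"] zw by (auto simp: wtemps_def)
      then show "\<forall>y. la (run passC u) 6 0 0 y = (if y \<in> insert a D then bval (pass z (zt z h) y) else la w 6 0 0 y)"
        using I by (intro passC_step[OF u _ zl[OF z] y W_clear _ a J]) auto
    qed (use lw l in \<open>auto simp: params_def wtemps_def\<close>)
    then show "(\<forall>y\<in>W l. la (run ?b w) 6 0 0 y = bval (zt (Suc z) h y)) \<and>
        (\<forall>y. y \<notin> W l \<longrightarrow> la (run ?b w) 6 0 0 y = la t2 6 0 0 y)"
      using I by simp
  qed auto
  \<comment> \<open>The truncated coefficient function inside \<open>extend\<close>. The table holds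
    it on \<open>Dl l\<close>: light points carry the first transform, heavy ones still carry the
    initial zeros.\<close>
  define h' where "h' y = (if wt y \<le> wlim d s l then zt ?M h y else 0)" for y
  have 3: "\<forall>y\<in>Dl l. la t3 6 0 0 y = bval (h' y)"
    using 1 2 3 Dl_W_iff[OF l(2)] by (auto simp: h'_def)
  have "\<forall>y\<in>Dl l. la (run ?c4 t3) 6 0 0 y = bval (zt ?M h' y)"
  proof (rule For_rule[where I = "\<lambda>z t. \<forall>y\<in>Dl l. la t 6 0 0 y = bval (zt z h' y)"])
    show "lval (dimE (LV ''l'')) t3 = ?M" using dimE_val[OF c(3), of "LV ''l''"] v[of "''l''" t3] l by simp
    show "\<forall>y\<in>Dl l. la t3 6 0 0 y = bval (zt 0 h' y)" using 3 by simp
    fix z w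
    let ?b = "forD d passC"
    assume z: "z < ?M" and I: "\<forall>y\<in>Dl l. la w 6 0 0 y = bval (zt z h' y)"
      and sm: "same (insert ''z'' (vars ?b)) (arrs ?b) t3 w" and zw: "lv w ''z'' = z"
    have w: "ctx w" by (rule ctx_same[OF c(3) sm]) (auto simp: params_def wtemps_def)
    have lw: "lv w ''l'' = l" using same_lv[OF sm, of "''l''"] v[of "''l''" t3] l by (auto simp: wtemps_def)
    have "\<forall>y. la (run ?b w) 6 0 0 y = (if y \<in> Dl l then bval (pass z (zt z h') y) else la w 6 0 0 y)"
    proof (rule forD_rule[where I = "\<lambda>D u. \<forall>y. la u 6 0 0 y = (if y \<in> D then bval (pass z (zt z h') y) else la w 6 0 0 y)", OF w lw l(2)])
      fix D u a
      assume a: "a \<in> Dl l" "a \<notin> D"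
        and J: "\<forall>y. la u 6 0 0 y = (if y \<in> D then bval (pass z (zt z h') y) else la w 6 0 0 y)"
        and smu: "same ({''u'', ''v'', ''y''} \<union> wtemps \<union> vars passC) (arrs passC) w u" and u: "ctx u" and y: "lv u ''y'' = a"
      have "lv u ''z'' = z" using same_lv[OF smu, of "''z''"] zw by (auto simp: wtemps_def)
      then show "\<forall>y. la (run passC u) 6 0 0 y = (if y \<in> insert a D then bval (pass z (zt z h') y) else la w 6 0 0 y)"
        using I by (intro passC_step[OF u _ zl[OF z] y Dl_clear[OF l(2)] _ a J]) auto
    qed (auto simp: params_def)
    then show "\<forall>y\<in>Dl l. la (run ?b w) 6 0 0 y = bval (zt (Suc z) h' y)" by simp
  qed auto
  moreover have "run (extendC d) t = run ?c4 t3"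
    by (simp only: extendC_def run.simps t3_def t2_def t1_def)
  ultimately show ?thesis using y by (simp add: extend_def h'_def[abs_def])
qed

lemma countC_correct:
  assumes t: "ctx t" and l: "lv t ''l'' = l" "l < s"
    and h: "\<And>r y. r < Y \<Longrightarrow> y \<in> W l \<Longrightarrow> la t 5 l (lv t ''i'' * Y + r) y = bval (h r y)"
    and y: "y \<in> Dl l"
  shows "la (run (countC d) t) 7 0 0 y = card {r. r < Y \<and> extend (N - s * l) (wlim d s l) (h r) y = 1}"
proof -
  let ?f = "\<lambda>r. extend (N - s * l) (wlim d s l) (h r)"
  let ?c1 = "forD d (sto1 7 (LV ''y'') (LC 0))"
  let ?i = "sto1 7 (LV ''y'') (LMin (LAdd (arr1 7 (LV ''y'')) (arr1 6 (LV ''y''))) (LV ''Z''))"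
  let ?b = "extendC d ;; forD d ?i"
  define t1 where "t1 = run ?c1 t"
  have t1: "ctx t1" unfolding t1_def by (rule ctx_run[OF t]) (auto simp: params_def wtemps_def)
  have v1: "lv t1 ''l'' = l" "lv t1 ''i'' = lv t ''i''" "la t1 5 = la t 5"
    unfolding t1_def using l by (auto simp: run_vars run_arrs wtemps_def)
  have 1: "\<forall>y\<in>Dl l. la t1 7 0 0 y = 0" unfolding t1_def
    by (rule forD_rule[where I = "\<lambda>D t. \<forall>y\<in>D. la t 7 0 0 y = 0", OF t l]) (auto simp: params_def)
  have card_Suc: "card {r. r < Suc k \<and> ?f r y = 1} = card {r. r < k \<and> ?f r y = 1} + bval (?f k y)" for k y
  proof -
    have "{r. r < Suc k \<and> ?f r y = 1} = (if ?f k y = 1 then insert k {r. r < k \<and> ?f r y = 1} else {r. r < k \<and> ?f r y = 1})"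
      by (auto simp: less_Suc_eq)
    then show ?thesis by (simp add: bval_def)
  qed
  have card_le: "card {r. r < k \<and> ?f r y = 1} \<le> k" for k y
    using card_mono[of "{..<k}" "{r. r < k \<and> ?f r y = 1}"] by auto
  have "\<forall>y\<in>Dl l. la (run (LFor ''r'' (LV ''Y'') ?b) t1) 7 0 0 y = card {r. r < Y \<and> ?f r y = 1}"
  proof (rule For_rule[where I = "\<lambda>k t. \<forall>y\<in>Dl l. la t 7 0 0 y = card {r. r < k \<and> ?f r y = 1}"])
    show "lval (LV ''Y'') t1 = Y" using ctxD(6)[OF t1] by simp
    show "\<forall>y\<in>Dl l. la t1 7 0 0 y = card {r. r < 0 \<and> ?f r y = 1}" using 1 by simp
    fix k w
    assume k: "k < Y" and I: "\<forall>y\<in>Dl l. la w 7 0 0 y = card {r. r < k \<and> ?f r y = 1}"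
      and sm: "same (insert ''r'' (vars ?b)) (arrs ?b) t1 w" and r: "lv w ''r'' = k"
    have w: "ctx w" by (rule ctx_same[OF t1 sm]) (auto simp: params_def wtemps_def)
    have vw: "lv w ''l'' = l" "lv w ''i'' = lv t ''i''" "la w 5 = la t 5"
      using same_lv[OF sm, of "''l''"] same_lv[OF sm, of "''i''"] same_la[OF sm, of 5] v1 by (auto simp: wtemps_def)
    define w1 where "w1 = run (extendC d) w"
    have w1: "ctx w1" unfolding w1_def by (rule ctx_run[OF w]) (auto simp: params_def wtemps_def)
    have vw1: "lv w1 ''l'' = l" "la w1 7 = la w 7" unfolding w1_def by (auto simp: run_vars run_arrs wtemps_def vw)
    have e: "la w1 6 0 0 y = bval (?f k y)" if "y \<in> Dl l" for y
      unfolding w1_def by (rule extendC_correct[OF w vw(1) l(2) _ that]) (use h[OF k] vw r in auto)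
    have "\<forall>y. la (run (forD d ?i) w1) 7 0 0 y = (if y \<in> Dl l then card {r. r < Suc k \<and> ?f r y = 1} else la w1 7 0 0 y)"
    proof (rule forD_rule[where I = "\<lambda>D t. \<forall>y. la t 7 0 0 y = (if y \<in> D then card {r. r < Suc k \<and> ?f r y = 1} else la w1 7 0 0 y)", OF w1 vw1(1) l(2)])
      fix D u a
      assume a: "a \<in> Dl l" "a \<notin> D"
        and J: "\<forall>y. la u 7 0 0 y = (if y \<in> D then card {r. r < Suc k \<and> ?f r y = 1} else la w1 7 0 0 y)"
        and smu: "same ({''u'', ''v'', ''y''} \<union> wtemps \<union> vars ?i) (arrs ?i) w1 u" and u: "ctx u" and y: "lv u ''y'' = a"
      have "la u 6 = la w1 6" using same_la[OF smu, of 6] by simp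
      then have "la u 7 0 0 a + la u 6 0 0 a = card {r. r < Suc k \<and> ?f r a = 1}"
        using J a e[OF a(1)] I vw1(2) by (simp add: card_Suc)
      moreover have "card {r. r < Suc k \<and> ?f r a = 1} \<le> Z"
        using card_le[of "Suc k" a] k Z(3) by linarith
      ultimately have "lval (LMin (LAdd (arr1 7 (LV ''y'')) (arr1 6 (LV ''y''))) (LV ''Z'')) u =
          card {r. r < Suc k \<and> ?f r a = 1}"
        using y ctxD(7)[OF u] by simp
      then have rn: "run ?i u = seta 7 0 0 a (card {r. r < Suc k \<and> ?f r a = 1}) u"
        unfolding vars_arr1_sto1(3) by (simp only: lval.simps(2) y)
      show "\<forall>y. la (run ?i u) 7 0 0 y = (if y \<in> insert a D then card {r. r < Suc k \<and> ?f r y = 1} else la w1 7 0 0 y)"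
        unfolding rn using J by simp
    qed (auto simp: params_def)
    moreover have "run ?b w = run (forD d ?i) w1" by (simp only: run.simps w1_def)
    ultimately show "\<forall>y\<in>Dl l. la (run ?b w) 7 0 0 y = card {r. r < Suc k \<and> ?f r y = 1}" by simp
  qed auto
  moreover have "run (countC d) t = run (LFor ''r'' (LV ''Y'') ?b) t1"
    by (simp only: countC_def run.simps t1_def)
  ultimately show ?thesis using y by simp
qed

lemma voteC_correct:
  assumes t: "ctx t" and l: "lv t ''l'' = l" "l < s"
  shows "la (run (voteC d) t) 5 a b u = (if a = Suc l \<and> b = lv t ''i'' \<and> u \<in> W (Suc l)
    then bval (\<Sum>v<2 ^ s. of_bool (Y < 2 * la t 7 0 0 (u * 2 ^ s + v))) else la t 5 a b u)"
proof -
  let ?f = "\<lambda>u. bval (\<Sum>v<2 ^ s. of_bool (Y < 2 * la t 7 0 0 (u * 2 ^ s + v)))"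
  let ?i = "LIf (LSub (LMul (LC 2) (arr1 7 (LAdd (LMul (LV ''u'') (pow2E (LV ''s''))) (LV ''v'')))) (LV ''Y''))
         (LSet ''acc'' (LSub (LC 1) (LV ''acc''))) skip"
  let ?b = "LSet ''acc'' (LC 0) ;; LFor ''v'' (LV ''S'') ?i ;;
     LSto 5 (LAdd (LV ''l'') (LC 1)) (LV ''i'') (LV ''u'') (LV ''acc'')"
  have "\<forall>a b u. la (run (voteC d) t) 5 a b u = (if a = Suc l \<and> b = lv t ''i'' \<and> u \<in> W (Suc l) then ?f u else la t 5 a b u)"
    unfolding voteC_def
  proof (rule forW_rule[where I = "\<lambda>D w. \<forall>a b u. la w 5 a b u =
      (if a = Suc l \<and> b = lv t ''i'' \<and> u \<in> D then ?f u else la t 5 a b u)", OF t])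
    fix D w u
    assume u: "u \<in> W (Suc l)" "u \<notin> D"
      and I: "\<forall>a b u. la w 5 a b u = (if a = Suc l \<and> b = lv t ''i'' \<and> u \<in> D then ?f u else la t 5 a b u)"
      and sm: "same (insert ''u'' (wtemps \<union> vars ?b)) (arrs ?b) t w" and w: "ctx w" and uw: "lv w ''u'' = u"
    have vw: "lv w ''l'' = l" "lv w ''i'' = lv t ''i''" "la w 7 = la t 7"
      using same_lv[OF sm, of "''l''"] same_lv[OF sm, of "''i''"] same_la[OF sm, of 7] l by (auto simp: wtemps_def)
    have s2: "lval (pow2E (LV ''s'')) w = 2 ^ s" if "ctx w" for w
      using pow2E_val[OF that, of "LV ''s''"] ctxD(3)[OF that] s_le_N[OF s] by simp
    define w0 where "w0 = setv ''acc'' 0 w"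
    have w0: "ctx w0" unfolding w0_def by (rule ctx_setv[OF w]) (simp add: params_def)
    define w1 where "w1 = run (LFor ''v'' (LV ''S'') ?i) w0"
    define J where "J k x \<longleftrightarrow> lv x ''acc'' = bval (\<Sum>v<k. of_bool (Y < 2 * la t 7 0 0 (u * 2 ^ s + v)))" for k and x :: lstate
    have "J (2 ^ s) w1" unfolding w1_def
    proof (rule For_rule)
      show "lval (LV ''S'') w0 = 2 ^ s" using ctxD(12)[OF w0] by simp
      show "J 0 w0" by (simp add: J_def w0_def)
      show "\<And>k t v. J k t \<Longrightarrow> J k (setv ''v'' v t)" by (simp add: J_def)
      fix k x
      assume J: "J k x" and smx: "same (insert ''v'' (vars ?i)) (arrs ?i) w0 x" and vx: "lv x ''v'' = k"
      have x: "ctx x" by (rule ctx_same[OF w0 smx]) (auto simp: params_def)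
      have "lv x ''u'' = u" "la x 7 = la t 7"
        using same_lv[OF smx, of "''u''"] same_la[OF smx, of 7] uw vw by (auto simp: w0_def)
      then have c: "lval (LSub (LMul (LC 2) (arr1 7 (LAdd (LMul (LV ''u'') (pow2E (LV ''s''))) (LV ''v'')))) (LV ''Y'')) x =
          2 * la t 7 0 0 (u * 2 ^ s + k) - Y"
        using s2[OF x] vx ctxD(6)[OF x] by simp
      show "J (Suc k) (run ?i x)"
      proof (cases "Y < 2 * la t 7 0 0 (u * 2 ^ s + k)")
        case True
        have "run ?i x = setv ''acc'' (1 - lv x ''acc'') x"
          unfolding run.simps(4) c using True by simp
        then show ?thesis using J True
          by (simp add: J_def bval_compl[unfolded One_nat_def] add.commute)
      next
        case False
        have "run ?i x = setv ''o'' 0 x" unfolding run.simps(4) c using False by (simp add: skip_def)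
        then show ?thesis using J False by (simp add: J_def)
      qed
    qed
    then have acc: "lv w1 ''acc'' = ?f u" by (simp add: J_def)
    have v1: "lv w1 ''l'' = l" "lv w1 ''i'' = lv t ''i''" "lv w1 ''u'' = u" "la w1 = la w"
      unfolding w1_def using run_vars[of _ "LFor ''v'' (LV ''S'') ?i" w0]
        run_arrs[of _ "LFor ''v'' (LV ''S'') ?i" w0] vw uw by (auto simp: w0_def fun_eq_iff)
    have "run ?b w = run (LSto 5 (LAdd (LV ''l'') (LC 1)) (LV ''i'') (LV ''u'') (LV ''acc'')) w1"
      unfolding w1_def w0_def by (simp only: run.simps lval.simps)
    then have rn: "run ?b w = seta 5 (Suc l) (lv t ''i'') u (?f u) w1"
      using v1 acc by (simp only: run.simps lval.simps) simp
    show "\<forall>a b u'. la (run ?b w) 5 a b u' = (if a = Suc l \<and> b = lv t ''i'' \<and> u' \<in> insert u D then ?f u' else la t 5 a b u')"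
      unfolding rn using I v1(4) by simp
  qed (use l in \<open>auto simp: params_def wtemps_def\<close>)
  then show ?thesis by blast
qed

lemma levelC_correct:
  assumes t: "ctx t" and l: "lv t ''l'' = l" "l < s"
    and f: "\<And>i y. i < Y ^ (s - l) \<Longrightarrow> y \<in> W l \<Longrightarrow> la t 5 l i y = bval (mpc d s Y C g l i y)"
    and i: "i < Y ^ (s - Suc l)" and u: "u \<in> W (Suc l)"
  shows "la (run (levelC d) t) 5 (Suc l) i u = bval (mpc d s Y C g (Suc l) i u)"
proof -
  let ?b = "countC d ;; voteC d"
  \<comment> \<open>\<open>countC\<close> reads level \<open>l\<close> of array 5 and
    \<open>voteC\<close> writes level \<open>Suc l\<close> only, so the second part keeps the input
    intact for later \<open>i\<close>.\<close>
  define I where "I k w \<longleftrightarrow> (\<forall>i<k. i < Y ^ (s - Suc l) \<longrightarrow> (\<forall>u\<in>W (Suc l). la w 5 (Suc l) i u = bval (mpc d s Y C g (Suc l) i u))) \<and>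
    (\<forall>i y. la w 5 l i y = la t 5 l i y)" for k and w :: lstate
  have "I (Y ^ s) (run (levelC d) t)" unfolding levelC_def
  proof (rule For_rule)
    show "lval (LV ''K'') t = Y ^ s" using ctxD[OF t] by simp
    show "I 0 t" by (simp add: I_def)
    show "\<And>k t v. I k t \<Longrightarrow> I k (setv ''i'' v t)" by (simp add: I_def)
    fix k w
    assume I: "I k w" and sm: "same (insert ''i'' (vars ?b)) (arrs ?b) t w" and iw: "lv w ''i'' = k"
    have w: "ctx w" by (rule ctx_same[OF t sm]) (auto simp: params_def wtemps_def)
    have lw: "lv w ''l'' = l" using same_lv[OF sm, of "''l''"] l by (auto simp: wtemps_def)
    define w1 where "w1 = run (countC d) w"
    have w1: "ctx w1" unfolding w1_def by (rule ctx_run[OF w]) (auto simp: params_def wtemps_def)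
    have v1: "lv w1 ''l'' = l" "lv w1 ''i'' = k" "la w1 5 = la w 5"
      unfolding w1_def by (auto simp: run_vars run_arrs wtemps_def lw iw)
    note V = voteC_correct[OF w1 v1(1) l(2)]
    have "la (run (voteC d) w1) 5 (Suc l) k u = bval (mpc d s Y C g (Suc l) k u)"
      if k: "k < Y ^ (s - Suc l)" and u: "u \<in> W (Suc l)" for u
    proof -
      have 5: "la w 5 l (lv w ''i'' * Y + r) y = bval (mpc d s Y C g l (k * Y + r) y)" if "r < Y" "y \<in> W l" for r y
      proof -
        have "k * Y + r < Y ^ (s - Suc l) * Y" by (rule digits_less[OF k that(1)])
        also have "Y ^ (s - Suc l) * Y = Y ^ (s - l)" using l(2) by (simp flip: power_Suc2 add: Suc_diff_Suc)
        finally show ?thesis using I f that(2) iw by (simp add: I_def)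
      qed
      have "la w1 7 0 0 (u * 2 ^ s + v) = card {r. r < Y \<and> extend (N - s * l) (wlim d s l)
          (mpc d s Y C g l (k * Y + r)) (u * 2 ^ s + v) = 1}" if "v < 2 ^ s" for v
        unfolding w1_def by (rule countC_correct[OF w lw l(2) 5]) (use u that in \<open>auto simp: Dl_def\<close>)
      then show ?thesis using V[of "Suc l" k u] u v1 by (simp add: majority_def)
    qed
    moreover have "la (run (voteC d) w1) 5 (Suc l) i u = la w 5 (Suc l) i u" if "i \<noteq> k" for i u
      using V[of "Suc l" i u] that v1 by simp
    moreover have "la (run (voteC d) w1) 5 l i y = la w 5 l i y" for i y
      using V[of l i y] v1 by simp
    moreover have "run ?b w = run (voteC d) w1" by (simp add: w1_def)
    ultimately show "I (Suc k) (run ?b w)" using I by (auto simp: I_def less_Suc_eq)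
  qed
  moreover have "i < Y ^ s"
  proof -
    have "Y ^ (s - Suc l) \<le> Y ^ s" using sY(3) by (intro power_increasing) auto
    then show ?thesis using i by simp
  qed
  ultimately show ?thesis using i u by (simp add: I_def)
qed

lemma mpcC_correct:
  assumes t: "ctx t" and k: "lv t ''k'' \<le> Suc N" and p: "lv t ''R'' = p" "p < Y" and e: "lv t ''e'' < N"
  shows "la (run (mpcC d) t) 5 s 0 0 = bval (mpc d s Y (A p) (top (lv t ''k'') (lv t ''e'') (A p s 0)) s 0 0)"
proof -
  let ?g = "top (lv t ''k'') (lv t ''e'') (A p s 0)"
  define t1 where "t1 = run (leavesC d) t"
  have t1: "ctx t1" unfolding t1_def by (rule ctx_run[OF t]) (auto simp: params_def wtemps_def)
  define I where "I l w \<longleftrightarrow> (\<forall>i<Y ^ (s - l). \<forall>y\<in>W l. la w 5 l i y = bval (mpc d s Y (A p) ?g l i y))" for l and w :: lstate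
  have "I s (run (LFor ''l'' (LV ''s'') (levelC d)) t1)"
  proof (rule For_rule)
    show "lval (LV ''s'') t1 = s" using ctxD[OF t1] by simp
    show "I 0 t1" using leavesC_correct[OF t k p e] by (simp add: I_def t1_def)
    show "\<And>k t v. I k t \<Longrightarrow> I k (setv ''l'' v t)" by (simp add: I_def)
    fix l w
    assume l: "l < s" and I: "I l w" and sm: "same (insert ''l'' (vars (levelC d))) (arrs (levelC d)) t1 w" and lw: "lv w ''l'' = l"
    have w: "ctx w" by (rule ctx_same[OF t1 sm]) (auto simp: params_def wtemps_def)
    show "I (Suc l) (run (levelC d) w)"
      using levelC_correct[OF w lw l, of "A p" ?g] I by (simp add: I_def)
  qed
  moreover have "0 \<in> W s" by (simp add: W_def)
  ultimately show ?thesis by (simp add: I_def mpcC_def t1_def)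
qed

end

subsection \<open>Search, output and initialization\<close>

definition outC :: lcom where
  "outC = sto1 0 (LC 0) (LV ''F'') ;;
     LFor ''i'' (LV ''n'') (sto1 0 (LAdd (LV ''i'') (LC 1)) (bitE (LV ''X'') (LV ''i'')))"

definition tableC :: "nat \<Rightarrow> lcom" where
  "tableC d = LSet ''b'' (wlimE d (LV ''s'')) ;;
     LFor ''w'' (LAdd (LV ''b'') (LC 1)) (LSto 2 (LC 0) (LC 0) (LV ''w'') (LC 1)) ;;
     LFor ''i'' (LV ''N'') (LSto 2 (LC 0) (LAdd (LV ''i'') (LC 1)) (LC 0) (LC 1) ;;
       LFor ''w'' (LV ''b'') (LSto 2 (LC 0) (LAdd (LV ''i'') (LC 1)) (LAdd (LV ''w'') (LC 1))
         (LMin (LAdd (LA 2 (LC 0) (LV ''i'') (LAdd (LV ''w'') (LC 1))) (LA 2 (LC 0) (LV ''i'') (LV ''w''))) (LV ''Z'')))) ;;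
     LFor ''l'' (LAdd (LV ''s'') (LC 1)) (sto1 3 (LV ''l'')
       (LA 2 (LC 0) (dimE (LV ''l'')) (wlimE d (LV ''l'')))) ;;
     LSet ''S'' (pow2E (LV ''s''))"

definition setupC :: "nat \<Rightarrow> lcom" where
  "setupC d = LSet ''n'' (inE (LC 0)) ;; LSet ''m'' (inE (LC 1)) ;; LSet ''s'' (LC 1) ;;
     LFor ''i'' (LV ''n'') (LIf (LSub (LV ''n'') (LMul (LV ''s'') (LV ''s'')))
       (LSet ''s'' (LMin (LAdd (LV ''s'') (LC 1)) (LV ''Y''))) skip) ;;
     LSet ''N'' (LMin (LMul (LV ''s'') (LV ''s'')) (LV ''Z'')) ;;
     LSet ''K'' (LC 1) ;;
     LFor ''i'' (LV ''s'') (LSet ''K'' (LMin (LMul (LV ''K'') (LV ''Y'')) (LV ''Z''))) ;;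
     tableC d"

lemma nlow_le: "nlow i w \<le> 2 ^ i"
proof (induction i arbitrary: w)
  case (Suc i)
  show ?case
  proof (cases w)
    case (Suc v)
    then show ?thesis using Suc.IH[of w] Suc.IH[of v] by simp
  qed simp
qed simp

lemma deg_sum_list: "(\<And>M. M \<in> set P \<Longrightarrow> deg N D (f M)) \<Longrightarrow> deg N D (\<lambda>x. \<Sum>M\<leftarrow>P. f M x)"
  by (induction P) (auto intro: deg_zero deg_add)

context solver
begin

lemma solC_correct:
  assumes t: "ctx t" and p: "lv t ''R'' = p" "p < Y" and k: "lv t ''k'' = k" "k \<le> Suc N" and e: "e < N"
  shows "la (run (solC d) t) 8 0 0 e = bval (mpc d s Y (A p) (top k e (A p s 0)) s 0 0)"
proof -
  let ?b = "mpcC d ;; sto1 8 (LV ''e'') (LA 5 (LV ''s'') (LC 0) (LC 0))"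
  define I where "I j w \<longleftrightarrow> (\<forall>e<j. la w 8 0 0 e = bval (mpc d s Y (A p) (top k e (A p s 0)) s 0 0))"
    for j and w :: lstate
  have "I N (run (solC d) t)" unfolding solC_def
  proof (rule For_rule)
    show "lval (LV ''N'') t = N" using ctxD[OF t] by simp
    show "I 0 t" by (simp add: I_def)
    show "\<And>k t v. I k t \<Longrightarrow> I k (setv ''e'' v t)" by (simp add: I_def)
    fix j w
    assume j: "j < N" and I: "I j w" and sm: "same (insert ''e'' (vars ?b)) (arrs ?b) t w" and ew: "lv w ''e'' = j"
    have w: "ctx w" by (rule ctx_same[OF t sm]) (auto simp: params_def wtemps_def)
    have v: "lv w ''R'' = p" "lv w ''k'' = k"
      using same_lv[OF sm, of "''R''"] same_lv[OF sm, of "''k''"] p k by (auto simp: wtemps_def)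
    define w1 where "w1 = run (mpcC d) w"
    have w1: "ctx w1" unfolding w1_def by (rule ctx_run[OF w]) (auto simp: params_def wtemps_def)
    have v1: "lv w1 ''e'' = j" "la w1 8 = la w 8" "lv w1 ''s'' = s"
      unfolding w1_def using ctxD(3)[OF w1] by (auto simp: run_vars run_arrs wtemps_def ew w1_def)
    have "la w1 5 s 0 0 = bval (mpc d s Y (A p) (top k j (A p s 0)) s 0 0)"
      unfolding w1_def using mpcC_correct[OF w _ v(1) p(2)] v k ew j by simp
    moreover have "run ?b w = seta 8 0 0 j (la w1 5 s 0 0) w1" using v1 by (simp add: w1_def)
    ultimately show "I (Suc j) (run ?b w)" using I v1 by (auto simp: I_def less_Suc_eq)
  qed
  then show ?thesis using e by (simp add: I_def)
qed

lemma asmC_correct: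
  assumes t: "ctx t" and x: "x < 2 ^ N" "\<And>e. e < N \<Longrightarrow> la t 8 0 0 e = bval (bt x e)"
  shows "lv (run asmC t) ''x'' = x"
proof -
  let ?b = "LSet ''x'' (LMin (LAdd (LV ''x'') (LMul (arr1 8 (LV ''e'')) (pow2E (LV ''e'')))) (LV ''Z''))"
  define t1 where "t1 = setv ''x'' 0 t"
  have t1: "ctx t1" unfolding t1_def by (rule ctx_setv[OF t]) (simp add: params_def)
  have "lv (run (LFor ''e'' (LV ''N'') ?b) t1) ''x'' = x mod 2 ^ N"
  proof (rule For_rule[where I = "\<lambda>k w. lv w ''x'' = x mod 2 ^ k"])
    show "lval (LV ''N'') t1 = N" using ctxD[OF t1] by simp
    show "lv t1 ''x'' = x mod 2 ^ 0" by (simp add: t1_def)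
    fix k w
    assume k: "k < N" and I: "lv w ''x'' = x mod 2 ^ k" and sm: "same (insert ''e'' (vars ?b)) (arrs ?b) t1 w"
      and e: "lv w ''e'' = k"
    have w: "ctx w" by (rule ctx_same[OF t1 sm]) (auto simp: params_def)
    have a8: "la w 8 0 0 k = bval (bt x k)" using same_la[OF sm, of 8] x(2)[OF k] by (simp add: t1_def)
    have p: "lval (pow2E (LV ''e'')) w = 2 ^ k" using pow2E_val[OF w, of "LV ''e''"] e k by simp
    have "x mod 2 ^ Suc k = x mod (2 ^ k * 2)" by (simp add: mult.commute)
    also have "\<dots> = x mod 2 ^ k + bval (bt x k) * 2 ^ k"
      unfolding mod_mult2_eq bval_bt by (simp add: mult.commute)
    finally have m: "x mod 2 ^ k + bval (bt x k) * 2 ^ k = x mod 2 ^ Suc k" ..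
    have "x mod 2 ^ Suc k \<le> x" by (rule mod_less_eq_dividend)
    then have "min (x mod 2 ^ Suc k) Z = x mod 2 ^ Suc k" using x(1) Z(1) by linarith
    then show "lv (run ?b w) ''x'' = x mod 2 ^ Suc k"
      using I a8 p e m ctxD(7)[OF w] by simp
  qed auto
  then show ?thesis using x(1) by (simp add: asmC_def t1_def del: run.simps(5))
qed

definition solved :: "nat \<Rightarrow> bool" where
  "solved x \<longleftrightarrow> (\<forall>P\<in>set E. pe P x = 0)"

lemma checkC_correct:
  assumes t: "ctx t"
  shows "lv (run checkC t) ''F'' = (if solved (lv t ''x'') then 1 else lv t ''F'')"
    and "lv (run checkC t) ''X'' = (if solved (lv t ''x'') then lv t ''x'' else lv t ''X'')"
proof -
  let ?b = "LIf (LA 4 (LV ''s'') (LC 0) (LV ''q'')) (LSet ''ok'' (LC 0)) skip"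
  define t1 where "t1 = setv ''ok'' 1 (run evalC t)"
  have t1: "ctx t1" unfolding t1_def by (intro ctx_setv ctx_run t) (auto simp: params_def)
  have a4: "la t1 4 s 0 q = bval (pe (E ! q) (lv t ''x''))" if "q < m" for q
    using evalC_correct(1)[OF t that] by (simp add: t1_def)
  define t2 where "t2 = run (LFor ''q'' (LV ''m'') ?b) t1"
  have "lv t2 ''ok'' = of_bool (\<forall>q<m. pe (E ! q) (lv t ''x'') = 0)" unfolding t2_def
  proof (rule For_rule[where I = "\<lambda>k w. lv w ''ok'' = of_bool (\<forall>q<k. pe (E ! q) (lv t ''x'') = 0)"])
    show "lval (LV ''m'') t1 = m" using ctxD[OF t1] by simp
    fix k w
    assume k: "k < m" and I: "lv w ''ok'' = of_bool (\<forall>q<k. pe (E ! q) (lv t ''x'') = 0)"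
      and sm: "same (insert ''q'' (vars ?b)) (arrs ?b) t1 w" and q: "lv w ''q'' = k"
    have w: "ctx w" by (rule ctx_same[OF t1 sm]) (auto simp: params_def)
    have "la w 4 = la t1 4" using same_la[OF sm, of 4] by simp
    then show "lv (run ?b w) ''ok'' = of_bool (\<forall>q<Suc k. pe (E ! q) (lv t ''x'') = 0)"
      using I q ctxD(3)[OF w] a4[OF k] by (auto simp: skip_def less_Suc_eq)
  qed (auto simp: t1_def)
  moreover have "(\<forall>q<m. pe (E ! q) (lv t ''x'') = 0) \<longleftrightarrow> solved (lv t ''x'')"
    by (auto simp: solved_def all_set_conv_all_nth)
  ultimately have ok: "lv t2 ''ok'' = of_bool (solved (lv t ''x''))" by simp
  have v2: "lv t2 z = lv t z" if "z \<in> {''x'', ''F'', ''X''}" for z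
  proof -
    have "lv t2 z = lv t1 z" unfolding t2_def using that by (intro run_vars) auto
    also have "\<dots> = lv t z" unfolding t1_def using that by (auto simp: run_vars)
    finally show ?thesis .
  qed
  have rn: "run checkC t = run (LIf (LV ''ok'') (LSet ''F'' (LC 1) ;; LSet ''X'' (LV ''x'')) skip) t2"
    by (simp only: checkC_def run.simps(1,3) lval.simps t2_def t1_def)
  show "lv (run checkC t) ''F'' = (if solved (lv t ''x'') then 1 else lv t ''F'')"
    "lv (run checkC t) ''X'' = (if solved (lv t ''x'') then lv t ''x'' else lv t ''X'')"
    unfolding rn using ok v2 by (auto simp: skip_def)
qed

text \<open>Forcing the padding variables to 0 keeps the number of solutions; otherwise each would
  reappear with every setting of the padding, and such copies would be candidates for isolation
  too.\<close>

definition Sols :: "nat set" where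
  "Sols = {x. x < 2 ^ N \<and> solved x \<and> (\<forall>j<N. n \<le> j \<longrightarrow> bt x j = 0)}"

lemma top_solutions:
  assumes x: "x < 2 ^ N" and k: "k \<le> Suc N" and e: "e < N"
  shows "sol_ind (top k e c) Y x = of_bool (x \<in> Sols \<and> (\<forall>q<k. hash N (c q) x = 0) \<and> bt x e = 1)"
proof -
  have "(\<forall>q<Y. top k e c q x = 0) \<longleftrightarrow> x \<in> Sols \<and> (\<forall>q<k. hash N (c q) x = 0) \<and> bt x e = 1"
  proof
    assume a: "\<forall>q<Y. top k e c q x = 0"
    have "pe P x = 0" if "P \<in> set E" for P
    proof -
      obtain q where "q < m" "P = E ! q" using \<open>P \<in> set E\<close> by (auto simp: in_set_conv_nth)
      then show ?thesis using a[rule_format, of q] Y by (simp add: top_def)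
    qed
    moreover have "bt x j = 0" if "j < N" "n \<le> j" for j
      using a[rule_format, of "m + j"] that Y by (simp add: top_def)
    moreover have "hash N (c q) x = 0" if "q < k" for q
      using a[rule_format, of "m + N + q"] that Y k by (simp add: top_def)
    moreover have "1 + bt x e = 0"
      using a[rule_format, of "m + 2 * N + 1"] Y k by (simp add: top_def)
    then have "bt x e = 1" by (metis bit_add_eq_0_iff)
    ultimately show "x \<in> Sols \<and> (\<forall>q<k. hash N (c q) x = 0) \<and> bt x e = 1"
      using x by (auto simp: Sols_def solved_def)
  next
    assume a: "x \<in> Sols \<and> (\<forall>q<k. hash N (c q) x = 0) \<and> bt x e = 1"
    then have "pe (E ! q) x = 0" if "q < m" for q using that by (simp add: Sols_def solved_def)
    with a show "\<forall>q<Y. top k e c q x = 0" by (auto simp: top_def Sols_def)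
  qed
  then show ?thesis by (simp add: sol_ind_eq)
qed

lemma deg_pe:
  assumes "is_anf d n P"
  shows "deg N d (pe P)"
proof -
  have "deg N d (\<lambda>x. \<Prod>i\<leftarrow>M. bt x i)" if "M \<in> set P" for M
  proof -
    have M: "sorted_wrt (<) M" "set M \<subseteq> {..<n}" "length M \<le> d" using assms that by (auto simp: is_anf_def)
    then have dist: "distinct M" by (simp add: strict_sorted_iff)
    then have "(\<Prod>i\<leftarrow>M. bt x i) = (\<Prod>i\<in>set M. bt x i)" for x
      by (simp add: prod.distinct_set_conv_list)
    moreover have "set M \<subseteq> {..<N}" using M(2) ns by auto
    moreover have "card (set M) \<le> d" using M(3) dist by (simp add: distinct_card)
    ultimately show ?thesis using deg_mono[of "set M" N d] by simp
  qed
  then have "deg N d (\<lambda>x. \<Sum>M\<leftarrow>P. \<Prod>i\<leftarrow>M. bt x i)" by (rule deg_sum_list)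
  then show ?thesis by (simp add: pe_def[abs_def])
qed

text \<open>The added equations are affine, so the degree stays \<open>d\<close>.\<close>

lemma deg_top:
  assumes "e < N"
  shows "deg N d (top k e c q)"
proof -
  have "deg N d (hash N r)" for r
    unfolding hash_def[abs_def] using d by (intro deg_add deg_sum deg_smult deg_const deg_bt) auto
  moreover have "deg N d (pe (E ! q))" if "q < m"
    using E that by (intro deg_pe) (auto simp: poly_system_def)
  moreover have "deg N d (\<lambda>x. bt x j)" if "j < N" for j using that d by (intro deg_bt) auto
  moreover have "deg N d (\<lambda>x. 1 + bt x e)" using assms d by (intro deg_add deg_one deg_bt) auto
  moreover have "top k e c q = (if q < m then pe (E ! q)
     else if q < m + N then (if n \<le> q - m then (\<lambda>x. bt x (q - m)) else (\<lambda>x. 0))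
     else if q < m + N + k then hash N (c (q - m - N))
     else if q = m + 2 * N + 1 then (\<lambda>x. 1 + bt x e) else (\<lambda>x. 0))"
    by (auto simp: top_def fun_eq_iff)
  ultimately show ?thesis by (auto intro: deg_zero)
qed

text \<open>The top system demands bit \<open>e\<close> to be 1, so beside the hashes it has the
  solution \<open>x\<close> if that bit is set, and none otherwise; the parity of 1 or 0 solutions
  is the bit itself.\<close>

lemma parity_isolated:
  assumes iso: "isolated N Sols k c x" and k: "k \<le> Suc N" and e: "e < N" and f: "faithful s Y C (top k e c)"
  shows "mpc d s Y C (top k e c) s 0 0 = bt x e"
proof -
  have x: "x < 2 ^ N" using iso by (auto simp: isolated_def Sols_def)
  have "mpc d s Y C (top k e c) s 0 0 = (\<Sum>y<2 ^ N. sol_ind (top k e c) Y y)"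
    by (rule mpc_parity[OF deg_top[OF e] _ f]) (use d in simp)
  also have "\<dots> = (\<Sum>y<2 ^ N. if y = x then bt x e else 0)"
  proof (rule sum.cong[OF refl])
    fix y :: nat
    assume "y \<in> {..<2 ^ N}"
    moreover have "y \<in> Sols \<and> (\<forall>q<k. hash N (c q) y = 0) \<longleftrightarrow> y = x"
      using iso by (auto simp: isolated_def)
    ultimately show "sol_ind (top k e c) Y y = (if y = x then bt x e else 0)"
      using top_solutions[OF _ k e, of y c] by (cases "bt x e" rule: bit_cases) auto
  qed
  also have "\<dots> = bt x e" using x by simp
  finally show ?thesis .
qed

definition lucky_at :: "nat \<Rightarrow> nat \<Rightarrow> bool" where
  "lucky_at p k \<longleftrightarrow> (\<exists>x. isolated N Sols k (A p s 0) x) \<and> (\<forall>i<N. faithful s Y (A p) (top k i (A p s 0)))"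

text \<open>The first two conclusions hold for all coins, namely soundness of a reported candidate
  and permanence of success; only the third relies on luck.\<close>

lemma tryC_correct:
  assumes t: "ctx t" and p: "lv t ''R'' = p" "p < Y" and k: "lv t ''k'' = k" "k \<le> Suc N"
    and F: "lv t ''F'' \<noteq> 0 \<Longrightarrow> solved (lv t ''X'')"
  defines "w \<equiv> run (solC d ;; asmC ;; checkC) t"
  shows "lv w ''F'' \<noteq> 0 \<Longrightarrow> solved (lv w ''X'')" "lv t ''F'' \<noteq> 0 \<Longrightarrow> lv w ''F'' \<noteq> 0"
    "lucky_at p k \<Longrightarrow> lv w ''F'' \<noteq> 0"
proof -
  define t1 where "t1 = run (solC d) t"
  define t2 where "t2 = run asmC t1"
  have c: "ctx t1" "ctx t2" unfolding t2_def t1_def by (intro ctx_run t; auto simp: params_def wtemps_def)+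
  have v: "lv t2 z = lv t z" if "z \<in> {''F'', ''X''}" for z
    unfolding t2_def t1_def using that by (auto simp: run_vars wtemps_def)
  have w: "w = run checkC t2" by (simp add: w_def t2_def t1_def)
  note C = checkC_correct[OF c(2)]
  show "lv w ''F'' \<noteq> 0 \<Longrightarrow> solved (lv w ''X'')" "lv t ''F'' \<noteq> 0 \<Longrightarrow> lv w ''F'' \<noteq> 0"
    unfolding w C using F v by (auto split: if_splits)
  assume L: "lucky_at p k"
  then obtain x where x: "isolated N Sols k (A p s 0) x" by (auto simp: lucky_at_def)
  then have xs: "x < 2 ^ N" "solved x" by (auto simp: isolated_def Sols_def)
  have "la t1 8 0 0 e = bval (bt x e)" if "e < N" for e
    unfolding t1_def using solC_correct[OF t p k that] parity_isolated[OF x k(2) that] L that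
    by (simp add: lucky_at_def)
  then have "lv t2 ''x'' = x" unfolding t2_def by (rule asmC_correct[OF c(1) xs(1)])
  then show "lv w ''F'' \<noteq> 0" unfolding w C using xs(2) by simp
qed

lemma searchC_correct:
  assumes t: "ctx t" and F: "lv t ''F'' = 0"
  defines "w \<equiv> run (searchC d) t"
  shows "lv w ''F'' \<noteq> 0 \<Longrightarrow> solved (lv w ''X'')"
    "\<exists>p<Y. lucky s Y Sols top (A p) \<Longrightarrow> lv w ''F'' \<noteq> 0"
proof -
  let ?c = "solC d ;; asmC ;; checkC"
  let ?b = "LFor ''k'' (LAdd (LV ''N'') (LC 2)) ?c"
  have lucky: "lucky s Y Sols top (A p) \<longleftrightarrow> (\<exists>k<N + 2. lucky_at p k)" for p
    by (auto simp: lucky_def lucky_at_def less_Suc_eq_le)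
  define I where "I p u \<longleftrightarrow> (lv u ''F'' \<noteq> 0 \<longrightarrow> solved (lv u ''X'')) \<and>
    ((\<exists>q<p. \<exists>k<N + 2. lucky_at q k) \<longrightarrow> lv u ''F'' \<noteq> 0)" for p and u :: lstate
  have "I Y w" unfolding w_def searchC_def
  proof (rule For_rule)
    show "lval (LV ''Y'') t = Y" using ctxD[OF t] by simp
    show "I 0 t" using F by (simp add: I_def)
    show "\<And>k t v. I k t \<Longrightarrow> I k (setv ''R'' v t)" by (simp add: I_def)
    fix p u
    assume p: "p < Y" and I: "I p u" and sm: "same (insert ''R'' (vars ?b)) (arrs ?b) t u" and pu: "lv u ''R'' = p"
    have u: "ctx u" by (rule ctx_same[OF t sm]) (auto simp: params_def wtemps_def)
    define J where "J k x \<longleftrightarrow> (lv x ''F'' \<noteq> 0 \<longrightarrow> solved (lv x ''X'')) \<and>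
      (lv u ''F'' \<noteq> 0 \<or> (\<exists>k'<k. lucky_at p k') \<longrightarrow> lv x ''F'' \<noteq> 0)" for k and x :: lstate
    have "J (N + 2) (run ?b u)"
    proof (rule For_rule)
      show "lval (LAdd (LV ''N'') (LC 2)) u = N + 2" using ctxD[OF u] by simp
      show "J 0 u" using I by (simp add: J_def I_def)
      show "\<And>k t v. J k t \<Longrightarrow> J k (setv ''k'' v t)" by (simp add: J_def)
      fix k x
      assume k: "k < N + 2" and J: "J k x" and smx: "same (insert ''k'' (vars ?c)) (arrs ?c) u x" and kx: "lv x ''k'' = k"
      have x: "ctx x" by (rule ctx_same[OF u smx]) (auto simp: params_def wtemps_def)
      have R: "lv x ''R'' = p" using same_lv[OF smx, of "''R''"] pu by (auto simp: wtemps_def)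
      note T = tryC_correct[OF x R p kx]
      show "J (Suc k) (run ?c x)" using T J k by (auto simp: J_def less_Suc_eq)
    qed
    then show "I (Suc p) (run ?b u)" using I by (auto simp: I_def J_def less_Suc_eq)
  qed
  then show "lv w ''F'' \<noteq> 0 \<Longrightarrow> solved (lv w ''X'')"
    "\<exists>p<Y. lucky s Y Sols top (A p) \<Longrightarrow> lv w ''F'' \<noteq> 0"
    unfolding lucky by (auto simp: I_def)
qed

lemma outC_correct:
  assumes t: "ctx t"
  shows "la (run outC t) 0 0 0 0 = lv t ''F''" "i < n \<Longrightarrow> la (run outC t) 0 0 0 (Suc i) = bval (bt (lv t ''X'') i)"
proof -
  let ?b = "sto1 0 (LAdd (LV ''i'') (LC 1)) (bitE (LV ''X'') (LV ''i''))"
  define t1 where "t1 = seta 0 0 0 0 (lv t ''F'') t"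
  \<comment> \<open>The first store overwrites the input in array 0 and thereby breaks
    \<open>ctx\<close>; from here on only variables and the powers of two in array 2 are
    read.\<close>
  have 1: "lv t1 = lv t" "la t1 2 = la t 2" "la t1 0 0 0 0 = lv t ''F''" by (auto simp: t1_def fun_eq_iff)
  define I where "I k w \<longleftrightarrow> la w 0 0 0 0 = lv t ''F'' \<and> (\<forall>i<k. la w 0 0 0 (Suc i) = bval (bt (lv t ''X'') i))"
    for k and w :: lstate
  have "I n (run (LFor ''i'' (LV ''n'') ?b) t1)"
  proof (rule For_rule)
    show "lval (LV ''n'') t1 = n" using ctxD[OF t] 1 by simp
    show "I 0 t1" using 1 by (simp add: I_def)
    show "\<And>k t v. I k t \<Longrightarrow> I k (setv ''i'' v t)" by (simp add: I_def)
    fix k w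
    assume k: "k < n" and I: "I k w" and sm: "same (insert ''i'' (vars ?b)) (arrs ?b) t1 w" and i: "lv w ''i'' = k"
    have "la w 2 = la t 2" "lv w ''X'' = lv t ''X''" "lv w ''N'' = N"
      using same_la[OF sm, of 2] same_lv[OF sm, of "''X''"] same_lv[OF sm, of "''N''"] 1 ctxD(4)[OF t] by auto
    moreover have "la t 2 0 k N = 2 ^ k"
      using ctxD(8)[OF t] k ns N_le_wlim by (simp add: nlow_pow)
    ultimately have "lval (bitE (LV ''X'') (LV ''i'')) w = bval (bt (lv t ''X'') k)"
      using i by (simp add: bitE_def pow2E_def bval_bt)
    then show "I (Suc k) (run ?b w)" using I i by (simp add: I_def less_Suc_eq)
  qed
  moreover have "run outC t = run (LFor ''i'' (LV ''n'') ?b) t1" by (simp add: outC_def t1_def)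
  ultimately show "la (run outC t) 0 0 0 0 = lv t ''F''" "i < n \<Longrightarrow> la (run outC t) 0 0 0 (Suc i) = bval (bt (lv t ''X'') i)"
    by (auto simp: I_def)
qed

text \<open>The second conclusion describes array 3 at every index, so that all its entries can be
  bounded by \<open>lmax d n\<close>; these entries are the round counts of the loops over
  \<open>''rk''\<close>.\<close>

lemma tableC_correct:
  assumes v: "lv t ''n'' = n" "lv t ''m'' = m" "lv t ''s'' = s" "lv t ''N'' = N"
     "lv t ''K'' = Y ^ s" "lv t ''Y'' = Y" "lv t ''Z'' = Z"
    and a0: "\<And>a. la t 0 0 0 a = inp a"
    and a1: "\<And>p l r q q'. p < Y \<Longrightarrow> l < Y \<Longrightarrow> r < Y \<Longrightarrow> q < Y \<Longrightarrow> q' < Y \<Longrightarrow>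
      la t 1 0 0 (cidx Y p l r q q') = bval (A p l r q q')"
  shows "ctx (run (tableC d) t)"
    and "la (run (tableC d) t) 3 a b c =
      (if a = 0 \<and> b = 0 \<and> c \<le> s then nlow (N - s * c) (wlim d s c) else la t 3 a b c)"
proof -
  let ?M = "wlim d s s"
  define V where "V = {''b'', ''w'', ''i'', ''l''}"
  define t1 where "t1 = setv ''b'' ?M t"
  define t2 where "t2 = run (LFor ''w'' (LAdd (LV ''b'') (LC 1)) (LSto 2 (LC 0) (LC 0) (LV ''w'') (LC 1))) t1"
  let ?i = "LSto 2 (LC 0) (LAdd (LV ''i'') (LC 1)) (LAdd (LV ''w'') (LC 1))
         (LMin (LAdd (LA 2 (LC 0) (LV ''i'') (LAdd (LV ''w'') (LC 1))) (LA 2 (LC 0) (LV ''i'') (LV ''w''))) (LV ''Z''))"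
  let ?b = "LSto 2 (LC 0) (LAdd (LV ''i'') (LC 1)) (LC 0) (LC 1) ;; LFor ''w'' (LV ''b'') ?i"
  define t3 where "t3 = run (LFor ''i'' (LV ''N'') ?b) t2"
  let ?l = "sto1 3 (LV ''l'') (LA 2 (LC 0) (dimE (LV ''l'')) (wlimE d (LV ''l'')))"
  define t4 where "t4 = run (LFor ''l'' (LAdd (LV ''s'') (LC 1)) ?l) t3"
  have run0: "run (tableC d) t = setv ''S'' (lval (pow2E (LV ''s'')) t4) t4"
    unfolding tableC_def t4_def t3_def t2_def t1_def using v(3)
    by (simp only: run.simps(1,3) wlimE_def lval.simps wlim_def)
  have s1: "same V {2} t t1" unfolding t1_def V_def by (intro same_setv same_refl) simp
  have s2: "same V {2} t t2" unfolding t2_def by (rule same_run[OF _ _ s1]) (auto simp: V_def)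
  have s3: "same V {2} t t3" unfolding t3_def by (rule same_run[OF _ _ s2]) (auto simp: V_def)
  have b1: "lv t1 ''b'' = ?M" by (simp add: t1_def)
  have 2: "\<forall>w<?M + 1. la t2 2 0 0 w = 1" unfolding t2_def
    by (rule For_rule[where I = "\<lambda>k u. \<forall>w<k. la u 2 0 0 w = 1"]) (auto simp: b1 less_Suc_eq)
  have b2: "lv t2 ''b'' = ?M" unfolding t2_def using b1 by (subst run_vars) auto
  have 3: "\<forall>i\<le>N. \<forall>w\<le>?M. la t3 2 0 i w = nlow i w" unfolding t3_def
  proof (rule For_rule[where I = "\<lambda>k u. \<forall>i\<le>k. \<forall>w\<le>?M. la u 2 0 i w = nlow i w"])
    show "lval (LV ''N'') t2 = N" using same_lv[OF s2, of "''N''"] v by (simp add: V_def)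
    show "\<forall>i\<le>0. \<forall>w\<le>?M. la t2 2 0 i w = nlow i w" using 2 by simp
    fix k u
    assume k: "k < N" and I: "\<forall>i\<le>k. \<forall>w\<le>?M. la u 2 0 i w = nlow i w"
      and sm: "same (insert ''i'' (vars ?b)) (arrs ?b) t2 u" and i: "lv u ''i'' = k"
    have vu: "lv u ''b'' = ?M" "lv u ''Z'' = Z"
      using same_lv[OF sm, of "''b''"] same_lv[OF sm, of "''Z''"] b2 same_lv[OF s2, of "''Z''"] v by (auto simp: V_def)
    define u1 where "u1 = seta 2 0 (Suc k) 0 1 u"
    have "(\<forall>w\<le>?M. la (run (LFor ''w'' (LV ''b'') ?i) u1) 2 0 (Suc k) w = nlow (Suc k) w) \<and>
      (\<forall>i\<le>k. \<forall>w\<le>?M. la (run (LFor ''w'' (LV ''b'') ?i) u1) 2 0 i w = nlow i w)"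
    proof (rule For_rule[where I = "\<lambda>j x. (\<forall>w\<le>j. la x 2 0 (Suc k) w = nlow (Suc k) w) \<and> (\<forall>i\<le>k. \<forall>w\<le>?M. la x 2 0 i w = nlow i w)"])
      show "lval (LV ''b'') u1 = ?M" using vu by (simp add: u1_def)
      show "(\<forall>w\<le>0. la u1 2 0 (Suc k) w = nlow (Suc k) w) \<and> (\<forall>i\<le>k. \<forall>w\<le>?M. la u1 2 0 i w = nlow i w)"
        using I by (simp add: u1_def)
      fix j x
      assume j: "j < ?M" and J: "(\<forall>w\<le>j. la x 2 0 (Suc k) w = nlow (Suc k) w) \<and> (\<forall>i\<le>k. \<forall>w\<le>?M. la x 2 0 i w = nlow i w)"
        and smx: "same (insert ''w'' (vars ?i)) (arrs ?i) u1 x" and w: "lv x ''w'' = j"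
      have vx: "lv x ''i'' = k" "lv x ''Z'' = Z"
        using same_lv[OF smx, of "''i''"] same_lv[OF smx, of "''Z''"] i vu by (auto simp: u1_def)
      have "nlow (Suc k) (Suc j) \<le> 2 ^ Suc k" by (rule nlow_le)
      also have "(2::nat) ^ Suc k \<le> 2 ^ N" using k by (intro power_increasing) auto
      finally have "nlow k (Suc j) + nlow k j \<le> Z" using Z(1) by simp
      then have "run ?i x = seta 2 0 (Suc k) (Suc j) (nlow (Suc k) (Suc j)) x"
        using vx w J j by simp
      then show "(\<forall>w\<le>Suc j. la (run ?i x) 2 0 (Suc k) w = nlow (Suc k) w) \<and> (\<forall>i\<le>k. \<forall>w\<le>?M. la (run ?i x) 2 0 i w = nlow i w)"
        using J by (auto simp: le_Suc_eq simp del: nlow.simps run.simps)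
    qed auto
    moreover have "run ?b u = run (LFor ''w'' (LV ''b'') ?i) u1"
      using i by (simp add: u1_def)
    ultimately show "\<forall>i\<le>Suc k. \<forall>w\<le>?M. la (run ?b u) 2 0 i w = nlow i w"
      by (simp add: le_Suc_eq del: nlow.simps run.simps)
  qed auto
  have a3: "la t3 3 = la t 3" using same_la[OF s3, of 3] by simp
  have 4: "\<forall>a b l. la t4 3 a b l =
      (if a = 0 \<and> b = 0 \<and> l < s + 1 then nlow (N - s * l) (wlim d s l) else la t 3 a b l)" unfolding t4_def
  proof (rule For_rule[where I = "\<lambda>k u. \<forall>a b l. la u 3 a b l =
      (if a = 0 \<and> b = 0 \<and> l < k then nlow (N - s * l) (wlim d s l) else la t 3 a b l)"])
    show "lval (LAdd (LV ''s'') (LC 1)) t3 = s + 1" using same_lv[OF s3, of "''s''"] v by (simp add: V_def)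
    fix k u
    assume k: "k < s + 1" and I: "\<forall>a b l. la u 3 a b l =
      (if a = 0 \<and> b = 0 \<and> l < k then nlow (N - s * l) (wlim d s l) else la t 3 a b l)"
      and sm: "same (insert ''l'' (vars ?l)) (arrs ?l) t3 u" and l: "lv u ''l'' = k"
    have vu: "lv u ''s'' = s" "lv u ''N'' = N" "la u 2 = la t3 2"
      using same_lv[OF sm, of "''s''"] same_lv[OF sm, of "''N''"] same_la[OF sm, of 2]
        same_lv[OF s3, of "''s''"] same_lv[OF s3, of "''N''"] v by (auto simp: V_def)
    have "la u 2 0 (N - s * k) (wlim d s k) = nlow (N - s * k) (wlim d s k)"
      using 3 wlim_le[of k] k vu by simp
    then have rn: "run ?l u = seta 3 0 0 k (nlow (N - s * k) (wlim d s k)) u"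
      using vu l by (simp add: dimE_def wlimE_def wlim_def)
    show "\<forall>a b l. la (run ?l u) 3 a b l =
      (if a = 0 \<and> b = 0 \<and> l < Suc k then nlow (N - s * l) (wlim d s l) else la t 3 a b l)"
      unfolding rn using I by (simp add: less_Suc_eq)
  qed (auto simp: a3)
  have s4: "same V {2, 3} t t4" unfolding t4_def
    by (rule same_run) (use s3 in \<open>auto simp: V_def same_def\<close>)
  have a2: "la t4 2 = la t3 2" unfolding t4_def by (subst run_arrs) auto
  have vp: "lv t4 x = lv t x" if "x \<in> params" for x using same_lv[OF s4, of x] that by (auto simp: V_def params_def)
  have "lval (pow2E (LV ''s'')) t4 = la t3 2 0 s N"
    using vp v a2 by (simp add: pow2E_def params_def)
  also have "\<dots> = 2 ^ s" using 3 s_le_N[OF s] N_le_wlim by (simp add: nlow_pow)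
  finally have run: "run (tableC d) t = setv ''S'' (2 ^ s) t4" unfolding run0 by simp
  show "la (run (tableC d) t) 3 a b c =
      (if a = 0 \<and> b = 0 \<and> c \<le> s then nlow (N - s * c) (wlim d s c) else la t 3 a b c)"
    unfolding run using 4 by (simp add: less_Suc_eq_le)
  note vp
  moreover have "la t4 0 = la t 0" "la t4 1 = la t 1" using same_la[OF s4, of 0] same_la[OF s4, of 1] by auto
  ultimately show "ctx (run (tableC d) t)" unfolding run ctx_def using v a0 a1 a2 3 4
    by (simp add: params_def less_Suc_eq_le)
qed

lemma setupC_correct:
  assumes least: "\<And>j. 1 \<le> j \<Longrightarrow> j < s \<Longrightarrow> j * j < n" and nY: "Suc n < Y" and KZ: "Y ^ s \<le> Z"
    and v: "lv t ''Y'' = Y" "lv t ''Z'' = Z"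
    and a0: "\<And>a. la t 0 0 0 a = inp a"
    and a1: "\<And>p l r q q'. p < Y \<Longrightarrow> l < Y \<Longrightarrow> r < Y \<Longrightarrow> q < Y \<Longrightarrow> q' < Y \<Longrightarrow>
      la t 1 0 0 (cidx Y p l r q q') = bval (A p l r q q')"
  shows "ctx (run (setupC d) t)" "lv (run (setupC d) t) ''F'' = lv t ''F''"
    "la (run (setupC d) t) 3 a b c =
      (if a = 0 \<and> b = 0 \<and> c \<le> s then nlow (N - s * c) (wlim d s c) else la t 3 a b c)"
proof -
  define t1 where "t1 = setv ''s'' 1 (setv ''m'' m (setv ''n'' n t))"
  let ?b = "LIf (LSub (LV ''n'') (LMul (LV ''s'') (LV ''s'')))
       (LSet ''s'' (LMin (LAdd (LV ''s'') (LC 1)) (LV ''Y''))) skip"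
  define t2 where "t2 = run (LFor ''i'' (LV ''n'') ?b) t1"
  define t3 where "t3 = setv ''K'' 1 (setv ''N'' N t2)"
  let ?c = "LSet ''K'' (LMin (LMul (LV ''K'') (LV ''Y'')) (LV ''Z''))"
  define t4 where "t4 = run (LFor ''i'' (LV ''s'') ?c) t3"
  have e: "encode n E ! 0 = n" "encode n E ! 1 = m" "2 \<le> length (encode n E)"
    by (simp_all add: encode_def)
  then have inp: "inp 0 = n" "inp 1 = m" by (auto simp: inp_def)
  \<comment> \<open>After \<open>k\<close> rounds the search has stopped at the least root or stands
    at \<open>Suc k\<close>; for \<open>k = n\<close> the second value is already large
    enough.\<close>
  define P where "P k r \<longleftrightarrow> 1 \<le> r \<and> r \<le> Suc k \<and> (\<forall>j. 1 \<le> j \<longrightarrow> j < r \<longrightarrow> j * j < n) \<and>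
    (n \<le> r * r \<or> r = Suc k)" for k r
  have I2: "P n (lv t2 ''s'')" unfolding t2_def
  proof (rule For_rule[where I = "\<lambda>k u. P k (lv u ''s'')"])
    show "lval (LV ''n'') t1 = n" by (simp add: t1_def)
    show "P 0 (lv t1 ''s'')" by (simp add: t1_def P_def)
    fix k u
    assume k: "k < n" and I: "P k (lv u ''s'')" and sm: "same (insert ''i'' (vars ?b)) (arrs ?b) t1 u"
    have vu: "lv u ''n'' = n" "lv u ''Y'' = Y"
      using same_lv[OF sm, of "''n''"] same_lv[OF sm, of "''Y''"] v by (auto simp: t1_def)
    show "P (Suc k) (lv (run ?b u) ''s'')"
    proof (cases "n \<le> lv u ''s'' * lv u ''s''")
      case True
      then have "run ?b u = setv ''o'' 0 u" using vu by (simp add: skip_def)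
      then show ?thesis using I True by (simp add: P_def)
    next
      case False
      have "min (Suc (lv u ''s'')) Y = Suc (lv u ''s'')" using I k nY by (simp add: P_def)
      then have "run ?b u = setv ''s'' (Suc (lv u ''s'')) u" using vu False by simp
      then show ?thesis using I False by (auto simp: P_def less_Suc_eq)
    qed
  qed auto
  have ss: "lv t2 ''s'' = s"
  proof (rule ccontr)
    assume "lv t2 ''s'' \<noteq> s"
    then consider "lv t2 ''s'' < s" | "s < lv t2 ''s''" by linarith
    then show False
    proof cases
      case 1
      then have "lv t2 ''s'' * lv t2 ''s'' < n" using least I2 by (simp add: P_def)
      moreover from this I2 have "lv t2 ''s'' = Suc n" by (auto simp: P_def)
      ultimately show False by simp
    next
      case 2
      then have "s * s < n" using I2 s by (simp add: P_def)
      then show False using ns by simp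
    qed
  qed
  have s2: "lv t2 x = lv t1 x" if "x \<notin> {''i'', ''s'', ''o''}" for x
    unfolding t2_def using that by (intro run_vars) auto
  have la2: "la t2 = la t" unfolding t2_def using run_arrs[of _ "LFor ''i'' (LV ''n'') ?b" t1]
    by (auto simp: t1_def fun_eq_iff)
  have "N \<le> 2 ^ N" by (rule less_imp_le) (rule less_exp)
  then have NZ: "min N Z = N" using Z(1) by linarith
  have Z2: "lv t2 ''Z'' = Z" using s2[of "''Z''"] v by (simp add: t1_def)
  have K: "lv t4 ''K'' = Y ^ s" unfolding t4_def
  proof (rule For_rule[where I = "\<lambda>k u. lv u ''K'' = Y ^ k"])
    show "lval (LV ''s'') t3 = s" using ss by (simp add: t3_def)
    show "lv t3 ''K'' = Y ^ 0" by (simp add: t3_def)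
    fix k u
    assume k: "k < s" and I: "lv u ''K'' = Y ^ k" and sm: "same (insert ''i'' (vars ?c)) (arrs ?c) t3 u"
    have vu: "lv u ''Y'' = Y" "lv u ''Z'' = Z"
      using same_lv[OF sm, of "''Y''"] same_lv[OF sm, of "''Z''"] v s2[of "''Y''"] Z2 by (auto simp: t3_def t1_def)
    have "Y ^ Suc k \<le> Y ^ s" using k sY(3) by (intro power_increasing) auto
    then have "min (Y ^ k * Y) Z = Y ^ Suc k" using KZ by (simp add: mult.commute)
    then show "lv (run ?c u) ''K'' = Y ^ Suc k" using I vu by simp
  qed auto
  have s4: "lv t4 x = lv t3 x" if "x \<notin> {''i'', ''K''}" for x
    unfolding t4_def using that by (intro run_vars) auto
  have la4: "la t4 = la t" unfolding t4_def using run_arrs[of _ "LFor ''i'' (LV ''s'') ?c" t3] la2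
    by (auto simp: t3_def fun_eq_iff)
  have run: "run (setupC d) t = run (tableC d) t4"
  proof -
    have "run (setupC d) t = run (tableC d) (run (LFor ''i'' (LV ''s'') ?c) (setv ''K'' 1
        (setv ''N'' (min (lv t2 ''s'' * lv t2 ''s'') (lv t2 ''Z'')) t2)))"
      unfolding setupC_def t2_def t1_def using a0 inp by (simp add: inE_def del: run.simps(5))
    then show ?thesis unfolding ss Z2 NZ t4_def t3_def .
  qed
  have v4: "lv t4 ''n'' = n" "lv t4 ''m'' = m" "lv t4 ''s'' = s" "lv t4 ''N'' = N"
     "lv t4 ''Y'' = Y" "lv t4 ''Z'' = Z" "lv t4 ''F'' = lv t ''F''"
    using s4 s2 ss Z2 v by (auto simp: t3_def t1_def)
  show "ctx (run (setupC d) t)" unfolding run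
    by (rule tableC_correct(1)) (use v4 K la4 a0 a1 in simp_all)
  show "la (run (setupC d) t) 3 a b c =
      (if a = 0 \<and> b = 0 \<and> c \<le> s then nlow (N - s * c) (wlim d s c) else la t 3 a b c)"
    unfolding run la4[symmetric] by (rule tableC_correct(2)) (use v4 K la4 a0 a1 in simp_all)
  show "lv (run (setupC d) t) ''F'' = lv t ''F''" unfolding run
    using run_vars[of "''F''" "tableC d" t4] v4 by (simp add: tableC_def)
qed

end

subsection \<open>Static bounds of the program\<close>

text \<open>
  The loops over \<open>rk\<close>, \<open>i\<close> and \<open>v\<close> are the only ones that are not polynomially bounded.
\<close>

definition wgt :: "nat \<Rightarrow> nat \<Rightarrow> nat \<Rightarrow> string \<Rightarrow> nat" where
  "wgt L K S x = (if x = ''rk'' then L else if x = ''i'' then K else if x = ''v'' then S else 1)"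

primrec small :: "(string \<Rightarrow> nat) \<Rightarrow> (nat \<Rightarrow> nat) \<Rightarrow> nat \<Rightarrow> (string \<Rightarrow> nat) \<Rightarrow> lcom \<Rightarrow> bool" where
  "small \<beta> \<gamma> P g (LSet x e) \<longleftrightarrow> esize e + 2 \<le> P"
| "small \<beta> \<gamma> P g (LSto k a b c e) \<longleftrightarrow> esize a + esize b + esize c + esize e + 20 \<le> P"
| "small \<beta> \<gamma> P g (LSeq c c') \<longleftrightarrow> small \<beta> \<gamma> P g c \<and> small \<beta> \<gamma> P g c'"
| "small \<beta> \<gamma> P g (LIf e c c') \<longleftrightarrow> 1 + esize e \<le> P \<and> small \<beta> \<gamma> P g c \<and> small \<beta> \<gamma> P g c'"
| "small \<beta> \<gamma> P g (LFor x e c) \<longleftrightarrow> esize e + 10 \<le> P \<and> bnd \<beta> \<gamma> e \<le> P * g x \<and> small \<beta> \<gamma> P g c"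

primrec pdeg :: "lcom \<Rightarrow> nat" where
  "pdeg (LSet x e) = 1"
| "pdeg (LSto k a b c e) = 1"
| "pdeg (LSeq c c') = Suc (max (pdeg c) (pdeg c'))"
| "pdeg (LIf e c c') = Suc (Suc (max (pdeg c) (pdeg c')))"
| "pdeg (LFor x e c) = Suc (Suc (pdeg c))"

primrec nest :: "string \<Rightarrow> lcom \<Rightarrow> nat" where
  "nest v (LSet x e) = 0"
| "nest v (LSto k a b c e) = 0"
| "nest v (LSeq c c') = max (nest v c) (nest v c')"
| "nest v (LIf e c c') = max (nest v c) (nest v c')"
| "nest v (LFor x e c) = (if x = v then 1 else 0) + nest v c"

definition vol :: "nat \<Rightarrow> nat \<Rightarrow> nat \<Rightarrow> lcom \<Rightarrow> nat" where
  "vol L K S c = L ^ nest ''rk'' c * K ^ nest ''i'' c * S ^ nest ''v'' c"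

lemma pdeg_pos: "1 \<le> pdeg c"
  by (induction c) auto

lemma vol_mono:
  assumes "1 \<le> L" "1 \<le> K" "1 \<le> S" "nest ''rk'' c \<le> nest ''rk'' c'" "nest ''i'' c \<le> nest ''i'' c'"
    "nest ''v'' c \<le> nest ''v'' c'"
  shows "vol L K S c \<le> vol L K S c'"
  unfolding vol_def using assms by (intro mult_le_mono power_increasing) auto

lemma vol_For: "vol L K S (LFor x e c) = wgt L K S x * vol L K S c"
  by (auto simp: vol_def wgt_def)

text \<open>A loop multiplies the cost by at most \<open>P\<close> times the weight of its counter,
  so the three heavy counters end up in \<open>vol\<close> with their nesting depth and everything
  else in a power of \<open>P\<close>. A sequence takes the larger volume and pays for adding two
  costs with one more factor \<open>P\<close>.\<close>

lemma steps_le: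
  assumes "12 \<le> P" "1 \<le> L" "1 \<le> K" "1 \<le> S" "small \<beta> \<gamma> P (wgt L K S) c"
  shows "steps \<beta> \<gamma> c \<le> P ^ pdeg c * vol L K S c"
  using assms(5)
proof (induction c)
  have V: "1 \<le> vol L K S c" for c unfolding vol_def using assms(2-4) by (simp add: Suc_le_eq)
  have two: "P ^ a * x + P ^ b * x \<le> P ^ Suc (max a b) * x" for a b x
  proof -
    have "P ^ a \<le> P ^ max a b" "P ^ b \<le> P ^ max a b" using assms(1) by (auto intro: power_increasing)
    then have "P ^ a * x + P ^ b * x \<le> P ^ max a b * x + P ^ max a b * x" by (intro add_mono mult_le_mono) auto
    also have "\<dots> = 2 * (P ^ max a b * x)" by simp
    also have "\<dots> \<le> P * (P ^ max a b * x)" using assms(1) by (intro mult_le_mono) auto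
    finally show ?thesis by simp
  qed
  {
    case (LSet x e)
    then show ?case by (simp add: vol_def)
  next
    case (LSto k a b c e)
    then show ?case by (simp add: vol_def)
  next
    case (LSeq c c')
    let ?V = "vol L K S (LSeq c c')"
    have "vol L K S c \<le> ?V" "vol L K S c' \<le> ?V" by (rule vol_mono; use assms in auto)+
    then have "steps \<beta> \<gamma> c \<le> P ^ pdeg c * ?V" "steps \<beta> \<gamma> c' \<le> P ^ pdeg c' * ?V"
      using LSeq by (auto intro: order_trans[OF _ mult_le_mono2])
    then have "steps \<beta> \<gamma> (LSeq c c') \<le> P ^ pdeg c * ?V + P ^ pdeg c' * ?V" by simp
    also note two
    finally show ?case by simp
  next
    case (LIf e c c')
    let ?V = "vol L K S (LIf e c c')" and ?m = "max (pdeg c) (pdeg c')"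
    have "vol L K S c \<le> ?V" "vol L K S c' \<le> ?V" by (rule vol_mono; use assms in auto)+
    then have 1: "steps \<beta> \<gamma> c \<le> P ^ pdeg c * ?V" "steps \<beta> \<gamma> c' \<le> P ^ pdeg c' * ?V"
      using LIf by (auto intro: order_trans[OF _ mult_le_mono2])
    have "P ^ 1 \<le> P ^ Suc ?m" using assms(1) by (intro power_increasing) auto
    then have "P ^ 1 * 1 \<le> P ^ Suc ?m * ?V" by (rule mult_le_mono[OF _ V])
    then have "P \<le> P ^ Suc ?m * ?V" by (simp only: power_one_right mult_1_right)
    then have "1 + esize e \<le> P ^ Suc ?m * ?V" using LIf.prems by (simp del: power_Suc)
    then have "steps \<beta> \<gamma> (LIf e c c') \<le> P ^ Suc ?m * ?V + P ^ Suc ?m * ?V"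
      using 1 two[of "pdeg c" ?V "pdeg c'"] by simp
    also have "\<dots> = 2 * (P ^ Suc ?m * ?V)" by simp
    also have "\<dots> \<le> P * (P ^ Suc ?m * ?V)" using assms(1) by (intro mult_le_mono) auto
    finally show ?case by simp
  next
    case (LFor x e c)
    let ?V = "vol L K S c" and ?w = "wgt L K S x" and ?a = "P ^ pdeg c"
    have w: "1 \<le> ?w" using assms by (simp add: wgt_def)
    have "P ^ 1 \<le> ?a" using assms(1) pdeg_pos by (intro power_increasing) auto
    then have "P * 1 \<le> ?a * ?V" using mult_le_mono[OF _ V] by simp
    then have aV: "P \<le> ?a * ?V" by simp
    have "steps \<beta> \<gamma> c + 12 \<le> 2 * (?a * ?V)" using LFor aV assms(1) by simp
    then have "bnd \<beta> \<gamma> e * (steps \<beta> \<gamma> c + 12) \<le> (P * ?w) * (2 * (?a * ?V))"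
      using LFor.prems by (intro mult_le_mono) auto
    also have "\<dots> = 2 * (P * (?w * (?a * ?V)))" by simp
    finally have 1: "bnd \<beta> \<gamma> e * (steps \<beta> \<gamma> c + 12) \<le> 2 * (P * (?w * (?a * ?V)))" .
    have "1 * P \<le> ?w * (?a * ?V)" by (rule mult_le_mono[OF w aV])
    also have "\<dots> \<le> P * (?w * (?a * ?V))" using assms(1) by (cases P) auto
    finally have "1 * P \<le> P * (?w * (?a * ?V))" .
    moreover have "esize e + 10 \<le> P" using LFor.prems by simp
    ultimately have "esize e + 10 \<le> P * (?w * (?a * ?V))" by linarith
    then have "steps \<beta> \<gamma> (LFor x e c) \<le> 3 * (P * (?w * (?a * ?V)))" using 1 by simp
    also have "\<dots> \<le> P * (P * (?w * (?a * ?V)))" using assms(1) by (intro mult_le_mono) auto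
    finally show ?case unfolding vol_For by (simp add: mult_ac)
  }
qed

section \<open>Static size conditions on expressions and assignments\<close>

primrec edeg :: "lexp \<Rightarrow> nat" where
  "edeg (LC k) = 1"
| "edeg (LV x) = 1"
| "edeg (LA k a b c) = max 1 (max (edeg a) (max (edeg b) (edeg c)))"
| "edeg (LAdd a b) = Suc (max (edeg a) (edeg b))"
| "edeg (LSub a b) = max (edeg a) (edeg b)"
| "edeg (LMul a b) = edeg a + edeg b"
| "edeg (LDiv a b) = max (edeg a) (edeg b)"
| "edeg (LMin a b) = max (edeg a) (edeg b)"
| "edeg (LMod2 a) = max 1 (edeg a)"

primrec cmax :: "lexp \<Rightarrow> nat" where
  "cmax (LC k) = k"
| "cmax (LV x) = 0"
| "cmax (LA k a b c) = max k (max (cmax a) (max (cmax b) (cmax c)))"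
| "cmax (LAdd a b) = max (cmax a) (cmax b)"
| "cmax (LSub a b) = max (cmax a) (cmax b)"
| "cmax (LMul a b) = max (cmax a) (cmax b)"
| "cmax (LDiv a b) = max (cmax a) (cmax b)"
| "cmax (LMin a b) = max (cmax a) (cmax b)"
| "cmax (LMod2 a) = cmax a"

lemma bnd_le_edeg:
  assumes "\<And>x. \<beta> x \<le> Z" "\<And>k. \<gamma> k \<le> Z" "2 \<le> Z" "cmax e \<le> Z"
  shows "bnd \<beta> \<gamma> e \<le> Z ^ edeg e"
  using assms(4)
proof (induction e)
  have up: "x \<le> Z ^ b" if "x \<le> Z ^ a" "a \<le> b" for a b x
    using that assms(3) by (meson le_trans one_le_numeral order_trans power_increasing)
  {
    case (LA k a b c)
    have "Z ^ 1 \<le> Z ^ edeg (LA k a b c)" using assms(3) by (intro power_increasing) auto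
    then show ?case using assms(2)[of k] by simp
  next
    case (LAdd a b)
    let ?m = "max (edeg a) (edeg b)"
    have "bnd \<beta> \<gamma> a \<le> Z ^ ?m" "bnd \<beta> \<gamma> b \<le> Z ^ ?m" using LAdd by (auto intro: up)
    then have "bnd \<beta> \<gamma> (LAdd a b) \<le> 2 * Z ^ ?m" by simp
    also have "\<dots> \<le> Z * Z ^ ?m" using assms(3) by (intro mult_le_mono) auto
    finally show ?case by simp
  next
    case (LMul a b)
    then show ?case by (simp add: power_add mult_le_mono)
  next
    case (LMin a b)
    then show ?case using up[of "bnd \<beta> \<gamma> a" "edeg a" "max (edeg a) (edeg b)"] by (auto intro: min.coboundedI1)
  next
    case (LMod2 a)
    have "1 \<le> Z ^ edeg (LMod2 a)" using assms(3) by simp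
    then show ?case by simp
  }
qed (use assms in \<open>auto intro: order_trans[OF _ power_increasing[OF max.cobounded1]]\<close>)

lemma safe_exp_edeg:
  assumes "\<And>x. \<beta> x \<le> Z" "\<And>k. \<gamma> k \<le> Z" "2 \<le> Z" "cmax e \<le> Z" "edeg e \<le> D" "1 \<le> D"
  shows "safe_exp \<beta> \<gamma> (Z ^ D) e"
  using assms(4,5)
proof (induction e)
  have ZD: "Z ^ 1 \<le> Z ^ D" using assms(3,6) by (intro power_increasing) auto
  have le: "bnd \<beta> \<gamma> e \<le> Z ^ D" if "cmax e \<le> Z" "edeg e \<le> D" for e
  proof -
    have "bnd \<beta> \<gamma> e \<le> Z ^ edeg e" by (rule bnd_le_edeg) (use assms that in auto)
    also have "\<dots> \<le> Z ^ D" using assms(3) that by (intro power_increasing) auto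
    finally show ?thesis .
  qed
  have Z: "x \<le> Z ^ D" if "x \<le> Z" for x using ZD that by simp
  {
    case (LC k) then show ?case by (auto intro: Z)
  next
    case (LV x) then show ?case by (auto intro: Z assms)
  next
    case (LA k a b c) then show ?case by (auto intro: Z assms)
  next
    case (LAdd a b) then show ?case using le[of "LAdd a b"] by auto
  next
    case (LSub a b) then show ?case by auto
  next
    case (LMul a b) then show ?case using le[of "LMul a b"] by auto
  next
    case (LDiv a b) then show ?case by auto
  next
    case (LMin a b) then show ?case by auto
  next
    case (LMod2 a) then show ?case using assms(3) by (auto intro: Z)
  }
qed

primrec exprs :: "(lexp \<Rightarrow> bool) \<Rightarrow> lcom \<Rightarrow> bool" where
  "exprs p (LSet x e) \<longleftrightarrow> p e"
| "exprs p (LSto k a b c e) \<longleftrightarrow> p (LA k a b c) \<and> p e"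
| "exprs p (LSeq c c') \<longleftrightarrow> exprs p c \<and> exprs p c'"
| "exprs p (LIf e c c') \<longleftrightarrow> p e \<and> exprs p c \<and> exprs p c'"
| "exprs p (LFor x e c) \<longleftrightarrow> p e \<and> exprs p c"

primrec keeps :: "(string \<Rightarrow> nat) \<Rightarrow> (nat \<Rightarrow> nat) \<Rightarrow> lcom \<Rightarrow> bool" where
  "keeps \<beta> \<gamma> (LSet x e) \<longleftrightarrow> bnd \<beta> \<gamma> e \<le> \<beta> x"
| "keeps \<beta> \<gamma> (LSto k a b c e) \<longleftrightarrow> bnd \<beta> \<gamma> e \<le> \<gamma> k"
| "keeps \<beta> \<gamma> (LSeq c c') \<longleftrightarrow> keeps \<beta> \<gamma> c \<and> keeps \<beta> \<gamma> c'"
| "keeps \<beta> \<gamma> (LIf e c c') \<longleftrightarrow> keeps \<beta> \<gamma> c \<and> keeps \<beta> \<gamma> c'"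
| "keeps \<beta> \<gamma> (LFor x e c) \<longleftrightarrow> bnd \<beta> \<gamma> e \<le> \<beta> x \<and> x \<notin> vars c \<and> keeps \<beta> \<gamma> c"

text \<open>Splits \<open>safe\<close> into a purely syntactic size test (\<open>exprs\<close>) with
  a uniform bound \<open>Z ^ D\<close>, and the inequalities of \<open>keeps\<close>, where the
  individual bounds matter. The simplifier decides both on the program text.\<close>

lemma safe_if_keeps:
  assumes "\<And>x. \<beta> x \<le> Z" "\<And>k. \<gamma> k \<le> Z" "2 \<le> Z" "1 \<le> D"
    and "exprs (\<lambda>e. cmax e \<le> Z \<and> edeg e \<le> D) c" "keeps \<beta> \<gamma> c"
  shows "safe \<beta> \<gamma> (Z ^ D) c"
  using assms(5,6)
proof (induction c)
  have s: "safe_exp \<beta> \<gamma> (Z ^ D) e" if "cmax e \<le> Z" "edeg e \<le> D" for e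
    by (rule safe_exp_edeg) (use assms that in auto)
  {
    case (LSet x e) then show ?case by (auto intro: s)
  next
    case (LSto k a b c e)
    then have "safe_exp \<beta> \<gamma> (Z ^ D) (LA k a b c)" by (intro s) auto
    with LSto show ?case by (auto intro: s)
  next
    case (LSeq c c') then show ?case by auto
  next
    case (LIf e c c') then show ?case by (auto intro: s)
  next
    case (LFor x e c) then show ?case by (auto intro: s)
  }
qed

text \<open>Used with two instances: \<open>K = S = Z\<close> during setup, which is only just
  computing these values, and \<open>K = Y ^ s\<close>, \<open>S = 2 ^ s\<close> afterwards, when
  they bound the loops over \<open>''i''\<close> and \<open>''v''\<close>.\<close>

definition vb :: "nat \<Rightarrow> nat \<Rightarrow> nat \<Rightarrow> nat \<Rightarrow> string \<Rightarrow> nat" where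
  "vb Y Z K S x =
     (if x \<in> {''n'', ''m'', ''s'', ''Y'', ''g'', ''a'', ''R'', ''ll''} then Y
      else if x \<in> {''N'', ''mm''} then Y * Y
      else if x \<in> {''k'', ''t''} then Y * Y + 4
      else if x = ''l'' then Y + 1
      else if x = ''b'' then Y ^ 3
      else if x \<in> {''acc'', ''pr'', ''F'', ''ok''} then 1
      else if x = ''K'' then K else if x = ''S'' then S else Z)"

definition ab :: "nat \<Rightarrow> nat \<Rightarrow> nat \<Rightarrow> nat \<Rightarrow> nat" where
  "ab Y Z L k = (if k = 0 then Y else if k = 2 \<or> k = 7 then Z else if k = 3 then L else 1)"

lemma vb_simps [simp]:
  "vb Y Z K S ''n'' = Y" "vb Y Z K S ''m'' = Y" "vb Y Z K S ''s'' = Y" "vb Y Z K S ''Y'' = Y"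
  "vb Y Z K S ''g'' = Y" "vb Y Z K S ''a'' = Y" "vb Y Z K S ''R'' = Y" "vb Y Z K S ''ll'' = Y"
  "vb Y Z K S ''N'' = Y * Y" "vb Y Z K S ''mm'' = Y * Y" "vb Y Z K S ''k'' = Y * Y + 4"
  "vb Y Z K S ''t'' = Y * Y + 4" "vb Y Z K S ''l'' = Y + 1" "vb Y Z K S ''b'' = Y ^ 3"
  "vb Y Z K S ''acc'' = 1" "vb Y Z K S ''pr'' = 1" "vb Y Z K S ''F'' = 1" "vb Y Z K S ''ok'' = 1"
  "vb Y Z K S ''K'' = K" "vb Y Z K S ''S'' = S" "vb Y Z K S ''Z'' = Z"
  "vb Y Z K S ''rk'' = Z" "vb Y Z K S ''rr'' = Z" "vb Y Z K S ''w'' = Z" "vb Y Z K S ''h'' = Z"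
  "vb Y Z K S ''c'' = Z" "vb Y Z K S ''o'' = Z" "vb Y Z K S ''x'' = Z" "vb Y Z K S ''y'' = Z"
  "vb Y Z K S ''u'' = Z" "vb Y Z K S ''v'' = Z" "vb Y Z K S ''pt'' = Z" "vb Y Z K S ''f'' = Z"
  "vb Y Z K S ''j'' = Z" "vb Y Z K S ''q'' = Z" "vb Y Z K S ''i'' = Z" "vb Y Z K S ''pa'' = Z"
  "vb Y Z K S ''r'' = Z" "vb Y Z K S ''z'' = Z" "vb Y Z K S ''e'' = Z" "vb Y Z K S ''X'' = Z"
  by (simp_all add: vb_def)

lemma ab_simps [simp]:
  "ab Y Z L 0 = Y" "ab Y Z L (Suc 0) = 1" "ab Y Z L 1 = 1" "ab Y Z L 2 = Z" "ab Y Z L 3 = L" "ab Y Z L 4 = 1"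
  "ab Y Z L 5 = 1" "ab Y Z L 6 = 1" "ab Y Z L 7 = Z" "ab Y Z L 8 = 1"
  by (simp_all add: ab_def)

definition mainC :: "nat \<Rightarrow> lcom" where
  "mainC d = searchC d ;; outC"

lemmas program_defs = searchC_def solC_def asmC_def checkC_def mpcC_def levelC_def countC_def voteC_def
  extendC_def passC_def forD_def forW_def unrankC_def leavesC_def leafC_def sysC_def syslevC_def sysrowC_def
  topC_def clearC_def padC_def hashC_def evalC_def polyC_def termC_def nextC_def outC_def
  tableC_def setupC_def sto1_def skip_def

lemmas exp_defs = arr1_def pow2E_def bitE_def wlimE_def dimE_def inE_def coinE_def

text \<open>Decisive for the exponent: no two heavy loops of the same kind are nested, so the number
  of points enters the running time to the first power.\<close>

lemma nest_main: "nest ''rk'' (mainC d) = 1" "nest ''i'' (mainC d) = 1" "nest ''v'' (mainC d) = 1"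
  by (simp_all add: mainC_def program_defs)

text \<open>The addresses of coins, Horner forms as in \<open>cidx\<close>, have the largest
  \<open>edeg\<close>; 20 leaves room above them.\<close>

lemma mainC_exprs:
  assumes "8 \<le> Z" "4 * d \<le> Z"
  shows "exprs (\<lambda>e. cmax e \<le> Z \<and> edeg e \<le> 20) (mainC d)" "exprs (\<lambda>e. cmax e \<le> Z \<and> edeg e \<le> 20) (setupC d)"
  using assms by (simp_all add: mainC_def program_defs exp_defs)

context
  fixes d Y Z K S L :: nat
  assumes dY: "d * (Y * (Y + 2) + 4) \<le> Y ^ 3" and Y: "1000 \<le> Y" and Z: "Y ^ 3 + 4 \<le> Z"
    and LKS: "L \<le> Z" "K \<le> Z" "S \<le> Z" "1 \<le> L" "1 \<le> K" "1 \<le> S"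
begin

lemma bounds_arith:
  "Y \<le> Z" "Y * Y \<le> Z" "Y * Y + 4 \<le> Z" "Y + 4 \<le> Z" "Y * Y + 4 \<le> Y ^ 3" "Y * Y \<le> Y ^ 3" "Y * Y + 6 \<le> Y ^ 3"
  "(d - 1) * (Y * (Y + 2)) + 4 * d \<le> Z" "(d - 1) * (Y * (Y + 1)) + 4 * d \<le> Z" "4 * d \<le> Z"
  "(d - 1) * (Y * Y) + 4 * d \<le> Y ^ 3" "Y ^ 3 \<le> Z" "Suc (Y ^ 3) \<le> Z" "Y + 4 \<le> Y ^ 3" "1 \<le> Z" "Y \<le> Y ^ 3"
proof -
  have y2: "Y * 1000 \<le> Y * Y" using Y by (intro mult_le_mono) auto
  have y3: "Y * Y * 1000 \<le> Y ^ 3" using Y by (auto simp: power3_eq_cube intro!: mult_le_mono)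
  show "Y \<le> Z" "Y * Y \<le> Z" "Y * Y + 4 \<le> Z" "Y + 4 \<le> Z" "Y * Y + 4 \<le> Y ^ 3" "Y * Y \<le> Y ^ 3" "Y * Y + 6 \<le> Y ^ 3"
    "Y ^ 3 \<le> Z" "Suc (Y ^ 3) \<le> Z" "Y + 4 \<le> Y ^ 3" "1 \<le> Z" "Y \<le> Y ^ 3"
    using y2 y3 Y Z by linarith+
  have b: "(d - 1) * a + 4 * d \<le> Y ^ 3" if "a \<le> Y * (Y + 2)" for a
  proof -
    have "(d - 1) * a \<le> d * (Y * (Y + 2))" using that by (intro mult_le_mono) auto
    then show ?thesis using dY by (simp add: distrib_left)
  qed
  show "(d - 1) * (Y * (Y + 2)) + 4 * d \<le> Z" "(d - 1) * (Y * (Y + 1)) + 4 * d \<le> Z"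
    "(d - 1) * (Y * Y) + 4 * d \<le> Y ^ 3"
    using b[of "Y * (Y + 2)"] b[of "Y * (Y + 1)"] b[of "Y * Y"] Z by (auto simp: algebra_simps)
  show "4 * d \<le> Z" using b[of 0] Z by simp
qed

lemma vb_le: "vb Y Z K S x \<le> Z"
  using bounds_arith LKS by (simp add: vb_def)

lemma ab_le: "ab Y Z L k \<le> Z"
  using bounds_arith LKS by (simp add: ab_def)

lemma main_keeps: "keeps (vb Y Z K S) (ab Y Z L) (mainC d)"
  using bounds_arith LKS Y le_square[of Y, THEN trans_le_add1, of 4]
  by (simp add: mainC_def program_defs exp_defs wtemps_def min.coboundedI2 algebra_simps)

lemma setup_keeps: "keeps (vb Y Z Z Z) (ab Y Z Z) (setupC d)"
  using bounds_arith LKS Y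
  by (simp add: program_defs exp_defs min.coboundedI2 algebra_simps)

lemma main_small: "small (vb Y Z K S) (ab Y Z L) (Y ^ 3 + 1) (wgt L K S) (mainC d)"
  using bounds_arith LKS Y mult_le_mono[OF bounds_arith(16) LKS(5), THEN trans_le_add2, of K]
  by (simp add: mainC_def program_defs exp_defs wgt_def)

lemma setup_small: "small (vb Y Z Z Z) (ab Y Z Z) (Y ^ 3 + 1) (wgt 1 1 1) (setupC d)"
  using bounds_arith LKS Y
  by (simp add: program_defs exp_defs wgt_def)

end

subsection \<open>The machine program\<close>

definition up_sqrt :: "nat \<Rightarrow> nat" where
  "up_sqrt n = (LEAST s. 1 \<le> s \<and> n \<le> s * s)"

text \<open>Serves as number of votes, number of tries and bound on the number of equations. The
  factor \<open>(n + 32) ^ d\<close> makes room for the at most \<open>(n + 1) ^ d\<close> given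
  equations; the remaining square lets \<open>2 ^ yv d n\<close> exceed the union bound in
  \<open>failure_bound_small\<close>.\<close>

definition yv :: "nat \<Rightarrow> nat \<Rightarrow> nat" where
  "yv d n = (n + 32) ^ (d + 2)"

text \<open>
  No number that the program meets exceeds a fixed power of \<open>zv d n\<close>, whose bit length is
  polynomial in \<open>n\<close>.
\<close>

definition zv :: "nat \<Rightarrow> nat \<Rightarrow> nat" where
  "zv d n = 2 ^ (yv d n ^ 6)"

definition lmax :: "nat \<Rightarrow> nat \<Rightarrow> nat" where
  "lmax d n = Max ((\<lambda>l. nlow (up_sqrt n * up_sqrt n - up_sqrt n * l) (wlim d (up_sqrt n) l)) ` {..up_sqrt n})"

lemma up_sqrt: "1 \<le> up_sqrt n" "n \<le> up_sqrt n * up_sqrt n" "1 \<le> j \<Longrightarrow> j < up_sqrt n \<Longrightarrow> j * j < n"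
proof -
  have ex: "1 \<le> Suc n \<and> n \<le> Suc n * Suc n" by simp
  from LeastI[of "\<lambda>s. 1 \<le> s \<and> n \<le> s * s", OF ex] show "1 \<le> up_sqrt n" "n \<le> up_sqrt n * up_sqrt n"
    by (auto simp: up_sqrt_def)
  show "1 \<le> j \<Longrightarrow> j < up_sqrt n \<Longrightarrow> j * j < n"
    using not_less_Least[of j "\<lambda>s. 1 \<le> s \<and> n \<le> s * s"] by (auto simp: up_sqrt_def)
qed

lemma up_sqrt_sq_le: "up_sqrt n * up_sqrt n \<le> 3 * n + 1"
proof (cases "up_sqrt n = 1")
  case False
  then obtain j where j: "up_sqrt n = Suc j" "1 \<le> j" using up_sqrt(1)[of n] by (cases "up_sqrt n") auto
  have "j * j < n" by (rule up_sqrt(3)) (use j in auto)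
  moreover have "j \<le> j * j" using j by simp
  ultimately show ?thesis unfolding j mult_Suc mult_Suc_right by linarith
qed simp

lemma sum_choose_le: "(\<Sum>i\<le>d. n choose i) \<le> (n + 1) ^ d"
proof -
  have "(\<Sum>i\<le>d. n choose i) \<le> (\<Sum>i\<le>d. (d choose i) * n ^ i * 1 ^ (d - i))"
  proof (rule sum_mono)
    fix i
    assume i: "i \<in> {..d}"
    have "n choose i \<le> n ^ i" by (cases "i \<le> n") (auto simp: binomial_le_pow binomial_eq_0)
    moreover have "1 \<le> d choose i" using i by (simp add: Suc_le_eq)
    ultimately show "n choose i \<le> (d choose i) * n ^ i * 1 ^ (d - i)"
      using mult_le_mono[of 1 "d choose i" "n choose i" "n ^ i"] by simp
  qed
  also have "\<dots> = (n + 1) ^ d" using binomial_ring[of n "1 :: nat" d] by simp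
  finally show ?thesis .
qed

lemma yv_ge: "(n + 1) ^ d + 8 * (n + 16) \<le> yv d n"
proof -
  have "(n + 1) ^ d \<le> (n + 32) ^ d" by (rule power_mono) auto
  moreover have "8 * (n + 16) \<le> (n + 32) ^ d * (8 * (n + 16))" by simp
  moreover have "(n + 32) ^ d * (8 * (n + 16)) + (n + 32) ^ d \<le> (n + 32) ^ d * ((n + 32) * (n + 32))"
  proof -
    have "8 * (n + 16) + 1 \<le> (n + 32) * (n + 32)" by (simp add: algebra_simps)
    then have "(n + 32) ^ d * (8 * (n + 16) + 1) \<le> (n + 32) ^ d * ((n + 32) * (n + 32))"
      by (rule mult_le_mono2)
    then show ?thesis by (simp add: distrib_left)
  qed
  moreover have "(n + 32) ^ d * ((n + 32) * (n + 32)) = yv d n"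
    by (simp add: yv_def power_add power2_eq_square)
  ultimately show ?thesis by linarith
qed

lemma yv_big: "1000 \<le> yv d n" "d \<ge> 2 \<Longrightarrow> 2 * d \<le> yv d n" "yv d n > 0"
proof -
  show "yv d n > 0" by (simp add: yv_def)
  assume d: "d \<ge> 2"
  have "d < 2 ^ d" by (rule less_exp)
  then have "2 * d \<le> 2 * 2 ^ d + 2 * 2 ^ d" by linarith
  then have "2 * d \<le> 2 ^ (d + 2)" by (simp add: power_add)
  also have "\<dots> \<le> (n + 32) ^ (d + 2)" by (rule power_mono) auto
  finally show "2 * d \<le> yv d n" by (simp add: yv_def)
next
  have "(32::nat) ^ 2 \<le> (n + 32) ^ 2" by (rule power_mono) auto
  also have "\<dots> \<le> yv d n" unfolding yv_def by (rule power_increasing) auto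
  finally show "1000 \<le> yv d n" by simp
qed

text \<open>The monomials of a polynomial are distinct lists of length at most \<open>d\<close> over
  \<open>n\<close> variables, and there are at most \<open>(n + 1) ^ d\<close> of those.\<close>

lemma encode_length_bound:
  assumes E: "poly_system d n E"
  shows "length (encode n E) \<le> 2 + length E * (1 + (n + 1) ^ d * (d + 1))"
    and "x \<in> set (encode n E) \<Longrightarrow> x \<le> n + d + (n + 1) ^ d + length E"
proof -
  have mon: "length P \<le> (n + 1) ^ d" if "P \<in> set E" for P
  proof -
    have P: "distinct P" "set P \<subseteq> {M. set M \<subseteq> {..<n} \<and> length M \<le> d}"
      using E that by (auto simp: poly_system_def is_anf_def)
    have "length P = card (set P)" using P(1) by (simp add: distinct_card)
    also have "\<dots> \<le> card {M. set M \<subseteq> {..<n} \<and> length M \<le> d}"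
      by (rule card_mono[OF finite_lists_length_le P(2)]) simp
    also have "\<dots> = (\<Sum>i\<le>d. n ^ i)" by (subst card_lists_length_le) auto
    also have "\<dots> \<le> (\<Sum>i\<le>d. (d choose i) * n ^ i * 1 ^ (d - i))"
      by (rule sum_mono) (auto simp: Suc_le_eq)
    also have "\<dots> = (n + 1) ^ d" using binomial_ring[of n "1 :: nat" d] by simp
    finally show ?thesis .
  qed
  have M: "set M \<subseteq> {..<n} \<and> length M \<le> d" if "M \<in> set P" "P \<in> set E" for M P
    using E that by (auto simp: poly_system_def is_anf_def)
  have inner: "length (concat (map (\<lambda>M. length M # M) P)) \<le> length P * (d + 1)"
    if "\<forall>M\<in>set P. length M \<le> d" for P :: anf
    using that by (induction P) auto
  have "length (concat (map (\<lambda>P. length P # concat (map (\<lambda>M. length M # M) P)) F)) \<le>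
      length F * (1 + (n + 1) ^ d * (d + 1))" if "set F \<subseteq> set E" for F
    using that
  proof (induction F)
    case (Cons P F)
    have "length (concat (map (\<lambda>M. length M # M) P)) \<le> length P * (d + 1)"
      by (rule inner) (use M Cons.prems in auto)
    also have "\<dots> \<le> (n + 1) ^ d * (d + 1)" using mon[of P] Cons.prems by (intro mult_le_mono) auto
    finally show ?case using Cons by simp
  qed simp
  then show "length (encode n E) \<le> 2 + length E * (1 + (n + 1) ^ d * (d + 1))"
    by (simp add: encode_def)
  assume "x \<in> set (encode n E)"
  then consider "x = n" | "x = length E" | P where "P \<in> set E" "x = length P"
    | P M where "P \<in> set E" "M \<in> set P" "x = length M"
    | P M where "P \<in> set E" "M \<in> set P" "x \<in> set M"
    by (auto simp: encode_def)
  then show "x \<le> n + d + (n + 1) ^ d + length E"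
  proof cases
    case 3 then show ?thesis using mon[of P] by simp
  next
    case 4 then show ?thesis using M[of M P] by simp
  next
    case 5 then show ?thesis using M[of M P] by force
  qed auto
qed

lemma zv_ge:
  assumes "k \<le> yv d n ^ 6"
  shows "2 ^ k \<le> zv d n"
  unfolding zv_def by (rule power_increasing[OF assms]) simp

lemma yv_pow: "yv d n ^ k \<le> yv d n ^ (k + j)"
  using yv_big(3)[of d n] by (intro power_increasing) auto

lemma yv_pow_zv: "k < 6 \<Longrightarrow> yv d n ^ k + 4 \<le> zv d n"
proof -
  assume k: "k < 6"
  let ?Y = "yv d n"
  have "?Y ^ k + 4 \<le> ?Y ^ k * ?Y"
  proof -
    have "1 \<le> ?Y ^ k" using yv_big(3)[of d n] by simp
    then have "?Y ^ k + 4 \<le> ?Y ^ k * 5" by simp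
    also have "\<dots> \<le> ?Y ^ k * ?Y" using yv_big(1)[of d n] by (intro mult_le_mono) auto
    finally show ?thesis .
  qed
  also have "\<dots> = ?Y ^ Suc k" by simp
  also have "\<dots> \<le> ?Y ^ 6" using yv_big(3)[of d n] k by (intro power_increasing) auto
  also have "\<dots> \<le> zv d n" unfolding zv_def by (rule less_imp_le[OF less_exp])
  finally show ?thesis .
qed

lemma root_le_yv: "up_sqrt n * up_sqrt n + 4 \<le> yv d n" "up_sqrt n \<le> yv d n" "Suc n < yv d n"
proof -
  have a: "8 * (n + 16) \<le> yv d n" using yv_ge[of n d] by linarith
  then show "up_sqrt n * up_sqrt n + 4 \<le> yv d n" "Suc n < yv d n" using up_sqrt_sq_le[of n] by auto
  moreover have "up_sqrt n \<le> up_sqrt n * up_sqrt n" using up_sqrt(1)[of n] by simp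
  ultimately show "up_sqrt n \<le> yv d n" by linarith
qed

lemma yv_root_pow: "yv d n ^ up_sqrt n \<le> zv d n"
proof -
  let ?Y = "yv d n"
  have "?Y ^ up_sqrt n \<le> (2 ^ ?Y) ^ up_sqrt n" by (rule power_mono) (auto intro: less_imp_le less_exp)
  also have "\<dots> = 2 ^ (?Y * up_sqrt n)" by (simp add: power_mult)
  also have "\<dots> \<le> zv d n"
  proof (rule zv_ge)
    have "?Y * up_sqrt n \<le> ?Y * ?Y" using root_le_yv(2) by (rule mult_le_mono2)
    also have "\<dots> = ?Y ^ 2" by (simp add: power2_eq_square)
    also have "\<dots> \<le> ?Y ^ 6" using yv_pow[of d n 2 4] by simp
    finally show "?Y * up_sqrt n \<le> ?Y ^ 6" .
  qed
  finally show ?thesis .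
qed

lemma two_root_pow: "2 ^ (up_sqrt n * up_sqrt n) \<le> zv d n" "2 ^ up_sqrt n \<le> zv d n"
proof -
  have Y: "yv d n \<le> yv d n ^ 6" using yv_pow[of d n 1 5] by simp
  show "2 ^ (up_sqrt n * up_sqrt n) \<le> zv d n"
    by (rule zv_ge) (use root_le_yv(1)[of n d] Y in linarith)
  show "2 ^ up_sqrt n \<le> zv d n"
    by (rule zv_ge) (use root_le_yv(2)[of n d] Y in linarith)
qed

lemma lmax_bounds: "1 \<le> lmax d n" "lmax d n \<le> zv d n"
  "l \<le> up_sqrt n \<Longrightarrow> nlow (up_sqrt n * up_sqrt n - up_sqrt n * l) (wlim d (up_sqrt n) l) \<le> lmax d n"
proof -
  let ?A = "(\<lambda>l. nlow (up_sqrt n * up_sqrt n - up_sqrt n * l) (wlim d (up_sqrt n) l)) ` {..up_sqrt n}"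
  have ge: "x \<le> lmax d n" if "x \<in> ?A" for x unfolding lmax_def by (rule Max_ge) (use that in auto)
  then show "l \<le> up_sqrt n \<Longrightarrow> nlow (up_sqrt n * up_sqrt n - up_sqrt n * l) (wlim d (up_sqrt n) l) \<le> lmax d n" by auto
  have "nlow (up_sqrt n * up_sqrt n - up_sqrt n * up_sqrt n) (wlim d (up_sqrt n) (up_sqrt n)) \<le> lmax d n"
    by (rule ge, rule imageI) simp
  then show "1 \<le> lmax d n" by simp
  have "lmax d n \<in> ?A" unfolding lmax_def by (rule Max_in) auto
  then obtain l where "lmax d n = nlow (up_sqrt n * up_sqrt n - up_sqrt n * l) (wlim d (up_sqrt n) l)" by auto
  also have "\<dots> \<le> 2 ^ (up_sqrt n * up_sqrt n - up_sqrt n * l)" by (rule nlow_le)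
  also have "\<dots> \<le> 2 ^ (up_sqrt n * up_sqrt n)" by (rule power_increasing) auto
  also note two_root_pow(1)
  finally show "lmax d n \<le> zv d n" .
qed

lemma solver_instance:
  assumes d: "2 \<le> d" and E: "poly_system d n E"
  shows "solver d n (up_sqrt n) (yv d n) (zv d n) E" "x \<in> set (encode n E) \<Longrightarrow> x \<le> yv d n"
    "length (encode n E) \<le> zv d n"
proof -
  let ?Y = "yv d n"
  have m: "length E \<le> (n + 1) ^ d"
    using E sum_choose_le[where n = n and d = d] by (auto simp: poly_system_def)
  have dY: "2 * d \<le> ?Y" by (rule yv_big(2)[OF d])
  have Y1: "(n + 1) ^ d + 8 * (n + 16) \<le> ?Y" by (rule yv_ge)
  have len: "length (encode n E) \<le> zv d n"
  proof -
    have "length (encode n E) \<le> 2 + length E * (1 + (n + 1) ^ d * (d + 1))"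
      by (rule encode_length_bound(1)[OF E])
    also have "\<dots> \<le> 2 + ?Y * (?Y * ?Y)"
    proof -
      have "1 + (n + 1) ^ d * (d + 1) \<le> (n + 1) ^ d * (d + 2)" by simp
      also have "\<dots> \<le> ?Y * ?Y" using Y1 dY d by (intro mult_le_mono) auto
      finally have "length E * (1 + (n + 1) ^ d * (d + 1)) \<le> ?Y * (?Y * ?Y)"
        using m Y1 by (intro mult_le_mono) auto
      then show ?thesis by simp
    qed
    also have "\<dots> \<le> ?Y ^ 3 + 4" by (simp add: power3_eq_cube mult.assoc)
    also have "\<dots> \<le> zv d n" by (rule yv_pow_zv) simp
    finally show ?thesis .
  qed
  then show "length (encode n E) \<le> zv d n" .
  have "?Y \<le> zv d n" using yv_pow_zv[of 1 d n] by simp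
  then show "solver d n (up_sqrt n) ?Y (zv d n) E"
    using d up_sqrt(1,2)[of n] E m Y1 up_sqrt_sq_le[of n] two_root_pow(1)[of n d] len
    by unfold_locales auto
  assume "x \<in> set (encode n E)"
  then have x: "x \<le> n + d + (n + 1) ^ d + length E" by (rule encode_length_bound(2)[OF E])
  have "2 * (n + 1) ^ d + d + n \<le> ?Y"
  proof -
    let ?a = "(n + 32) ^ d"
    have "(n + 1) ^ d \<le> ?a" by (rule power_mono) auto
    moreover have "d < 2 ^ d" by (rule less_exp)
    moreover have "(2::nat) ^ d \<le> ?a" by (rule power_mono) auto
    moreover have "(n + 32) ^ 1 \<le> ?a" using d by (intro power_increasing) auto
    then have "n \<le> ?a" by simp
    ultimately have "2 * (n + 1) ^ d + d + n \<le> 4 * ?a" by linarith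
    also have "\<dots> \<le> ((n + 32) * (n + 32)) * ?a"
      using mult_le_mono[of 2 "n + 32" 2 "n + 32"] by (intro mult_le_mono1) simp
    finally show ?thesis by (simp add: yv_def power_add power2_eq_square ac_simps)
  qed
  with x m show "x \<le> ?Y" by linarith
qed

section \<open>The prelude: parameters, address base and coin tosses\<close>

primrec powE :: "exp \<Rightarrow> nat \<Rightarrow> exp" where
  "powE e 0 = Const 1"
| "powE e (Suc k) = Mul (powE e k) e"

lemma val_powE: "val (powE e k) s = val e s ^ k"
  by (induction k) auto

lemma cost_powE:
  assumes "bit_length (val e s ^ k) \<le> w" "exp_cost e s \<le> c * w" "1 \<le> w" "1 \<le> k \<longrightarrow> 1 \<le> val e s"
  shows "exp_cost (powE e k) s \<le> (1 + k * (c + 2)) * w"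
  using assms(1,4)
proof (induction k)
  case 0
  then show ?case using assms(3) by (simp add: bit_length_def floorlog_def)
next
  case (Suc k)
  have "val e s ^ k \<le> val e s ^ Suc k" "val e s ^ 1 \<le> val e s ^ Suc k"
    by (rule power_increasing; use Suc.prems(2) in simp)+
  then have b: "bit_length (val e s ^ k) \<le> w" "bit_length (val e s) \<le> w"
    using Suc.prems(1) bit_length_mono[of "val e s ^ k" "val e s ^ Suc k"]
      bit_length_mono[of "val e s" "val e s ^ Suc k"] by auto
  then have "exp_cost (powE e k) s \<le> (1 + k * (c + 2)) * w" using Suc by auto
  then show ?case using b assms(2) by (simp add: val_powE algebra_simps)
qed

definition doubleC :: com where
  "doubleC = While (Reg ''q'') (Seq (SetReg ''vZ'' (Add (Reg ''vZ'') (Reg ''vZ'')))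
     (SetReg ''q'' (Sub (Reg ''q'') (Const 1))))"

text \<open>The address \<open>B ^ 3 + q\<close> equals \<open>adr B 1 0 0 q\<close>, so the tosses
  become array 1.\<close>

definition flipsC :: com where
  "flipsC = While (Sub (Reg ''c'') (Reg ''q'')) (Seq (Flip ''f'')
     (Seq (Store (Add (powE (Reg ''B'') 3) (Reg ''q'')) (Reg ''f''))
       (SetReg ''q'' (Add (Reg ''q'') (Const 1)))))"

text \<open>Written directly for the machine, since compiled code presupposes the base in register
  \<open>B\<close> and cannot toss coins. All tosses are drawn here and the rest is deterministic.
  Cell 0 of the input is \<open>n\<close>.\<close>

definition preludeC :: "nat \<Rightarrow> com" where
  "preludeC d = Seq (SetReg ''vY'' (powE (Add (Load (Const 0)) (Const 32)) (d + 2)))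
     (Seq (SetReg ''q'' (powE (Reg ''vY'') 6)) (Seq (SetReg ''vZ'' (Const 1)) (Seq doubleC
     (Seq (SetReg ''B'' (powE (Reg ''vZ'') 21)) (Seq (SetReg ''c'' (powE (Reg ''vY'') 5)) flipsC)))))"

lemma exec_doubleC:
  assumes "reg \<sigma> ''q'' = k" "\<And>x. x \<le> reg \<sigma> ''vZ'' * 2 ^ k + k \<Longrightarrow> bit_length x \<le> w" "1 \<le> w" "1 \<le> reg \<sigma> ''vZ''"
  shows "\<exists>t \<sigma>'. (\<forall>r. exec doubleC \<sigma> r t \<sigma>' r) \<and> t \<le> Suc k * (20 * w) \<and>
    \<sigma>' = \<sigma>\<lparr>reg := (reg \<sigma>)(''vZ'' := reg \<sigma> ''vZ'' * 2 ^ k, ''q'' := 0)\<rparr>"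
  using assms
proof (induction k arbitrary: \<sigma>)
  case 0
  have "exec doubleC \<sigma> r (1 + exp_cost (Reg ''q'') \<sigma>) \<sigma> r" for r
    unfolding doubleC_def by (rule exec.WhileFalse) (simp add: 0)
  moreover have "1 + exp_cost (Reg ''q'') \<sigma> \<le> Suc 0 * (20 * w)" using 0(1,3) 0(2)[of 0] by simp
  moreover have "\<sigma> = \<sigma>\<lparr>reg := (reg \<sigma>)(''vZ'' := reg \<sigma> ''vZ'' * 2 ^ 0, ''q'' := 0)\<rparr>"
    using 0(1) by (metis (no_types, lifting) fun_upd_triv mult_1_right power_0 state.surjective state.update_convs(1))
  ultimately show ?case by blast
next
  case (Suc k)
  let ?z = "reg \<sigma> ''vZ''"
  define \<sigma>1 where "\<sigma>1 = \<sigma>\<lparr>reg := (reg \<sigma>)(''vZ'' := ?z + ?z)\<rparr>"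
  define \<sigma>2 where "\<sigma>2 = \<sigma>1\<lparr>reg := (reg \<sigma>1)(''q'' := k)\<rparr>"
  have w: "bit_length x \<le> w" if "x \<le> ?z * 2 ^ Suc k + Suc k" for x using Suc.prems(2) that by simp
  have z2: "?z + ?z \<le> ?z * 2 ^ Suc k"
  proof -
    have "2 ^ 1 \<le> (2::nat) ^ Suc k" by (rule power_increasing) auto
    then have "?z * 2 \<le> ?z * 2 ^ Suc k" by (intro mult_le_mono) auto
    then show ?thesis by linarith
  qed
  have b: "bit_length ?z \<le> w" "bit_length (?z + ?z) \<le> w" "bit_length (Suc k) \<le> w" "bit_length k \<le> w" "bit_length 1 \<le> w"
    by (rule w; use z2 Suc.prems(4) in linarith)+
  let ?t1 = "1 + exp_cost (Add (Reg ''vZ'') (Reg ''vZ'')) \<sigma> + bit_length (?z + ?z)"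
  have 1: "exec (SetReg ''vZ'' (Add (Reg ''vZ'') (Reg ''vZ''))) \<sigma> r ?t1 \<sigma>1 r" for r
    using exec.SetReg[of "''vZ''" "Add (Reg ''vZ'') (Reg ''vZ'')" \<sigma> r] by (simp add: \<sigma>1_def)
  let ?t2 = "1 + exp_cost (Sub (Reg ''q'') (Const 1)) \<sigma>1 + bit_length k"
  have 2: "exec (SetReg ''q'' (Sub (Reg ''q'') (Const 1))) \<sigma>1 r ?t2 \<sigma>2 r" for r
    using exec.SetReg[of "''q''" "Sub (Reg ''q'') (Const 1)" \<sigma>1 r] Suc.prems(1) by (simp add: \<sigma>2_def \<sigma>1_def)
  have r2: "reg \<sigma>2 ''q'' = k" "reg \<sigma>2 ''vZ'' = ?z + ?z" by (simp_all add: \<sigma>2_def \<sigma>1_def)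
  have "\<exists>t \<sigma>'. (\<forall>r. exec doubleC \<sigma>2 r t \<sigma>' r) \<and> t \<le> Suc k * (20 * w) \<and>
      \<sigma>' = \<sigma>2\<lparr>reg := (reg \<sigma>2)(''vZ'' := reg \<sigma>2 ''vZ'' * 2 ^ k, ''q'' := 0)\<rparr>"
  proof (rule Suc.IH)
    show "\<And>x. x \<le> reg \<sigma>2 ''vZ'' * 2 ^ k + k \<Longrightarrow> bit_length x \<le> w"
      unfolding r2 by (rule w) (simp add: algebra_simps)
  qed (use r2 Suc.prems in auto)
  then obtain t where 3: "\<And>r. exec doubleC \<sigma>2 r t (\<sigma>2\<lparr>reg := (reg \<sigma>2)(''vZ'' := reg \<sigma>2 ''vZ'' * 2 ^ k, ''q'' := 0)\<rparr>) r"
    "t \<le> Suc k * (20 * w)" by blast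
  have eq: "\<sigma>2\<lparr>reg := (reg \<sigma>2)(''vZ'' := reg \<sigma>2 ''vZ'' * 2 ^ k, ''q'' := 0)\<rparr> =
      \<sigma>\<lparr>reg := (reg \<sigma>)(''vZ'' := ?z * 2 ^ Suc k, ''q'' := 0)\<rparr>"
    unfolding r2(2) by (simp add: \<sigma>2_def \<sigma>1_def fun_upd_twist algebra_simps flip: mult_2)
  have "exec doubleC \<sigma> r (1 + exp_cost (Reg ''q'') \<sigma> + (?t1 + ?t2) + t)
      (\<sigma>\<lparr>reg := (reg \<sigma>)(''vZ'' := ?z * 2 ^ Suc k, ''q'' := 0)\<rparr>) r" for r
    using exec.WhileTrue[OF _ exec.Seq[OF 1 2] 3(1)[unfolded eq doubleC_def]] Suc.prems(1)
    by (simp add: doubleC_def)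
  moreover have "1 + exp_cost (Reg ''q'') \<sigma> + (?t1 + ?t2) + t \<le> Suc (Suc k) * (20 * w)"
    using 3(2) b Suc.prems(1,3) by (simp add: \<sigma>1_def)
  ultimately show ?case by blast
qed

lemma exec_flipsC:
  assumes "reg \<sigma> ''c'' = reg \<sigma> ''q'' + length b" "reg \<sigma> ''B'' = B" "1 \<le> B"
    "\<And>x. x \<le> B ^ 3 + reg \<sigma> ''c'' + 1 \<Longrightarrow> bit_length x \<le> w" "1 \<le> w"
  shows "\<exists>t \<sigma>'. (\<forall>r. exec flipsC \<sigma> (b @ r) t \<sigma>' r) \<and> t \<le> Suc (length b) * (40 * w) \<and>
    (\<forall>x. x \<notin> {''q'', ''f''} \<longrightarrow> reg \<sigma>' x = reg \<sigma> x) \<and>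
    (\<forall>a. mem \<sigma>' a = (if B ^ 3 + reg \<sigma> ''q'' \<le> a \<and> a < B ^ 3 + reg \<sigma> ''c''
      then of_bool (b ! (a - (B ^ 3 + reg \<sigma> ''q''))) else mem \<sigma> a))"
  using assms
proof (induction b arbitrary: \<sigma>)
  case Nil
  let ?e = "Sub (Reg ''c'') (Reg ''q'')"
  have "exec flipsC \<sigma> ([] @ r) (1 + exp_cost ?e \<sigma>) \<sigma> r" for r
    using exec.WhileFalse[of ?e \<sigma> _ r] Nil(1) by (simp add: flipsC_def)
  moreover have "1 + exp_cost ?e \<sigma> \<le> Suc (length ([] :: bool list)) * (40 * w)"
  proof -
    have "bit_length (reg \<sigma> ''q'') \<le> w" by (rule Nil(4)) (use Nil(1) in simp)
    then show ?thesis using Nil(1,5) by simp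
  qed
  ultimately show ?case using Nil(1) by (intro exI[of _ "1 + exp_cost ?e \<sigma>"] exI[of _ \<sigma>]) auto
next
  case (Cons c b)
  let ?e = "Sub (Reg ''c'') (Reg ''q'')" and ?q = "reg \<sigma> ''q''" and ?c = "reg \<sigma> ''c''"
  define \<sigma>1 where "\<sigma>1 = \<sigma>\<lparr>reg := (reg \<sigma>)(''f'' := of_bool c)\<rparr>"
  define \<sigma>2 where "\<sigma>2 = \<sigma>1\<lparr>mem := (mem \<sigma>1)(B ^ 3 + ?q := of_bool c)\<rparr>"
  define \<sigma>3 where "\<sigma>3 = \<sigma>2\<lparr>reg := (reg \<sigma>2)(''q'' := Suc ?q)\<rparr>"
  have w: "bit_length x \<le> w" if "x \<le> B ^ 3 + ?c + 1" for x using Cons.prems(4) that by simp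
  have qc: "?q < ?c" using Cons.prems(1) by simp
  have B1: "B \<le> B ^ 3" using Cons.prems(3) by (simp add: power3_eq_cube)
  have b: "bit_length ?q \<le> w" "bit_length ?c \<le> w" "bit_length (B ^ 3) \<le> w" "bit_length (B ^ 3 + ?q) \<le> w"
    "bit_length (of_bool c) \<le> w" "bit_length (Suc ?q) \<le> w" "bit_length 1 \<le> w" "bit_length B \<le> w"
    by (rule w; use qc Cons.prems(3) B1 in \<open>auto simp: of_bool_def\<close>)+
  have v1: "reg \<sigma>1 ''B'' = B" "reg \<sigma>1 ''q'' = ?q" "reg \<sigma>1 ''f'' = of_bool c"
    using Cons.prems(2) by (simp_all add: \<sigma>1_def)
  have 1: "exec (Flip ''f'') \<sigma> (c # r) 1 \<sigma>1 r" for r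
    unfolding \<sigma>1_def by (rule exec.Flip)
  let ?a = "Add (powE (Reg ''B'') 3) (Reg ''q'')"
  let ?t2 = "1 + exp_cost ?a \<sigma>1 + exp_cost (Reg ''f'') \<sigma>1 + bit_length (B ^ 3 + ?q) + bit_length (of_bool c)"
  have 2: "exec (Store ?a (Reg ''f'')) \<sigma>1 r ?t2 \<sigma>2 r" for r
    using exec.Store[of ?a "Reg ''f''" \<sigma>1 r] v1 by (simp add: \<sigma>2_def val_powE)
  have "exp_cost (powE (Reg ''B'') 3) \<sigma>1 \<le> (1 + 3 * (1 + 2)) * w"
    by (rule cost_powE) (use v1 b Cons.prems in auto)
  then have "exp_cost (powE (Reg ''B'') 3) \<sigma>1 \<le> 10 * w" by simp
  moreover have "exp_cost ?a \<sigma>1 = exp_cost (powE (Reg ''B'') 3) \<sigma>1 + bit_length ?q + bit_length (B ^ 3) + bit_length ?q"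
    using v1 by (simp add: val_powE)
  moreover have "exp_cost (Reg ''f'') \<sigma>1 = bit_length (of_bool c)" using v1 by simp
  ultimately have t2: "?t2 \<le> 20 * w" using b Cons.prems(5) by linarith
  let ?t3 = "1 + exp_cost (Add (Reg ''q'') (Const 1)) \<sigma>2 + bit_length (Suc ?q)"
  have v2: "reg \<sigma>2 ''q'' = ?q" by (simp add: \<sigma>2_def \<sigma>1_def)
  have 3: "exec (SetReg ''q'' (Add (Reg ''q'') (Const 1))) \<sigma>2 r ?t3 \<sigma>3 r" for r
    using exec.SetReg[of "''q''" "Add (Reg ''q'') (Const 1)" \<sigma>2 r] v2 by (simp add: \<sigma>3_def)
  have v3: "reg \<sigma>3 ''q'' = Suc ?q" "reg \<sigma>3 ''c'' = ?c" "reg \<sigma>3 ''B'' = B"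
    using Cons.prems(2) by (simp_all add: \<sigma>3_def \<sigma>2_def \<sigma>1_def)
  have "\<exists>t \<sigma>'. (\<forall>r. exec flipsC \<sigma>3 (b @ r) t \<sigma>' r) \<and> t \<le> Suc (length b) * (40 * w) \<and>
    (\<forall>x. x \<notin> {''q'', ''f''} \<longrightarrow> reg \<sigma>' x = reg \<sigma>3 x) \<and>
    (\<forall>a. mem \<sigma>' a = (if B ^ 3 + reg \<sigma>3 ''q'' \<le> a \<and> a < B ^ 3 + reg \<sigma>3 ''c''
      then of_bool (b ! (a - (B ^ 3 + reg \<sigma>3 ''q''))) else mem \<sigma>3 a))"
    by (rule Cons.IH) (use v3 Cons.prems in auto)
  then obtain t \<sigma>' where *: "(\<forall>r. exec flipsC \<sigma>3 (b @ r) t \<sigma>' r) \<and> t \<le> Suc (length b) * (40 * w) \<and>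
    (\<forall>x. x \<notin> {''q'', ''f''} \<longrightarrow> reg \<sigma>' x = reg \<sigma>3 x) \<and>
    (\<forall>a. mem \<sigma>' a = (if B ^ 3 + reg \<sigma>3 ''q'' \<le> a \<and> a < B ^ 3 + reg \<sigma>3 ''c''
      then of_bool (b ! (a - (B ^ 3 + reg \<sigma>3 ''q''))) else mem \<sigma>3 a))"
    by (elim exE)
  have 4: "exec flipsC \<sigma>3 (b @ r) t \<sigma>' r" "t \<le> Suc (length b) * (40 * w)"
    "x \<notin> {''q'', ''f''} \<Longrightarrow> reg \<sigma>' x = reg \<sigma>3 x"
    "mem \<sigma>' a = (if B ^ 3 + Suc ?q \<le> a \<and> a < B ^ 3 + ?c
      then of_bool (b ! (a - (B ^ 3 + Suc ?q))) else mem \<sigma>3 a)" for r x a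
    using *[THEN conjunct1] *[THEN conjunct2, THEN conjunct1]
      *[THEN conjunct2, THEN conjunct2, THEN conjunct1]
      *[THEN conjunct2, THEN conjunct2, THEN conjunct2, THEN spec, of a] unfolding v3 by simp_all
  let ?T = "1 + exp_cost ?e \<sigma> + (1 + (?t2 + ?t3)) + t"
  have "exec flipsC \<sigma> ((c # b) @ r) ?T \<sigma>' r" for r
    using exec.WhileTrue[OF _ exec.Seq[OF 1 exec.Seq[OF 2 3]] 4(1)[unfolded flipsC_def]] qc
    by (simp add: flipsC_def)
  moreover have "?T \<le> Suc (length (c # b)) * (40 * w)"
  proof -
    have "exp_cost ?e \<sigma> \<le> 4 * w" using b by simp
    moreover have "exp_cost (Add (Reg ''q'') (Const 1)) \<sigma>2 \<le> 4 * w" using b v2 by simp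
    moreover have "Suc (length (c # b)) * (40 * w) = Suc (length b) * (40 * w) + 40 * w" by simp
    ultimately show ?thesis using 4(2) t2 b Cons.prems(5) by linarith
  qed
  moreover have "reg \<sigma>' x = reg \<sigma> x" if "x \<notin> {''q'', ''f''}" for x
    using 4(3)[OF that] that by (simp add: \<sigma>3_def \<sigma>2_def \<sigma>1_def)
  moreover have "mem \<sigma>' a = (if B ^ 3 + ?q \<le> a \<and> a < B ^ 3 + ?c
      then of_bool ((c # b) ! (a - (B ^ 3 + ?q))) else mem \<sigma> a)" for a
  proof -
    consider "a = B ^ 3 + ?q" | "a < B ^ 3 + ?q" | "B ^ 3 + Suc ?q \<le> a" by linarith
    then show ?thesis
    proof cases
      case 3
      then have "a - (B ^ 3 + ?q) = Suc (a - (B ^ 3 + Suc ?q))" by simp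
      then show ?thesis using 3 unfolding 4(4) by (simp add: \<sigma>3_def \<sigma>2_def \<sigma>1_def)
    qed (use qc in \<open>auto simp: 4(4) \<sigma>3_def \<sigma>2_def \<sigma>1_def\<close>)
  qed
  ultimately show ?case by blast
qed

lemma yv_cube:
  assumes d: "2 \<le> d"
  shows "d * (yv d n * (yv d n + 2) + 4) \<le> yv d n ^ 3"
proof -
  let ?Y = "yv d n"
  note Y = yv_big(1)[of d n] yv_big(2)[OF d, of n]
  have "2 * ?Y + 4 \<le> ?Y * ?Y" using mult_le_mono1[OF Y(1), of ?Y] Y(1) by linarith
  then have "d * (?Y * (?Y + 2) + 4) \<le> d * (2 * (?Y * ?Y))" by (intro mult_le_mono2) (simp add: algebra_simps)
  also have "\<dots> = (2 * d) * (?Y * ?Y)" by simp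
  also have "\<dots> \<le> ?Y * (?Y * ?Y)" using Y(2) by (rule mult_le_mono1)
  finally show ?thesis by (simp add: power3_eq_cube)
qed

lemma exec_SetReg:
  "val a \<sigma> = v \<Longrightarrow> exec (SetReg x a) \<sigma> r (1 + exp_cost a \<sigma> + bit_length v) (\<sigma>\<lparr>reg := (reg \<sigma>)(x := v)\<rparr>) r"
  using exec.SetReg[of x a \<sigma> r] by simp

text \<open>The base has to exceed every intermediate result, and \<open>safe\<close> is established
  for the bound \<open>zv d n ^ 20\<close>.\<close>

abbreviation bv :: "nat \<Rightarrow> nat \<Rightarrow> nat" where
  "bv d n \<equiv> zv d n ^ 21"

lemma bv_bounds:
  "zv d n < bv d n" "1 \<le> bv d n" "bv d n ^ 3 + yv d n ^ 5 + 1 < bv d n ^ 4"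
  "2 ^ (yv d n ^ 6) + yv d n ^ 6 \<le> bv d n ^ 3"
proof -
  let ?Z = "zv d n" and ?B = "bv d n" and ?Y = "yv d n"
  have Z: "?Y ^ 5 + 4 \<le> ?Z" by (rule yv_pow_zv) simp
  then have Z2: "2 \<le> ?Z" by simp
  show ZB: "?Z < ?B" using power_strict_increasing[of 1 21 ?Z] Z2 by simp
  then show B1: "1 \<le> ?B" using Z2 by linarith
  have B3: "?B \<le> ?B ^ 3" using power_increasing[of 1 3 ?B] B1 by simp
  have B2: "2 \<le> ?B" using ZB Z2 by linarith
  have "2 * ?B ^ 3 \<le> ?B * ?B ^ 3" using B2 by (rule mult_le_mono1)
  also have "?B * ?B ^ 3 = ?B ^ 4" by (simp add: power_numeral_reduce del: power_mult)
  finally show "?B ^ 3 + ?Y ^ 5 + 1 < ?B ^ 4" using Z ZB B3 by linarith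
  have "?Y ^ 6 < ?Z" unfolding zv_def by (rule less_exp)
  moreover have "2 * ?Z \<le> ?Z * ?Z" using Z2 by (rule mult_le_mono1)
  moreover have "?Z ^ 2 \<le> ?B" by (rule power_increasing) (use Z2 in auto)
  ultimately show "2 ^ (?Y ^ 6) + ?Y ^ 6 \<le> ?B ^ 3"
    using B3 unfolding zv_def[symmetric] power2_eq_square by linarith
qed

lemma exec_preludeC:
  assumes d: "2 \<le> d" and b: "length b = yv d n ^ 5"
  shows "\<exists>t \<sigma>. (\<forall>r. exec (preludeC d) (initial_state n E) (b @ r) t \<sigma> r) \<and>
    t \<le> 300 * yv d n ^ 6 * width (bv d n) \<and>
    reg \<sigma> ''vY'' = yv d n \<and> reg \<sigma> ''vZ'' = zv d n \<and> reg \<sigma> ''B'' = bv d n \<and>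
    (\<forall>x. x \<notin> {''vY'', ''vZ'', ''B'', ''q'', ''c'', ''f''} \<longrightarrow> reg \<sigma> x = 0) \<and>
    (\<forall>a. mem \<sigma> a = (if bv d n ^ 3 \<le> a \<and> a < bv d n ^ 3 + yv d n ^ 5
      then of_bool (b ! (a - bv d n ^ 3)) else mem (initial_state n E) a))"
proof -
  let ?Z = "zv d n" and ?B = "bv d n" and ?Y = "yv d n"
  let ?w = "width ?B"
  let ?\<sigma>0 = "initial_state n E"
  have w: "bit_length x \<le> ?w" if "x \<le> ?B ^ 3 + ?Y ^ 5 + 1" for x
    by (rule width_bound[OF bv_bounds(1)]) (use bv_bounds(3)[of d n] that in linarith)
  have w1: "1 \<le> ?w" using bit_length_pos[of 1] w[of 1] by linarith
  have Y1: "1 \<le> ?Y" using yv_big(3)[of d n] by simp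
  have Yp: "?Y ^ k \<le> ?Y ^ 6" if "k \<le> 6" for k using Y1 that by (rule power_increasing[rotated])
  have Y6: "?Y ^ 6 \<le> ?B ^ 3" "?Z + ?Y ^ 6 \<le> ?B ^ 3" "?Z \<le> ?B ^ 3"
    using bv_bounds(4)[of d n] by (auto simp: zv_def)
  have B3: "?B \<le> ?B ^ 3" using power_increasing[of 1 3 ?B] bv_bounds(2)[of d n] by simp
  have Yk: "?Y ^ k \<le> ?B ^ 3 + ?Y ^ 5 + 1" if "k \<le> 6" for k using Yp[OF that] Y6 by linarith
  have nY: "n + 32 \<le> ?Y" using yv_ge[of n d] by simp
  have bw: "bit_length 0 \<le> ?w" "bit_length 1 \<le> ?w" "bit_length 32 \<le> ?w" "bit_length n \<le> ?w"
    "bit_length ?Y \<le> ?w" "bit_length (?Y ^ 6) \<le> ?w" "bit_length (?Y ^ 5) \<le> ?w" "bit_length ?B \<le> ?w"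
    "bit_length ?Z \<le> ?w"
    by (rule w; use Yk[of 1, unfolded power_one_right] Yk[of 6] Yk[of 5] nY B3 Y6 in linarith)+
  define \<sigma>1 where "\<sigma>1 = ?\<sigma>0\<lparr>reg := (reg ?\<sigma>0)(''vY'' := ?Y)\<rparr>"
  define \<sigma>2 where "\<sigma>2 = \<sigma>1\<lparr>reg := (reg \<sigma>1)(''q'' := ?Y ^ 6)\<rparr>"
  define \<sigma>3 where "\<sigma>3 = \<sigma>2\<lparr>reg := (reg \<sigma>2)(''vZ'' := 1)\<rparr>"
  define \<sigma>4 where "\<sigma>4 = \<sigma>3\<lparr>reg := (reg \<sigma>3)(''vZ'' := ?Z, ''q'' := 0)\<rparr>"
  define \<sigma>5 where "\<sigma>5 = \<sigma>4\<lparr>reg := (reg \<sigma>4)(''B'' := ?B)\<rparr>"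
  define \<sigma>6 where "\<sigma>6 = \<sigma>5\<lparr>reg := (reg \<sigma>5)(''c'' := ?Y ^ 5)\<rparr>"
  note defs = \<sigma>1_def \<sigma>2_def \<sigma>3_def \<sigma>4_def \<sigma>5_def \<sigma>6_def
  let ?e1 = "powE (Add (Load (Const 0)) (Const 32)) (d + 2)"
  have m0: "mem ?\<sigma>0 0 = n" by (simp add: initial_state_def encode_def)
  have v1: "val ?e1 ?\<sigma>0 = ?Y" using m0 by (simp add: val_powE yv_def)
  have 1: "exec (SetReg ''vY'' ?e1) ?\<sigma>0 r (1 + exp_cost ?e1 ?\<sigma>0 + bit_length ?Y) \<sigma>1 r" for r
    unfolding \<sigma>1_def by (rule exec_SetReg[OF v1])
  have "exp_cost ?e1 ?\<sigma>0 \<le> (1 + (d + 2) * (7 + 2)) * ?w"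
    by (rule cost_powE) (use bw m0 v1 w1 in \<open>auto simp: val_powE yv_def\<close>)
  then have c1: "exp_cost ?e1 ?\<sigma>0 \<le> (9 * d + 19) * ?w" by (simp add: algebra_simps)
  have v2: "val (powE (Reg ''vY'') 6) \<sigma>1 = ?Y ^ 6" by (simp add: val_powE \<sigma>1_def)
  have 2: "exec (SetReg ''q'' (powE (Reg ''vY'') 6)) \<sigma>1 r (1 + exp_cost (powE (Reg ''vY'') 6) \<sigma>1 + bit_length (?Y ^ 6)) \<sigma>2 r" for r
    unfolding \<sigma>2_def by (rule exec_SetReg[OF v2])
  have "exp_cost (powE (Reg ''vY'') 6) \<sigma>1 \<le> (1 + 6 * (1 + 2)) * ?w"
    by (rule cost_powE) (use bw w1 Y1 in \<open>auto simp: \<sigma>1_def\<close>)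
  then have c2: "exp_cost (powE (Reg ''vY'') 6) \<sigma>1 \<le> 19 * ?w" by simp
  have 3: "exec (SetReg ''vZ'' (Const 1)) \<sigma>2 r (1 + exp_cost (Const 1) \<sigma>2 + bit_length 1) \<sigma>3 r" for r
    unfolding \<sigma>3_def by (rule exec_SetReg) simp
  have "\<exists>t \<sigma>'. (\<forall>r. exec doubleC \<sigma>3 r t \<sigma>' r) \<and> t \<le> Suc (?Y ^ 6) * (20 * ?w) \<and>
      \<sigma>' = \<sigma>3\<lparr>reg := (reg \<sigma>3)(''vZ'' := reg \<sigma>3 ''vZ'' * 2 ^ (?Y ^ 6), ''q'' := 0)\<rparr>"
  proof (rule exec_doubleC)
    show "bit_length x \<le> ?w" if "x \<le> reg \<sigma>3 ''vZ'' * 2 ^ (?Y ^ 6) + ?Y ^ 6" for x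
      by (rule w) (use that bv_bounds(4)[of d n] in \<open>simp add: \<sigma>3_def\<close>)
  qed (use w1 in \<open>simp_all add: \<sigma>3_def \<sigma>2_def\<close>)
  moreover have "\<sigma>3\<lparr>reg := (reg \<sigma>3)(''vZ'' := reg \<sigma>3 ''vZ'' * 2 ^ (?Y ^ 6), ''q'' := 0)\<rparr> = \<sigma>4"
    by (simp add: \<sigma>4_def \<sigma>3_def zv_def)
  ultimately obtain t4 where 4: "\<And>r. exec doubleC \<sigma>3 r t4 \<sigma>4 r" "t4 \<le> Suc (?Y ^ 6) * (20 * ?w)"
    by auto
  have v5: "val (powE (Reg ''vZ'') 21) \<sigma>4 = ?B" by (simp add: val_powE \<sigma>4_def)
  have 5: "exec (SetReg ''B'' (powE (Reg ''vZ'') 21)) \<sigma>4 r (1 + exp_cost (powE (Reg ''vZ'') 21) \<sigma>4 + bit_length ?B) \<sigma>5 r" for r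
    unfolding \<sigma>5_def by (rule exec_SetReg[OF v5])
  have "exp_cost (powE (Reg ''vZ'') 21) \<sigma>4 \<le> (1 + 21 * (1 + 2)) * ?w"
    by (rule cost_powE) (use bw w1 bv_bounds[of d n] in \<open>auto simp: \<sigma>4_def zv_def\<close>)
  then have c5: "exp_cost (powE (Reg ''vZ'') 21) \<sigma>4 \<le> 64 * ?w" by simp
  have v6: "val (powE (Reg ''vY'') 5) \<sigma>5 = ?Y ^ 5" by (simp add: val_powE defs)
  have 6: "exec (SetReg ''c'' (powE (Reg ''vY'') 5)) \<sigma>5 r (1 + exp_cost (powE (Reg ''vY'') 5) \<sigma>5 + bit_length (?Y ^ 5)) \<sigma>6 r" for r
    unfolding \<sigma>6_def by (rule exec_SetReg[OF v6])
  have "exp_cost (powE (Reg ''vY'') 5) \<sigma>5 \<le> (1 + 5 * (1 + 2)) * ?w"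
    by (rule cost_powE) (use bw w1 Y1 in \<open>auto simp: defs\<close>)
  then have c6: "exp_cost (powE (Reg ''vY'') 5) \<sigma>5 \<le> 16 * ?w" by simp
  have r6: "reg \<sigma>6 ''c'' = ?Y ^ 5" "reg \<sigma>6 ''q'' = 0" "reg \<sigma>6 ''B'' = ?B" "mem \<sigma>6 = mem ?\<sigma>0"
    by (simp_all add: defs)
  have "\<exists>t \<sigma>'. (\<forall>r. exec flipsC \<sigma>6 (b @ r) t \<sigma>' r) \<and> t \<le> Suc (length b) * (40 * ?w) \<and>
    (\<forall>x. x \<notin> {''q'', ''f''} \<longrightarrow> reg \<sigma>' x = reg \<sigma>6 x) \<and>
    (\<forall>a. mem \<sigma>' a = (if ?B ^ 3 + reg \<sigma>6 ''q'' \<le> a \<and> a < ?B ^ 3 + reg \<sigma>6 ''c''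
      then of_bool (b ! (a - (?B ^ 3 + reg \<sigma>6 ''q''))) else mem \<sigma>6 a))"
    by (rule exec_flipsC) (use r6 b w w1 bv_bounds(2)[of d n] in auto)
  then obtain t7 \<sigma>7 where 7: "(\<forall>r. exec flipsC \<sigma>6 (b @ r) t7 \<sigma>7 r) \<and> t7 \<le> Suc (length b) * (40 * ?w) \<and>
    (\<forall>x. x \<notin> {''q'', ''f''} \<longrightarrow> reg \<sigma>7 x = reg \<sigma>6 x) \<and>
    (\<forall>a. mem \<sigma>7 a = (if ?B ^ 3 + reg \<sigma>6 ''q'' \<le> a \<and> a < ?B ^ 3 + reg \<sigma>6 ''c''
      then of_bool (b ! (a - (?B ^ 3 + reg \<sigma>6 ''q''))) else mem \<sigma>6 a))"
    by (elim exE)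
  have 7: "exec flipsC \<sigma>6 (b @ r) t7 \<sigma>7 r" "t7 \<le> Suc (?Y ^ 5) * (40 * ?w)"
    "x \<notin> {''q'', ''f''} \<Longrightarrow> reg \<sigma>7 x = reg \<sigma>6 x"
    "mem \<sigma>7 a = (if ?B ^ 3 \<le> a \<and> a < ?B ^ 3 + ?Y ^ 5 then of_bool (b ! (a - ?B ^ 3)) else mem ?\<sigma>0 a)"
    for r x a
    using 7[THEN conjunct1] 7[THEN conjunct2, THEN conjunct1] 7[THEN conjunct2, THEN conjunct2, THEN conjunct1]
      7[THEN conjunct2, THEN conjunct2, THEN conjunct2, THEN spec, of a] b unfolding r6 by simp_all
  let ?T = "(1 + exp_cost ?e1 ?\<sigma>0 + bit_length ?Y) +
    ((1 + exp_cost (powE (Reg ''vY'') 6) \<sigma>1 + bit_length (?Y ^ 6)) +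
    ((1 + exp_cost (Const 1) \<sigma>2 + bit_length 1) + (t4 +
    ((1 + exp_cost (powE (Reg ''vZ'') 21) \<sigma>4 + bit_length ?B) +
    ((1 + exp_cost (powE (Reg ''vY'') 5) \<sigma>5 + bit_length (?Y ^ 5)) + t7)))))"
  have "exec (preludeC d) ?\<sigma>0 (b @ r) ?T \<sigma>7 r" for r
    unfolding preludeC_def by (intro exec.Seq[OF 1] exec.Seq[OF 2] exec.Seq[OF 3] exec.Seq[OF 4(1)]
        exec.Seq[OF 5] exec.Seq[OF 6] 7(1))
  moreover have "?T \<le> 300 * ?Y ^ 6 * ?w"
  proof -
    let ?Q = "?Y ^ 6 * ?w"
    have "1 * ?w \<le> ?Q" using Y1 by (intro mult_le_mono1) simp
    then have wQ: "?w \<le> ?Q" by simp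
    have "Suc (?Y ^ 6) * (20 * ?w) = 20 * ?Q + 20 * ?w" by (simp add: algebra_simps)
    then have a4: "t4 \<le> 40 * ?Q" using 4(2) wQ by linarith
    have "?Y ^ 5 * ?w \<le> ?Q" using Yp[of 5] by (intro mult_le_mono1) simp
    moreover have "Suc (?Y ^ 5) * (40 * ?w) = 40 * (?Y ^ 5 * ?w) + 40 * ?w" by (simp add: algebra_simps)
    ultimately have a7: "t7 \<le> 80 * ?Q" using 7(2) wQ by linarith
    have "d \<le> ?Y ^ 1" using yv_big(2)[OF d, of n] by simp
    also have "\<dots> \<le> ?Y ^ 6" by (rule Yp) simp
    finally have "d * ?w \<le> ?Q" by (rule mult_le_mono1)
    moreover have "(9 * d + 19) * ?w = 9 * (d * ?w) + 19 * ?w" by (simp add: algebra_simps)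
    ultimately have a1: "exp_cost ?e1 ?\<sigma>0 \<le> 28 * ?Q" using c1 wQ by linarith
    have "exp_cost (Const 1) \<sigma>2 \<le> ?w" using bw by simp
    then have "?T \<le> 28 * ?Q + (40 * ?Q + (80 * ?Q + 110 * ?w))"
      using a1 a4 a7 c2 c5 c6 bw w1 by linarith
    also have "\<dots> \<le> 300 * ?Q" using wQ by linarith
    finally show ?thesis by (simp only: mult.assoc)
  qed
  moreover have "reg \<sigma>7 ''vY'' = ?Y" "reg \<sigma>7 ''vZ'' = ?Z" "reg \<sigma>7 ''B'' = ?B"
    by (simp_all add: 7(3) defs)
  moreover have "reg \<sigma>7 x = 0" if "x \<notin> {''vY'', ''vZ'', ''B'', ''q'', ''c'', ''f''}" for x
    using that by (simp add: 7(3) defs initial_state_def)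
  ultimately show ?thesis using 7(4)
    by (intro exI[of _ ?T] exI[of _ \<sigma>7]) blast
qed

section \<open>The complete program and its success probability\<close>

definition solveC :: "nat \<Rightarrow> com" where
  "solveC d = Seq (preludeC d) (Seq (comp (setupC d)) (comp (mainC d)))"

definition solve_time :: "nat \<Rightarrow> nat \<Rightarrow> nat" where
  "solve_time d n = width (bv d n) * (300 * yv d n ^ 6 +
     steps (vb (yv d n) (zv d n) (zv d n) (zv d n)) (ab (yv d n) (zv d n) (zv d n)) (setupC d) +
     steps (vb (yv d n) (zv d n) (yv d n ^ up_sqrt n) (2 ^ up_sqrt n)) (ab (yv d n) (zv d n) (lmax d n)) (mainC d))"

definition start :: "nat \<Rightarrow> nat \<Rightarrow> anf list \<Rightarrow> bool list \<Rightarrow> lstate" where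
  "start d n E b = \<lparr>lv = (\<lambda>x. if x = ''Y'' then yv d n else if x = ''Z'' then zv d n else 0),
     la = (\<lambda>k i j l. if i = 0 \<and> j = 0 then
       (if k = 0 then (if l < length (encode n E) then encode n E ! l else 0)
        else if k = 1 \<and> l < yv d n ^ 5 then of_bool (b ! l) else 0) else 0)\<rparr>"

lemma bv_gt_lengths:
  assumes d: "2 \<le> d" and E: "poly_system d n E"
  shows "length (encode n E) < bv d n" "yv d n ^ 5 < bv d n"
  using solver_instance(3)[OF d E] bv_bounds(1)[of d n] yv_pow_zv[of 5 d n] by auto

text \<open>Digits in base \<open>B\<close> are unique and both input and coin list are shorter than
  \<open>B\<close>; hence the input meets only array 0, the tosses only array 1, and all other
  represented cells are still 0.\<close>

lemma represents_start:
  assumes d: "2 \<le> d" and E: "poly_system d n E"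
    and \<sigma>: "reg \<sigma> ''vY'' = yv d n" "reg \<sigma> ''vZ'' = zv d n" "reg \<sigma> ''B'' = bv d n"
      "\<And>x. x \<notin> {''vY'', ''vZ'', ''B'', ''q'', ''c'', ''f''} \<Longrightarrow> reg \<sigma> x = 0"
      "\<And>a. mem \<sigma> a = (if bv d n ^ 3 \<le> a \<and> a < bv d n ^ 3 + yv d n ^ 5
        then of_bool (b ! (a - bv d n ^ 3)) else mem (initial_state n E) a)"
  shows "represents (bv d n) (start d n E b) \<sigma>"
proof -
  let ?B = "bv d n"
  note B = bv_gt_lengths[OF d E]
  have "mem \<sigma> (adr ?B k i j l) = la (start d n E b) k i j l"
    if l: "k < ?B" "i < ?B" "j < ?B" "l < ?B" for k i j l
  proof -
    have B2: "1 < ?B" using B(1) by (simp add: encode_def)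
    have c: "adr ?B 1 0 0 q = ?B ^ 3 + q" "adr ?B 0 0 0 q = q" for q
      by (simp_all add: adr_def power3_eq_cube)
    have inj: "adr ?B k i j l = adr ?B k' 0 0 q \<longleftrightarrow> k = k' \<and> i = 0 \<and> j = 0 \<and> l = q" if "q < ?B" for k' q
      using adr_inj[of ?B k i j l k' 0 0 q] l that B2 by (auto simp: zv_def)
    have 1: "?B ^ 3 \<le> adr ?B k i j l \<and> adr ?B k i j l < ?B ^ 3 + yv d n ^ 5 \<longleftrightarrow>
        k = 1 \<and> i = 0 \<and> j = 0 \<and> l < yv d n ^ 5"
    proof
      assume a: "?B ^ 3 \<le> adr ?B k i j l \<and> adr ?B k i j l < ?B ^ 3 + yv d n ^ 5"
      define q where "q = adr ?B k i j l - ?B ^ 3"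
      have q: "q < yv d n ^ 5" "adr ?B k i j l = adr ?B 1 0 0 q" unfolding c using a by (auto simp: q_def)
      then show "k = 1 \<and> i = 0 \<and> j = 0 \<and> l < yv d n ^ 5" using inj[of q 1] B(2) by auto
    next
      assume "k = 1 \<and> i = 0 \<and> j = 0 \<and> l < yv d n ^ 5"
      then show "?B ^ 3 \<le> adr ?B k i j l \<and> adr ?B k i j l < ?B ^ 3 + yv d n ^ 5" using c(1)[of l] by simp
    qed
    have 2: "adr ?B k i j l < length (encode n E) \<longleftrightarrow> k = 0 \<and> i = 0 \<and> j = 0 \<and> l < length (encode n E)"
    proof
      assume a: "adr ?B k i j l < length (encode n E)"
      then show "k = 0 \<and> i = 0 \<and> j = 0 \<and> l < length (encode n E)"
        using inj[of "adr ?B k i j l" 0] c(2) B(1) by auto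
    qed (auto simp: c)
    show ?thesis
      unfolding \<sigma>(5) 1 using 2 by (auto simp: start_def initial_state_def c(1)[unfolded One_nat_def] c(2))
  qed
  then show ?thesis using \<sigma> by (simp add: represents_def start_def)
qed

context solver
begin

lemma exec_solveC:
  assumes inst: "s = up_sqrt n" "Y = yv d n" "Z = zv d n"
    and b: "length b = Y ^ 5" and A: "A = coins Y b"
  shows "\<exists>t \<sigma>. (\<forall>r. exec (solveC d) (initial_state n E) (b @ r) t \<sigma> r) \<and> t \<le> solve_time d n \<and>
    (mem \<sigma> 0 \<noteq> 0 \<longrightarrow> (\<exists>x. solved x \<and> (\<forall>i<n. mem \<sigma> (Suc i) = bval (bt x i)))) \<and>
    ((\<exists>p<Y. lucky s Y Sols top (A p)) \<longrightarrow> mem \<sigma> 0 \<noteq> 0)"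
proof -
  let ?B = "Z ^ 21"
  note Bdef = inst(3)
  have GB: "Z ^ 20 < ?B"
    using power_strict_increasing[of 20 21 Z] yv_pow_zv[of 0 d n] inst by simp
  have Y3: "Y ^ 3 + 4 \<le> Z" "Y ^ 0 + 4 \<le> Z" "1000 \<le> Y" "2 * d \<le> Y"
    using yv_pow_zv[of 3 d n] yv_pow_zv[of 0 d n] yv_big(1)[of d n] yv_big(2)[OF d, of n] inst by auto
  have dY: "d * (Y * (Y + 2) + 4) \<le> Y ^ 3" using yv_cube[OF d, of n] inst by simp
  have Z1: "1 \<le> Z" "2 \<le> Z" "8 \<le> Z" "4 * d \<le> Z"
  proof -
    have "Y * 1000 \<le> Y * (Y * Y)" using Y3(3) by (intro mult_le_mono2) (meson le_square le_trans)
    then show "1 \<le> Z" "2 \<le> Z" "8 \<le> Z" "4 * d \<le> Z"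
      using Y3 unfolding power3_eq_cube mult.assoc by linarith+
  qed
  have L: "1 \<le> lmax d n" "lmax d n \<le> Z" using lmax_bounds(1,2) inst by auto
  have K: "1 \<le> Y ^ s" "Y ^ s \<le> Z" "1 \<le> (2::nat) ^ s" "2 ^ s \<le> Z"
    using Y3(3) yv_root_pow[of d n] two_root_pow(2)[of n d] inst by auto
  let ?\<beta>1 = "vb Y Z Z Z" and ?\<gamma>1 = "ab Y Z Z"
  let ?\<beta>2 = "vb Y Z (Y ^ s) (2 ^ s)" and ?\<gamma>2 = "ab Y Z (lmax d n)"
  note bnds1 = vb_le[OF dY Y3(3,1) order.refl order.refl order.refl Z1(1) Z1(1) Z1(1)]
    ab_le[OF dY Y3(3,1) order.refl order.refl order.refl Z1(1) Z1(1) Z1(1)]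
  note bnds2 = vb_le[OF dY Y3(3,1) L(2) K(2,4) L(1) K(1,3)] ab_le[OF dY Y3(3,1) L(2) K(2,4) L(1) K(1,3)]
  note ex = mainC_exprs[OF Z1(3,4)]
  have safe1: "safe ?\<beta>1 ?\<gamma>1 (Z ^ 20) (setupC d)"
    by (rule safe_if_keeps[OF bnds1 Z1(2) _ ex(2)
        setup_keeps[OF dY Y3(3,1) order.refl order.refl order.refl Z1(1) Z1(1) Z1(1)]]) simp
  have safe2: "safe ?\<beta>2 ?\<gamma>2 (Z ^ 20) (mainC d)"
    by (rule safe_if_keeps[OF bnds2 Z1(2) _ ex(1) main_keeps[OF dY Y3(3,1) L(2) K(2,4) L(1) K(1,3)]]) simp
  let ?s0 = "start d n E b"
  let ?s1 = "run (setupC d) ?s0"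
  let ?s2 = "run (mainC d) ?s1"
  have in_le: "x \<le> Y" if "x \<in> set (encode n E)" for x
    using solver_instance(2)[OF d E that] inst by simp
  have bd0: "bounded ?\<beta>1 ?\<gamma>1 ?s0"
    using in_le[OF nth_mem] Z1(1) inst by (auto simp: bounded_def start_def vb_def ab_def)
  have v0: "lv ?s0 ''Y'' = Y" "lv ?s0 ''Z'' = Z" using inst by (simp_all add: start_def)
  have a0: "la ?s0 0 0 0 a = inp a" for a by (simp add: start_def inp_def)
  have a1: "la ?s0 1 0 0 (cidx Y p l r q q') = bval (A p l r q q')"
    if "p < Y" "l < Y" "r < Y" "q < Y" "q' < Y" for p l r q q'
    using cidx_less[OF that] that inst(2) by (simp add: start_def A coins_def bval_def)
  have nY: "Suc n < Y" using root_le_yv(3)[of n d] inst by simp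
  have least: "j * j < n" if "1 \<le> j" "j < s" for j using up_sqrt(3) that inst by simp
  note stp = setupC_correct[OF least nY K(2) v0 a0 a1]
  have ctx1: "ctx ?s1" by (rule stp(1))
  have bd1: "bounded ?\<beta>1 ?\<gamma>1 ?s1" by (rule bounded_run[OF GB safe1 bd0])
  \<comment> \<open>The sharper bounds differ only at \<open>''K''\<close>, \<open>''S''\<close> and
    array 3, whose exact contents are known after setup.\<close>
  have bd2: "bounded ?\<beta>2 ?\<gamma>2 ?s1"
  proof -
    have "lv ?s1 x \<le> ?\<beta>2 x" for x
    proof -
      have "lv ?s1 x \<le> ?\<beta>1 x" using bd1 by (simp add: bounded_def)
      moreover have "?\<beta>2 x = ?\<beta>1 x" if "x \<noteq> ''K''" "x \<noteq> ''S''" using that by (simp add: vb_def)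
      ultimately show ?thesis using ctxD(5,12)[OF ctx1] by (cases "x = ''K'' \<or> x = ''S''") auto
    qed
    moreover have "la ?s1 k i j l \<le> ?\<gamma>2 k" for k i j l
    proof (cases "k = 3")
      case True
      then show ?thesis using lmax_bounds(3)[of l n d] stp(3)[of i j l] inst by (auto simp: start_def)
    next
      case False
      then have "?\<gamma>2 k = ?\<gamma>1 k" by (simp add: ab_def)
      then show ?thesis using bd1 by (simp add: bounded_def)
    qed
    ultimately show ?thesis by (simp add: bounded_def)
  qed
  have F1: "lv ?s1 ''F'' = 0" using stp(2) by (simp add: start_def)
  obtain t0 \<sigma>0 where 0: "(\<forall>r. exec (preludeC d) (initial_state n E) (b @ r) t0 \<sigma>0 r) \<and>
    t0 \<le> 300 * yv d n ^ 6 * width (bv d n) \<and>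
    reg \<sigma>0 ''vY'' = yv d n \<and> reg \<sigma>0 ''vZ'' = zv d n \<and> reg \<sigma>0 ''B'' = bv d n \<and>
    (\<forall>x. x \<notin> {''vY'', ''vZ'', ''B'', ''q'', ''c'', ''f''} \<longrightarrow> reg \<sigma>0 x = 0) \<and>
    (\<forall>a. mem \<sigma>0 a = (if bv d n ^ 3 \<le> a \<and> a < bv d n ^ 3 + yv d n ^ 5
      then of_bool (b ! (a - bv d n ^ 3)) else mem (initial_state n E) a))"
    using exec_preludeC[OF d, of b n E] b inst by auto
  note 0 = 0[THEN conjunct1] 0[THEN conjunct2, THEN conjunct1] 0[THEN conjunct2, THEN conjunct2]
  have rep0: "represents ?B ?s0 \<sigma>0"
    unfolding Bdef by (rule represents_start[OF d E]) (use 0(3) in \<open>elim conjE; simp\<close>)+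
  from comp_correct[OF GB safe1 bd0 rep0] obtain t1 \<sigma>1
    where 1: "(\<forall>r. exec (comp (setupC d)) \<sigma>0 r t1 \<sigma>1 r) \<and> t1 \<le> width ?B * steps ?\<beta>1 ?\<gamma>1 (setupC d) \<and>
      represents ?B ?s1 \<sigma>1 \<and>
      (\<forall>x. x \<notin> vars (setupC d) \<longrightarrow> reg \<sigma>1 (CHR ''l'' # x) = reg \<sigma>0 (CHR ''l'' # x))" by (elim exE)
  note 1 = 1[THEN conjunct1, rule_format] 1[THEN conjunct2, THEN conjunct1]
    1[THEN conjunct2, THEN conjunct2, THEN conjunct1]
  from comp_correct[OF GB safe2 bd2 1(3)] obtain t2 \<sigma>2
    where 2: "(\<forall>r. exec (comp (mainC d)) \<sigma>1 r t2 \<sigma>2 r) \<and> t2 \<le> width ?B * steps ?\<beta>2 ?\<gamma>2 (mainC d) \<and>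
      represents ?B ?s2 \<sigma>2 \<and>
      (\<forall>x. x \<notin> vars (mainC d) \<longrightarrow> reg \<sigma>2 (CHR ''l'' # x) = reg \<sigma>1 (CHR ''l'' # x))" by (elim exE)
  note 2 = 2[THEN conjunct1, rule_format] 2[THEN conjunct2, THEN conjunct1]
    2[THEN conjunct2, THEN conjunct2, THEN conjunct1]
  have exe: "exec (solveC d) (initial_state n E) (b @ r) (t0 + (t1 + t2)) \<sigma>2 r" for r
    unfolding solveC_def by (intro exec.Seq[OF 0(1)[rule_format]] exec.Seq[OF 1(1)] 2(1))
  have time: "t0 + (t1 + t2) \<le> solve_time d n"
    using 0(2) 1(2) 2(2) unfolding solve_time_def inst distrib_left by (simp only: mult.commute)
  have cell: "mem \<sigma>2 l = la ?s2 0 0 0 l" if "l < ?B" for l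
  proof -
    have "mem \<sigma>2 (adr ?B 0 0 0 l) = la ?s2 0 0 0 l"
      using 2(3)[unfolded represents_def, THEN conjunct2, THEN conjunct2, rule_format, of 0 0 0 l] that Z1 by simp
    then show ?thesis by (simp add: adr_def)
  qed
  have B0: "0 < ?B" using Z1 by simp
  let ?t = "run (searchC d) ?s1"
  have s2: "?s2 = run outC ?t" by (simp add: mainC_def)
  have "same (vars (searchC d)) (arrs (searchC d)) ?s1 ?t" by (intro same_run same_refl order.refl)
  then have ctxt: "ctx ?t"
    by (rule ctx_same[OF ctx1]) (simp_all add: program_defs params_def wtemps_def)
  have "Suc i < ?B" if "i < n" for i
    using that nY Z(3) bv_bounds(1)[of d n] unfolding inst(3)[symmetric] by linarith
  then have out: "mem \<sigma>2 0 = lv ?t ''F''" "i < n \<Longrightarrow> mem \<sigma>2 (Suc i) = bval (bt (lv ?t ''X'') i)" for i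
    using cell outC_correct[OF ctxt] B0 s2 by simp_all
  have "mem \<sigma>2 0 \<noteq> 0 \<longrightarrow> (\<exists>x. solved x \<and> (\<forall>i<n. mem \<sigma>2 (Suc i) = bval (bt x i)))"
    "(\<exists>p<Y. lucky s Y Sols top (A p)) \<longrightarrow> mem \<sigma>2 0 \<noteq> 0"
    unfolding out(1) using searchC_correct[OF ctx1 F1] out(2) by blast+
  with exe time show ?thesis by blast
qed

end

lemma solve_time_ge: "yv d n ^ 5 \<le> solve_time d n"
proof -
  have "yv d n ^ 5 \<le> yv d n ^ 6" using yv_pow[of d n 5 1] by simp
  also have "\<dots> \<le> width (bv d n) * (300 * yv d n ^ 6 + k)" for k
    using mult_le_mono[OF width_pos[OF bv_bounds(1)[of d n]], of "yv d n ^ 6" "300 * yv d n ^ 6 + k"] by simp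
  finally show ?thesis unfolding solve_time_def add.assoc .
qed

lemma coins_take: "coins Y (take (Y ^ 5) b) = coins Y b"
  using cidx_less[of _ Y] by (auto simp: coins_def fun_eq_iff)

lemma of_nat_bval: "of_nat (bval b) = b"
  by (cases b rule: bit_cases) auto

lemma anf_eval_bt:
  assumes "is_anf d n P" "length x = n" "\<And>i. i < n \<Longrightarrow> x ! i = bt X i"
  shows "anf_eval P x = pe P X"
proof -
  have "(\<Prod>i\<leftarrow>M. x ! i) = (\<Prod>i\<leftarrow>M. bt X i)" if "M \<in> set P" for M
    by (rule arg_cong[where f = prod_list], rule map_cong) (use assms that in \<open>auto simp: is_anf_def\<close>)
  then show ?thesis unfolding anf_eval_def pe_def by (intro arg_cong[where f = sum_list] map_cong) auto
qed

context solver
begin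

lemma Sols_nonempty:
  assumes x: "is_solution n E x"
  shows "Sols \<noteq> {}"
proof -
  define X :: nat where "X = horner_sum of_bool 2 (map (\<lambda>b. b = 1) x)"
  have len: "length x = n" using x by (simp add: is_solution_def)
  have bits: "bit X i \<longleftrightarrow> i < n \<and> x ! i = 1" for i
    unfolding X_def using len by (auto simp: bit_horner_sum_bit_iff)
  have bt: "bt X i = x ! i" if "i < n" for i
    using that by (cases "x ! i" rule: bit_cases) (simp_all add: bt_eq bits)
  have "take_bit N X = X" by (rule bit_eqI) (use ns in \<open>auto simp: bit_take_bit_iff bits\<close>)
  then have "X < 2 ^ N" by (metis take_bit_nat_less_exp)
  moreover have "solved X"
    unfolding solved_def
  proof
    fix P
    assume P: "P \<in> set E"
    then have "anf_eval P x = pe P X" using E len bt by (intro anf_eval_bt) (auto simp: poly_system_def)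
    then show "pe P X = 0" using x P by (simp add: is_solution_def)
  qed
  moreover have "bt X j = 0" if "n \<le> j" for j using that by (simp add: bt_eq bits)
  ultimately show ?thesis by (auto simp: Sols_def)
qed

text \<open>A reported solution is correct for all coins, so only the answer that there is none can
  be wrong, and only if a solution exists and no try is lucky.\<close>

lemma solveC_correct:
  assumes inst: "s = up_sqrt n" "Y = yv d n" "Z = zv d n"
    and r: "length r = solve_time d n" and A: "A = coins Y r"
  shows "\<exists>t \<sigma> r'. exec (solveC d) (initial_state n E) r t \<sigma> r' \<and> t \<le> solve_time d n \<and>
    ((\<exists>p<Y. lucky s Y Sols top (A p)) \<or> (\<nexists>x. is_solution n E x) \<longrightarrow> correct_answer n E (answer n \<sigma>))"
proof -
  have len: "length (take (Y ^ 5) r) = Y ^ 5" using r solve_time_ge[of d n] inst by simp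
  obtain t \<sigma> where *: "(\<forall>r'. exec (solveC d) (initial_state n E) (take (Y ^ 5) r @ r') t \<sigma> r')" "t \<le> solve_time d n"
    "mem \<sigma> 0 \<noteq> 0 \<longrightarrow> (\<exists>x. solved x \<and> (\<forall>i<n. mem \<sigma> (Suc i) = bval (bt x i)))"
    "(\<exists>p<Y. lucky s Y Sols top (A p)) \<longrightarrow> mem \<sigma> 0 \<noteq> 0"
    using exec_solveC[OF inst len] A coins_take by metis
  have e: "exec (solveC d) (initial_state n E) r t \<sigma> (drop (Y ^ 5) r)"
    using *(1)[rule_format, of "drop (Y ^ 5) r"] by simp
  have sol: "correct_answer n E (answer n \<sigma>) \<and> (\<exists>x. is_solution n E x)" if nz: "mem \<sigma> 0 \<noteq> 0"
  proof -
    from *(3) nz obtain X where X: "solved X" "\<And>i. i < n \<Longrightarrow> mem \<sigma> (Suc i) = bval (bt X i)" by auto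
    let ?x = "map (\<lambda>i. of_nat (mem \<sigma> (Suc i))) [0..<n] :: bit list"
    have "is_solution n E ?x"
      unfolding is_solution_def
    proof (intro conjI ballI)
      fix P
      assume P: "P \<in> set E"
      have "anf_eval P ?x = pe P X"
        by (rule anf_eval_bt[of d n]) (use E P X in \<open>auto simp: poly_system_def of_nat_bval\<close>)
      then show "anf_eval P ?x = 0" using X(1) P by (simp add: solved_def)
    qed simp
    then show ?thesis using nz by (auto simp: answer_def correct_answer_def)
  qed
  have "correct_answer n E (answer n \<sigma>)" if "(\<exists>p<Y. lucky s Y Sols top (A p)) \<or> (\<nexists>x. is_solution n E x)"
  proof (cases "mem \<sigma> 0 = 0")
    case True
    then show ?thesis using *(4) that by (auto simp: answer_def correct_answer_def)
  qed (use sol in blast)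
  then show ?thesis using e *(2) by blast
qed

end

lemma solveC_runs:
  assumes d: "2 \<le> d"
  shows "runs_in_time d (solveC d) (solve_time d)"
  unfolding runs_in_time_def
proof (intro allI impI)
  fix n :: nat and E and r :: "bool list"
  assume a: "poly_system d n E \<and> length r = solve_time d n"
  interpret solver d n "up_sqrt n" "yv d n" "zv d n" E "coins (yv d n) r"
    by (rule solver_instance(1)[OF d]) (use a in simp)
  show "\<exists>t s r'. exec (solveC d) (initial_state n E) r t s r' \<and> t \<le> solve_time d n"
    using solveC_correct[OF refl refl refl _ refl] a by blast
qed

lemma solveC_success:
  assumes d: "2 \<le> d" and E: "poly_system d n E"
    and small: "16 * (up_sqrt n * up_sqrt n * (up_sqrt n * yv d n ^ up_sqrt n * 2 ^ (up_sqrt n * up_sqrt n))) \<le> 2 ^ yv d n"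
  shows "success_prob (solveC d) n E (solve_time d n) \<ge> 1 - (15 / 16) ^ yv d n"
proof -
  let ?T = "solve_time d n" and ?Y = "yv d n" and ?s = "up_sqrt n"
  let ?M = "pmf_of_set {r :: bool list. length r = ?T}"
  let ?ok = "\<lambda>r. \<exists>t s r'. exec (solveC d) (initial_state n E) r t s r' \<and> correct_answer n E (answer n s)"
  have fin: "finite {r :: bool list. length r = ?T}" using finite_lists_length_eq[of "UNIV :: bool set" ?T] by simp
  have ne: "{r :: bool list. length r = ?T} \<noteq> {}" using Ex_list_of_length[of ?T] by auto
  have sp: "success_prob (solveC d) n E ?T = measure_pmf.prob ?M {r. ?ok r}" by (simp add: success_prob_def)
  note solver = solver_instance(1)[OF d E]
  show ?thesis
  proof (cases "\<exists>x. is_solution n E x")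
    case False
    \<comment> \<open>An unsolvable system is answered correctly with certainty, since no candidate
      passes the check.\<close>
    have "?ok r" if "length r = ?T" for r
      using solver.solveC_correct[OF solver refl refl refl that refl] False by blast
    then have "measure_pmf.prob ?M {r. ?ok r} = 1"
      by (subst measure_pmf.prob_eq_1) (auto simp: AE_measure_pmf_iff set_pmf_of_set[OF ne fin])
    then show ?thesis by (simp add: sp)
  next
    case True
    let ?P = "\<lambda>A. \<exists>p<?Y. lucky ?s ?Y (solver.Sols n ?s E) (solver.top n ?s E) (A p)"
    have "?ok r" if "length r = ?T" "?P (coins ?Y r)" for r
      using solver.solveC_correct[OF solver refl refl refl that(1) refl] that(2) by blast
    then have "measure_pmf.prob ?M {r. ?P (coins ?Y r)} \<le> measure_pmf.prob ?M {r. ?ok r}"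
      by (intro measure_pmf.finite_measure_mono_AE) (auto simp: AE_measure_pmf_iff set_pmf_of_set[OF ne fin])
    moreover have "measure_pmf.prob ?M {r. ?P (coins ?Y r)} = measure_pmf.prob (rrep ?Y) {A. ?P A}"
      by (rule prob_coins[OF solve_time_ge])
    moreover have "measure_pmf.prob (rlev ?Y) {A. lucky ?s ?Y (solver.Sols n ?s E) (solver.top n ?s E) A} \<ge> 1 / 16"
    proof (rule prob_lucky[OF root_le_yv(1) _ _ small])
      show "solver.Sols n ?s E \<subseteq> {..<2 ^ (?s * ?s)}" by (auto simp: solver.Sols_def[OF solver])
      show "solver.Sols n ?s E \<noteq> {}" using True solver.Sols_nonempty[OF solver] by blast
    qed
    then have "measure_pmf.prob (rrep ?Y) {A. ?P A} \<ge> 1 - (15 / 16) ^ ?Y" by (rule prob_some_lucky)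
    ultimately show ?thesis by (simp add: sp)
  qed
qed

subsection \<open>The running time\<close>

lemma nlow_entropy:
  assumes m: "0 < m" and w: "2 * w \<le> m"
  shows "real (nlow m w) \<le> 2 powr (real m * binary_entropy (real w / real m))"
proof (cases "w = 0")
  case True
  then show ?thesis by (simp add: nlow_0 binary_entropy_def)
next
  case False
  define q where "q = real w / real m"
  have q: "0 < q" "q \<le> 1 / 2" using False m w by (auto simp: q_def field_simps)
  have "real (nlow m w) * (q ^ w * (1 - q) ^ (m - w)) =
      (\<Sum>k\<le>w. real (m choose k) * (q ^ w * (1 - q) ^ (m - w)))"
    by (simp add: nlow_choose sum_distrib_right)
  also have "\<dots> \<le> (\<Sum>k\<le>w. real (m choose k) * q ^ k * (1 - q) ^ (m - k))"
  proof (rule sum_mono)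
    fix k
    assume k: "k \<in> {..w}"
    have "q ^ w = q ^ k * q ^ (w - k)" using k by (simp flip: power_add)
    also have "\<dots> \<le> q ^ k * (1 - q) ^ (w - k)" using q by (intro mult_left_mono power_mono) auto
    finally have "q ^ w * (1 - q) ^ (m - w) \<le> q ^ k * (1 - q) ^ (w - k) * (1 - q) ^ (m - w)"
      using q by (intro mult_right_mono) auto
    also have "\<dots> = q ^ k * (1 - q) ^ (m - k)" using k w by (simp add: mult.assoc flip: power_add)
    finally show "real (m choose k) * (q ^ w * (1 - q) ^ (m - w)) \<le> real (m choose k) * q ^ k * (1 - q) ^ (m - k)"
      by (simp add: mult.assoc mult_left_mono)
  qed
  also have "\<dots> \<le> (\<Sum>k\<le>m. real (m choose k) * q ^ k * (1 - q) ^ (m - k))"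
    using q w by (intro sum_mono2) auto
  also have "\<dots> = (q + (1 - q)) ^ m" by (simp only: binomial_ring)
  finally have "real (nlow m w) * (q ^ w * (1 - q) ^ (m - w)) \<le> 1" by simp
  moreover have "q ^ w * (1 - q) ^ (m - w) > 0" using q by simp
  ultimately have "real (nlow m w) \<le> 1 / (q ^ w * (1 - q) ^ (m - w))" by (simp add: pos_le_divide_eq)
  also have "\<dots> = 2 powr (- (real w * log 2 q + real (m - w) * log 2 (1 - q)))"
  proof -
    have "2 powr (real k * log 2 x) = x ^ k" if "0 < x" for k and x :: real
      using that by (simp add: mult.commute[of "real k"] powr_powr[symmetric] powr_realpow)
    then show ?thesis using q by (simp only: powr_minus_divide powr_add)
  qed
  also have "- (real w * log 2 q + real (m - w) * log 2 (1 - q)) = real m * binary_entropy q"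
  proof -
    have "real w = real m * q" "real (m - w) = real m * (1 - q)"
      using m w by (auto simp: q_def of_nat_diff field_simps)
    then show ?thesis by (simp add: binary_entropy_def algebra_simps)
  qed
  finally show ?thesis by (simp add: q_def)
qed

text \<open>A binomial coefficient is at most \<open>m\<close> times its predecessor. Applied
  \<open>4 * d\<close> times, this removes the constant part of \<open>wlim\<close> at the price of
  a polynomial factor.\<close>

lemma nlow_Suc_le: "nlow m (Suc w) \<le> (m + 1) * nlow m w"
proof -
  have "m choose Suc w \<le> m * (m choose w)"
  proof -
    have "m choose Suc w \<le> Suc w * (m choose Suc w)" by simp
    also have "\<dots> = (m choose w) * (m - w)" by (metis binomial_absorb_comp binomial_absorption mult.commute)
    also have "\<dots> \<le> (m choose w) * m" by (intro mult_le_mono2) simp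
    finally show ?thesis by (simp add: mult.commute)
  qed
  moreover have "m choose w \<le> nlow m w" unfolding nlow_choose by (rule member_le_sum) auto
  ultimately have "m choose Suc w \<le> m * nlow m w" by (meson le_trans mult_le_mono2)
  then show ?thesis by (simp add: nlow_choose)
qed

lemma nlow_add_le: "nlow m (w + j) \<le> (m + 1) ^ j * nlow m w"
proof (induction j)
  case (Suc j)
  have "nlow m (w + Suc j) \<le> (m + 1) * nlow m (w + j)" using nlow_Suc_le[of m "w + j"] by simp
  also have "\<dots> \<le> (m + 1) * ((m + 1) ^ j * nlow m w)" using Suc by (rule mult_le_mono2)
  finally show ?case by (simp only: power_Suc mult.assoc)
qed simp

text \<open>At the end point the argument of the entropy is 1/2, where the entropy attains its
  maximum 1.\<close>

lemma entropy_bound_end: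
  assumes "2 \<le> d"
  shows "entropy_bound d (1 / (2 * real d - 1)) = 1 - 1 / (2 * real d - 1)"
proof -
  define r where "r = 2 * real d - 1"
  have r: "0 < r" "1 < r" "real d - 1 = (r - 1) / 2" using assms by (auto simp: r_def)
  then have "(real d - 1) * (1 / r) / (1 - 1 / r) = 1 / 2" by (simp add: divide_simps)
  moreover have "binary_entropy (1 / 2) = 1" by (simp add: binary_entropy_def log_divide)
  ultimately show ?thesis unfolding entropy_bound_def r_def[symmetric] by (simp only: mult_1_right)
qed

lemma level_size_le:
  assumes d: "2 \<le> d" and s: "1 \<le> s" and l: "l \<le> s"
  shows "real (nlow (s * s - s * l) (wlim d s l)) \<le> (real (s * s) + 1) ^ (4 * d) * 2 powr (tau d * real (s * s))"
proof -
  define N p where "N = s * s" and "p = real (s * l) / real N"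
  have N: "0 < N" "s * l \<le> N" using s l by (auto simp: N_def)
  have p: "real (s * l) = real N * p" "0 \<le> p" using N by (auto simp: p_def)
  have tau: "entropy_bound d x \<le> tau d" if "0 \<le> x" "x \<le> 1 / (2 * real d - 1)" for x
    using tau_is_maximum(2)[OF d] that by simp
  have M: "real (N - s * l) = real N * (1 - p)" using N p by (simp add: of_nat_diff algebra_simps)
  have one: "1 \<le> (real N + 1) ^ (4 * d)" by (rule one_le_power) simp
  have D: "3 \<le> 2 * real d - 1" using d by simp
  have "real (nlow (N - s * l) (wlim d s l)) \<le> (real N + 1) ^ (4 * d) * 2 powr (tau d * real N)"
  proof (cases "p \<le> 1 / (2 * real d - 1)")
    case True
    then have pd: "p * (2 * real d - 1) \<le> 1" using D by (simp add: field_simps)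
    moreover have "p * 3 \<le> p * (2 * real d - 1)" using p(2) D by (rule mult_left_mono[rotated])
    ultimately have p1: "p < 1" by linarith
    let ?m = "N - s * l" and ?w = "(d - 1) * (s * l)"
    have "0 < real ?m" unfolding M using p1 N by simp
    then have m: "0 < ?m" by simp
    have rw: "real ?w = real N * ((real d - 1) * p)" using d p(1) by (simp add: of_nat_diff algebra_simps)
    \<comment> \<open>The condition \<open>p \<le> 1 / (2 * d - 1)\<close> says precisely that the
      weight limit \<open>(d - 1) * (s * l)\<close> is at most half of the remaining dimension, the
      range in which the entropy estimate is valid.\<close>
    have "real (2 * ?w) \<le> real ?m"
    proof -
      have "2 * ((real d - 1) * p) \<le> 1 - p" using pd by (simp add: algebra_simps)
      then have "real N * (2 * ((real d - 1) * p)) \<le> real N * (1 - p)" by (rule mult_left_mono) simp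
      then show ?thesis unfolding M using rw by (simp add: algebra_simps)
    qed
    then have w: "2 * ?w \<le> ?m" by linarith
    have "real ?m * binary_entropy (real ?w / real ?m) = entropy_bound d p * real N"
    proof -
      have "real ?w / real ?m = (real d - 1) * p / (1 - p)" unfolding rw M using N p1 by simp
      then show ?thesis unfolding M by (simp add: entropy_bound_def)
    qed
    also have "\<dots> \<le> tau d * real N" using tau[OF p(2) True] by (rule mult_right_mono) simp
    finally have "2 powr (real ?m * binary_entropy (real ?w / real ?m)) \<le> 2 powr (tau d * real N)" by simp
    with nlow_entropy[OF m w] have a: "real (nlow ?m ?w) \<le> 2 powr (tau d * real N)" by linarith
    have "real (nlow ?m (?w + 4 * d)) \<le> real ((?m + 1) ^ (4 * d) * nlow ?m ?w)"
      by (subst of_nat_le_iff) (rule nlow_add_le)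
    also have "\<dots> = (real ?m + 1) ^ (4 * d) * real (nlow ?m ?w)" by (simp add: add.commute)
    also have "\<dots> \<le> (real N + 1) ^ (4 * d) * 2 powr (tau d * real N)"
      by (intro mult_mono power_mono a) auto
    finally show ?thesis by (simp add: wlim_def)
  next
    case False
    \<comment> \<open>Beyond the end point all masks are counted: \<open>2 ^ (N - s * l)\<close> has
      exponent \<open>N * (1 - p)\<close>, which is below \<open>N\<close> times the value of
      \<open>entropy_bound\<close> at the end point.\<close>
    have "real (nlow (N - s * l) (wlim d s l)) \<le> real (2 ^ (N - s * l))"
      by (subst of_nat_le_iff) (rule nlow_le)
    also have "\<dots> = 2 powr (real N * (1 - p))" unfolding M[symmetric] by (simp add: powr_realpow)
    also have "\<dots> \<le> 2 powr (tau d * real N)"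
    proof -
      have "1 - p \<le> entropy_bound d (1 / (2 * real d - 1))"
        using False entropy_bound_end[OF d] by simp
      also have "\<dots> \<le> tau d" by (rule tau) (use D in auto)
      finally have "(1 - p) * real N \<le> tau d * real N" by (rule mult_right_mono) simp
      then show ?thesis by (simp add: mult.commute)
    qed
    also have "\<dots> \<le> (real N + 1) ^ (4 * d) * 2 powr (tau d * real N)"
      using mult_right_mono[OF one, of "2 powr (tau d * real N)"] by simp
    finally show ?thesis .
  qed
  then show ?thesis by (simp add: N_def)
qed

lemma lmax_le:
  assumes d: "2 \<le> d"
  shows "real (lmax d n) \<le> real (yv d n) ^ (4 * d) * 2 powr (tau d * real (up_sqrt n * up_sqrt n))"
proof -
  let ?s = "up_sqrt n"
  have "lmax d n \<in> (\<lambda>l. nlow (?s * ?s - ?s * l) (wlim d ?s l)) ` {..?s}"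
    unfolding lmax_def by (rule Max_in) auto
  then obtain l where l: "l \<le> ?s" "lmax d n = nlow (?s * ?s - ?s * l) (wlim d ?s l)" by auto
  have "real (lmax d n) \<le> (real (?s * ?s) + 1) ^ (4 * d) * 2 powr (tau d * real (?s * ?s))"
    unfolding l(2) by (rule level_size_le[OF d up_sqrt(1) l(1)])
  also have "\<dots> \<le> real (yv d n) ^ (4 * d) * 2 powr (tau d * real (?s * ?s))"
  proof (intro mult_right_mono power_mono)
    have "real (?s * ?s + 4) \<le> real (yv d n)" using root_le_yv(1)[of n d] by (subst of_nat_le_iff)
    then show "real (?s * ?s) + 1 \<le> real (yv d n)" by simp
  qed auto
  finally show ?thesis .
qed

text \<open>The exponent of 2 in \<open>bv d n ^ 4\<close> is \<open>4 * 21 = 84\<close> times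
  \<open>yv d n ^ 6\<close>; one more multiple absorbs the leading digit.\<close>

lemma width_bv: "width (bv d n) \<le> 85 * yv d n ^ 6"
proof -
  have "bv d n ^ 4 = 2 ^ (84 * yv d n ^ 6)"
    by (simp add: zv_def flip: power_mult)
  moreover have "bit_length (2 ^ k) = Suc k" for k
    by (simp add: bit_length_def floorlog_def)
  ultimately have "width (bv d n) = Suc (84 * yv d n ^ 6)"
    using width_def[OF bv_bounds(1)[of d n]] by simp
  moreover have "1 \<le> yv d n ^ 6" using yv_big(3)[of d n] by simp
  ultimately show ?thesis by linarith
qed

lemma solve_time_le:
  assumes d: "2 \<le> d"
  obtains e where "\<And>n. solve_time d n \<le> 30000 * yv d n ^ e * (lmax d n * yv d n ^ up_sqrt n * 2 ^ up_sqrt n)"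
proof
  fix n
  let ?Y = "yv d n" and ?Z = "zv d n" and ?s = "up_sqrt n" and ?L = "lmax d n"
  let ?K = "?Y ^ ?s" and ?S = "2 ^ ?s :: nat"
  let ?a = "pdeg (setupC d)" and ?b = "pdeg (mainC d)"
  let ?V = "?L * ?K * ?S"
  have Y3: "?Y ^ 3 + 4 \<le> ?Z" "1000 \<le> ?Y" "2 * d \<le> ?Y"
    using yv_pow_zv[of 3 d n] yv_big(1)[of d n] yv_big(2)[OF d, of n] by auto
  note dY = yv_cube[OF d, of n]
  have Z1: "1 \<le> ?Z" using Y3 by linarith
  have ones: "1 \<le> ?L" "1 \<le> ?K" "1 \<le> ?S" using lmax_bounds(1) Y3(2) by auto
  have Y1: "1 \<le> ?Y" using Y3(2) by linarith
  have P: "?Y ^ 3 + 1 \<le> ?Y ^ 4"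
  proof -
    have "?Y ^ 3 * 2 \<le> ?Y ^ 3 * ?Y" using Y3(2) by (intro mult_le_mono2) simp
    moreover have "1 \<le> ?Y ^ 3" using Y1 by simp
    moreover have "?Y ^ 3 * ?Y = ?Y ^ 4" by (simp add: power_numeral_reduce)
    ultimately show ?thesis by linarith
  qed
  have P12: "12 \<le> ?Y ^ 3 + 1"
    using power_increasing[of 1 3 ?Y] Y3(2) by simp
  have "steps (vb ?Y ?Z ?Z ?Z) (ab ?Y ?Z ?Z) (setupC d) \<le> (?Y ^ 3 + 1) ^ ?a * vol 1 1 1 (setupC d)"
    by (rule steps_le[OF P12 _ _ _ setup_small[OF dY Y3(2,1) order.refl order.refl order.refl Z1 Z1 Z1]]) auto
  also have "\<dots> \<le> (?Y ^ 4) ^ ?a" using P by (simp add: vol_def power_mono)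
  finally have st1: "steps (vb ?Y ?Z ?Z ?Z) (ab ?Y ?Z ?Z) (setupC d) \<le> ?Y ^ (4 * ?a)" by (simp add: power_mult)
  have "steps (vb ?Y ?Z ?K ?S) (ab ?Y ?Z ?L) (mainC d) \<le> (?Y ^ 3 + 1) ^ ?b * vol ?L ?K ?S (mainC d)"
    by (rule steps_le[OF P12 ones main_small[OF dY Y3(2,1) lmax_bounds(2) yv_root_pow two_root_pow(2) ones]])
  also have "vol ?L ?K ?S (mainC d) = ?V" by (simp add: vol_def nest_main)
  also have "(?Y ^ 3 + 1) ^ ?b * ?V \<le> (?Y ^ 4) ^ ?b * ?V" using P by (intro mult_le_mono1 power_mono) auto
  finally have st2: "steps (vb ?Y ?Z ?K ?S) (ab ?Y ?Z ?L) (mainC d) \<le> ?Y ^ (4 * ?b) * ?V" by (simp add: power_mult)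
  let ?e = "6 + 4 * ?a + 4 * ?b"
  have V1: "1 \<le> ?V" using ones by (metis mult_le_mono nat_mult_1)
  have Ye: "?Y ^ k \<le> ?Y ^ ?e" if "k \<le> ?e" for k using that Y1 by (rule power_increasing)
  have YV: "?Y ^ k \<le> ?Y ^ ?e * ?V" if "k \<le> ?e" for k using mult_le_mono[OF Ye[OF that] V1] by simp
  have "?Y ^ (4 * ?b) * ?V \<le> ?Y ^ ?e * ?V" by (intro mult_le_mono1 Ye) simp
  then have "300 * ?Y ^ 6 + steps (vb ?Y ?Z ?Z ?Z) (ab ?Y ?Z ?Z) (setupC d) +
      steps (vb ?Y ?Z ?K ?S) (ab ?Y ?Z ?L) (mainC d) \<le> 302 * (?Y ^ ?e * ?V)"
    using st1 st2 YV[of 6] YV[of "4 * ?a"] by linarith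
  \<comment> \<open>The product \<open>85 * 302 = 25670\<close> is rounded up to 30000 in the
    end.\<close>
  then have "solve_time d n \<le> (85 * ?Y ^ 6) * (302 * (?Y ^ ?e * ?V))"
    unfolding solve_time_def by (intro mult_le_mono width_bv)
  also have "\<dots> = 25670 * (?Y ^ (6 + ?e) * ?V)" by (simp add: power_add ac_simps)
  also have "\<dots> \<le> 30000 * (?Y ^ (6 + ?e) * ?V)" by (rule mult_le_mono1) simp
  finally show "solve_time d n \<le> 30000 * ?Y ^ (6 + ?e) * ?V" by (simp add: mult.assoc)
qed

text \<open>Rounding \<open>n\<close> up to a square adds at most \<open>2 * up_sqrt n\<close>
  variables, a subexponential factor in the running time.\<close>

lemma up_sqrt_real: "real (up_sqrt n) \<le> sqrt (real n) + 1" "up_sqrt n * up_sqrt n \<le> n + 2 * up_sqrt n"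
proof -
  have "real (up_sqrt n) \<le> sqrt (real n) + 1 \<and> up_sqrt n * up_sqrt n \<le> n + 2 * up_sqrt n"
  proof (cases "up_sqrt n = 1")
    case False
    then obtain j where j: "up_sqrt n = Suc j" "1 \<le> j" using up_sqrt(1)[of n] by (cases "up_sqrt n") auto
    have "j * j < n" by (rule up_sqrt(3)) (use j in auto)
    then have "real j \<le> sqrt (real n)"
      by (metis less_imp_le of_nat_le_iff of_nat_mult power2_eq_square real_le_rsqrt)
    then show ?thesis using j \<open>j * j < n\<close> by simp
  qed simp
  then show "real (up_sqrt n) \<le> sqrt (real n) + 1" "up_sqrt n * up_sqrt n \<le> n + 2 * up_sqrt n" by auto
qed

text \<open>Apart from \<open>2 powr (tau d * n)\<close>, every factor is at most a power of
  \<open>yv d n = (n + 32) ^ (d + 2)\<close> whose exponent is linear in \<open>up_sqrt n\<close>;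
  this gives \<open>a\<close> and \<open>b\<close>.\<close>

lemma solve_time_exp:
  assumes d: "2 \<le> d"
  obtains a b where "0 \<le> a" "0 \<le> b"
    "\<And>n. real (solve_time d n) \<le> 30000 * exp ((a + b * sqrt (real n)) * ln (real n + 32)) * 2 powr (tau d * real n)"
proof -
  obtain e where e: "\<And>n. solve_time d n \<le> 30000 * yv d n ^ e * (lmax d n * yv d n ^ up_sqrt n * 2 ^ up_sqrt n)"
    using solve_time_le[OF d] by blast
  obtain t :: nat where t: "tau d \<le> real t" using real_arch_simple by blast
  have tau0: "0 \<le> tau d"
  proof -
    have "entropy_bound d 0 \<le> tau d" by (rule tau_is_maximum(2)[OF d]) (use d in simp)
    then show ?thesis by (simp add: entropy_bound_def binary_entropy_def)
  qed
  let ?c = "real (d + 2)"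
  define a b where "a = ?c * (real e + 4 * real d + 2 + 2 * real t)" and "b = ?c * (2 + 2 * real t)"
  have "real (solve_time d n) \<le> 30000 * exp ((a + b * sqrt (real n)) * ln (real n + 32)) * 2 powr (tau d * real n)" for n
  proof -
    let ?y = "real (yv d n)" and ?s = "up_sqrt n"
    have y: "2 \<le> ?y" using yv_big(1)[of d n] by simp
    \<comment> \<open>Replaces the padded number of variables by \<open>n\<close>; the surplus is
      charged to a power of \<open>yv d n\<close>, with the integer \<open>t\<close> standing in for
      \<open>tau d\<close>.\<close>
    have N: "2 powr (tau d * real (?s * ?s)) \<le> ?y ^ (2 * t * ?s) * 2 powr (tau d * real n)"
    proof -
      have "tau d * real (?s * ?s) \<le> tau d * real (n + 2 * ?s)"
        using up_sqrt_real(2)[of n] tau0 by (intro mult_left_mono) (simp_all only: of_nat_le_iff)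
      also have "\<dots> \<le> real (2 * t * ?s) + tau d * real n"
        using mult_right_mono[OF t, of "2 * real ?s"] by (simp add: algebra_simps)
      finally have "2 powr (tau d * real (?s * ?s)) \<le> 2 powr (real (2 * t * ?s) + tau d * real n)" by simp
      also have "\<dots> = 2 ^ (2 * t * ?s) * 2 powr (tau d * real n)" by (simp only: powr_add powr_realpow zero_less_numeral)
      also have "\<dots> \<le> ?y ^ (2 * t * ?s) * 2 powr (tau d * real n)"
        using y by (intro mult_right_mono power_mono) auto
      finally show ?thesis .
    qed
    have "real (solve_time d n) \<le> real (30000 * yv d n ^ e * (lmax d n * yv d n ^ ?s * 2 ^ ?s))"
      using e by (simp only: of_nat_le_iff)
    also have "\<dots> = 30000 * ?y ^ e * (real (lmax d n) * ?y ^ ?s * 2 ^ ?s)" by simp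
    also have "\<dots> \<le> 30000 * ?y ^ e * ((?y ^ (4 * d) * (?y ^ (2 * t * ?s) * 2 powr (tau d * real n))) * ?y ^ ?s * ?y ^ ?s)"
      using y order_trans[OF lmax_le[OF d, of n] mult_left_mono[OF N, of "?y ^ (4 * d)"]]
      by (intro mult_mono power_mono) auto
    also have "\<dots> = 30000 * ?y ^ (e + 4 * d + 2 * t * ?s + ?s + ?s) * 2 powr (tau d * real n)"
      by (simp only: power_add mult_ac)
    also have "?y ^ (e + 4 * d + 2 * t * ?s + ?s + ?s) =
        exp (?c * real (e + 4 * d + 2 * t * ?s + ?s + ?s) * ln (real n + 32))"
    proof -
      have "?y = (real n + 32) ^ (d + 2)" by (simp add: yv_def)
      also have "\<dots> = exp (?c * ln (real n + 32))" by (simp only: exp_of_nat_mult) simp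
      finally show ?thesis by (simp add: mult_ac flip: exp_of_nat_mult)
    qed
    also have "exp (?c * real (e + 4 * d + 2 * t * ?s + ?s + ?s) * ln (real n + 32)) \<le>
        exp ((a + b * sqrt (real n)) * ln (real n + 32))"
    proof -
      have "real (e + 4 * d + 2 * t * ?s + ?s + ?s) = real e + 4 * real d + (2 + 2 * real t) * real ?s"
        by (simp add: algebra_simps)
      also have "\<dots> \<le> real e + 4 * real d + (2 + 2 * real t) * (sqrt (real n) + 1)"
        using up_sqrt_real(1)[of n] by (intro add_left_mono mult_left_mono) auto
      finally have "?c * real (e + 4 * d + 2 * t * ?s + ?s + ?s) \<le>
          ?c * (real e + 4 * real d + (2 + 2 * real t) * (sqrt (real n) + 1))" by (rule mult_left_mono) simp
      also have "\<dots> = a + b * sqrt (real n)" by (simp add: a_def b_def algebra_simps)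
      finally show ?thesis by (intro iffD2[OF exp_le_cancel_iff] mult_right_mono) auto
    qed
    finally show ?thesis by (simp add: mult_right_mono)
  qed
  then show thesis by (intro that[of a b]) (auto simp: a_def b_def)
qed

lemma solve_time_bigo:
  assumes d: "2 \<le> d" and \<epsilon>: "0 < \<epsilon>"
  shows "(\<lambda>n. real (solve_time d n)) \<in> O(\<lambda>n. 2 powr ((tau d + \<epsilon>) * real n))"
proof -
  obtain a b where ab: "0 \<le> a" "0 \<le> b"
    "\<And>n. real (solve_time d n) \<le> 30000 * exp ((a + b * sqrt (real n)) * ln (real n + 32)) * 2 powr (tau d * real n)"
    using solve_time_exp[OF d] by blast
  have "(\<lambda>n. a * (ln (real n + 32) / real n) + b * (sqrt (real n) * ln (real n + 32) / real n)) \<longlonglongrightarrow> a * 0 + b * 0"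
    by (intro tendsto_add tendsto_mult tendsto_const; real_asymp)
  then have "\<forall>\<^sub>F n in sequentially. a * (ln (real n + 32) / real n) + b * (sqrt (real n) * ln (real n + 32) / real n) < \<epsilon> * ln 2"
    using \<epsilon> by (intro order_tendstoD(2)) auto
  then have "\<forall>\<^sub>F n in sequentially. norm (real (solve_time d n)) \<le> 30000 * norm (2 powr ((tau d + \<epsilon>) * real n))"
    using eventually_gt_at_top[of 0]
  proof eventually_elim
    case (elim n)
    then have "(a + b * sqrt (real n)) * ln (real n + 32) \<le> \<epsilon> * real n * ln 2"
      by (simp add: field_simps)
    then have "exp ((a + b * sqrt (real n)) * ln (real n + 32)) \<le> 2 powr (\<epsilon> * real n)"
      by (simp add: powr_def)
    then have "30000 * exp ((a + b * sqrt (real n)) * ln (real n + 32)) * 2 powr (tau d * real n) \<le>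
        30000 * 2 powr (\<epsilon> * real n) * 2 powr (tau d * real n)" by (intro mult_right_mono mult_left_mono) auto
    then have "real (solve_time d n) \<le> 30000 * 2 powr (\<epsilon> * real n) * 2 powr (tau d * real n)"
      using ab(3)[of n] by linarith
    moreover have "2 powr ((tau d + \<epsilon>) * real n) = 2 powr (tau d * real n) * 2 powr (\<epsilon> * real n)"
      by (simp add: distrib_right powr_add)
    ultimately show ?case by (simp add: mult_ac)
  qed
  then show ?thesis by (rule bigoI)
qed

text \<open>Written as powers of 2, all factors together have an exponent of at most
  \<open>(2 ^ d + 1) * x ^ 2\<close> with \<open>x = n + 32\<close>, whereas the right-hand side has
  the exponent \<open>x ^ (d + 2)\<close>.\<close>

lemma failure_bound_small:
  assumes d: "2 \<le> d"
  shows "16 * (up_sqrt n * up_sqrt n * (up_sqrt n * yv d n ^ up_sqrt n * 2 ^ (up_sqrt n * up_sqrt n))) \<le> 2 ^ yv d n"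
proof -
  let ?s = "up_sqrt n"
  define x where "x = n + 32"
  have x: "32 \<le> x" "yv d n = x ^ (d + 2)" by (simp_all add: x_def yv_def)
  have N: "?s * ?s \<le> 3 * x" using up_sqrt_sq_le[of n] by (simp add: x_def)
  have sx: "?s \<le> x"
  proof (rule ccontr)
    assume "\<not> ?s \<le> x"
    then have "x * x \<le> ?s * ?s" by (intro mult_le_mono) auto
    moreover have "32 * x \<le> x * x" using x(1) by (intro mult_le_mono1) simp
    ultimately show False using N x(1) by linarith
  qed
  have s2: "?s \<le> 2 ^ ?s" by (rule less_imp_le[OF less_exp])
  have "yv d n ^ ?s \<le> ((2 ^ x) ^ (d + 2)) ^ ?s"
    unfolding x(2) by (intro power_mono less_imp_le[OF less_exp]) auto
  then have yv: "yv d n ^ ?s \<le> 2 ^ (x * (d + 2) * ?s)" by (simp only: power_mult)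
  have "16 * (?s * ?s * (?s * yv d n ^ ?s * 2 ^ (?s * ?s))) \<le>
      2 ^ 4 * (2 ^ ?s * 2 ^ ?s * (2 ^ ?s * 2 ^ (x * (d + 2) * ?s) * 2 ^ (?s * ?s)))"
    by (intro mult_le_mono s2 yv) auto
  also have "\<dots> = 2 ^ (4 + (?s + ?s + (?s + x * (d + 2) * ?s + ?s * ?s)))" by (simp only: power_add)
  also have "\<dots> \<le> 2 ^ yv d n"
  proof (rule power_increasing)
    have "d + 2 \<le> 2 ^ d" using d by (induction d rule: dec_induct) auto
    then have "x * (d + 2) * ?s \<le> x * 2 ^ d * x" using sx by (intro mult_le_mono) auto
    moreover have "7 * x \<le> x * x" using x(1) by (intro mult_le_mono1) simp
    ultimately have "4 + (?s + ?s + (?s + x * (d + 2) * ?s + ?s * ?s)) \<le> x * 2 ^ d * x + x * x"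
      using N sx x(1) by linarith
    also have "\<dots> = (2 ^ d + 1) * (x * x)" by (simp add: algebra_simps)
    also have "\<dots> \<le> x ^ d * (x * x)"
    proof (rule mult_le_mono1)
      have "(2::nat) ^ d + 1 \<le> 4 ^ d" using power_strict_mono[of 2 "4::nat" d] d by simp
      also have "(4::nat) ^ d \<le> x ^ d" using x(1) by (intro power_mono) auto
      finally show "2 ^ d + 1 \<le> x ^ d" .
    qed
    also have "\<dots> = yv d n" by (simp add: x(2) power_add power2_eq_square)
    finally show "4 + (?s + ?s + (?s + x * (d + 2) * ?s + ?s * ?s)) \<le> yv d n" .
  qed simp
  finally show ?thesis .
qed

text \<open>As \<open>n \<le> yv d n\<close>, all tries fail with probability at most
  \<open>(15/16) ^ n\<close>, which is below every inverse polynomial.\<close>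

lemma solveC_whp:
  assumes d: "2 \<le> d"
  shows "solves_whp d (solveC d) (solve_time d)"
  unfolding solves_whp_def
proof
  fix k :: nat
  have "\<forall>\<^sub>F n in sequentially. (15 / 16 :: real) ^ n \<le> 1 / real n ^ k" by real_asymp
  then show "\<forall>\<^sub>F n in sequentially. \<forall>E. poly_system d n E \<longrightarrow>
      success_prob (solveC d) n E (solve_time d n) \<ge> 1 - 1 / real n ^ k"
  proof eventually_elim
    case (elim n)
    show ?case
    proof (intro allI impI)
      fix E
      assume E: "poly_system d n E"
      have "n \<le> yv d n" using yv_ge[of n d] by simp
      then have "(15 / 16 :: real) ^ yv d n \<le> (15 / 16) ^ n" by (intro power_decreasing) auto
      with elim solveC_success[OF d E failure_bound_small[OF d]]
      show "success_prob (solveC d) n E (solve_time d n) \<ge> 1 - 1 / real n ^ k" by linarith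
    qed
  qed
qed

theorem theorem3:
  fixes d :: nat
  assumes "d \<ge> 2"
  shows "\<exists>c T. runs_in_time d c T \<and> solves_whp d c T \<and>
    (\<forall>\<epsilon>>0. (\<lambda>n. real (T n)) \<in> O(\<lambda>n. 2 powr ((tau d + \<epsilon>) * real n)))"
  using solveC_runs[OF assms] solveC_whp[OF assms] solve_time_bigo[OF assms] by blast

end
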